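(* Let $\Bbbk$ be a field of characteristic $p>0$, let $m,n\ge 0$ be integers, let $\mathbf{s}=(s_1,\dots,s_m)$ be a sequence of non-negative integers, and let $1\le j\le m-1$. Let $\bigtriangleup^j(\mathbf{s})$ be the splitter $(D(\mathbf{s}^j,n),D(\mathbf{s},n))$-bimodule and $\bigtriangledown^j(\mathbf{s})$ the splitter $(D(\mathbf{s},n),D(\mathbf{s}^j,n))$-bimodule (defined in the context), and let $\partial_\bigtriangleup:\bigtriangleup^j(\mathbf{s})\to\bigtriangleup^j(\mathbf{s})$ and $\partial_\bigtriangledown:\bigtriangledown^j(\mathbf{s})\to\bigtriangledown^j(\mathbf{s})$ be the maps defined by the formula $\partial_D\otimes\mathrm{id}+\mathrm{id}\otimes\partial_D$ on the tensor products. Then these maps are well defined, and $(\bigtriangleup^j(\mathbf{s}),\partial_\bigtriangleup)$ and $(\bigtriangledown^j(\mathbf{s}),\partial_\bigtriangledown)$ are $p$-DG (bi)modules over the $p$-DG algebras $(D(\mathbf{s}^j,n),\partial_D)$ and $(D(\mathbf{s},n),\partial_D)$.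
   Context: **$p$-DG algebras and modules.** A $p$-DG algebra is a $\mathbb{Z}$-graded $\Bbbk$-algebra $A$ with a $\Bbbk$-linear map $\partial_A:A\to A$ of degree $2$ such that $\partial_A^p=0$ and $\partial_A(ab)=\partial_A(a)b+a\partial_A(b)$. A left (resp. right) $p$-DG module over $(A,\partial_A)$ is a $\mathbb{Z}$-graded left (resp. right) $A$-module $M$ with a $\Bbbk$-linear degree $2$ endomorphism $\partial_M$ satisfying $\partial_M^p=0$ and $\partial_M(am)=\partial_A(a)m+a\partial_M(m)$ (resp. $\partial_M(ma)=m\partial_A(a)+\partial_M(m)a$). A graded $(A,B)$-bimodule $M$ with $\partial_M$ is a $p$-DG bimodule if it is a left $p$-DG $A$-module and a right $p$-DG $B$-module. **Sequences.** For $\mathbf{s}=(s_1,\dots,s_m)$, $\mathrm{Seq}(\mathbf{s},n)$ is the set of sequences $\mathbf{i}=(\mathbf{i}_1,\dots,\mathbf{i}_{m+n})$ in which $n$ of the entries equal the symbol $\mathfrak{b}$ and the remaining $m$ entries are $s_1,\dots,s_m$, each appearing exactly once, in this order. $I_{\mathbf{s}}=\{s_i\mid 1\le i\le m\}$, so "$\mathbf{i}_j\in I_{\mathbf{s}}$" means $\mathbf{i}_j\neq\mathfrak{b}$. The simple transposition $\sigma_j$ swaps the $j$-th and $(j+1)$-st entries of a sequence (the result need not lie in $\mathrm{Seq}(\mathbf{s},n)$; then $e(\sigma_j(\mathbf{i}))$ is read as $0$). **Deformed Webster algebra.** $D(\mathbf{s},n)$ is the $\mathbb{Z}$-graded unital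 $\Bbbk$-algebra generated by $e(\mathbf{i})$ ($\mathbf{i}\in\mathrm{Seq}(\mathbf{s},n)$), $x_j$ and $E(d)_j$ ($1\le j\le m+n$, $d\ge 1$), and $\psi_\ell$ ($1\le \ell\le m+n-1$), with $1=\sum_{\mathbf{i}}e(\mathbf{i})$ and the convention $E(0)_j=1$, subject to the relations (for all admissible indices, with $d,d'\ge1$ in the relations of the first list): - $e(\mathbf{i})e(\mathbf{j})=\delta_{\mathbf{i},\mathbf{j}}e(\mathbf{i})$; $E(d)_je(\mathbf{i})=e(\mathbf{i})E(d)_j$; $x_je(\mathbf{i})=e(\mathbf{i})x_j$; $\psi_je(\mathbf{i})=e(\sigma_j(\mathbf{i}))\psi_j$; - $E(d)_je(\mathbf{i})=0$ if $\mathbf{i}_j=\mathfrak{b}$; $E(d)_je(\mathbf{i})=0$ if $\mathbf{i}_j\in I_{\mathbf{s}}$ and $d>\mathbf{i}_j$; $x_je(\mathbf{i})=0$ if $\mathbf{i}_j\in I_{\mathbf{s}}$; $\psi_je(\mathbf{i})=0$ if $\mathbf{i}_j,\mathbf{i}_{j+1}\in I_{\mathbf{s}}$; - $x_jx_\ell=x_\ell x_j$; $E(d)_jx_\ell=x_\ell E(d)_j$; $E(d)_jE(d')_\ell=E(d')_\ell E(d)_j$; - $\psi_jx_\ell=x_\ell\psi_j$ and $\psi_jE(d)_\ell=E(d)_\ell\psi_j$ if $\ell\ne j,j+1$; $\psi_jE(d)_j=E(d)_{j+1}\psi_j$; $E(d)_j\psi_j=\psi_jE(d)_{j+1}$; $\psi_j\psi_\ell=\psi_\ell\psi_j$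 if $|j-\ell|>1$; and - $x_j\psi_je(\mathbf{i})-\psi_jx_{j+1}e(\mathbf{i})=e(\mathbf{i})$ if $\mathbf{i}_j=\mathbf{i}_{j+1}=\mathfrak{b}$, and $=0$ if $\mathbf{i}_j\in I_{\mathbf{s}},\mathbf{i}_{j+1}=\mathfrak{b}$; - $\psi_jx_je(\mathbf{i})-x_{j+1}\psi_je(\mathbf{i})=e(\mathbf{i})$ if $\mathbf{i}_j=\mathbf{i}_{j+1}=\mathfrak{b}$, and $=0$ if $\mathbf{i}_j=\mathfrak{b},\mathbf{i}_{j+1}\in I_{\mathbf{s}}$; - $\psi_j^2e(\mathbf{i})=0$ if $\mathbf{i}_j=\mathbf{i}_{j+1}=\mathfrak{b}$; $\psi_j^2e(\mathbf{i})=\sum_{d=0}^{\mathbf{i}_j}(-1)^dE(d)_jx_{j+1}^{\mathbf{i}_j-d}e(\mathbf{i})$ if $\mathbf{i}_j\in I_{\mathbf{s}},\mathbf{i}_{j+1}=\mathfrak{b}$; $\psi_j^2e(\mathbf{i})=\sum_{d=0}^{\mathbf{i}_{j+1}}(-1)^dx_j^{\mathbf{i}_{j+1}-d}E(d)_{j+1}e(\mathbf{i})$ if $\mathbf{i}_j=\mathfrak{b},\mathbf{i}_{j+1}\in I_{\mathbf{s}}$; - $(\psi_j\psi_{j+1}\psi_j-\psi_{j+1}\psi_j\psi_{j+1})e(\mathbf{i})=\sum_{d_1+d_2+d_3=\mathbf{i}_{j+1}-1}(-1)^{d_3}x_j^{d_1}E(d_3)_{j+1}x_{j+2}^{d_2}e(\mathbf{i})$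 (sum over non-negative integers) if $\mathbf{i}_{j+1}\in I_{\mathbf{s}}$ and $\mathbf{i}_j=\mathbf{i}_{j+2}=\mathfrak{b}$, and $=0$ otherwise. **Grading.** $\deg e(\mathbf{i})=0$, $\deg x_j=2$, $\deg E(d)_j=2d$, $\deg\psi_je(\mathbf{i})=-2$ if $\mathbf{i}_j=\mathbf{i}_{j+1}=\mathfrak{b}$, and $\deg\psi_je(\mathbf{i})=s$ if one of $\mathbf{i}_j,\mathbf{i}_{j+1}$ is $\mathfrak{b}$ and the other is $s\in I_{\mathbf{s}}$. **The derivation $\partial_D$.** For every $\mathbf{s}$ and $n$, $\partial_D$ is the degree $2$ derivation making $D(\mathbf{s},n)$ a $p$-DG algebra, determined by the Leibniz rule and: $\partial_D(e(\mathbf{i}))=0$; $\partial_D(x_j)=x_j^2$; for $\mathbf{i}_j\in I_{\mathbf{s}}$ and $d\ge1$, $\partial_D(E(d)_je(\mathbf{i}))=(E(d)_jE(1)_j-(d+1)E(d+1)_j)e(\mathbf{i})$ if $d<\mathbf{i}_j$ and $=E(d)_jE(1)_je(\mathbf{i})$ if $d=\mathbf{i}_j$; $\partial_D(\psi_je(\mathbf{i}))=-x_j\psi_je(\mathbf{i})-\psi_jx_{j+1}e(\mathbf{i})$ if $\mathbf{i}_j=\mathbf{i}_{j+1}=\mathfrak{b}$, $=s\psi_jx_{j+1}e(\mathbf{i})$ if $\mathbf{i}_j=s\in I_{\mathbf{s}},\mathbf{i}_{j+1}=\mathfrak{b}$, and $=\psi_jE(1)_{j+1}e(\mathbf{i})$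 if $\mathbf{i}_j=\mathfrak{b},\mathbf{i}_{j+1}\in I_{\mathbf{s}}$. **Merging, splitting, and the inclusion map.** For $1\le j\le m-1$ put $\mathbf{s}^j=(s_1,\dots,s_{j-1},s_j+s_{j+1},s_{j+2},\dots,s_m)$. For $1\le j\le m$ and $0\le a\le s_j$ put $\phi_{j,a}(\mathbf{s})=(s_1,\dots,s_{j-1},s_j-a,a,s_{j+1},\dots,s_m)$; thus $\phi_{j,s_{j+1}}(\mathbf{s}^j)=\mathbf{s}$. The map $\phi_{j,a}:\mathrm{Seq}(\mathbf{s},n)\to\mathrm{Seq}(\phi_{j,a}(\mathbf{s}),n)$ replaces the entry $s_j$ (the $j$-th non-$\mathfrak{b}$ entry) of $\mathbf{i}$ by the two consecutive entries $s_j-a,a$. There is an injective (not necessarily unital) algebra homomorphism $\Phi_{j,a}:D(\mathbf{s},n)\to D(\phi_{j,a}(\mathbf{s}),n)$ given as follows, where $\ell'$ denotes the position in $\mathbf{i}$ of the entry $s_j$ and $e'=e(\phi_{j,a}(\mathbf{i}))$: - $\Phi_{j,a}(e(\mathbf{i}))=e'$; - $\Phi_{j,a}(E(d)_\ell e(\mathbf{i}))=E(d)_\ell e'$ if $\ell<\ell'$; $=E(d)_{\ell+1}e'$ if $\ell>\ell'$; $=\sum_{d_1+d_2=d}E(d_1)_\ell E(d_2)_{\ell+1}e'$ if $\ell=\ell'$ and $1\le d\le s_j$; - $\Phi_{j,a}(x_\ell e(\mathbf{i}))=x_\ell e'$ if $\ell<\ell'$; $=x_{\ell+1}e'$ if $\ell>\ell'$;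 - $\Phi_{j,a}(\psi_\ell e(\mathbf{i}))=\psi_\ell e'$ if $\ell<\ell'-1$; $=\psi_{\ell+1}\psi_\ell e'$ if $\ell=\ell'-1$ and $\mathbf{i}_{\ell'-1}=\mathfrak{b}$; $=\psi_\ell\psi_{\ell+1}e'$ if $\ell=\ell'$ and $\mathbf{i}_{\ell'+1}=\mathfrak{b}$; $=\psi_{\ell+1}e'$ if $\ell>\ell'$. **Splitter bimodules.** For $1\le j\le m-1$, let $\mathrm{Seq}^j(\mathbf{s},n)\subset\mathrm{Seq}(\mathbf{s},n)$ be the set of sequences in which the entries $s_j$ and $s_{j+1}$ (the $j$-th and $(j+1)$-st non-$\mathfrak{b}$ entries) occupy adjacent positions, and $\hat{e}_j=\sum_{\mathbf{i}\in\mathrm{Seq}^j(\mathbf{s},n)}e(\mathbf{i})\in D(\mathbf{s},n)$. Via $\Phi_{j,s_{j+1}}:D(\mathbf{s}^j,n)\to D(\mathbf{s},n)$ (whose unit maps to $\hat{e}_j$), $D(\mathbf{s}^j,n)$ acts on the left on $\hat{e}_jD(\mathbf{s},n)$ and on the right on $D(\mathbf{s},n)\hat{e}_j$. Define $$\bigtriangleup^j(\mathbf{s})=D(\mathbf{s}^j,n)\otimes_{D(\mathbf{s}^j,n)}\hat{e}_jD(\mathbf{s},n)\{-s_js_{j+1}\},\qquad \bigtriangledown^j(\mathbf{s})=D(\mathbf{s},n)\hat{e}_j\otimes_{D(\mathbf{s}^j,n)}D(\mathbf{s}^j,n),$$ where $\{\cdot\}$ is a grading shift. *)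

theory Defs
  imports
    "HOL-Algebra.Algebra"
    "HOL-Algebra.Algebraic_Closure_Type"
    "HOL-Library.Poly_Mapping"
begin

section \<open>Graded vector spaces, p-DG algebras and p-DG modules\<close>

text \<open>
  The ground field is a type \<^typ>\<open>'k::field\<close>; as a ring record it is
  \<^const>\<open>ring_of_type_algebra\<close>. A graded vector space, graded algebra or graded bimodule carries
  its homogeneous parts in the field \<open>hom_part\<close>. The ring fields \<open>mult\<close> and \<open>one\<close>
  are meaningful for algebras only.
\<close>

record ('k, 'v) graded = "('k, 'v) module" +
  hom_part :: "int \<Rightarrow> 'v set"

record ('k, 'v, 'a, 'b) gbimod = "('k, 'v) graded" +
  lact :: "'a \<Rightarrow> 'v \<Rightarrow> 'v"
  ract :: "'v \<Rightarrow> 'b \<Rightarrow> 'v"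

definition linear_maps ::
    "('k, 'v, 'y) graded_scheme \<Rightarrow> ('k, 'w, 'z) graded_scheme \<Rightarrow> ('v \<Rightarrow> 'w) set" where
  "linear_maps V W = {f. f \<in> carrier V \<rightarrow> carrier W
     \<and> (\<forall>x\<in>carrier V. \<forall>y\<in>carrier V. f (x \<oplus>\<^bsub>V\<^esub> y) = f x \<oplus>\<^bsub>W\<^esub> f y)
     \<and> (\<forall>c. \<forall>x\<in>carrier V. f (c \<odot>\<^bsub>V\<^esub> x) = c \<odot>\<^bsub>W\<^esub> f x)}"

locale graded_space = module "ring_of_type_algebra :: 'k::field ring" V
  for V :: "('k::field, 'v, 'z) graded_scheme" +
  assumes hom_part_submodule:
      "submodule (hom_part V k) (ring_of_type_algebra :: 'k ring) V"
    and hom_part_decomposition: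
      "x \<in> carrier V \<Longrightarrow>
        \<exists>!f. (\<forall>k. f k \<in> hom_part V k) \<and> finite {k. f k \<noteq> \<zero>\<^bsub>V\<^esub>}
           \<and> x = (\<Oplus>\<^bsub>V\<^esub>k\<in>{k. f k \<noteq> \<zero>\<^bsub>V\<^esub>}. f k)"

locale pdg_space = graded_space V
  for p :: nat and V :: "('k::field, 'v, 'z) graded_scheme" and d :: "'v \<Rightarrow> 'v" +
  assumes d_linear: "d \<in> linear_maps V V"
    and d_degree: "x \<in> hom_part V k \<Longrightarrow> d x \<in> hom_part V (k + 2)"
    and d_nilpotent: "x \<in> carrier V \<Longrightarrow> (d ^^ p) x = \<zero>\<^bsub>V\<^esub>"

locale pdg_algebra = pdg_space p A dA + ring A
  for p :: nat and A :: "('k::field, 'a, 'z) graded_scheme" and dA :: "'a \<Rightarrow> 'a" +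
  assumes smult_mult_left:
      "\<lbrakk>a \<in> carrier A; b \<in> carrier A\<rbrakk> \<Longrightarrow> (c \<odot>\<^bsub>A\<^esub> a) \<otimes>\<^bsub>A\<^esub> b = c \<odot>\<^bsub>A\<^esub> (a \<otimes>\<^bsub>A\<^esub> b)"
    and smult_mult_right:
      "\<lbrakk>a \<in> carrier A; b \<in> carrier A\<rbrakk> \<Longrightarrow> a \<otimes>\<^bsub>A\<^esub> (c \<odot>\<^bsub>A\<^esub> b) = c \<odot>\<^bsub>A\<^esub> (a \<otimes>\<^bsub>A\<^esub> b)"
    and one_degree: "\<one>\<^bsub>A\<^esub> \<in> hom_part A 0"
    and mult_degree:
      "\<lbrakk>a \<in> hom_part A k; b \<in> hom_part A l\<rbrakk> \<Longrightarrow> a \<otimes>\<^bsub>A\<^esub> b \<in> hom_part A (k + l)"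
    and leibniz:
      "\<lbrakk>a \<in> carrier A; b \<in> carrier A\<rbrakk> \<Longrightarrow> dA (a \<otimes>\<^bsub>A\<^esub> b) = dA a \<otimes>\<^bsub>A\<^esub> b \<oplus>\<^bsub>A\<^esub> a \<otimes>\<^bsub>A\<^esub> dA b"

locale left_pdg_module = alg: pdg_algebra p A dA + mdl: pdg_space p M dM
  for p :: nat and A :: "('k::field, 'a, 'y) graded_scheme" and dA :: "'a \<Rightarrow> 'a"
    and M :: "('k, 'v, 'a, 'b, 'z) gbimod_scheme" and dM :: "'v \<Rightarrow> 'v" +
  assumes lact_closed: "\<lbrakk>a \<in> carrier A; x \<in> carrier M\<rbrakk> \<Longrightarrow> lact M a x \<in> carrier M"
    and lact_add_left:
      "\<lbrakk>a \<in> carrier A; a' \<in> carrier A; x \<in> carrier M\<rbrakk> \<Longrightarrow>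
        lact M (a \<oplus>\<^bsub>A\<^esub> a') x = lact M a x \<oplus>\<^bsub>M\<^esub> lact M a' x"
    and lact_add_right:
      "\<lbrakk>a \<in> carrier A; x \<in> carrier M; y \<in> carrier M\<rbrakk> \<Longrightarrow>
        lact M a (x \<oplus>\<^bsub>M\<^esub> y) = lact M a x \<oplus>\<^bsub>M\<^esub> lact M a y"
    and lact_smult_left:
      "\<lbrakk>a \<in> carrier A; x \<in> carrier M\<rbrakk> \<Longrightarrow> lact M (c \<odot>\<^bsub>A\<^esub> a) x = c \<odot>\<^bsub>M\<^esub> lact M a x"
    and lact_smult_right:
      "\<lbrakk>a \<in> carrier A; x \<in> carrier M\<rbrakk> \<Longrightarrow> lact M a (c \<odot>\<^bsub>M\<^esub> x) = c \<odot>\<^bsub>M\<^esub> lact M a x"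
    and lact_mult:
      "\<lbrakk>a \<in> carrier A; a' \<in> carrier A; x \<in> carrier M\<rbrakk> \<Longrightarrow>
        lact M (a \<otimes>\<^bsub>A\<^esub> a') x = lact M a (lact M a' x)"
    and lact_one: "x \<in> carrier M \<Longrightarrow> lact M \<one>\<^bsub>A\<^esub> x = x"
    and lact_degree:
      "\<lbrakk>a \<in> hom_part A k; x \<in> hom_part M l\<rbrakk> \<Longrightarrow> lact M a x \<in> hom_part M (k + l)"
    and left_leibniz:
      "\<lbrakk>a \<in> carrier A; x \<in> carrier M\<rbrakk> \<Longrightarrow>
        dM (lact M a x) = lact M (dA a) x \<oplus>\<^bsub>M\<^esub> lact M a (dM x)"

locale right_pdg_module = alg: pdg_algebra p B dB + mdl: pdg_space p M dM
  for p :: nat and B :: "('k::field, 'b, 'y) graded_scheme" and dB :: "'b \<Rightarrow> 'b"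
    and M :: "('k, 'v, 'a, 'b, 'z) gbimod_scheme" and dM :: "'v \<Rightarrow> 'v" +
  assumes ract_closed: "\<lbrakk>x \<in> carrier M; b \<in> carrier B\<rbrakk> \<Longrightarrow> ract M x b \<in> carrier M"
    and ract_add_right:
      "\<lbrakk>x \<in> carrier M; b \<in> carrier B; b' \<in> carrier B\<rbrakk> \<Longrightarrow>
        ract M x (b \<oplus>\<^bsub>B\<^esub> b') = ract M x b \<oplus>\<^bsub>M\<^esub> ract M x b'"
    and ract_add_left:
      "\<lbrakk>x \<in> carrier M; y \<in> carrier M; b \<in> carrier B\<rbrakk> \<Longrightarrow>
        ract M (x \<oplus>\<^bsub>M\<^esub> y) b = ract M x b \<oplus>\<^bsub>M\<^esub> ract M y b"
    and ract_smult_right: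
      "\<lbrakk>x \<in> carrier M; b \<in> carrier B\<rbrakk> \<Longrightarrow> ract M x (c \<odot>\<^bsub>B\<^esub> b) = c \<odot>\<^bsub>M\<^esub> ract M x b"
    and ract_smult_left:
      "\<lbrakk>x \<in> carrier M; b \<in> carrier B\<rbrakk> \<Longrightarrow> ract M (c \<odot>\<^bsub>M\<^esub> x) b = c \<odot>\<^bsub>M\<^esub> ract M x b"
    and ract_mult:
      "\<lbrakk>x \<in> carrier M; b \<in> carrier B; b' \<in> carrier B\<rbrakk> \<Longrightarrow>
        ract M x (b \<otimes>\<^bsub>B\<^esub> b') = ract M (ract M x b) b'"
    and ract_one: "x \<in> carrier M \<Longrightarrow> ract M x \<one>\<^bsub>B\<^esub> = x"
    and ract_degree:
      "\<lbrakk>x \<in> hom_part M k; b \<in> hom_part B l\<rbrakk> \<Longrightarrow> ract M x b \<in> hom_part M (k + l)"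
    and right_leibniz:
      "\<lbrakk>x \<in> carrier M; b \<in> carrier B\<rbrakk> \<Longrightarrow>
        dM (ract M x b) = ract M x (dB b) \<oplus>\<^bsub>M\<^esub> ract M (dM x) b"

locale pdg_bimodule = left: left_pdg_module p A dA M dM + right: right_pdg_module p B dB M dM
  for p :: nat and A :: "('k::field, 'a, 'x) graded_scheme" and dA :: "'a \<Rightarrow> 'a"
    and B :: "('k, 'b, 'y) graded_scheme" and dB :: "'b \<Rightarrow> 'b"
    and M :: "('k, 'v, 'a, 'b, 'z) gbimod_scheme" and dM :: "'v \<Rightarrow> 'v" +
  assumes lact_ract:
      "\<lbrakk>a \<in> carrier A; x \<in> carrier M; b \<in> carrier B\<rbrakk> \<Longrightarrow>
        ract M (lact M a x) b = lact M a (ract M x b)"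


section \<open>Tensor products of graded bimodules\<close>

text \<open>
  The tensor product over \<open>B\<close> is the quotient of the free vector space on
  \<open>carrier M \<times> carrier N\<close> by the subspace \<open>tensor_rels B M N\<close>; its elements are
  cosets.
\<close>

abbreviation scal :: "'k::field \<Rightarrow> ('x \<Rightarrow>\<^sub>0 'k) \<Rightarrow> ('x \<Rightarrow>\<^sub>0 'k)" where
  "scal c \<equiv> Poly_Mapping.map ((*) c)"

definition lin_ext :: "('x \<Rightarrow> 'y) \<Rightarrow> ('x \<Rightarrow>\<^sub>0 'k::field) \<Rightarrow> ('y \<Rightarrow>\<^sub>0 'k)" where
  "lin_ext h f =
    (\<Sum>z\<in>Poly_Mapping.keys f. Poly_Mapping.single (h z) (Poly_Mapping.lookup f z))"

inductive_set tensor_rels ::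
    "('k::field, 'b, 'w) graded_scheme \<Rightarrow> ('k, 'u, 'a, 'b, 'y) gbimod_scheme \<Rightarrow>
     ('k, 'v, 'b, 'c, 'z) gbimod_scheme \<Rightarrow> (('u \<times> 'v) \<Rightarrow>\<^sub>0 'k) set"
  for B M N where
  zero: "0 \<in> tensor_rels B M N"
| plus: "\<lbrakk>f \<in> tensor_rels B M N; g \<in> tensor_rels B M N\<rbrakk> \<Longrightarrow> f + g \<in> tensor_rels B M N"
| scal: "f \<in> tensor_rels B M N \<Longrightarrow> scal c f \<in> tensor_rels B M N"
| add_left: "\<lbrakk>x \<in> carrier M; x' \<in> carrier M; y \<in> carrier N\<rbrakk> \<Longrightarrow>
    Poly_Mapping.single (x \<oplus>\<^bsub>M\<^esub> x', y) 1 - Poly_Mapping.single (x, y) 1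
      - Poly_Mapping.single (x', y) 1 \<in> tensor_rels B M N"
| add_right: "\<lbrakk>x \<in> carrier M; y \<in> carrier N; y' \<in> carrier N\<rbrakk> \<Longrightarrow>
    Poly_Mapping.single (x, y \<oplus>\<^bsub>N\<^esub> y') 1 - Poly_Mapping.single (x, y) 1
      - Poly_Mapping.single (x, y') 1 \<in> tensor_rels B M N"
| smult_left: "\<lbrakk>x \<in> carrier M; y \<in> carrier N\<rbrakk> \<Longrightarrow>
    Poly_Mapping.single (c \<odot>\<^bsub>M\<^esub> x, y) 1 - Poly_Mapping.single (x, y) c \<in> tensor_rels B M N"
| smult_right: "\<lbrakk>x \<in> carrier M; y \<in> carrier N\<rbrakk> \<Longrightarrow>
    Poly_Mapping.single (x, c \<odot>\<^bsub>N\<^esub> y) 1 - Poly_Mapping.single (x, y) c \<in> tensor_rels B M N"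
| balanced: "\<lbrakk>x \<in> carrier M; b \<in> carrier B; y \<in> carrier N\<rbrakk> \<Longrightarrow>
    Poly_Mapping.single (ract M x b, y) 1 - Poly_Mapping.single (x, lact N b y) 1
      \<in> tensor_rels B M N"

definition tensor_class ::
    "('k::field, 'b, 'w) graded_scheme \<Rightarrow> ('k, 'u, 'a, 'b, 'y) gbimod_scheme \<Rightarrow>
     ('k, 'v, 'b, 'c, 'z) gbimod_scheme \<Rightarrow> (('u \<times> 'v) \<Rightarrow>\<^sub>0 'k) \<Rightarrow> (('u \<times> 'v) \<Rightarrow>\<^sub>0 'k) set" where
  "tensor_class B M N f = (\<lambda>u. f + u) ` tensor_rels B M N"

definition pure_tensor ::
    "('k::field, 'b, 'w) graded_scheme \<Rightarrow> ('k, 'u, 'a, 'b, 'y) gbimod_scheme \<Rightarrow>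
     ('k, 'v, 'b, 'c, 'z) gbimod_scheme \<Rightarrow> 'u \<Rightarrow> 'v \<Rightarrow> (('u \<times> 'v) \<Rightarrow>\<^sub>0 'k) set" where
  "pure_tensor B M N x y = tensor_class B M N (Poly_Mapping.single (x, y) 1)"

definition tensor ::
    "('k::field, 'b, 'w) graded_scheme \<Rightarrow> ('k, 'u, 'a, 'b, 'y) gbimod_scheme \<Rightarrow>
     ('k, 'v, 'b, 'c, 'z) gbimod_scheme \<Rightarrow> ('k, (('u \<times> 'v) \<Rightarrow>\<^sub>0 'k) set, 'a, 'c) gbimod" where
  "tensor B M N = \<lparr>
     carrier = tensor_class B M N ` {f. Poly_Mapping.keys f \<subseteq> carrier M \<times> carrier N},
     monoid.mult = undefined,
     one = undefined,
     ring.zero = tensor_rels B M N,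
     add = (\<lambda>S T. \<Union>f\<in>S. \<Union>g\<in>T. tensor_class B M N (f + g)),
     module.smult = (\<lambda>c S. \<Union>f\<in>S. tensor_class B M N (scal c f)),
     hom_part = (\<lambda>k. tensor_class B M N `
       {f. \<forall>(x, y) \<in> Poly_Mapping.keys f.
            \<exists>a b. a + b = k \<and> x \<in> hom_part M a \<and> y \<in> hom_part N b}),
     lact = (\<lambda>a S. \<Union>f\<in>S. tensor_class B M N (lin_ext (\<lambda>(x, y). (lact M a x, y)) f)),
     ract = (\<lambda>S c. \<Union>f\<in>S. tensor_class B M N (lin_ext (\<lambda>(x, y). (x, ract N y c)) f))\<rparr>"

text \<open>Maps are taken in \<^const>\<open>extensional\<close> form so that uniqueness is uniqueness as maps on
  the carrier.\<close>

definition is_tensor_diff ::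
    "('k::field, 'b, 'w) graded_scheme \<Rightarrow> ('k, 'u, 'a, 'b, 'y) gbimod_scheme \<Rightarrow> ('u \<Rightarrow> 'u) \<Rightarrow>
     ('k, 'v, 'b, 'c, 'z) gbimod_scheme \<Rightarrow> ('v \<Rightarrow> 'v) \<Rightarrow>
     ((('u \<times> 'v) \<Rightarrow>\<^sub>0 'k) set \<Rightarrow> (('u \<times> 'v) \<Rightarrow>\<^sub>0 'k) set) \<Rightarrow> bool" where
  "is_tensor_diff B M dM N dN \<delta> \<longleftrightarrow>
     \<delta> \<in> extensional (carrier (tensor B M N)) \<and>
     \<delta> \<in> linear_maps (tensor B M N) (tensor B M N) \<and>
     (\<forall>x\<in>carrier M. \<forall>y\<in>carrier N.
        \<delta> (pure_tensor B M N x y) =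
          pure_tensor B M N (dM x) y \<oplus>\<^bsub>tensor B M N\<^esub> pure_tensor B M N x (dN y))"

text \<open>The shift by \<open>r\<close> moves an element of degree \<open>k\<close> to degree \<open>k + r\<close>.\<close>

definition shift :: "int \<Rightarrow> ('k, 'v, 'z) graded_scheme \<Rightarrow> ('k, 'v, 'z) graded_scheme" where
  "shift r M = M\<lparr>hom_part := (\<lambda>k. hom_part M (k - r))\<rparr>"

definition with_actions ::
    "('k, 'v) graded \<Rightarrow> ('a \<Rightarrow> 'v \<Rightarrow> 'v) \<Rightarrow> ('v \<Rightarrow> 'b \<Rightarrow> 'v) \<Rightarrow> ('k, 'v, 'a, 'b) gbimod" where
  "with_actions V l r = graded.extend V (gbimod.fields l r)"

definition regular_bimodule :: "('k, 'a) graded \<Rightarrow> ('k, 'a, 'a, 'a) gbimod" where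
  "regular_bimodule A = with_actions A (\<lambda>a x. a \<otimes>\<^bsub>A\<^esub> x) (\<lambda>x b. x \<otimes>\<^bsub>A\<^esub> b)"

definition graded_subspace :: "('k, 'v) graded \<Rightarrow> 'v set \<Rightarrow> ('k, 'v) graded" where
  "graded_subspace V C = V\<lparr>carrier := C, hom_part := (\<lambda>k. hom_part V k \<inter> C)\<rparr>"


section \<open>Sequences\<close>

datatype entry = Black | Red nat

definition Seq :: "nat list \<Rightarrow> nat \<Rightarrow> entry list set" where
  "Seq s n = {i. filter (\<lambda>c. c \<noteq> Black) i = map Red s \<and> count_list i Black = n}"

text \<open>Positions in sequences are counted from 1.\<close>

definition ent :: "entry list \<Rightarrow> nat \<Rightarrow> entry" where
  "ent i j = i ! (j - 1)"

definition swap_entries :: "nat \<Rightarrow> entry list \<Rightarrow> entry list" where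
  "swap_entries j i = i[j - 1 := ent i (j + 1), j := ent i j]"

text \<open>The position of the \<open>j\<close>-th entry different from \<^const>\<open>Black\<close>.\<close>

definition red_pos :: "nat \<Rightarrow> entry list \<Rightarrow> nat" where
  "red_pos j i = filter (\<lambda>l. ent i l \<noteq> Black) [1..<length i + 1] ! (j - 1)"

definition merge :: "nat \<Rightarrow> nat list \<Rightarrow> nat list" where
  "merge j s = take (j - 1) s @ [s ! (j - 1) + s ! j] @ drop (j + 1) s"

definition split_list :: "nat \<Rightarrow> nat \<Rightarrow> nat list \<Rightarrow> nat list" where
  "split_list j a s = take (j - 1) s @ [s ! (j - 1) - a, a] @ drop j s"

definition split_seq :: "nat list \<Rightarrow> nat \<Rightarrow> nat \<Rightarrow> entry list \<Rightarrow> entry list" where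
  "split_seq s j a i =
     take (red_pos j i - 1) i @ [Red (s ! (j - 1) - a), Red a] @ drop (red_pos j i) i"


section \<open>The deformed Webster algebra\<close>

text \<open>
  The free algebra on a set of letters is the monoid algebra of the free monoid of words.
\<close>

datatype 'g fword = FWord (letters: "'g list")

instantiation fword :: (type) monoid_add
begin

definition zero_fword :: "'a fword" where "zero_fword = FWord []"

definition plus_fword :: "'a fword \<Rightarrow> 'a fword \<Rightarrow> 'a fword" where
  "plus_fword v w = FWord (letters v @ letters w)"

instance
  by standard (auto simp: zero_fword_def plus_fword_def)

end

datatype gen = GI "entry list" | GX nat | GE nat nat | GPsi nat

type_synonym 'k falg = "gen fword \<Rightarrow>\<^sub>0 'k"

definition letter :: "gen \<Rightarrow> 'k::field falg" where
  "letter g = Poly_Mapping.single (FWord [g]) 1"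

definition idem :: "entry list \<Rightarrow> 'k::field falg" where "idem i = letter (GI i)"

definition vx :: "nat \<Rightarrow> 'k::field falg" where "vx j = letter (GX j)"

definition vE :: "nat \<Rightarrow> nat \<Rightarrow> 'k::field falg" where
  "vE d j = (if d = 0 then 1 else letter (GE d j))"

definition psi :: "nat \<Rightarrow> 'k::field falg" where "psi j = letter (GPsi j)"

definition is_gen :: "nat list \<Rightarrow> nat \<Rightarrow> gen \<Rightarrow> bool" where
  "is_gen s n g = (case g of
      GI i \<Rightarrow> i \<in> Seq s n
    | GX j \<Rightarrow> 1 \<le> j \<and> j \<le> length s + n
    | GE d j \<Rightarrow> 1 \<le> d \<and> 1 \<le> j \<and> j \<le> length s + n
    | GPsi j \<Rightarrow> 1 \<le> j \<and> j + 1 \<le> length s + n)"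

text \<open>
  Each relation \<open>a = b\<close> is entered as the element \<open>a - b\<close>. The type \<^typ>\<open>gen\<close> contains
  letters that are not generators for the given \<open>s\<close>, \<open>n\<close>; rule \<open>no_gen\<close> sets them to zero, so
  that the quotient is the algebra on the actual generators. In particular \<open>idem (swap_entries j i)\<close>
  is zero in the quotient when the swapped sequence is not in \<open>Seq s n\<close>.
\<close>

inductive_set D_rels :: "nat list \<Rightarrow> nat \<Rightarrow> 'k::field falg set" for s n where
  no_gen: "\<not> is_gen s n g \<Longrightarrow> letter g \<in> D_rels s n"
| unit: "1 - (\<Sum>i\<in>Seq s n. idem i) \<in> D_rels s n"

| idem_idem: "\<lbrakk>i \<in> Seq s n; i' \<in> Seq s n\<rbrakk> \<Longrightarrow>
    idem i * idem i' - (if i = i' then idem i else 0) \<in> D_rels s n"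
| E_idem: "\<lbrakk>i \<in> Seq s n; is_gen s n (GE d j)\<rbrakk> \<Longrightarrow>
    vE d j * idem i - idem i * vE d j \<in> D_rels s n"
| x_idem: "\<lbrakk>i \<in> Seq s n; is_gen s n (GX j)\<rbrakk> \<Longrightarrow>
    vx j * idem i - idem i * vx j \<in> D_rels s n"
| psi_idem: "\<lbrakk>i \<in> Seq s n; is_gen s n (GPsi j)\<rbrakk> \<Longrightarrow>
    psi j * idem i - idem (swap_entries j i) * psi j \<in> D_rels s n"

| E_black: "\<lbrakk>i \<in> Seq s n; is_gen s n (GE d j); ent i j = Black\<rbrakk> \<Longrightarrow>
    vE d j * idem i \<in> D_rels s n"
| E_large: "\<lbrakk>i \<in> Seq s n; is_gen s n (GE d j); ent i j = Red a; d > a\<rbrakk> \<Longrightarrow>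
    vE d j * idem i \<in> D_rels s n"
| x_red: "\<lbrakk>i \<in> Seq s n; is_gen s n (GX j); ent i j = Red a\<rbrakk> \<Longrightarrow>
    vx j * idem i \<in> D_rels s n"
| psi_red_red: "\<lbrakk>i \<in> Seq s n; is_gen s n (GPsi j); ent i j = Red a; ent i (j + 1) = Red b\<rbrakk> \<Longrightarrow>
    psi j * idem i \<in> D_rels s n"

| x_x: "\<lbrakk>is_gen s n (GX j); is_gen s n (GX l)\<rbrakk> \<Longrightarrow>
    vx j * vx l - vx l * vx j \<in> D_rels s n"
| E_x: "\<lbrakk>is_gen s n (GE d j); is_gen s n (GX l)\<rbrakk> \<Longrightarrow>
    vE d j * vx l - vx l * vE d j \<in> D_rels s n"
| E_E: "\<lbrakk>is_gen s n (GE d j); is_gen s n (GE d' l)\<rbrakk> \<Longrightarrow>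
    vE d j * vE d' l - vE d' l * vE d j \<in> D_rels s n"

| psi_x_far: "\<lbrakk>is_gen s n (GPsi j); is_gen s n (GX l); l \<noteq> j; l \<noteq> j + 1\<rbrakk> \<Longrightarrow>
    psi j * vx l - vx l * psi j \<in> D_rels s n"
| psi_E_far: "\<lbrakk>is_gen s n (GPsi j); is_gen s n (GE d l); l \<noteq> j; l \<noteq> j + 1\<rbrakk> \<Longrightarrow>
    psi j * vE d l - vE d l * psi j \<in> D_rels s n"
| psi_E: "\<lbrakk>is_gen s n (GPsi j); d \<ge> 1\<rbrakk> \<Longrightarrow>
    psi j * vE d j - vE d (j + 1) * psi j \<in> D_rels s n"
| E_psi: "\<lbrakk>is_gen s n (GPsi j); d \<ge> 1\<rbrakk> \<Longrightarrow>
    vE d j * psi j - psi j * vE d (j + 1) \<in> D_rels s n"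
| psi_psi_far: "\<lbrakk>is_gen s n (GPsi j); is_gen s n (GPsi l); j + 1 < l \<or> l + 1 < j\<rbrakk> \<Longrightarrow>
    psi j * psi l - psi l * psi j \<in> D_rels s n"

| x_psi_black_black:
    "\<lbrakk>i \<in> Seq s n; is_gen s n (GPsi j); ent i j = Black; ent i (j + 1) = Black\<rbrakk> \<Longrightarrow>
    (vx j * psi j * idem i - psi j * vx (j + 1) * idem i) - idem i \<in> D_rels s n"
| x_psi_red_black:
    "\<lbrakk>i \<in> Seq s n; is_gen s n (GPsi j); ent i j = Red a; ent i (j + 1) = Black\<rbrakk> \<Longrightarrow>
    vx j * psi j * idem i - psi j * vx (j + 1) * idem i \<in> D_rels s n"
| psi_x_black_black:
    "\<lbrakk>i \<in> Seq s n; is_gen s n (GPsi j); ent i j = Black; ent i (j + 1) = Black\<rbrakk> \<Longrightarrow>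
    (psi j * vx j * idem i - vx (j + 1) * psi j * idem i) - idem i \<in> D_rels s n"
| psi_x_black_red:
    "\<lbrakk>i \<in> Seq s n; is_gen s n (GPsi j); ent i j = Black; ent i (j + 1) = Red a\<rbrakk> \<Longrightarrow>
    psi j * vx j * idem i - vx (j + 1) * psi j * idem i \<in> D_rels s n"

| psi_square_black_black:
    "\<lbrakk>i \<in> Seq s n; is_gen s n (GPsi j); ent i j = Black; ent i (j + 1) = Black\<rbrakk> \<Longrightarrow>
    psi j ^ 2 * idem i \<in> D_rels s n"
| psi_square_red_black:
    "\<lbrakk>i \<in> Seq s n; is_gen s n (GPsi j); ent i j = Red a; ent i (j + 1) = Black\<rbrakk> \<Longrightarrow>
    psi j ^ 2 * idem i
      - (\<Sum>d=0..a. (-1) ^ d * vE d j * vx (j + 1) ^ (a - d) * idem i) \<in> D_rels s n"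
| psi_square_black_red:
    "\<lbrakk>i \<in> Seq s n; is_gen s n (GPsi j); ent i j = Black; ent i (j + 1) = Red a\<rbrakk> \<Longrightarrow>
    psi j ^ 2 * idem i
      - (\<Sum>d=0..a. (-1) ^ d * vx j ^ (a - d) * vE d (j + 1) * idem i) \<in> D_rels s n"

| braid_black_red_black:
    "\<lbrakk>i \<in> Seq s n; is_gen s n (GPsi j); is_gen s n (GPsi (j + 1));
      ent i j = Black; ent i (j + 1) = Red a; ent i (j + 2) = Black\<rbrakk> \<Longrightarrow>
    (psi j * psi (j + 1) * psi j - psi (j + 1) * psi j * psi (j + 1)) * idem i
      - (\<Sum>(d1, d2, d3) \<in> {(d1, d2, d3). d1 + d2 + d3 + 1 = a}.
           (-1) ^ d3 * vx j ^ d1 * vE d3 (j + 1) * vx (j + 2) ^ d2 * idem i) \<in> D_rels s n"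
| braid_other:
    "\<lbrakk>i \<in> Seq s n; is_gen s n (GPsi j); is_gen s n (GPsi (j + 1));
      \<not> (ent i j = Black \<and> ent i (j + 1) \<noteq> Black \<and> ent i (j + 2) = Black)\<rbrakk> \<Longrightarrow>
    (psi j * psi (j + 1) * psi j - psi (j + 1) * psi j * psi (j + 1)) * idem i \<in> D_rels s n"

definition D_ideal :: "nat list \<Rightarrow> nat \<Rightarrow> 'k::field falg set" where
  "D_ideal s n = Idl\<^bsub>ring_of_type_algebra\<^esub> (D_rels s n)"

definition cls :: "nat list \<Rightarrow> nat \<Rightarrow> 'k::field falg \<Rightarrow> 'k falg set" where
  "cls s n a = D_ideal s n +>\<^bsub>ring_of_type_algebra\<^esub> a"

text \<open>
  \<open>homog s n k a\<close> expresses that \<open>a\<close> represents an element of degree \<open>k\<close>. The letter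
  \<open>psi j\<close> alone is not homogeneous; its degree depends on the idempotent it is multiplied with.
\<close>

inductive homog :: "nat list \<Rightarrow> nat \<Rightarrow> int \<Rightarrow> 'k::field falg \<Rightarrow> bool" for s n where
  zero: "homog s n k 0"
| plus: "\<lbrakk>homog s n k a; homog s n k b\<rbrakk> \<Longrightarrow> homog s n k (a + b)"
| scal: "homog s n k a \<Longrightarrow> homog s n k (scal c a)"
| one: "homog s n 0 1"
| times: "\<lbrakk>homog s n k a; homog s n l b\<rbrakk> \<Longrightarrow> homog s n (k + l) (a * b)"
| idem: "i \<in> Seq s n \<Longrightarrow> homog s n 0 (idem i)"
| x: "is_gen s n (GX j) \<Longrightarrow> homog s n 2 (vx j)"
| E: "is_gen s n (GE d j) \<Longrightarrow> homog s n (2 * int d) (vE d j)"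
| psi_black_black:
    "\<lbrakk>i \<in> Seq s n; is_gen s n (GPsi j); ent i j = Black; ent i (j + 1) = Black\<rbrakk> \<Longrightarrow>
    homog s n (-2) (psi j * idem i)"
| psi_red_black:
    "\<lbrakk>i \<in> Seq s n; is_gen s n (GPsi j); ent i j = Red a; ent i (j + 1) = Black\<rbrakk> \<Longrightarrow>
    homog s n (int a) (psi j * idem i)"
| psi_black_red:
    "\<lbrakk>i \<in> Seq s n; is_gen s n (GPsi j); ent i j = Black; ent i (j + 1) = Red a\<rbrakk> \<Longrightarrow>
    homog s n (int a) (psi j * idem i)"

definition D :: "nat list \<Rightarrow> nat \<Rightarrow> ('k::field, 'k falg set) graded" where
  "D s n = (let Q = ring_of_type_algebra Quot D_ideal s n in \<lparr>
     carrier = carrier Q,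
     monoid.mult = monoid.mult Q,
     one = one Q,
     ring.zero = ring.zero Q,
     add = add Q,
     module.smult = (\<lambda>c S. cls s n (Poly_Mapping.single 0 c) \<otimes>\<^bsub>Q\<^esub> S),
     hom_part = (\<lambda>k. cls s n ` {a. homog s n k a})\<rparr>)"


section \<open>The derivation\<close>

definition is_partial_D ::
    "nat list \<Rightarrow> nat \<Rightarrow> ('k::field falg set \<Rightarrow> 'k falg set) \<Rightarrow> bool" where
  "is_partial_D s n \<delta> \<longleftrightarrow>
     \<delta> \<in> extensional (carrier (D s n)) \<and>
     \<delta> \<in> linear_maps (D s n) (D s n) \<and>
     (\<forall>a\<in>carrier (D s n). \<forall>b\<in>carrier (D s n).
        \<delta> (a \<otimes>\<^bsub>D s n\<^esub> b) = \<delta> a \<otimes>\<^bsub>D s n\<^esub> b \<oplus>\<^bsub>D s n\<^esub> a \<otimes>\<^bsub>D s n\<^esub> \<delta> b) \<and>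
     (\<forall>i\<in>Seq s n. \<delta> (cls s n (idem i)) = cls s n 0) \<and>
     (\<forall>j. is_gen s n (GX j) \<longrightarrow> \<delta> (cls s n (vx j)) = cls s n (vx j ^ 2)) \<and>
     (\<forall>i\<in>Seq s n. \<forall>j d a. is_gen s n (GE d j) \<and> ent i j = Red a \<longrightarrow>
        (d < a \<longrightarrow> \<delta> (cls s n (vE d j * idem i)) =
           cls s n ((vE d j * vE 1 j - of_nat (d + 1) * vE (d + 1) j) * idem i)) \<and>
        (d = a \<longrightarrow> \<delta> (cls s n (vE d j * idem i)) = cls s n (vE d j * vE 1 j * idem i))) \<and>
     (\<forall>i\<in>Seq s n. \<forall>j. is_gen s n (GPsi j) \<longrightarrow>
        (ent i j = Black \<and> ent i (j + 1) = Black \<longrightarrow>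
           \<delta> (cls s n (psi j * idem i)) =
             cls s n (- (vx j * psi j * idem i) - psi j * vx (j + 1) * idem i)) \<and>
        (\<forall>a. ent i j = Red a \<and> ent i (j + 1) = Black \<longrightarrow>
           \<delta> (cls s n (psi j * idem i)) =
             cls s n (of_nat a * psi j * vx (j + 1) * idem i)) \<and>
        (\<forall>a. ent i j = Black \<and> ent i (j + 1) = Red a \<longrightarrow>
           \<delta> (cls s n (psi j * idem i)) = cls s n (psi j * vE 1 (j + 1) * idem i)))"

definition partial_D :: "nat list \<Rightarrow> nat \<Rightarrow> 'k::field falg set \<Rightarrow> 'k falg set" where
  "partial_D s n = (THE \<delta>. is_partial_D s n \<delta>)"


section \<open>The inclusion maps\<close>

definition is_Phi ::
    "nat list \<Rightarrow> nat \<Rightarrow> nat \<Rightarrow> nat \<Rightarrow> ('k::field falg set \<Rightarrow> 'k falg set) \<Rightarrow> bool" where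
  "is_Phi s n j a f \<longleftrightarrow> (let t = split_list j a s; c = cls s n; c' = cls t n in
     f \<in> extensional (carrier (D s n)) \<and>
     f \<in> linear_maps (D s n) (D t n) \<and>
     (\<forall>u\<in>carrier (D s n). \<forall>v\<in>carrier (D s n).
        f (u \<otimes>\<^bsub>D s n\<^esub> v) = f u \<otimes>\<^bsub>D t n\<^esub> f v) \<and>
     (\<forall>i\<in>Seq s n. let l' = red_pos j i; e' = idem (split_seq s j a i) in
        f (c (idem i)) = c' e' \<and>
        (\<forall>d l. is_gen s n (GE d l) \<longrightarrow>
           (l < l' \<longrightarrow> f (c (vE d l * idem i)) = c' (vE d l * e')) \<and>
           (l > l' \<longrightarrow> f (c (vE d l * idem i)) = c' (vE d (l + 1) * e')) \<and>
           (l = l' \<and> d \<le> s ! (j - 1) \<longrightarrow>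
              f (c (vE d l * idem i)) =
                c' (\<Sum>(d1, d2) \<in> {(d1, d2). d1 + d2 = d}. vE d1 l * vE d2 (l + 1) * e'))) \<and>
        (\<forall>l. is_gen s n (GX l) \<longrightarrow>
           (l < l' \<longrightarrow> f (c (vx l * idem i)) = c' (vx l * e')) \<and>
           (l > l' \<longrightarrow> f (c (vx l * idem i)) = c' (vx (l + 1) * e'))) \<and>
        (\<forall>l. is_gen s n (GPsi l) \<longrightarrow>
           (l + 1 < l' \<longrightarrow> f (c (psi l * idem i)) = c' (psi l * e')) \<and>
           (l + 1 = l' \<and> ent i l = Black \<longrightarrow>
              f (c (psi l * idem i)) = c' (psi (l + 1) * psi l * e')) \<and>
           (l = l' \<and> ent i (l + 1) = Black \<longrightarrow>
              f (c (psi l * idem i)) = c' (psi l * psi (l + 1) * e')) \<and>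
           (l > l' \<longrightarrow> f (c (psi l * idem i)) = c' (psi (l + 1) * e')))))"

definition Phi :: "nat list \<Rightarrow> nat \<Rightarrow> nat \<Rightarrow> nat \<Rightarrow> 'k::field falg set \<Rightarrow> 'k falg set" where
  "Phi s n j a = (THE f. is_Phi s n j a f)"


section \<open>Splitter bimodules\<close>

definition adjacent_Seq :: "nat list \<Rightarrow> nat \<Rightarrow> nat \<Rightarrow> entry list set" where
  "adjacent_Seq s n j = {i \<in> Seq s n. red_pos (j + 1) i = red_pos j i + 1}"

definition e_hat :: "nat list \<Rightarrow> nat \<Rightarrow> nat \<Rightarrow> 'k::field falg set" where
  "e_hat s n j = cls s n (\<Sum>i\<in>adjacent_Seq s n j. idem i)"

text \<open>The inclusion of \<open>D (merge j s) n\<close> into \<open>D s n\<close>; note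
  \<open>split_list j (s ! j) (merge j s) = s\<close>, where \<open>s ! j\<close> is the entry with 1-based
  index \<open>j + 1\<close>.\<close>

definition incl :: "nat list \<Rightarrow> nat \<Rightarrow> nat \<Rightarrow> 'k::field falg set \<Rightarrow> 'k falg set" where
  "incl s n j = Phi (merge j s) n j (s ! j)"

definition e_hat_D ::
    "nat list \<Rightarrow> nat \<Rightarrow> nat \<Rightarrow> ('k::field, 'k falg set, 'k falg set, 'k falg set) gbimod" where
  "e_hat_D s n j = with_actions
     (graded_subspace (D s n) {e_hat s n j \<otimes>\<^bsub>D s n\<^esub> y | y. y \<in> carrier (D s n)})
     (\<lambda>a y. incl s n j a \<otimes>\<^bsub>D s n\<^esub> y) (\<lambda>y b. y \<otimes>\<^bsub>D s n\<^esub> b)"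

definition D_e_hat ::
    "nat list \<Rightarrow> nat \<Rightarrow> nat \<Rightarrow> ('k::field, 'k falg set, 'k falg set, 'k falg set) gbimod" where
  "D_e_hat s n j = with_actions
     (graded_subspace (D s n) {y \<otimes>\<^bsub>D s n\<^esub> e_hat s n j | y. y \<in> carrier (D s n)})
     (\<lambda>b y. b \<otimes>\<^bsub>D s n\<^esub> y) (\<lambda>y a. y \<otimes>\<^bsub>D s n\<^esub> incl s n j a)"

type_synonym 'k splitter_elt = "(('k falg set \<times> 'k falg set) \<Rightarrow>\<^sub>0 'k) set"

definition tri_up ::
    "nat list \<Rightarrow> nat \<Rightarrow> nat \<Rightarrow> ('k::field, 'k splitter_elt, 'k falg set, 'k falg set) gbimod" where
  "tri_up s n j = shift (- int (s ! (j - 1) * s ! j))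
     (tensor (D (merge j s) n) (regular_bimodule (D (merge j s) n)) (e_hat_D s n j))"

definition tri_down ::
    "nat list \<Rightarrow> nat \<Rightarrow> nat \<Rightarrow> ('k::field, 'k splitter_elt, 'k falg set, 'k falg set) gbimod" where
  "tri_down s n j =
     tensor (D (merge j s) n) (D_e_hat s n j) (regular_bimodule (D (merge j s) n))"

definition is_partial_up ::
    "nat list \<Rightarrow> nat \<Rightarrow> nat \<Rightarrow> ('k::field splitter_elt \<Rightarrow> 'k splitter_elt) \<Rightarrow> bool" where
  "is_partial_up s n j = is_tensor_diff (D (merge j s) n)
     (regular_bimodule (D (merge j s) n)) (partial_D (merge j s) n)
     (e_hat_D s n j) (partial_D s n)"

definition is_partial_down ::
    "nat list \<Rightarrow> nat \<Rightarrow> nat \<Rightarrow> ('k::field splitter_elt \<Rightarrow> 'k splitter_elt) \<Rightarrow> bool" where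
  "is_partial_down s n j = is_tensor_diff (D (merge j s) n)
     (D_e_hat s n j) (partial_D s n)
     (regular_bimodule (D (merge j s) n)) (partial_D (merge j s) n)"

definition partial_up ::
    "nat list \<Rightarrow> nat \<Rightarrow> nat \<Rightarrow> 'k::field splitter_elt \<Rightarrow> 'k splitter_elt" where
  "partial_up s n j = (THE \<delta>. is_partial_up s n j \<delta>)"

definition partial_down ::
    "nat list \<Rightarrow> nat \<Rightarrow> nat \<Rightarrow> 'k::field splitter_elt \<Rightarrow> 'k splitter_elt" where
  "partial_down s n j = (THE \<delta>. is_partial_down s n j \<delta>)"

end

theory Submission imports Defs
begin

text \<open>
  A tensor product \<open>A \<otimes>\<^sub>A M\<close> is \<open>M\<close> itself, and under this identification
  \<open>\<partial> \<otimes> id + id \<otimes> \<partial>\<close> is the derivation of \<open>M\<close>. So the theorem reduces to three facts: \<open>D s n\<close> is a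
  p-DG algebra, the inclusion map is a well-defined graded homomorphism, and it commutes with the
  derivations; then \<open>\<partial> e_hat = \<partial> (\<Phi> 1) = 0\<close>, and the derivation restricts to
  \<open>e_hat D\<close> and \<open>D e_hat\<close>.

  A map on generators is checked against the relations one idempotent \<open>e(i)\<close> at a time: on
  elements \<open>v\<close> with \<open>e(i) v = v\<close> the relations become commutation rules between the generators,
  with \<open>chi a E x = \<Sum>(-1)^d E(d) x^(a-d)\<close> as the square of \<open>\<psi>\<close> and the divided difference of
  \<open>chi\<close> as the defect of the braid relation. Merging two red entries multiplies the polynomials
  \<open>chi\<close>, which gives the relations for the inclusion map. The derivation is \<open>p\<close>-nilpotent
  because its \<open>p\<close>-th power is again a derivation and kills the generators.
\<close>

section \<open>Maps out of the free algebra\<close>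

lemma scal_conv: "scal c a = Poly_Mapping.single 0 c * a"
  by (rule mult_map_scale_conv_mult)

lemma poly_mapping_sum_singles:
  fixes f :: "'x \<Rightarrow>\<^sub>0 'r::comm_monoid_add"
  shows
  "f = (\<Sum>k\<in>Poly_Mapping.keys f. Poly_Mapping.single k (Poly_Mapping.lookup f k))"
  by (rule poly_mapping_eqI)
    (auto simp: lookup_sum lookup_single when_def in_keys_iff sum.delta)

lemma poly_mapping_single_induct [case_names zero add single]:
  fixes f :: "'x \<Rightarrow>\<^sub>0 'r::comm_monoid_add"
  assumes "P 0" and "\<And>a b. P a \<Longrightarrow> P b \<Longrightarrow> P (a + b)"
    and "\<And>k v. P (Poly_Mapping.single k v)"
  shows "P f"
proof -
  have "finite K \<Longrightarrow> P (\<Sum>k\<in>K. Poly_Mapping.single k (Poly_Mapping.lookup f k))" for K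
    by (induction K rule: finite_induct) (auto intro: assms)
  from this[OF finite_keys] show ?thesis
    by (subst poly_mapping_sum_singles)
qed

lemma single_zero_central:
  assumes "\<And>r. c * r = r * c"
  shows "Poly_Mapping.single 0 c * a = a * Poly_Mapping.single (0::'m::monoid_add) (c::'r::ring_1)"
  by (induction a rule: poly_mapping_single_induct)
    (auto simp: algebra_simps mult_single assms)

definition word :: "gen list \<Rightarrow> 'k::field falg" where
  "word w = Poly_Mapping.single (FWord w) 1"

lemma word_Nil [simp]: "word [] = 1"
  by (simp add: word_def flip: zero_fword_def single_one)

lemma word_append: "word (v @ w) = word v * word w"
  by (simp add: word_def mult_single plus_fword_def)

lemma letter_word: "letter g = word [g]"
  by (simp add: letter_def word_def)

lemma word_Cons: "word (g # w) = letter g * word w"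
  using word_append[of "[g]" w] by (simp add: letter_word)

lemma single_word: "Poly_Mapping.single w c = scal c (word (letters w))"
  by (simp add: word_def)

lemma falg_induct [case_names add scal one letter]:
  assumes "\<And>a b. P a \<Longrightarrow> P b \<Longrightarrow> P (a + b)" and "\<And>c a. P a \<Longrightarrow> P (scal c a)"
    and "P 1" and "\<And>g a. P a \<Longrightarrow> P (letter g * a)"
  shows "P (a :: 'k::field falg)"
proof (induction a rule: poly_mapping_single_induct)
  case zero
  have "scal 0 1 = (0 :: 'k falg)" by (simp add: scal_conv)
  with assms(2)[OF assms(3), of 0] show ?case by simp
next
  case (single k v)
  have "P (word w)" for w
    by (induction w) (auto simp: word_Cons intro: assms)
  then show ?case by (simp add: single_word assms(2))
qed (rule assms(1))

definition lin :: "('k::field \<Rightarrow> 'q::ring_1) \<Rightarrow> (gen fword \<Rightarrow> 'q) \<Rightarrow> 'k falg \<Rightarrow> 'q" where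
  "lin \<kappa> F a = (\<Sum>w\<in>Poly_Mapping.keys a. \<kappa> (Poly_Mapping.lookup a w) * F w)"

locale scalar_hom =
  fixes \<kappa> :: "'k::field \<Rightarrow> 'q::ring_1"
  assumes one: "\<kappa> 1 = 1" and add: "\<kappa> (a + b) = \<kappa> a + \<kappa> b" and mult: "\<kappa> (a * b) = \<kappa> a * \<kappa> b"
    and central: "\<kappa> a * q = q * \<kappa> a"
begin

lemma zero: "\<kappa> 0 = 0"
  using add[of 0 0] by simp

lemma lin_add: "lin \<kappa> F (a + b) = lin \<kappa> F a + lin \<kappa> F b"
  unfolding lin_def by (rule setsum_keys_plus_distrib) (auto simp: zero add algebra_simps)

lemma lin_zero [simp]: "lin \<kappa> F 0 = 0"
  by (simp add: lin_def)

lemma lin_single: "lin \<kappa> F (Poly_Mapping.single w c) = \<kappa> c * F w"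
  by (cases "c = 0") (auto simp: lin_def zero)

lemma lin_word: "lin \<kappa> F (word w) = F (FWord w)"
  by (simp add: word_def lin_single one)

lemma lin_mult:
  assumes "\<And>v w. F (v + w) = F1 v * G1 w + F2 v * G2 w"
  shows "lin \<kappa> F (a * b) = lin \<kappa> F1 a * lin \<kappa> G1 b + lin \<kappa> F2 a * lin \<kappa> G2 b"
proof (induction a rule: poly_mapping_single_induct)
  case (single v c)
  show ?case
  proof (induction b rule: poly_mapping_single_induct)
    case (single w d)
    have c: "x * (\<kappa> d * y) = \<kappa> d * (x * y)" for x y
      by (metis central mult.assoc)
    show ?case
      by (simp add: mult_single lin_single assms mult distrib_left mult.assoc c)
  qed (auto simp: lin_add algebra_simps)
qed (auto simp: lin_add algebra_simps)

lemma lin_scal: "lin \<kappa> F (scal c a) = \<kappa> c * lin \<kappa> F a"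
proof (induction a rule: poly_mapping_single_induct)
  case (add a b)
  have "scal c (a + b) = scal c a + scal c b"
    by (simp only: scal_conv distrib_left)
  with add show ?case by (simp only: lin_add distrib_left)
qed (simp_all add: scal_conv mult_single lin_single mult mult.assoc)

end

lemma scalar_hom_single: "scalar_hom (Poly_Mapping.single 0 :: 'k::field \<Rightarrow> 'k falg)"
proof
  show "Poly_Mapping.single 0 a * q = q * Poly_Mapping.single 0 a" for a and q :: "'k falg"
    by (rule single_zero_central) (rule mult.commute)
qed (simp_all add: single_add mult_single)

lemma scal_mult_left [simp]: "scal c a * b = scal c (a * (b :: 'k::field falg))"
  unfolding scal_conv by (rule mult.assoc)

lemma scal_mult_right [simp]: "a * scal c b = scal c (a * (b :: 'k::field falg))"
proof -
  have "Poly_Mapping.single 0 c * a * b = a * Poly_Mapping.single 0 c * b"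
    by (subst scalar_hom.central[OF scalar_hom_single]) (rule refl)
  then show ?thesis
    unfolding scal_conv by (simp only: mult.assoc)
qed

lemma scal_zero [simp]: "scal c (0 :: 'k::field falg) = 0"
  and scal_one_left [simp]: "scal 1 a = (a :: 'k::field falg)"
  and scal_add: "scal c (a + b) = scal c a + scal c (b :: 'k::field falg)"
  and scal_scal [simp]: "scal c (scal d a) = scal (c * d) (a :: 'k::field falg)"
  and scal_add_left: "scal (c + d) a = scal c a + scal d (a :: 'k::field falg)"
  by (simp_all add: scal_conv algebra_simps single_add mult_single flip: mult.assoc)

lemma uminus_scal: "- a = scal (- 1) (a :: 'k::field falg)"
proof -
  have "a + scal (- 1) a = scal (1 + - 1) a"
    by (simp only: scal_add_left scal_one_left)
  then show ?thesis by (simp add: scal_conv eq_neg_iff_add_eq_0 add.commute neg_eq_iff_add_eq_0)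
qed

definition hom_ext :: "('k::field \<Rightarrow> 'q::ring_1) \<Rightarrow> 'q \<Rightarrow> (gen \<Rightarrow> 'q) \<Rightarrow> 'k falg \<Rightarrow> 'q" where
  "hom_ext \<kappa> u g = lin \<kappa> (\<lambda>w. foldr (\<lambda>x y. g x * y) (letters w) u)"

locale corner_hom = scalar_hom \<kappa>
  for \<kappa> :: "'k::field \<Rightarrow> 'q::ring_1" +
  fixes u :: 'q and g :: "gen \<Rightarrow> 'q"
  assumes unit: "u * u = u" "u * g x = g x" "g x * u = g x"
begin

lemma hom_ext_add: "hom_ext \<kappa> u g (a + b) = hom_ext \<kappa> u g a + hom_ext \<kappa> u g b"
  and hom_ext_scal: "hom_ext \<kappa> u g (scal c a) = \<kappa> c * hom_ext \<kappa> u g a"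
  by (simp_all add: hom_ext_def lin_add lin_scal)

lemma unit_foldr: "u * foldr (\<lambda>x y. g x * y) w u = foldr (\<lambda>x y. g x * y) w u"
  by (cases w) (auto simp: unit simp flip: mult.assoc)

lemma hom_ext_mult: "hom_ext \<kappa> u g (a * b) = hom_ext \<kappa> u g a * hom_ext \<kappa> u g b"
proof -
  have *: "foldr (\<lambda>x y. g x * y) (v @ w) u
      = foldr (\<lambda>x y. g x * y) v u * foldr (\<lambda>x y. g x * y) w u" for v w
    by (induction v) (auto simp: unit_foldr mult.assoc)
  show ?thesis
    unfolding hom_ext_def using *
    by (subst lin_mult[where ?F1.0 = "\<lambda>w. foldr (\<lambda>x y. g x * y) (letters w) u"
          and ?G1.0 = "\<lambda>w. foldr (\<lambda>x y. g x * y) (letters w) u" and ?F2.0 = "\<lambda>_. 0" and ?G2.0 = "\<lambda>_. 0"])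
      (auto simp: plus_fword_def lin_def)
qed

lemma hom_ext_one: "hom_ext \<kappa> u g 1 = u"
  using lin_word[of _ "[]"] by (simp add: hom_ext_def)

lemma hom_ext_letter: "hom_ext \<kappa> u g (letter x) = g x"
  by (simp add: hom_ext_def letter_word lin_word unit)

end

primrec der_word :: "(gen \<Rightarrow> 'k::field falg) \<Rightarrow> gen list \<Rightarrow> 'k falg" where
  "der_word d [] = 0"
| "der_word d (x # w) = d x * word w + letter x * der_word d w"

definition der :: "(gen \<Rightarrow> 'k::field falg) \<Rightarrow> 'k falg \<Rightarrow> 'k falg" where
  "der d = lin (Poly_Mapping.single 0) (\<lambda>w. der_word d (letters w))"

context
  fixes d :: "gen \<Rightarrow> 'k::field falg"
begin

interpretation scalar_hom "Poly_Mapping.single 0 :: 'k \<Rightarrow> 'k falg"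
  by (rule scalar_hom_single)

lemma der_add: "der d (a + b) = der d a + der d b"
  and der_letter: "der d (letter x) = d x"
  and der_one: "der d 1 = 0"
  using lin_word[of _ "[]"]
  by (simp_all add: der_def lin_add letter_word lin_word)

lemma der_scal: "der d (scal c a) = scal c (der d a)"
  unfolding der_def lin_scal by (simp only: scal_conv)

lemma der_mult: "der d (a * b) = der d a * b + a * der d b"
proof -
  have id: "lin (Poly_Mapping.single 0) (\<lambda>w. word (letters w)) a = a" for a :: "'k falg"
  proof (induction a rule: poly_mapping_single_induct)
    case (single k v)
    show ?case
      unfolding lin_single by (subst single_word[of k v]) (rule scal_conv[symmetric])
  qed (simp_all add: lin_add)
  have *: "der_word d (v @ w) = der_word d v * word w + word v * der_word d w" for v w
    by (induction v) (auto simp: word_append word_Cons algebra_simps)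
  have "der d (a * b) = der d a * lin (Poly_Mapping.single 0) (\<lambda>w. word (letters w)) b
      + lin (Poly_Mapping.single 0) (\<lambda>w. word (letters w)) a * der d b"
    unfolding der_def by (rule lin_mult) (auto simp: plus_fword_def *)
  then show ?thesis by (simp add: id)
qed

lemma der_zero: "der d 0 = 0"
  by (simp add: der_def)

lemma der_uminus: "der d (- a) = - der d a"
  by (simp only: uminus_scal der_scal)

lemma der_diff: "der d (a - b) = der d a - der d b"
  using der_add[of a "- b"] by (simp add: der_uminus)

lemma der_sum: "der d (sum f A) = (\<Sum>x\<in>A. der d (f x))"
  by (induction A rule: infinite_finite_induct) (auto simp: der_zero der_add)

end

section \<open>The relations as a congruence\<close>

lemma ring_of_type_algebra_ring: "ring (ring_of_type_algebra :: 'a::ring_1 ring)"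
proof -
  have "\<exists>y. x + y = 0" for x :: 'a
    by (metis add.right_inverse)
  then show ?thesis
    unfolding ring_of_type_algebra_def
    by unfold_locales (auto simp: algebra_simps Units_def)
qed

lemma ideal_of_type_algebraI:
  fixes J :: "'a::ring_1 set"
  assumes "0 \<in> J" and "\<And>a b. a \<in> J \<Longrightarrow> b \<in> J \<Longrightarrow> a + b \<in> J"
    and "\<And>a x. a \<in> J \<Longrightarrow> x * a \<in> J" and "\<And>a x. a \<in> J \<Longrightarrow> a * x \<in> J"
  shows "ideal J ring_of_type_algebra"
proof (rule idealI)
  have m: "- a \<in> J" if "a \<in> J" for a
    using assms(3)[OF that, of "- 1"] by simp
  have "group (add_monoid (ring_of_type_algebra :: 'a ring))"
    using ring.is_abelian_group[OF ring_of_type_algebra_ring] abelian_group.a_group by blast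
  then show "subgroup J (add_monoid (ring_of_type_algebra :: 'a ring))"
  proof (rule group.subgroupI)
    fix a assume a: "a \<in> J"
    have "inv\<^bsub>add_monoid (ring_of_type_algebra :: 'a ring)\<^esub> a = - a"
      by (rule group.inv_equality[OF \<open>group _\<close>]) (auto simp: ring_of_type_algebra_def)
    with m[OF a] show "inv\<^bsub>add_monoid (ring_of_type_algebra :: 'a ring)\<^esub> a \<in> J" by simp
  qed (use assms in \<open>auto simp: ring_of_type_algebra_def\<close>)
qed (use assms ring_of_type_algebra_ring in \<open>auto simp: ring_of_type_algebra_def\<close>)

lemma D_ideal_ideal: "ideal (D_ideal s n :: 'k::field falg set) ring_of_type_algebra"
  unfolding D_ideal_def
  by (rule ring.genideal_ideal[OF ring_of_type_algebra_ring]) (simp add: ring_of_type_algebra_def)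

lemma D_rels_subset: "D_rels s n \<subseteq> (D_ideal s n :: 'k::field falg set)"
  unfolding D_ideal_def
  by (rule ring.genideal_self[OF ring_of_type_algebra_ring]) (simp add: ring_of_type_algebra_def)

lemma D_ideal_minimal:
  assumes "D_rels s n \<subseteq> J" and "0 \<in> J" and "\<And>a b. a \<in> J \<Longrightarrow> b \<in> J \<Longrightarrow> a + b \<in> J"
    and "\<And>a x. a \<in> J \<Longrightarrow> x * a \<in> J" and "\<And>a x. a \<in> J \<Longrightarrow> a * x \<in> J"
  shows "D_ideal s n \<subseteq> (J :: 'k::field falg set)"
  unfolding D_ideal_def
  by (rule ring.genideal_minimal[OF ring_of_type_algebra_ring ideal_of_type_algebraI]) (use assms in auto)

lemma D_ideal_zero: "0 \<in> (D_ideal s n :: 'k::field falg set)"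
  and D_ideal_add: "a \<in> D_ideal s n \<Longrightarrow> b \<in> D_ideal s n \<Longrightarrow> a + b \<in> D_ideal s n"
  and D_ideal_mult_left: "a \<in> D_ideal s n \<Longrightarrow> x * a \<in> D_ideal s n"
  and D_ideal_mult_right: "a \<in> D_ideal s n \<Longrightarrow> a * x \<in> D_ideal s n"
  for a b x :: "'k::field falg"
proof -
  interpret ideal "D_ideal s n :: 'k falg set" ring_of_type_algebra
    by (rule D_ideal_ideal)
  show "0 \<in> (D_ideal s n :: 'k::field falg set)"
    using additive_subgroup.zero_closed[OF ideal.axioms(1)[OF D_ideal_ideal]]
    by (simp add: ring_of_type_algebra_def)
  show "a \<in> D_ideal s n \<Longrightarrow> b \<in> D_ideal s n \<Longrightarrow> a + b \<in> D_ideal s n"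
    using additive_subgroup.a_closed[OF ideal.axioms(1)[OF D_ideal_ideal]] by (simp add: ring_of_type_algebra_def)
  show "a \<in> D_ideal s n \<Longrightarrow> x * a \<in> D_ideal s n"
    using I_l_closed by (simp add: ring_of_type_algebra_def)
  show "a \<in> D_ideal s n \<Longrightarrow> a * x \<in> D_ideal s n"
    using I_r_closed by (simp add: ring_of_type_algebra_def)
qed

lemma D_ideal_uminus: "a \<in> D_ideal s n \<Longrightarrow> - a \<in> (D_ideal s n :: 'k::field falg set)"
  using D_ideal_mult_left[of a s n "- 1"] by simp

text \<open>
  The product of all the algebras \<open>D s n\<close> and of the free algebra (index \<^const>\<open>None\<close>, which
  ensures \<open>0 \<noteq> 1\<close>). Unlike a single algebra, whose carrier depends on \<open>s\<close> and \<open>n\<close>, it is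
  a type, so that one can compute in it by rewriting.
\<close>

definition dw_ideal :: "(nat list \<times> nat) option \<Rightarrow> 'k::field falg set" where
  "dw_ideal c = (case c of None \<Rightarrow> {0} | Some (s, n) \<Rightarrow> D_ideal s n)"

lemma dw_ideal_Some [simp]: "dw_ideal (Some (s, n)) = D_ideal s n"
  by (simp add: dw_ideal_def)

lemma dw_ideal_zero: "0 \<in> dw_ideal c"
  and dw_ideal_add: "a \<in> dw_ideal c \<Longrightarrow> b \<in> dw_ideal c \<Longrightarrow> a + b \<in> dw_ideal c"
  and dw_ideal_uminus: "a \<in> dw_ideal c \<Longrightarrow> - a \<in> dw_ideal c"
  and dw_ideal_mult_left: "a \<in> dw_ideal c \<Longrightarrow> x * a \<in> dw_ideal c"
  and dw_ideal_mult_right: "a \<in> dw_ideal c \<Longrightarrow> a * x \<in> dw_ideal c"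
  for a b x :: "'k::field falg"
  by (auto simp: dw_ideal_def D_ideal_zero D_ideal_add D_ideal_uminus D_ideal_mult_left
      D_ideal_mult_right split: option.splits)

definition dw_rel ::
    "((nat list \<times> nat) option \<Rightarrow> 'k::field falg) \<Rightarrow> ((nat list \<times> nat) option \<Rightarrow> 'k falg) \<Rightarrow> bool" where
  "dw_rel f g \<longleftrightarrow> (\<forall>c. f c - g c \<in> dw_ideal c)"

lemma dw_rel_refl: "dw_rel f f"
  by (simp add: dw_rel_def dw_ideal_zero)

lemma dw_relI: "(\<And>c. f c = g c) \<Longrightarrow> dw_rel f g"
  by (simp add: dw_rel_def dw_ideal_zero)

lemma dw_rel_equivp: "equivp dw_rel"
proof (rule equivpI)
  show "reflp dw_rel" by (auto simp: reflp_def dw_rel_refl)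
  show "symp dw_rel"
  proof (rule sympI)
    fix f g :: "(nat list \<times> nat) option \<Rightarrow> 'k::field falg" assume "dw_rel f g"
    then show "dw_rel g f"
      unfolding dw_rel_def by (metis dw_ideal_uminus minus_diff_eq)
  qed
  show "transp dw_rel"
  proof (rule transpI)
    fix f g h :: "(nat list \<times> nat) option \<Rightarrow> 'k::field falg" assume *: "dw_rel f g" "dw_rel g h"
    have "f c - h c = (f c - g c) + (g c - h c)" for c by simp
    with * show "dw_rel f h"
      unfolding dw_rel_def by (simp only: dw_ideal_add simp_thms)
  qed
qed

quotient_type (overloaded) 'k dw = "(nat list \<times> nat) option \<Rightarrow> 'k::field falg" / dw_rel
  by (rule dw_rel_equivp)

instantiation dw :: (field) ring_1
begin

lift_definition zero_dw :: "'a dw" is "\<lambda>_. 0" .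
lift_definition one_dw :: "'a dw" is "\<lambda>_. 1" .
lift_definition plus_dw :: "'a dw \<Rightarrow> 'a dw \<Rightarrow> 'a dw" is "\<lambda>f g c. f c + g c"
  unfolding dw_rel_def by (simp only: add_diff_add dw_ideal_add simp_thms)
lift_definition uminus_dw :: "'a dw \<Rightarrow> 'a dw" is "\<lambda>f c. - f c"
  unfolding dw_rel_def by (simp only: minus_diff_minus dw_ideal_uminus simp_thms)
lift_definition minus_dw :: "'a dw \<Rightarrow> 'a dw \<Rightarrow> 'a dw" is "\<lambda>f g c. f c - g c"
proof -
  fix f f' g g' :: "(nat list \<times> nat) option \<Rightarrow> 'a falg"
  assume a: "dw_rel f f'" "dw_rel g g'"
  have "f c - g c - (f' c - g' c) = (f c - f' c) + - (g c - g' c)" for c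
    by simp
  with a show "dw_rel (\<lambda>c. f c - g c) (\<lambda>c. f' c - g' c)"
    unfolding dw_rel_def by (simp only: dw_ideal_add dw_ideal_uminus simp_thms)
qed
lift_definition times_dw :: "'a dw \<Rightarrow> 'a dw \<Rightarrow> 'a dw" is "\<lambda>f g c. f c * g c"
proof -
  fix f f' g g' :: "(nat list \<times> nat) option \<Rightarrow> 'a falg"
  assume a: "dw_rel f f'" "dw_rel g g'"
  have "f c * g c - f' c * g' c = f c * (g c - g' c) + (f c - f' c) * g' c" for c
    by (simp add: algebra_simps)
  moreover have "f c - f' c \<in> dw_ideal c" "g c - g' c \<in> dw_ideal c" for c
    using a by (auto simp: dw_rel_def)
  ultimately show "dw_rel (\<lambda>c. f c * g c) (\<lambda>c. f' c * g' c)"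
    unfolding dw_rel_def by (simp only: dw_ideal_add dw_ideal_mult_left dw_ideal_mult_right simp_thms)
qed

instance
proof
  show "(0 :: 'a dw) \<noteq> 1"
    by (simp add: zero_dw_def one_dw_def dw.abs_eq_iff dw_rel_def dw_ideal_def split: option.splits)
      (metis option.distinct(1))
qed (transfer; rule dw_relI; simp add: algebra_simps)+

end

lift_definition dw_scal :: "'k::field \<Rightarrow> 'k dw" is "\<lambda>c _. Poly_Mapping.single 0 c" .

definition proj :: "nat list \<Rightarrow> nat \<Rightarrow> 'k::field falg \<Rightarrow> 'k dw" where
  "proj s n a = abs_dw (\<lambda>c. if c = Some (s, n) then a else 0)"

lemma proj_eq_iff: "proj s n a = proj s n b \<longleftrightarrow> a - b \<in> D_ideal s n"
  by (auto simp: proj_def dw.abs_eq_iff dw_rel_def dw_ideal_zero)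

lemma proj_add: "proj s n (a + b) = proj s n a + proj s n b"
  by (auto simp: proj_def plus_dw.abs_eq intro!: arg_cong[where f = abs_dw])

lemma proj_mult: "proj s n (a * b) = proj s n a * proj s n b"
  by (auto simp: proj_def times_dw.abs_eq intro!: arg_cong[where f = abs_dw])

lemma proj_scal: "proj s n (scal c a) = dw_scal c * proj s n a"
  by (auto simp: proj_def times_dw.abs_eq dw_scal.abs_eq scal_conv intro!: arg_cong[where f = abs_dw])

lemma proj_zero: "proj s n 0 = 0"
  using proj_add[of s n 0 0] by simp

lemma proj_eq_0_iff: "proj s n a = 0 \<longleftrightarrow> a \<in> D_ideal s n"
  using proj_eq_iff[of s n a 0] by (simp add: proj_zero)

section \<open>Sequences\<close>

lemma length_Seq: "i \<in> Seq s n \<Longrightarrow> length i = length s + n"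
proof -
  assume "i \<in> Seq s n"
  then have "length (filter (\<lambda>c. c \<noteq> Black) i) = length s" "count_list i Black = n"
    by (auto simp: Seq_def)
  moreover have "length i = length (filter (\<lambda>c. c \<noteq> Black) i) + count_list i Black"
    by (induction i) auto
  ultimately show ?thesis by simp
qed

lemma finite_Seq: "finite (Seq s n)"
proof -
  have "set i \<subseteq> insert Black (Red ` set s)" if "i \<in> Seq s n" for i
  proof
    fix c assume "c \<in> set i"
    moreover have "set (filter (\<lambda>c. c \<noteq> Black) i) = set (map Red s)"
      using that by (simp only: Seq_def mem_Collect_eq)
    ultimately show "c \<in> insert Black (Red ` set s)" by auto
  qed
  then have "Seq s n \<subseteq> {i. set i \<subseteq> insert Black (Red ` set s) \<and> length i = length s + n}"
    by (auto simp: length_Seq)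
  then show ?thesis
    by (rule finite_subset) (rule finite_lists_length_eq, simp)
qed

lemma length_swap [simp]: "length (swap_entries j i) = length i"
  by (simp add: swap_entries_def)

lemma ent_swap_left: "1 \<le> j \<Longrightarrow> j < length i \<Longrightarrow> ent (swap_entries j i) j = ent i (j + 1)"
  and ent_swap_right: "1 \<le> j \<Longrightarrow> j < length i \<Longrightarrow> ent (swap_entries j i) (j + 1) = ent i j"
  and ent_swap_other: "1 \<le> j \<Longrightarrow> 1 \<le> k \<Longrightarrow> k \<noteq> j \<Longrightarrow> k \<noteq> j + 1 \<Longrightarrow> ent (swap_entries j i) k = ent i k"
  by (auto simp: ent_def swap_entries_def nth_list_update)

lemma ent_eqI:
  assumes "length i = length i'" and "\<And>k. 1 \<le> k \<Longrightarrow> k \<le> length i \<Longrightarrow> ent i k = ent i' k"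
  shows "i = i'"
proof (rule nth_equalityI)
  fix k assume "k < length i"
  with assms(2)[of "k + 1"] show "i ! k = i' ! k" by (simp add: ent_def)
qed (rule assms)

lemma ent_swap:
  "1 \<le> j \<Longrightarrow> j < length i \<Longrightarrow> 1 \<le> k \<Longrightarrow>
    ent (swap_entries j i) k = (if k = j then ent i (j + 1) else if k = j + 1 then ent i j else ent i k)"
  using ent_swap_left[of j i] ent_swap_right[of j i] ent_swap_other[of j k i] by auto

section \<open>Local relations\<close>

text \<open>
  For \<open>F d\<close> the elementary symmetric functions of variables \<open>z\<close>, \<open>chi a F x\<close> is
  \<open>\<Prod>(x - z)\<close> and \<open>dquot a F x y\<close> is the divided difference
  \<open>(chi a F x - chi a F y) / (x - y)\<close>.
\<close>

definition chi :: "nat \<Rightarrow> (nat \<Rightarrow> 'q::ring_1) \<Rightarrow> 'q \<Rightarrow> 'q" where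
  "chi a F x = (\<Sum>d=0..a. (-1) ^ d * F d * x ^ (a - d))"

definition hsum :: "nat \<Rightarrow> 'q::ring_1 \<Rightarrow> 'q \<Rightarrow> 'q" where
  "hsum k x y = (\<Sum>i\<le>k. x ^ i * y ^ (k - i))"

definition dquot :: "nat \<Rightarrow> (nat \<Rightarrow> 'q::ring_1) \<Rightarrow> 'q \<Rightarrow> 'q \<Rightarrow> 'q" where
  "dquot a F x y = (\<Sum>d<a. (-1) ^ d * F d * hsum (a - 1 - d) x y)"

lemma sum_triples:
  fixes g :: "nat \<Rightarrow> nat \<Rightarrow> nat \<Rightarrow> 'q::comm_monoid_add"
  shows "(\<Sum>(d1, d2, d3) \<in> {(d1, d2, d3). d1 + d2 + d3 + 1 = a}. g d1 d2 d3)
    = (\<Sum>d<a. \<Sum>i\<le>a - 1 - d. g i (a - 1 - d - i) d)"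
proof -
  have "(\<Sum>d<a. \<Sum>i\<le>a - 1 - d. g i (a - 1 - d - i) d)
      = (\<Sum>(d, i)\<in>(SIGMA d:{..<a}. {..a - 1 - d}). g i (a - 1 - d - i) d)"
    by (rule sum.Sigma) auto
  also have "\<dots> = (\<Sum>(d1, d2, d3) \<in> {(d1, d2, d3). d1 + d2 + d3 + 1 = a}. g d1 d2 d3)"
    by (rule sum.reindex_bij_witness[of _ "\<lambda>(d1, d2, d3). (d3, d1)" "\<lambda>(d, i). (i, a - 1 - d - i, d)"])
      auto
  finally show ?thesis by simp
qed

locale webster_rep =
  fixes s :: "nat list" and n :: nat and h :: "'k::field falg \<Rightarrow> 'q::ring_1"
  assumes h_add: "h (a + b) = h a + h b" and h_mult: "h (a * b) = h a * h b"
    and h_rel: "r \<in> D_rels s n \<Longrightarrow> h r = 0"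
begin

lemma h_zero: "h 0 = 0"
  using h_add[of 0 0] by simp

lemma h_uminus: "h (- a) = - h a"
  using h_add[of a "- a"] by (simp add: h_zero minus_unique)

lemma h_diff: "h (a - b) = h a - h b"
  using h_add[of a "- b"] by (simp add: h_uminus)

lemma h_sum: "h (sum f A) = (\<Sum>x\<in>A. h (f x))"
  by (induction A rule: infinite_finite_induct) (auto simp: h_zero h_add)

lemma h_sign: "h ((-1) ^ d * a) = (-1) ^ d * h a"
  by (cases "even d") (auto simp: h_uminus)

lemma h_of_nat: "h (of_nat c * a) = of_nat c * h a"
  by (induction c) (auto simp: h_zero h_add distrib_right)

lemmas h_simps = h_add h_mult h_zero h_uminus h_diff h_sum

abbreviation "e i \<equiv> h (idem i)"
abbreviation "Y j \<equiv> h (vx j)"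
abbreviation "E d j \<equiv> h (vE d j)"
abbreviation "P j \<equiv> h (psi j)"

definition V :: "entry list \<Rightarrow> 'q set" where "V i = {v. e i * v = v}"

lemma VD: "v \<in> V i \<Longrightarrow> e i * v = v" by (simp add: V_def)

lemma V_transfer: "a * e i = b * e i \<Longrightarrow> v \<in> V i \<Longrightarrow> a * v = b * v"
  by (metis VD mult.assoc)

lemma V_zero: "0 \<in> V i"
  and V_add: "v \<in> V i \<Longrightarrow> w \<in> V i \<Longrightarrow> v + w \<in> V i"
  and V_diff: "v \<in> V i \<Longrightarrow> w \<in> V i \<Longrightarrow> v - w \<in> V i"
  and V_uminus: "v \<in> V i \<Longrightarrow> - v \<in> V i"
  and V_mult_right: "v \<in> V i \<Longrightarrow> v * w \<in> V i"
  by (auto simp: V_def distrib_left right_diff_distrib simp flip: mult.assoc)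

lemma V_sum: "(\<And>x. x \<in> A \<Longrightarrow> f x \<in> V i) \<Longrightarrow> sum f A \<in> V i"
  by (induction A rule: infinite_finite_induct) (auto simp: V_zero V_add)

lemma no_gen: "\<not> is_gen s n g \<Longrightarrow> h (letter g) = 0"
  by (rule h_rel[OF D_rels.no_gen])

lemma e_notin: "i \<notin> Seq s n \<Longrightarrow> e i = 0"
  using no_gen[of "GI i"] by (simp add: idem_def is_gen_def)

lemma V_notin: "v \<in> V i \<Longrightarrow> i \<notin> Seq s n \<Longrightarrow> v = 0"
  using e_notin by (auto dest: VD)

lemma X_notin: "\<not> (1 \<le> j \<and> j \<le> length s + n) \<Longrightarrow> Y j = 0"
  using no_gen[of "GX j"] by (auto simp: vx_def is_gen_def)

lemma E_notin: "1 \<le> d \<Longrightarrow> \<not> (1 \<le> j \<and> j \<le> length s + n) \<Longrightarrow> E d j = 0"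
  using no_gen[of "GE d j"] by (auto simp: vE_def is_gen_def)

lemma P_notin: "\<not> (1 \<le> j \<and> j + 1 \<le> length s + n) \<Longrightarrow> P j = 0"
  using no_gen[of "GPsi j"] by (auto simp: psi_def is_gen_def)

lemma unit: "h 1 = (\<Sum>i\<in>Seq s n. e i)"
  using h_rel[OF D_rels.unit] by (simp add: h_simps)

lemma E_zero: "E 0 j = h 1"
  by (simp add: vE_def)

lemma one_mult [simp]: "h 1 * h a = h a" "h a * h 1 = h a"
  by (simp_all flip: h_mult)

lemma one_V [simp]: "v \<in> V i \<Longrightarrow> h 1 * v = v"
  using V_transfer[of "h 1" i 1] by simp

lemma e_e: "e i * e i' = (if i = i' then e i else 0)"
proof (cases "i \<in> Seq s n \<and> i' \<in> Seq s n")
  case True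
  with h_rel[OF D_rels.idem_idem, of i i'] show ?thesis
    by (auto simp: h_simps split: if_splits)
qed (auto simp: e_notin)

lemma e_V: "e i \<in> V i"
  by (simp add: V_def e_e)

lemma e_V_other: "v \<in> V i \<Longrightarrow> i \<noteq> i' \<Longrightarrow> e i' * v = 0"
  using V_transfer[of "e i'" i 0] by (simp add: e_e)

lemma X_e: "Y j * e i = e i * Y j"
proof (cases "i \<in> Seq s n \<and> is_gen s n (GX j)")
  case True
  with h_rel[OF D_rels.x_idem, of i j] show ?thesis by (simp add: h_simps)
qed (auto simp: e_notin X_notin is_gen_def)

lemma E_e: "E d j * e i = e i * E d j"
proof (cases "i \<in> Seq s n \<and> is_gen s n (GE d j)")
  case True
  with h_rel[OF D_rels.E_idem, of i d j] show ?thesis by (simp add: h_simps)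
qed (cases "d = 0"; auto simp: E_zero e_notin E_notin is_gen_def)

lemma P_e: "P j * e i = e (swap_entries j i) * P j" if "i \<in> Seq s n"
proof (cases "is_gen s n (GPsi j)")
  case True
  with that h_rel[OF D_rels.psi_idem, of i j] show ?thesis by (simp add: h_simps)
qed (auto simp: P_notin is_gen_def)

lemma X_V: "v \<in> V i \<Longrightarrow> Y j * v \<in> V i"
  unfolding V_def by (metis (mono_tags) X_e mem_Collect_eq mult.assoc)

lemma E_V: "v \<in> V i \<Longrightarrow> E d j * v \<in> V i"
  unfolding V_def by (metis (mono_tags) E_e mem_Collect_eq mult.assoc)

lemma P_V: "v \<in> V i \<Longrightarrow> P j * v \<in> V (swap_entries j i)"
  by (cases "i \<in> Seq s n") (metis (mono_tags, lifting) P_e V_def mem_Collect_eq mult.assoc,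
      metis V_notin V_zero mult_zero_right)

lemma X_pow_V: "v \<in> V i \<Longrightarrow> Y j ^ k * v \<in> V i"
  by (induction k) (auto simp: X_V mult.assoc)

lemma h_X_pow: "v \<in> V i \<Longrightarrow> h (vx j ^ k) * v = Y j ^ k * v"
  by (induction k) (auto simp: h_mult mult.assoc)

lemma x_red: "v \<in> V i \<Longrightarrow> ent i j = Red a \<Longrightarrow> Y j * v = 0"
proof (cases "i \<in> Seq s n \<and> is_gen s n (GX j)")
  case True
  assume "v \<in> V i" "ent i j = Red a"
  with True h_rel[OF D_rels.x_red, of i j a] show ?thesis
    using V_transfer[of "Y j" i 0 v] by (simp add: h_simps)
qed (auto dest: V_notin simp: X_notin is_gen_def)

lemma E_black: "v \<in> V i \<Longrightarrow> ent i j = Black \<Longrightarrow> 1 \<le> d \<Longrightarrow> E d j * v = 0"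
proof (cases "i \<in> Seq s n \<and> is_gen s n (GE d j)")
  case True
  assume "v \<in> V i" "ent i j = Black"
  with True h_rel[OF D_rels.E_black, of i d j] show ?thesis
    using V_transfer[of "E d j" i 0 v] by (simp add: h_simps)
qed (auto dest: V_notin simp: E_notin is_gen_def)

lemma E_large: "v \<in> V i \<Longrightarrow> ent i j = Red a \<Longrightarrow> a < d \<Longrightarrow> E d j * v = 0"
proof (cases "i \<in> Seq s n \<and> is_gen s n (GE d j)")
  case True
  assume "v \<in> V i" "ent i j = Red a" "a < d"
  with True h_rel[OF D_rels.E_large, of i d j a] show ?thesis
    using V_transfer[of "E d j" i 0 v] by (simp add: h_simps)
qed (auto dest: V_notin simp: E_notin is_gen_def)

lemma P_red_red: "v \<in> V i \<Longrightarrow> ent i j = Red a \<Longrightarrow> ent i (j + 1) = Red b \<Longrightarrow> P j * v = 0"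
proof (cases "i \<in> Seq s n \<and> is_gen s n (GPsi j)")
  case True
  assume "v \<in> V i" "ent i j = Red a" "ent i (j + 1) = Red b"
  with True h_rel[OF D_rels.psi_red_red, of i j a b] show ?thesis
    using V_transfer[of "P j" i 0 v] by (simp add: h_simps)
qed (auto dest: V_notin simp: P_notin is_gen_def)

lemma X_X: "Y j * Y l = Y l * Y j"
proof (cases "is_gen s n (GX j) \<and> is_gen s n (GX l)")
  case True
  with h_rel[OF D_rels.x_x, of j l] show ?thesis by (simp add: h_simps)
qed (auto simp: X_notin is_gen_def)

lemma E_X: "E d j * Y l = Y l * E d j"
proof (cases "is_gen s n (GE d j) \<and> is_gen s n (GX l)")
  case True
  with h_rel[OF D_rels.E_x, of d j l] show ?thesis by (simp add: h_simps)
qed (cases "d = 0"; auto simp: E_zero X_notin E_notin is_gen_def)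

lemma E_E: "E d j * E d' l = E d' l * E d j"
proof (cases "is_gen s n (GE d j) \<and> is_gen s n (GE d' l)")
  case True
  with h_rel[OF D_rels.E_E, of d j d' l] show ?thesis by (simp add: h_simps)
qed (cases "d = 0"; cases "d' = 0"; auto simp: E_zero E_notin is_gen_def)

lemma P_X_far: "l \<noteq> j \<Longrightarrow> l \<noteq> j + 1 \<Longrightarrow> P j * Y l = Y l * P j"
proof (cases "is_gen s n (GPsi j) \<and> is_gen s n (GX l)")
  case True
  assume "l \<noteq> j" "l \<noteq> j + 1"
  with True h_rel[OF D_rels.psi_x_far, of j l] show ?thesis by (simp add: h_simps)
qed (auto simp: X_notin P_notin is_gen_def)

lemma P_E_far: "l \<noteq> j \<Longrightarrow> l \<noteq> j + 1 \<Longrightarrow> P j * E d l = E d l * P j"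
proof (cases "is_gen s n (GPsi j) \<and> is_gen s n (GE d l)")
  case True
  assume "l \<noteq> j" "l \<noteq> j + 1"
  with True h_rel[OF D_rels.psi_E_far, of j d l] show ?thesis by (simp add: h_simps)
qed (cases "d = 0"; auto simp: E_zero E_notin P_notin is_gen_def)

lemma P_E: "P j * E d j = E d (j + 1) * P j"
proof (cases "is_gen s n (GPsi j) \<and> d \<ge> 1")
  case True
  with h_rel[OF D_rels.psi_E, of j d] show ?thesis by (simp add: h_simps)
qed (cases "d = 0"; auto simp: E_zero P_notin is_gen_def)

lemma E_P: "E d j * P j = P j * E d (j + 1)"
proof (cases "is_gen s n (GPsi j) \<and> d \<ge> 1")
  case True
  with h_rel[OF D_rels.E_psi, of j d] show ?thesis by (simp add: h_simps)
qed (cases "d = 0"; auto simp: E_zero P_notin is_gen_def)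

lemma P_P_far: "j + 1 < l \<or> l + 1 < j \<Longrightarrow> P j * P l = P l * P j"
proof (cases "is_gen s n (GPsi j) \<and> is_gen s n (GPsi l)")
  case True
  assume "j + 1 < l \<or> l + 1 < j"
  with True h_rel[OF D_rels.psi_psi_far, of j l] show ?thesis by (simp add: h_simps)
qed (auto simp: P_notin is_gen_def)

lemma X_P_bb:
  assumes "v \<in> V i" "ent i j = Black" "ent i (j + 1) = Black" "1 \<le> j" "j + 1 \<le> length s + n"
  shows "Y j * (P j * v) = P j * (Y (j + 1) * v) + v"
proof (cases "i \<in> Seq s n")
  case True
  with h_rel[OF D_rels.x_psi_black_black, of i j] assms
  have "(Y j * P j) * e i = (P j * Y (j + 1) + 1) * e i"
    by (simp add: h_simps is_gen_def algebra_simps)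
  from V_transfer[OF this assms(1)] show ?thesis by (simp add: algebra_simps)
qed (use V_notin[OF assms(1)] in simp)

lemma P_X_bb:
  assumes "v \<in> V i" "ent i j = Black" "ent i (j + 1) = Black" "1 \<le> j" "j + 1 \<le> length s + n"
  shows "P j * (Y j * v) = Y (j + 1) * (P j * v) + v"
proof (cases "i \<in> Seq s n")
  case True
  with h_rel[OF D_rels.psi_x_black_black, of i j] assms
  have "(P j * Y j) * e i = (Y (j + 1) * P j + 1) * e i"
    by (simp add: h_simps is_gen_def algebra_simps)
  from V_transfer[OF this assms(1)] show ?thesis by (simp add: algebra_simps)
qed (use V_notin[OF assms(1)] in simp)

lemma X_P_rb:
  assumes "v \<in> V i" "ent i j = Red a" "ent i (j + 1) = Black"
  shows "Y j * (P j * v) = P j * (Y (j + 1) * v)"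
proof (cases "i \<in> Seq s n \<and> is_gen s n (GPsi j)")
  case True
  with h_rel[OF D_rels.x_psi_red_black, of i j a] assms
  have "(Y j * P j) * e i = (P j * Y (j + 1)) * e i"
    by (simp add: h_simps algebra_simps)
  from V_transfer[OF this assms(1)] show ?thesis by (simp add: algebra_simps)
qed (use V_notin[OF assms(1)] in \<open>auto simp: P_notin is_gen_def\<close>)

lemma P_X_br:
  assumes "v \<in> V i" "ent i j = Black" "ent i (j + 1) = Red a"
  shows "P j * (Y j * v) = Y (j + 1) * (P j * v)"
proof (cases "i \<in> Seq s n \<and> is_gen s n (GPsi j)")
  case True
  with h_rel[OF D_rels.psi_x_black_red, of i j a] assms
  have "(P j * Y j) * e i = (Y (j + 1) * P j) * e i"
    by (simp add: h_simps algebra_simps)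
  from V_transfer[OF this assms(1)] show ?thesis by (simp add: algebra_simps)
qed (use V_notin[OF assms(1)] in \<open>auto simp: P_notin is_gen_def\<close>)

lemma P_P_bb:
  assumes "v \<in> V i" "ent i j = Black" "ent i (j + 1) = Black"
  shows "P j * (P j * v) = 0"
proof (cases "i \<in> Seq s n \<and> is_gen s n (GPsi j)")
  case True
  with h_rel[OF D_rels.psi_square_black_black, of i j] assms
  have "(P j * P j) * e i = 0 * e i"
    by (simp add: h_simps algebra_simps power2_eq_square)
  from V_transfer[OF this assms(1)] show ?thesis by (simp add: algebra_simps)
qed (use V_notin[OF assms(1)] in \<open>auto simp: P_notin is_gen_def\<close>)

lemma P_P_rb:
  assumes "v \<in> V i" "ent i j = Red a" "ent i (j + 1) = Black" "1 \<le> j" "j + 1 \<le> length s + n"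
  shows "P j * (P j * v) = chi a (\<lambda>d. E d j) (Y (j + 1)) * v"
proof (cases "i \<in> Seq s n")
  case True
  have "h ((-1) ^ d * vE d j * vx (j + 1) ^ (a - d) * idem i)
      = (-1) ^ d * E d j * Y (j + 1) ^ (a - d) * e i" for d
    by (simp only: mult.assoc h_sign) (simp only: h_mult h_X_pow[OF e_V])
  with True h_rel[OF D_rels.psi_square_red_black, of i j a] assms
  have "(P j * P j) * e i = chi a (\<lambda>d. E d j) (Y (j + 1)) * e i"
    by (simp add: h_diff h_sum is_gen_def power2_eq_square chi_def sum_distrib_right)
      (simp add: h_mult)
  from V_transfer[OF this assms(1)] show ?thesis by (simp add: mult.assoc)
qed (use V_notin[OF assms(1)] in simp)

lemma P_P_br:
  assumes "v \<in> V i" "ent i j = Black" "ent i (j + 1) = Red a" "1 \<le> j" "j + 1 \<le> length s + n"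
  shows "P j * (P j * v) = chi a (\<lambda>d. E d (j + 1)) (Y j) * v"
proof (cases "i \<in> Seq s n")
  case True
  have comm: "h (vx j ^ k) * E d (j + 1) = E d (j + 1) * h (vx j ^ k)" for k d
  proof (induction k)
    case (Suc k)
    have "h (vx j ^ Suc k) * E d (j + 1) = Y j * (h (vx j ^ k) * E d (j + 1))"
      by (simp add: h_mult mult.assoc)
    also have "\<dots> = Y j * (E d (j + 1) * h (vx j ^ k))"
      by (simp only: Suc.IH)
    also have "\<dots> = E d (j + 1) * h (vx j ^ Suc k)"
      by (simp add: E_X h_mult flip: mult.assoc)
    finally show ?case .
  qed simp
  have "h ((-1) ^ d * vx j ^ (a - d) * vE d (j + 1) * idem i)
      = (-1) ^ d * E d (j + 1) * Y j ^ (a - d) * e i" for d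
  proof -
    have "h (vx j ^ (a - d)) * (E d (j + 1) * e i) = E d (j + 1) * (h (vx j ^ (a - d)) * e i)"
      by (simp only: comm flip: mult.assoc)
    then show ?thesis
      by (simp only: mult.assoc h_sign) (simp only: h_mult h_X_pow[OF e_V])
  qed
  with True h_rel[OF D_rels.psi_square_black_red, of i j a] assms
  have "(P j * P j) * e i = chi a (\<lambda>d. E d (j + 1)) (Y j) * e i"
    by (simp add: h_diff h_sum is_gen_def power2_eq_square chi_def sum_distrib_right)
      (simp add: h_mult)
  from V_transfer[OF this assms(1)] show ?thesis by (simp add: mult.assoc)
qed (use V_notin[OF assms(1)] in simp)

lemma X_pow_E: "Y j ^ k * E d l = E d l * Y j ^ k"
proof (induction k)
  case (Suc k)
  have "Y j ^ Suc k * E d l = Y j * (E d l * Y j ^ k)"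
    by (simp add: mult.assoc Suc.IH)
  also have "\<dots> = E d l * Y j ^ Suc k"
    by (simp add: E_X flip: mult.assoc)
  finally show ?case .
qed simp

lemma braid_brb:
  assumes "v \<in> V i" "ent i j = Black" "ent i (j + 1) = Red a" "ent i (j + 2) = Black"
    "1 \<le> j" "j + 2 \<le> length s + n"
  shows "P j * (P (j + 1) * (P j * v))
    = P (j + 1) * (P j * (P (j + 1) * v)) + dquot a (\<lambda>d. E d (j + 1)) (Y j) (Y (j + 2)) * v"
proof (cases "i \<in> Seq s n")
  case True
  have term_eq: "h ((-1) ^ d3 * vx j ^ d1 * vE d3 (j + 1) * vx (j + 2) ^ d2 * idem i)
      = (-1) ^ d3 * E d3 (j + 1) * (Y j ^ d1 * Y (j + 2) ^ d2) * e i" for d1 d2 d3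
  proof -
    have "Y (j + 2) ^ d2 * e i \<in> V i" by (rule X_pow_V[OF e_V])
    note v = E_V[OF this] this
    have "h ((-1) ^ d3 * vx j ^ d1 * vE d3 (j + 1) * vx (j + 2) ^ d2 * idem i)
        = (-1) ^ d3 * (h (vx j ^ d1) * (E d3 (j + 1) * (h (vx (j + 2) ^ d2) * e i)))"
      by (simp only: mult.assoc h_sign) (simp only: h_mult)
    also have "\<dots> = (-1) ^ d3 * (Y j ^ d1 * (E d3 (j + 1) * (Y (j + 2) ^ d2 * e i)))"
      by (simp only: h_X_pow[OF e_V] h_X_pow[OF v(1)])
    also have "\<dots> = (-1) ^ d3 * ((Y j ^ d1 * E d3 (j + 1)) * (Y (j + 2) ^ d2 * e i))"
      by (simp only: mult.assoc)
    also have "\<dots> = (-1) ^ d3 * E d3 (j + 1) * (Y j ^ d1 * Y (j + 2) ^ d2) * e i"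
      by (simp only: X_pow_E mult.assoc)
    finally show ?thesis .
  qed
  have "h (\<Sum>(d1, d2, d3) \<in> {(d1, d2, d3). d1 + d2 + d3 + 1 = a}.
        (-1) ^ d3 * vx j ^ d1 * vE d3 (j + 1) * vx (j + 2) ^ d2 * idem i)
      = dquot a (\<lambda>d. E d (j + 1)) (Y j) (Y (j + 2)) * e i"
    by (simp only: sum_triples h_sum term_eq)
      (simp add: dquot_def hsum_def sum_distrib_right sum_distrib_left mult.assoc)
  with True h_rel[OF D_rels.braid_black_red_black, of i j a] assms(2-)
  have "(P j * P (j + 1) * P j) * e i = (P (j + 1) * P j * P (j + 1)
      + dquot a (\<lambda>d. E d (j + 1)) (Y j) (Y (j + 2))) * e i"
    by (simp add: h_diff is_gen_def) (simp add: h_simps algebra_simps)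
  from V_transfer[OF this assms(1)] show ?thesis by (simp add: algebra_simps)
qed (use V_notin[OF assms(1)] in simp)

lemma braid_other:
  assumes "v \<in> V i" "\<not> (ent i j = Black \<and> ent i (j + 1) \<noteq> Black \<and> ent i (j + 2) = Black)"
  shows "P j * (P (j + 1) * (P j * v)) = P (j + 1) * (P j * (P (j + 1) * v))"
proof (cases "i \<in> Seq s n \<and> is_gen s n (GPsi j) \<and> is_gen s n (GPsi (j + 1))")
  case True
  with h_rel[OF D_rels.braid_other, of i j] assms
  have "(P j * P (j + 1) * P j) * e i = (P (j + 1) * P j * P (j + 1)) * e i"
    by (auto simp add: h_simps algebra_simps)
  from V_transfer[OF this assms(1)] show ?thesis by (simp add: algebra_simps)
qed (use V_notin[OF assms(1)] in \<open>auto simp: P_notin is_gen_def\<close>)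

text \<open>As \<open>1 = \<Sum>e i\<close>, an element is determined by its action on the \<open>V i\<close>.\<close>

lemma h_eq_0I: "(\<And>i. i \<in> Seq s n \<Longrightarrow> h r * e i = 0) \<Longrightarrow> h r = 0"
proof -
  assume "\<And>i. i \<in> Seq s n \<Longrightarrow> h r * e i = 0"
  then have "h r * h 1 = 0" by (simp add: unit sum_distrib_left)
  then show ?thesis by simp
qed

end

section \<open>Derivatives of symmetric expressions\<close>

definition dF :: "(nat \<Rightarrow> 'q::ring_1) \<Rightarrow> nat \<Rightarrow> 'q" where
  "dF F d = F d * F 1 - of_nat (d + 1) * F (d + 1)"

definition dchi :: "nat \<Rightarrow> (nat \<Rightarrow> 'q::ring_1) \<Rightarrow> 'q \<Rightarrow> 'q" where
  "dchi a F x = (\<Sum>d=0..a. (-1) ^ d * (dF F d * x ^ (a - d) + F d * (of_nat (a - d) * x ^ (a - d + 1))))"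

definition dhsum :: "nat \<Rightarrow> 'q::ring_1 \<Rightarrow> 'q \<Rightarrow> 'q" where
  "dhsum k x y = (\<Sum>i\<le>k. of_nat i * x ^ (i + 1) * y ^ (k - i) + x ^ i * (of_nat (k - i) * y ^ (k - i + 1)))"

definition ddquot :: "nat \<Rightarrow> (nat \<Rightarrow> 'q::ring_1) \<Rightarrow> 'q \<Rightarrow> 'q \<Rightarrow> 'q" where
  "ddquot a F x y = (\<Sum>d<a. (-1) ^ d * (dF F d * hsum (a - 1 - d) x y + F d * dhsum (a - 1 - d) x y))"

lemma of_nat_left_commute: "of_nat k * (x * y) = x * (of_nat k * (y :: 'q::ring_1))"
  by (metis mult.assoc mult_of_nat_commute)

lemma sign_left_commute: "(-1) ^ k * (x * y) = x * ((-1) ^ k * (y :: 'q::ring_1))"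
  by (cases "even k") auto

lemma dchi_eq:
  assumes c: "F 1 * x = x * F (1 :: nat)"
  shows "dchi a F x + (-1) ^ a * (of_nat (a + 1) * F (a + 1))
    = chi a F x * F 1 + of_nat a * (chi a F x * (x :: 'q::ring_1))"
proof -
  define g where "g d = (-1) ^ d * (of_nat d * (F d * x ^ (a + 1 - d)))" for d
  have c': "F 1 * x ^ k = x ^ k * F 1" for k
    using power_commuting_commutes[of x "F 1"] c by simp
  have "dchi a F x = (\<Sum>d=0..a. (-1) ^ d * (F d * (x ^ (a - d) * F 1)) + g (Suc d)
      + (-1) ^ d * (F d * (of_nat (a - d) * x ^ (a - d + 1))))"
    unfolding dchi_def by (rule sum.cong) (simp_all add: dF_def g_def algebra_simps c'[unfolded One_nat_def])
  also have "\<dots> = (\<Sum>d=0..a. (-1) ^ d * (F d * (x ^ (a - d) * F 1))) + (\<Sum>d=0..a. g (Suc d))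
      + (\<Sum>d=0..a. (-1) ^ d * (F d * (of_nat (a - d) * x ^ (a - d + 1))))"
    by (simp only: sum.distrib)
  also have "(\<Sum>d=0..a. g (Suc d)) = (\<Sum>d=0..Suc a. g d)"
    by (subst sum.atLeast0_atMost_Suc_shift) (simp add: g_def)
  also have "\<dots> = (\<Sum>d=0..a. g d) + g (Suc a)" by simp
  also have "(\<Sum>d=0..a. (-1) ^ d * (F d * (x ^ (a - d) * F 1))) = chi a F x * F 1"
    by (simp add: chi_def sum_distrib_right mult.assoc)
  finally have *: "dchi a F x = chi a F x * F 1 + ((\<Sum>d=0..a. g d) + g (Suc a))
      + (\<Sum>d=0..a. (-1) ^ d * (F d * (of_nat (a - d) * x ^ (a - d + 1))))" .
  have "(\<Sum>d=0..a. g d) + (\<Sum>d=0..a. (-1) ^ d * (F d * (of_nat (a - d) * x ^ (a - d + 1))))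
      = (\<Sum>d=0..a. (-1) ^ d * (F d * (of_nat a * x ^ (a - d + 1))))"
    unfolding sum.distrib[symmetric]
  proof (rule sum.cong[OF refl])
    fix d assume "d \<in> {0..a}"
    then have d: "Suc a - d = Suc (a - d)" and a: "(of_nat a :: 'q) = of_nat d + of_nat (a - d)"
      by (auto simp flip: of_nat_add)
    show "g d + (-1) ^ d * (F d * (of_nat (a - d) * x ^ (a - d + 1)))
        = (-1) ^ d * (F d * (of_nat a * x ^ (a - d + 1)))"
      unfolding a by (simp add: g_def d distrib_right distrib_left of_nat_left_commute[of d])
  qed
  also have "\<dots> = of_nat a * (chi a F x * x)"
    by (simp add: chi_def sum_distrib_right sum_distrib_left mult.assoc of_nat_left_commute
        power_Suc2 del: power_Suc)
  finally show ?thesis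
    using * by (simp add: g_def algebra_simps)
qed

lemma hsum_Suc: "hsum (Suc k) x y = hsum k x y * y + x ^ Suc k"
proof -
  have "x ^ i * y ^ (Suc k - i) = x ^ i * y ^ (k - i) * y" if "i \<le> k" for i
    using that by (simp add: Suc_diff_le mult.assoc power_Suc2 del: power_Suc)
  then show ?thesis
    by (simp add: hsum_def sum_distrib_right)
qed

lemma dhsum_eq:
  assumes c: "x * y = y * (x :: 'q::ring_1)"
  shows "dhsum k x y + hsum k x y * y
    = of_nat k * (hsum k x y * y) + of_nat k * x ^ (k + 1) + y ^ (k + 1)"
proof (induction k)
  case 0
  show ?case by (simp add: dhsum_def hsum_def)
next
  case (Suc k)
  have t: "of_nat i * x ^ (i + 1) * y ^ (Suc k - i) + x ^ i * (of_nat (Suc k - i) * y ^ (Suc k - i + 1))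
     = (of_nat i * x ^ (i + 1) * y ^ (k - i) + x ^ i * (of_nat (k - i) * y ^ (k - i + 1))) * y
       + x ^ i * y ^ (k - i) * (y * y)" if "i \<le> k" for i
  proof -
    have "y ^ Suc (Suc (k - i)) = y ^ (k - i) * (y * y)" "y ^ Suc (k - i) = y ^ (k - i) * y"
      by (metis mult.assoc power_Suc2)+
    with that show ?thesis
      by (simp add: Suc_diff_le algebra_simps del: power_Suc)
  qed
  have "dhsum (Suc k) x y = (\<Sum>i\<le>k. of_nat i * x ^ (i + 1) * y ^ (Suc k - i)
      + x ^ i * (of_nat (Suc k - i) * y ^ (Suc k - i + 1))) + of_nat (Suc k) * x ^ (Suc k + 1)"
    by (simp only: dhsum_def sum.atMost_Suc) simp
  also have "(\<Sum>i\<le>k. of_nat i * x ^ (i + 1) * y ^ (Suc k - i)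
      + x ^ i * (of_nat (Suc k - i) * y ^ (Suc k - i + 1))) = (\<Sum>i\<le>k. (of_nat i * x ^ (i + 1) * y ^ (k - i)
      + x ^ i * (of_nat (k - i) * y ^ (k - i + 1))) * y + x ^ i * y ^ (k - i) * (y * y))"
    by (intro sum.cong refl t) simp
  finally have d: "dhsum (Suc k) x y = dhsum k x y * y + hsum k x y * (y * y) + of_nat (Suc k) * x ^ (Suc k + 1)"
    by (simp only: dhsum_def[of k] hsum_def[of k] sum.distrib sum_distrib_right distrib_right)
  have "dhsum k x y * y + hsum k x y * (y * y) = (dhsum k x y + hsum k x y * y) * y"
    by (simp add: algebra_simps)
  also have "\<dots> = of_nat k * (hsum k x y * (y * y)) + of_nat k * (x ^ (k + 1) * y) + y ^ (Suc k + 1)"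
    by (simp add: Suc.IH algebra_simps power_Suc2 del: power_Suc)
  finally show ?case
    by (simp add: d hsum_Suc algebra_simps)
qed

lemma ddquot_eq:
  assumes c: "x * y = y * (x :: 'q::ring_1)" and cx: "F 1 * x = x * F 1" and cy: "F 1 * y = y * F (1 :: nat)"
  shows "ddquot a F x y + 2 * (dquot a F x y * y) + chi a F x
    = of_nat a * (dquot a F x y * y) + dquot a F x y * F 1 + of_nat a * chi a F x + chi a F y"
proof -
  have ch: "F 1 * hsum k x y = hsum k x y * F 1" for k
  proof -
    have "F 1 * (x ^ i * y ^ l) = x ^ i * y ^ l * F 1" for i l
    proof -
      have "F 1 * x ^ i = x ^ i * F 1" "F 1 * y ^ l = y ^ l * F 1"
        using power_commuting_commutes[of x "F 1" i] power_commuting_commutes[of y "F 1" l] cx cy by simp_all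
      then show ?thesis by (metis mult.assoc)
    qed
    then show ?thesis by (simp add: hsum_def sum_distrib_left sum_distrib_right)
  qed
  define g where "g d = (-1) ^ d * (of_nat d * (F d * hsum (a - d) x y))" for d
  have "ddquot a F x y = (\<Sum>d<a. (-1) ^ d * (F d * (hsum (a - 1 - d) x y * F 1)) + g (Suc d)
      + (-1) ^ d * (F d * dhsum (a - 1 - d) x y))"
    unfolding ddquot_def by (rule sum.cong) (simp_all add: dF_def g_def algebra_simps ch[unfolded One_nat_def])
  also have "\<dots> = dquot a F x y * F 1 + (\<Sum>d<a. g (Suc d))
      + (\<Sum>d<a. (-1) ^ d * (F d * dhsum (a - 1 - d) x y))"
    by (simp add: sum.distrib dquot_def sum_distrib_right mult.assoc)
  also have "(\<Sum>d<a. g (Suc d)) = (\<Sum>d<a. g d) + g a"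
  proof -
    have "(\<Sum>d<Suc a. g d) = g 0 + (\<Sum>d<a. g (Suc d))"
      by (rule sum.lessThan_Suc_shift)
    then show ?thesis by (simp add: g_def)
  qed
  finally have dd: "ddquot a F x y = dquot a F x y * F 1 + ((\<Sum>d<a. g d) + g a)
      + (\<Sum>d<a. (-1) ^ d * (F d * dhsum (a - 1 - d) x y))" .
  have chi: "chi a F z = (\<Sum>d<a. (-1) ^ d * (F d * z ^ (a - d))) + (-1) ^ a * F a" for z
    by (simp add: chi_def atLeast0AtMost mult.assoc flip: lessThan_Suc_atMost)
  have main: "(\<Sum>d<a. g d) + (\<Sum>d<a. (-1) ^ d * (F d * dhsum (a - 1 - d) x y)) + 2 * (dquot a F x y * y)
      + (\<Sum>d<a. (-1) ^ d * (F d * x ^ (a - d)))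
    = of_nat a * (dquot a F x y * y) + of_nat a * (\<Sum>d<a. (-1) ^ d * (F d * x ^ (a - d)))
      + (\<Sum>d<a. (-1) ^ d * (F d * y ^ (a - d)))"
    unfolding dquot_def sum_distrib_right sum_distrib_left sum.distrib[symmetric]
  proof (rule sum.cong[OF refl])
    fix d assume "d \<in> {..<a}"
    then obtain k where a: "a = d + Suc k"
      by (metis add_Suc_right lessThan_iff less_iff_Suc_add)
    let ?h = "hsum k x y"
    have ad: "a - d = Suc k" "a - 1 - d = k" by (simp_all add: a)
    have e: "of_nat d * hsum (Suc k) x y + dhsum k x y + 2 * (?h * y) + x ^ Suc k
        = of_nat a * (?h * y) + of_nat a * x ^ Suc k + y ^ Suc k"
    proof -
      have "of_nat d * hsum (Suc k) x y + dhsum k x y + 2 * (?h * y) + x ^ Suc k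
          = of_nat d * (?h * y) + of_nat d * x ^ Suc k + (dhsum k x y + ?h * y) + ?h * y + x ^ Suc k"
        by (simp only: hsum_Suc distrib_left mult_2 ac_simps)
      then show ?thesis
        unfolding dhsum_eq[OF c] a
        by (simp only: of_nat_add of_nat_Suc distrib_right mult_1_left Suc_eq_plus1 of_nat_1 ac_simps)
    qed
    have "F d * (of_nat d * hsum (Suc k) x y + dhsum k x y + 2 * (?h * y) + x ^ Suc k)
        = of_nat d * (F d * hsum (Suc k) x y) + F d * dhsum k x y + 2 * (F d * (?h * y)) + F d * x ^ Suc k"
      by (simp only: distrib_left of_nat_left_commute mult_2)
    moreover have "F d * (of_nat a * (?h * y) + of_nat a * x ^ Suc k + y ^ Suc k)
        = of_nat a * (F d * (?h * y)) + of_nat a * (F d * x ^ Suc k) + F d * y ^ Suc k"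
      by (simp only: distrib_left of_nat_left_commute)
    ultimately have "of_nat d * (F d * hsum (Suc k) x y) + F d * dhsum k x y + 2 * (F d * (?h * y)) + F d * x ^ Suc k
        = of_nat a * (F d * (?h * y)) + of_nat a * (F d * x ^ Suc k) + F d * y ^ Suc k"
      using e by simp
    from arg_cong[OF this, of "\<lambda>z. (-1) ^ d * z"]
    show "g d + (-1) ^ d * (F d * dhsum (a - 1 - d) x y) + 2 * ((-1) ^ d * F d * hsum (a - 1 - d) x y * y)
        + (-1) ^ d * (F d * x ^ (a - d))
      = of_nat a * ((-1) ^ d * F d * hsum (a - 1 - d) x y * y) + of_nat a * ((-1) ^ d * (F d * x ^ (a - d)))
        + (-1) ^ d * (F d * y ^ (a - d))"
      unfolding g_def ad mult_2
      by (simp only: distrib_left of_nat_left_commute mult.assoc add.assoc)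
  qed
  have "g a = of_nat a * ((-1) ^ a * F a)"
    by (simp add: g_def hsum_def of_nat_left_commute)
  note ga = this
  have "ddquot a F x y + 2 * (dquot a F x y * y) + chi a F x = dquot a F x y * F 1
      + ((\<Sum>d<a. g d) + (\<Sum>d<a. (-1) ^ d * (F d * dhsum (a - 1 - d) x y)) + 2 * (dquot a F x y * y)
      + (\<Sum>d<a. (-1) ^ d * (F d * x ^ (a - d)))) + g a + (-1) ^ a * F a"
    by (simp only: dd chi ac_simps)
  then show ?thesis
    unfolding main by (simp only: chi ga distrib_left ac_simps)
qed

section \<open>The derivation on the free algebra\<close>

definition psi_val :: "nat \<Rightarrow> entry list \<Rightarrow> 'k::field falg" where
  "psi_val j i = (case (ent i j, ent i (j + 1)) of
      (Black, Black) \<Rightarrow> - (vx j * psi j * idem i) - psi j * vx (j + 1) * idem i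
    | (Red a, Black) \<Rightarrow> of_nat a * psi j * vx (j + 1) * idem i
    | (Black, Red a) \<Rightarrow> psi j * vE 1 (j + 1) * idem i
    | (Red a, Red b) \<Rightarrow> 0)"

definition dgen :: "nat list \<Rightarrow> nat \<Rightarrow> gen \<Rightarrow> 'k::field falg" where
  "dgen s n g = (if is_gen s n g then (case g of
      GI i \<Rightarrow> 0
    | GX j \<Rightarrow> vx j ^ 2
    | GE d j \<Rightarrow> vE d j * vE 1 j - of_nat (d + 1) * vE (d + 1) j
    | GPsi j \<Rightarrow> \<Sum>i\<in>Seq s n. psi_val j i) else 0)"

definition dD :: "nat list \<Rightarrow> nat \<Rightarrow> 'k::field falg \<Rightarrow> 'k falg" where
  "dD s n = der (dgen s n)"

context webster_rep
begin

lemma h_of_nat_one: "h (of_nat c) = of_nat c * h 1"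
  using h_of_nat[of c 1] by simp

lemma one_mult_left [simp]: "h 1 * (h a * w) = h a * w"
  by (simp flip: mult.assoc)

lemma Y_left_commute: "Y j * (Y l * w) = Y l * (Y j * w)"
  by (metis X_X mult.assoc)

lemma E_Y_left_commute: "E d j * (Y l * w) = Y l * (E d j * w)"
  by (metis E_X mult.assoc)

lemma E_left_commute: "E d j * (E d' l * w) = E d' l * (E d j * w)"
  by (metis E_E mult.assoc)

lemma Y_P_bb:
  assumes "v \<in> V i" "ent i j = Black" "ent i (j + 1) = Black" "1 \<le> j" "j + 1 \<le> length s + n"
  shows "Y j * (P j * v) = P j * (Y (j + 1) * v) + v" "Y (j + 1) * (P j * v) = P j * (Y j * v) - v"
  using X_P_bb[OF assms] P_X_bb[OF assms] by simp_all

lemma V_length: "v \<in> V i \<Longrightarrow> v \<noteq> 0 \<Longrightarrow> length i = length s + n"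
  using V_notin[of v i] length_Seq[of i s n] by blast

lemma ent_swap_V:
  assumes "v \<in> V i" "v \<noteq> 0" "1 \<le> j" "j + 1 \<le> length s + n"
  shows "1 \<le> k \<Longrightarrow> ent (swap_entries j i) k = (if k = j then ent i (j + 1) else if k = j + 1 then ent i j else ent i k)"
  using V_length[OF assms(1,2)] assms(3,4) by (intro ent_swap) auto

lemma Y_P_rb:
  assumes "v \<in> V i" "ent i j = Red a" "ent i (j + 1) = Black"
  shows "Y j * (P j * v) = P j * (Y (j + 1) * v)" "Y (j + 1) * (P j * v) = 0"
    "E d j * (P j * v) = P j * (E d (j + 1) * v)" "E d (j + 1) * (P j * v) = P j * (E d j * v)"
proof -
  show "Y (j + 1) * (P j * v) = 0"
  proof (cases "v \<noteq> 0 \<and> 1 \<le> j \<and> j + 1 \<le> length s + n")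
    case True
    then have "ent (swap_entries j i) (j + 1) = Red a"
      using ent_swap_V[OF assms(1), of j "j + 1"] assms by simp
    then show ?thesis by (rule x_red[OF P_V[OF assms(1)]])
  qed (auto simp: P_notin)
  show "E d j * (P j * v) = P j * (E d (j + 1) * v)" "E d (j + 1) * (P j * v) = P j * (E d j * v)"
    using E_P[of d j] P_E[of j d] by (simp_all flip: mult.assoc)
qed (rule X_P_rb[OF assms])

lemma Y_P_br:
  assumes "v \<in> V i" "ent i j = Black" "ent i (j + 1) = Red a"
  shows "Y j * (P j * v) = 0" "Y (j + 1) * (P j * v) = P j * (Y j * v)"
    "E d j * (P j * v) = P j * (E d (j + 1) * v)" "E d (j + 1) * (P j * v) = P j * (E d j * v)"
proof -
  show "Y j * (P j * v) = 0"
  proof (cases "v \<noteq> 0 \<and> 1 \<le> j \<and> j + 1 \<le> length s + n")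
    case True
    then have "ent (swap_entries j i) j = Red a"
      using ent_swap_V[OF assms(1), of j j] assms by simp
    then show ?thesis by (rule x_red[OF P_V[OF assms(1)]])
  qed (auto simp: P_notin)
  show "E d j * (P j * v) = P j * (E d (j + 1) * v)" "E d (j + 1) * (P j * v) = P j * (E d j * v)"
    using E_P[of d j] P_E[of j d] by (simp_all flip: mult.assoc)
qed (rule P_X_br[OF assms, symmetric])

definition \<delta> :: "'k falg \<Rightarrow> 'q" where "\<delta> a = h (dD s n a)"

lemma \<delta>_add: "\<delta> (a + b) = \<delta> a + \<delta> b"
  and \<delta>_diff: "\<delta> (a - b) = \<delta> a - \<delta> b"
  and \<delta>_uminus: "\<delta> (- a) = - \<delta> a"
  and \<delta>_sum: "\<delta> (sum f A) = (\<Sum>x\<in>A. \<delta> (f x))"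
  and \<delta>_zero: "\<delta> 0 = 0"
  and \<delta>_one: "\<delta> 1 = 0"
  and \<delta>_mult: "\<delta> (a * b) = \<delta> a * h b + h a * \<delta> b"
  by (simp_all add: \<delta>_def dD_def der_add der_diff der_uminus der_sum der_zero der_one der_mult
      h_add h_mult h_zero h_sum h_diff h_uminus)

lemma \<delta>_idem: "\<delta> (idem i) = 0"
  by (simp add: \<delta>_def dD_def idem_def der_letter dgen_def h_zero)

lemma \<delta>_idem_right: "\<delta> (a * idem i) = \<delta> a * e i"
  by (simp add: \<delta>_mult \<delta>_idem)

lemma \<delta>_vx: "\<delta> (vx j) = Y j * Y j"
  using no_gen[of "GX j"]
  by (auto simp: \<delta>_def dD_def vx_def der_letter dgen_def h_zero h_mult power2_eq_square)

lemma \<delta>_vE: "\<delta> (vE d j) = E d j * E 1 j - of_nat (d + 1) * E (d + 1) j"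
proof (cases "d = 0")
  case True
  then show ?thesis by (simp add: vE_def \<delta>_one)
next
  case False
  then show ?thesis
    using no_gen[of "GE d j"] no_gen[of "GE (d + 1) j"]
    by (auto simp: \<delta>_def dD_def vE_def der_letter dgen_def h_zero h_mult h_diff h_of_nat_one
        is_gen_def mult.assoc simp del: of_nat_Suc)
qed

lemma \<delta>_psi_notin: "\<not> (1 \<le> j \<and> j + 1 \<le> length s + n) \<Longrightarrow> \<delta> (psi j) = 0"
  by (auto simp: \<delta>_def dD_def psi_def der_letter dgen_def h_zero is_gen_def)

lemma \<delta>_psi:
  assumes "v \<in> V i"
  shows "\<delta> (psi j) * v = h (psi_val j i) * v"
proof (cases "i \<in> Seq s n \<and> 1 \<le> j \<and> j + 1 \<le> length s + n")
  case True
  have "\<delta> (psi j) * v = (\<Sum>i'\<in>Seq s n. h (psi_val j i') * v)"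
    using True by (simp add: \<delta>_def dD_def psi_def der_letter dgen_def h_sum is_gen_def sum_distrib_right)
  also have "\<dots> = (\<Sum>i'\<in>Seq s n. if i' = i then h (psi_val j i) * v else 0)"
    using e_V_other[OF assms]
    by (intro sum.cong) (auto simp: psi_val_def h_simps mult.assoc left_diff_distrib split: entry.splits)
  finally show ?thesis using True by (simp add: finite_Seq)
next
  case False
  then consider "i \<notin> Seq s n" | "\<not> (1 \<le> j \<and> j + 1 \<le> length s + n)" by auto
  then show ?thesis
  proof cases
    case 1
    then show ?thesis using V_notin[OF assms] by simp
  next
    case 2
    with P_notin[OF 2] \<delta>_psi_notin[OF 2] show ?thesis
      by (auto simp: psi_val_def h_simps split: entry.splits)
  qed
qed

lemma \<delta>_psi_bb:
    "v \<in> V i \<Longrightarrow> ent i j = Black \<Longrightarrow> ent i (j + 1) = Black \<Longrightarrow>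
      \<delta> (psi j) * v = - (Y j * (P j * v)) - P j * (Y (j + 1) * v)"
  and \<delta>_psi_rb: "v \<in> V i \<Longrightarrow> ent i j = Red a \<Longrightarrow> ent i (j + 1) = Black \<Longrightarrow>
      \<delta> (psi j) * v = of_nat a * (P j * (Y (j + 1) * v))"
  and \<delta>_psi_br: "v \<in> V i \<Longrightarrow> ent i j = Black \<Longrightarrow> ent i (j + 1) = Red a \<Longrightarrow>
      \<delta> (psi j) * v = P j * (E 1 (j + 1) * v)"
  and \<delta>_psi_rr: "v \<in> V i \<Longrightarrow> ent i j = Red a \<Longrightarrow> ent i (j + 1) = Red b \<Longrightarrow> \<delta> (psi j) * v = 0"
  by (simp_all add: \<delta>_psi psi_val_def h_simps h_of_nat_one mult.assoc left_diff_distrib VD)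

lemma \<delta>_psi_V: "v \<in> V i \<Longrightarrow> \<delta> (psi j) * v \<in> V (swap_entries j i)"
proof -
  assume v: "v \<in> V i"
  consider "ent i j = Black" "ent i (j + 1) = Black" | a where "ent i j = Red a" "ent i (j + 1) = Black"
    | a where "ent i j = Black" "ent i (j + 1) = Red a" | a b where "ent i j = Red a" "ent i (j + 1) = Red b"
    by (metis entry.exhaust)
  then show ?thesis
  proof cases
    case 1
    with v show ?thesis by (simp add: \<delta>_psi_bb V_diff V_uminus X_V P_V)
  next
    case (2 a)
    then have "\<delta> (psi j) * v = P j * (Y (j + 1) * v) * of_nat a"
      using \<delta>_psi_rb[OF v] by (simp add: mult_of_nat_commute)
    with v show ?thesis by (simp add: V_mult_right X_V P_V)
  next
    case (3 a)
    with v show ?thesis by (simp only: \<delta>_psi_br E_V P_V)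
  next
    case (4 a b)
    with v show ?thesis by (simp add: \<delta>_psi_rr V_zero)
  qed
qed

lemma \<delta>_psi_commute:
  assumes v: "v \<in> V i" and Av: "h A * v \<in> V i'"
    and ent: "ent i' j = ent i j" "ent i' (j + 1) = ent i (j + 1)"
    and comm: "h A * P j = P j * h A" "h A * Y j = Y j * h A" "h A * Y (j + 1) = Y (j + 1) * h A"
      "h A * E 1 (j + 1) = E 1 (j + 1) * h A"
  shows "\<delta> (psi j) * (h A * v) = h A * (\<delta> (psi j) * v)"
proof -
  have c: "h A * (P j * w) = P j * (h A * w)" "h A * (Y j * w) = Y j * (h A * w)"
    "h A * (Y (j + 1) * w) = Y (j + 1) * (h A * w)" "h A * (E 1 (j + 1) * w) = E 1 (j + 1) * (h A * w)" for w
    by (simp_all only: comm flip: mult.assoc)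
  consider "ent i j = Black" "ent i (j + 1) = Black" | a where "ent i j = Red a" "ent i (j + 1) = Black"
    | a where "ent i j = Black" "ent i (j + 1) = Red a" | a b where "ent i j = Red a" "ent i (j + 1) = Red b"
    by (metis entry.exhaust)
  then show ?thesis
  proof cases
    case 1
    then show ?thesis
      using \<delta>_psi_bb[OF v, of j] \<delta>_psi_bb[OF Av, of j] ent c
      by (simp add: right_diff_distrib)
  next
    case (2 a)
    have "h A * (of_nat a * w) = of_nat a * (h A * w)" for w
      by (metis mult.assoc mult_of_nat_commute)
    with 2 show ?thesis
      using \<delta>_psi_rb[OF v, of j a] \<delta>_psi_rb[OF Av, of j a] ent c by simp
  next
    case (3 a)
    then show ?thesis
      using \<delta>_psi_br[OF v, of j a] \<delta>_psi_br[OF Av, of j a] ent c by simp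
  next
    case (4 a b)
    then show ?thesis
      using \<delta>_psi_rr[OF v, of j a b] \<delta>_psi_rr[OF Av, of j a b] ent by simp
  qed
qed

lemma \<delta>_eq_0I: "(\<And>i v. i \<in> Seq s n \<Longrightarrow> v \<in> V i \<Longrightarrow> \<delta> r * v = 0) \<Longrightarrow> \<delta> r = 0"
  unfolding \<delta>_def by (rule h_eq_0I) (auto intro: e_V)

lemma \<delta>_vE_commute:
  assumes "\<And>d. h A * E d j = E d j * h A"
  shows "h A * \<delta> (vE d j) = \<delta> (vE d j) * h A"
proof -
  have "h A * (E d j * E 1 j) = E d j * E 1 j * h A"
    using assms by (metis mult.assoc)
  moreover have "h A * (of_nat (d + 1) * E (d + 1) j) = of_nat (d + 1) * E (d + 1) j * h A"
    using assms by (metis mult.assoc mult_of_nat_commute)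
  ultimately show ?thesis by (simp add: \<delta>_vE algebra_simps)
qed

lemma \<delta>_vx_pow: "v \<in> V i \<Longrightarrow> \<delta> (vx j ^ k) * v = of_nat k * (Y j ^ (k + 1) * v)"
proof (induction k)
  case (Suc k)
  have "\<delta> (vx j ^ Suc k) * v = Y j * (Y j * (Y j ^ k * v)) + Y j * (of_nat k * (Y j ^ (k + 1) * v))"
    using Suc by (simp add: \<delta>_mult \<delta>_vx distrib_right mult.assoc h_X_pow)
  also have "Y j * (of_nat k * (Y j ^ (k + 1) * v)) = of_nat k * (Y j * (Y j ^ (k + 1) * v))"
    by (metis mult.assoc mult_of_nat_commute)
  finally show ?case by (simp add: algebra_simps)
qed (simp add: \<delta>_one)

lemma \<delta>_sign: "\<delta> ((-1) ^ d * a) = (-1) ^ d * \<delta> a"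
  by (cases "even d") (auto simp: \<delta>_uminus)

lemma \<delta>_chi:
  assumes "ent i l = Red a"
  shows "(\<Sum>d=0..a. \<delta> ((-1) ^ d * vE d l * vx j ^ (a - d) * idem i))
      = chi a (\<lambda>d. E d l) (Y j) * (E 1 l * e i) + of_nat a * (chi a (\<lambda>d. E d l) (Y j) * (Y j * e i))"
proof -
  have "(\<Sum>d=0..a. \<delta> ((-1) ^ d * vE d l * vx j ^ (a - d) * idem i)) = dchi a (\<lambda>d. E d l) (Y j) * e i"
    unfolding dchi_def sum_distrib_right
  proof (rule sum.cong[OF refl])
    fix d
    have "\<delta> ((-1) ^ d * vE d l * vx j ^ (a - d) * idem i)
        = (-1) ^ d * (\<delta> (vE d l) * (Y j ^ (a - d) * e i) + E d l * (of_nat (a - d) * (Y j ^ (a - d + 1) * e i)))"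
      by (simp only: mult.assoc \<delta>_sign)
        (simp only: \<delta>_mult \<delta>_idem mult_zero_right add_0_right h_mult h_X_pow[OF e_V] \<delta>_vx_pow[OF e_V])
    then show "\<delta> ((-1) ^ d * vE d l * vx j ^ (a - d) * idem i) = (-1) ^ d * (dF (\<lambda>d. E d l) d * Y j ^ (a - d)
        + E d l * (of_nat (a - d) * Y j ^ (a - d + 1))) * e i"
      by (simp only: \<delta>_vE dF_def mult.assoc distrib_right)
  qed
  also have "\<dots> = (dchi a (\<lambda>d. E d l) (Y j) + (-1) ^ a * (of_nat (a + 1) * E (a + 1) l)) * e i"
    using E_large[OF e_V assms, of "a + 1"] by (simp add: distrib_right mult.assoc)
  also have "\<dots> = chi a (\<lambda>d. E d l) (Y j) * (E 1 l * e i) + of_nat a * (chi a (\<lambda>d. E d l) (Y j) * (Y j * e i))"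
    by (subst dchi_eq) (simp_all only: E_X distrib_right mult.assoc)
  finally show ?thesis .
qed

end

lemma swap_same:
  assumes "1 \<le> j" "j < length i" "ent i j = ent i (j + 1)"
  shows "swap_entries j i = i"
  by (rule ent_eqI) (use assms in \<open>auto simp: ent_swap\<close>)

lemma swap_swap:
  assumes "1 \<le> j" "j < length i"
  shows "swap_entries j (swap_entries j i) = i"
  by (rule ent_eqI) (use assms in \<open>auto simp: ent_swap\<close>)

lemma entry_pair_cases:
  obtains (bb) "ent i j = Black" "ent i (j + 1) = Black"
    | (rb) a where "ent i j = Red a" "ent i (j + 1) = Black"
    | (br) a where "ent i j = Black" "ent i (j + 1) = Red a"
    | (rr) a b where "ent i j = Red a" "ent i (j + 1) = Red b"
  by (metis entry.exhaust)

context webster_rep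
begin

lemma of_nat_pull: "h b * (of_nat c * w) = of_nat c * (h b * w)"
  by (rule of_nat_left_commute[symmetric])

lemma V_of_nat: "v \<in> V i \<Longrightarrow> of_nat c * v \<in> V i"
  by (simp add: mult_of_nat_commute V_mult_right)

lemma Y_P_far_left: "l \<noteq> j \<Longrightarrow> l \<noteq> j + 1 \<Longrightarrow> Y l * (P j * w) = P j * (Y l * w)"
  by (simp add: P_X_far flip: mult.assoc)

lemma E_P_far_left: "l \<noteq> j \<Longrightarrow> l \<noteq> j + 1 \<Longrightarrow> E d l * (P j * w) = P j * (E d l * w)"
  by (simp add: P_E_far flip: mult.assoc)

lemma E_P_left: "E d j * (P j * w) = P j * (E d (j + 1) * w)"
  and E_P_left': "E d (j + 1) * (P j * w) = P j * (E d j * w)"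
  using E_P[of d j] P_E[of j d] by (simp_all flip: mult.assoc)

lemma \<delta>_PPP: "\<delta> (psi j * psi k * psi l) * v
    = \<delta> (psi j) * (P k * (P l * v)) + P j * (\<delta> (psi k) * (P l * v)) + P j * (P k * (\<delta> (psi l) * v))"
  by (simp add: \<delta>_mult h_mult algebra_simps)

lemma \<delta>_dquot:
  assumes "ent i (j + 1) = Red a"
  defines "F \<equiv> \<lambda>d. E d (j + 1)"
  shows "(\<Sum>(d1, d2, d3) \<in> {(d1, d2, d3). d1 + d2 + d3 + 1 = a}.
        \<delta> ((-1) ^ d3 * vx j ^ d1 * vE d3 (j + 1) * vx (j + 2) ^ d2 * idem i))
      = ddquot a F (Y j) (Y (j + 2)) * e i"
proof -
  have t: "\<delta> ((-1) ^ d3 * vx j ^ d1 * vE d3 (j + 1) * vx (j + 2) ^ d2 * idem i)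
      = (-1) ^ d3 * (dF F d3 * (Y j ^ d1 * Y (j + 2) ^ d2)
          + F d3 * (of_nat d1 * Y j ^ (d1 + 1) * Y (j + 2) ^ d2
            + Y j ^ d1 * (of_nat d2 * Y (j + 2) ^ (d2 + 1)))) * e i" for d1 d2 d3
  proof -
    have v0: "Y (j + 2) ^ d2 * e i \<in> V i" by (rule X_pow_V[OF e_V])
    have v1: "E d3 (j + 1) * (Y (j + 2) ^ d2 * e i) \<in> V i" by (rule E_V[OF v0])
    have v2: "\<delta> (vE d3 (j + 1)) * (Y (j + 2) ^ d2 * e i) \<in> V i"
      by (simp only: \<delta>_vE left_diff_distrib mult.assoc) (intro V_diff E_V V_of_nat v0)
    have v3: "E d3 (j + 1) * (of_nat d2 * (Y (j + 2) ^ (d2 + 1) * e i)) \<in> V i"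
      by (intro E_V V_of_nat X_pow_V e_V)
    have "\<delta> ((-1) ^ d3 * vx j ^ d1 * vE d3 (j + 1) * vx (j + 2) ^ d2 * idem i)
        = (-1) ^ d3 * (of_nat d1 * (Y j ^ (d1 + 1) * (E d3 (j + 1) * (Y (j + 2) ^ d2 * e i)))
          + (Y j ^ d1 * (\<delta> (vE d3 (j + 1)) * (Y (j + 2) ^ d2 * e i))
            + Y j ^ d1 * (E d3 (j + 1) * (of_nat d2 * (Y (j + 2) ^ (d2 + 1) * e i)))))"
      by (simp only: mult.assoc \<delta>_sign)
        (simp only: \<delta>_mult \<delta>_idem mult_zero_right add_0_right h_mult h_X_pow[OF e_V] \<delta>_vx_pow[OF e_V]
          \<delta>_vx_pow[OF v1] h_X_pow[OF v2] h_X_pow[OF v3] distrib_left)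
    moreover have pw: "Y j ^ k * (E d (j + 1) * w) = E d (j + 1) * (Y j ^ k * w)" for k d w
      by (simp only: X_pow_E flip: mult.assoc)
    moreover have "Y j ^ d1 * (\<delta> (vE d3 (j + 1)) * w) = dF F d3 * (Y j ^ d1 * w)" for w
    proof -
      have "Y j ^ d1 * (of_nat (d3 + 1) * (E (d3 + 1) (j + 1) * w))
          = of_nat (d3 + 1) * (E (d3 + 1) (j + 1) * (Y j ^ d1 * w))"
        by (simp only: of_nat_left_commute[symmetric] pw)
      then show ?thesis
        by (simp only: \<delta>_vE dF_def F_def left_diff_distrib right_diff_distrib mult.assoc pw)
    qed
    ultimately show ?thesis
      by (simp only: F_def distrib_right distrib_left mult.assoc of_nat_left_commute
          add.assoc add.commute add.left_commute)
  qed
  show ?thesis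
    unfolding sum_triples t ddquot_def hsum_def dhsum_def
    by (simp only: sum_distrib_right sum_distrib_left distrib_left distrib_right sum.distrib mult.assoc)
qed

lemma \<delta>_braid_brb:
  assumes i: "ent i j = Black" "ent i (j + 1) = Red a" "ent i (j + 2) = Black"
    and j: "1 \<le> j" "j + 2 \<le> length s + n" and l: "length i = length s + n"
  defines "F \<equiv> \<lambda>d. E d (j + 1)"
  shows "\<delta> (psi j * psi (j + 1) * psi j - psi (j + 1) * psi j * psi (j + 1)) * e i
    = ddquot a F (Y j) (Y (j + 2)) * e i"
proof -
  define v where "v = e i"
  define i1 where "i1 = swap_entries j i"
  define i2 where "i2 = swap_entries (j + 1) i"
  let ?Q = "dquot a F (Y j) (Y (j + 2))"
  have e1: "ent i1 j = Red a" "ent i1 (j + 1) = Black" "ent i1 (j + 1 + 1) = Black"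
    and e2: "ent i2 j = Black" "ent i2 (j + 1) = Black" "ent i2 (j + 1 + 1) = Red a"
    using i j l by (auto simp: i1_def i2_def ent_swap)
  have s1: "swap_entries (j + 1) i1 = i1" and s2: "swap_entries j i2 = i2"
    using e1 e2 j l by (auto intro!: swap_same simp: i1_def i2_def)
  have v: "v \<in> V i" by (simp add: v_def e_V)
  have v1: "P j * v \<in> V i1" unfolding i1_def by (rule P_V[OF v])
  have v2: "P (j + 1) * v \<in> V i2" unfolding i2_def by (rule P_V[OF v])
  have v11: "P (j + 1) * (P j * v) \<in> V i1" using P_V[OF v1, of "j + 1"] by (simp only: s1)
  have v22: "P j * (P (j + 1) * v) \<in> V i2" using P_V[OF v2, of j] by (simp only: s2)
  have i': "ent i (j + 1 + 1) = Black" using i(3) by simp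
  have j': "j + 1 \<le> length s + n" "1 \<le> j + 1" "j + 1 + 1 \<le> length s + n" using j by auto
  have two: "j + 1 + 1 = j + 2" by simp
  note far = Y_P_far_left[of "j + 2" j] Y_P_far_left[of j "j + 1"]
  have A1: "\<delta> (psi j) * v = P j * (E 1 (j + 1) * v)"
    by (rule \<delta>_psi_br[OF v i(1,2)])
  have yA: "Y (j + 1) * (P (j + 1) * (P j * v)) = P (j + 1) * (P j * (Y (j + 2) * v)) + P j * v"
    using Y_P_bb(1)[OF v1 e1(2,3) j'(2,3)] far(1) by (simp add: two)
  have A2: "\<delta> (psi (j + 1)) * (P j * v) = - (2 * (P (j + 1) * (P j * (Y (j + 2) * v)))) - P j * v"
    using \<delta>_psi_bb[OF v1 e1(2,3)] yA far(1) by (simp add: two mult_2)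
  have A3: "\<delta> (psi j) * (P (j + 1) * (P j * v))
      = of_nat a * (P j * (P (j + 1) * (P j * (Y (j + 2) * v)))) + of_nat a * (chi a F (Y j) * v)"
    using \<delta>_psi_rb[OF v11 e1(1,2)] P_P_br[OF v i(1,2) j(1) j'(1)]
    by (simp only: yA distrib_left F_def)
  have yB: "P j * (Y (j + 1) * (P (j + 1) * v)) = P j * (P (j + 1) * (Y (j + 2) * v))"
    using Y_P_rb(1)[OF v i(2) i'] by (simp only: two)
  have B1: "\<delta> (psi (j + 1)) * v = of_nat a * (P (j + 1) * (Y (j + 2) * v))"
    using \<delta>_psi_rb[OF v i(2) i'] by (simp only: two)
  have B2: "\<delta> (psi j) * (P (j + 1) * v) = - (2 * (P j * (P (j + 1) * (Y (j + 2) * v)))) - P (j + 1) * v"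
    using \<delta>_psi_bb[OF v2 e2(1,2)] Y_P_bb(1)[OF v2 e2(1,2) j(1) j'(1)] yB by (simp add: mult_2)
  have B3: "\<delta> (psi (j + 1)) * (P j * (P (j + 1) * v)) = P (j + 1) * (P j * (P (j + 1) * (E 1 (j + 1) * v)))"
    using \<delta>_psi_br[OF v22 e2(2,3)] by (simp only: E_P_left' E_P_far_left two) (simp add: E_P_far_left E_P_left'[of _ "Suc j", simplified])
  have Pm: "P b * (- w) = - (P b * w)" "P b * (2 * w) = 2 * (P b * w)" for b w
    by (simp_all add: mult_2 distrib_left)
  have br: "P j * (P (j + 1) * (P j * w)) = P (j + 1) * (P j * (P (j + 1) * w)) + ?Q * w" if "w \<in> V i" for w
    unfolding F_def by (rule braid_brb[OF that i j])
  note brY = br[OF X_V[OF v, of "j + 2"]] and brE = br[OF E_V[OF v, of 1 "j + 1"]]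
  have "\<delta> (psi j * psi (j + 1) * psi j) * v
      = of_nat a * (P j * (P (j + 1) * (P j * (Y (j + 2) * v)))) + of_nat a * (chi a F (Y j) * v)
        - 2 * (P j * (P (j + 1) * (P j * (Y (j + 2) * v)))) - chi a F (Y j) * v
        + P j * (P (j + 1) * (P j * (E 1 (j + 1) * v)))"
    using P_P_br[OF v i(1,2) j(1) j'(1)]
    by (simp add: \<delta>_PPP A1 A2[simplified] A3[simplified] Pm right_diff_distrib F_def)
  moreover have "\<delta> (psi (j + 1) * psi j * psi (j + 1)) * v
      = P (j + 1) * (P j * (P (j + 1) * (E 1 (j + 1) * v)))
        - 2 * (P (j + 1) * (P j * (P (j + 1) * (Y (j + 2) * v)))) - chi a F (Y (j + 2)) * v
        + of_nat a * (P (j + 1) * (P j * (P (j + 1) * (Y (j + 2) * v))))"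
    using P_P_rb[OF v i(2) i' j'(2,3)]
    by (simp add: \<delta>_PPP B1[simplified] B2[simplified] B3[simplified] Pm right_diff_distrib F_def of_nat_pull)
  ultimately have "\<delta> (psi j * psi (j + 1) * psi j - psi (j + 1) * psi j * psi (j + 1)) * v
      = of_nat a * (?Q * (Y (j + 2) * v)) - 2 * (?Q * (Y (j + 2) * v)) + ?Q * (E 1 (j + 1) * v)
        + of_nat a * (chi a F (Y j) * v) - chi a F (Y j) * v + chi a F (Y (j + 2)) * v"
    by (simp only: \<delta>_diff left_diff_distrib brY brE distrib_left) (simp add: algebra_simps)
  also have "\<dots> = ddquot a F (Y j) (Y (j + 2)) * v"
  proof -
    have "ddquot a F (Y j) (Y (j + 2)) + 2 * (?Q * Y (j + 2)) + chi a F (Y j)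
        = of_nat a * (?Q * Y (j + 2)) + ?Q * F 1 + of_nat a * chi a F (Y j) + chi a F (Y (j + 2))"
      by (rule ddquot_eq) (simp_all add: F_def X_X E_X)
    from arg_cong[OF this, of "\<lambda>z. z * v"] show ?thesis
      by (simp only: distrib_right mult.assoc F_def) (simp add: algebra_simps)
  qed
  finally show ?thesis by (simp only: v_def)
qed

lemma \<delta>_braid_bbb:
  assumes v: "v \<in> V i" and i: "ent i j = Black" "ent i (j + 1) = Black" "ent i (j + 2) = Black"
    and j: "1 \<le> j" "j + 2 \<le> length s + n" and l: "length i = length s + n"
  shows "\<delta> (psi j * psi (j + 1) * psi j) * v = \<delta> (psi (j + 1) * psi j * psi (j + 1)) * v"
proof -
  have i': "ent i (j + 1 + 1) = Black" using i(3) by simp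
  have j': "j + 1 \<le> length s + n" "1 \<le> j + 1" "j + 1 + 1 \<le> length s + n" using j by auto
  have "swap_entries j i = i" "swap_entries (j + 1) i = i"
    using i i' j l by (auto intro!: swap_same)
  then have PV: "w \<in> V i \<Longrightarrow> P j * w \<in> V i" "w \<in> V i \<Longrightarrow> P (j + 1) * w \<in> V i" for w
    using P_V[of w i j] P_V[of w i "j + 1"] by auto
  have YP: "w \<in> V i \<Longrightarrow> Y j * (P j * w) = P j * (Y (j + 1) * w) + w"
    "w \<in> V i \<Longrightarrow> Y (j + 1) * (P j * w) = P j * (Y j * w) - w"
    "w \<in> V i \<Longrightarrow> Y (j + 1) * (P (j + 1) * w) = P (j + 1) * (Y (j + 1 + 1) * w) + w"
    "w \<in> V i \<Longrightarrow> Y (j + 1 + 1) * (P (j + 1) * w) = P (j + 1) * (Y (j + 1) * w) - w" for w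
    using Y_P_bb[of w i j] Y_P_bb[of w i "j + 1"] i i' j j' by auto
  have PP: "w \<in> V i \<Longrightarrow> P j * (P j * w) = 0" "w \<in> V i \<Longrightarrow> P (j + 1) * (P (j + 1) * w) = 0" for w
    using P_P_bb[of w i] i i' by auto
  have br: "w \<in> V i \<Longrightarrow> P j * (P (j + 1) * (P j * w)) = P (j + 1) * (P j * (P (j + 1) * w))" for w
    using braid_other[of w i j] i by auto
  have \<delta>P: "w \<in> V i \<Longrightarrow> \<delta> (psi j) * w = - (Y j * (P j * w)) - P j * (Y (j + 1) * w)"
    "w \<in> V i \<Longrightarrow> \<delta> (psi (j + 1)) * w = - (Y (j + 1) * (P (j + 1) * w)) - P (j + 1) * (Y (j + 1 + 1) * w)" for w
    using \<delta>_psi_bb[of w i] i i' by auto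
  note far = Y_P_far_left[of "j + 1 + 1" j] Y_P_far_left[of j "j + 1"]
  show ?thesis
    unfolding \<delta>_PPP
    using v by (simp add: \<delta>P[simplified] YP[simplified] PP[simplified] br[simplified] far[simplified] PV[simplified]
        X_V V_add V_diff V_uminus distrib_left right_diff_distrib)
qed

lemma \<delta>_braid_bbr:
  assumes v: "v \<in> V i" and i: "ent i j = Black" "ent i (j + 1) = Black" "ent i (j + 2) = Red a"
    and j: "1 \<le> j" "j + 2 \<le> length s + n" and l: "length i = length s + n"
  shows "\<delta> (psi j * psi (j + 1) * psi j) * v = \<delta> (psi (j + 1) * psi j * psi (j + 1)) * v"
proof -
  have i': "ent i (j + 1 + 1) = Red a" using i(3) by simp
  have j': "j + 1 \<le> length s + n" "1 \<le> j + 1" "j + 1 + 1 \<le> length s + n" using j by auto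
  define i1 where "i1 = swap_entries (j + 1) i"
  define i2 where "i2 = swap_entries j i1"
  have e1: "ent i1 j = Black" "ent i1 (j + 1) = Red a" "ent i1 (j + 1 + 1) = Black" and l1: "length i1 = length s + n"
    using i j l by (auto simp: i1_def ent_swap)
  have e2: "ent i2 j = Red a" "ent i2 (j + 1) = Black" "ent i2 (j + 1 + 1) = Black" and l2: "length i2 = length s + n"
    using e1 j l1 by (auto simp: i2_def ent_swap)
  have "swap_entries j i = i" "swap_entries (j + 1) i2 = i2"
    using i e2 j l l2 by (auto intro!: swap_same)
  then have PV: "w \<in> V i \<Longrightarrow> P j * w \<in> V i" "w \<in> V i \<Longrightarrow> P (j + 1) * w \<in> V i1"
    "w \<in> V i1 \<Longrightarrow> P j * w \<in> V i2" "w \<in> V i2 \<Longrightarrow> P (j + 1) * w \<in> V i2" for w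
    using P_V[of w i j] P_V[of w i "j + 1"] P_V[of w i1 j] P_V[of w i2 "j + 1"] by (auto simp: i1_def i2_def)
  have YP: "w \<in> V i \<Longrightarrow> Y j * (P j * w) = P j * (Y (j + 1) * w) + w"
    "w \<in> V i \<Longrightarrow> Y (j + 1 + 1) * (P (j + 1) * w) = P (j + 1) * (Y (j + 1) * w)"
    "w \<in> V i2 \<Longrightarrow> Y (j + 1) * (P (j + 1) * w) = P (j + 1) * (Y (j + 1 + 1) * w) + w" for w
    using Y_P_bb[of w i j] Y_P_br[of w i "j + 1" a] Y_P_bb[of w i2 "j + 1"] i i' e2 j j' by auto
  have br: "w \<in> V i \<Longrightarrow> P j * (P (j + 1) * (P j * w)) = P (j + 1) * (P j * (P (j + 1) * w))" for w
    using braid_other[of w i j] i by auto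
  have \<delta>P: "w \<in> V i \<Longrightarrow> \<delta> (psi j) * w = - (Y j * (P j * w)) - P j * (Y (j + 1) * w)"
    "w \<in> V i \<Longrightarrow> \<delta> (psi (j + 1)) * w = P (j + 1) * (E 1 (j + 1 + 1) * w)"
    "w \<in> V i1 \<Longrightarrow> \<delta> (psi j) * w = P j * (E 1 (j + 1) * w)"
    "w \<in> V i2 \<Longrightarrow> \<delta> (psi (j + 1)) * w = - (Y (j + 1) * (P (j + 1) * w)) - P (j + 1) * (Y (j + 1 + 1) * w)" for w
    using \<delta>_psi_bb[of w i j] \<delta>_psi_br[of w i "j + 1" a] \<delta>_psi_br[of w i1 j a] \<delta>_psi_bb[of w i2 "j + 1"] i i' e1 e2
    by auto
  note far = Y_P_far_left[of "j + 1 + 1" j] Y_P_far_left[of j "j + 1"] E_P_far_left[of "j + 1 + 1" j]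
    E_P_left[of _ "j + 1"] E_P_left'[of _ j]
  show ?thesis
    unfolding \<delta>_PPP
    using v by (simp add: \<delta>P[simplified] YP[simplified] br[simplified] far[simplified] PV[simplified]
        X_V E_V V_add V_diff V_uminus distrib_left right_diff_distrib)
qed

lemma \<delta>_braid_rbb:
  assumes v: "v \<in> V i" and i: "ent i j = Red a" "ent i (j + 1) = Black" "ent i (j + 2) = Black"
    and j: "1 \<le> j" "j + 2 \<le> length s + n" and l: "length i = length s + n"
  shows "\<delta> (psi j * psi (j + 1) * psi j) * v = \<delta> (psi (j + 1) * psi j * psi (j + 1)) * v"
proof -
  have i': "ent i (j + 1 + 1) = Black" using i(3) by simp
  have j': "j + 1 \<le> length s + n" "1 \<le> j + 1" "j + 1 + 1 \<le> length s + n" using j by auto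
  define i1 where "i1 = swap_entries j i"
  define i2 where "i2 = swap_entries (j + 1) i1"
  have e1: "ent i1 j = Black" "ent i1 (j + 1) = Red a" "ent i1 (j + 1 + 1) = Black" and l1: "length i1 = length s + n"
    using i j l by (auto simp: i1_def ent_swap)
  have e2: "ent i2 j = Black" "ent i2 (j + 1) = Black" "ent i2 (j + 1 + 1) = Red a" and l2: "length i2 = length s + n"
    using e1 j l1 by (auto simp: i2_def ent_swap)
  have "swap_entries (j + 1) i = i" "swap_entries j i2 = i2"
    using i i' e2 j l l2 by (auto intro!: swap_same)
  then have PV: "w \<in> V i \<Longrightarrow> P (j + 1) * w \<in> V i" "w \<in> V i \<Longrightarrow> P j * w \<in> V i1"
    "w \<in> V i1 \<Longrightarrow> P (j + 1) * w \<in> V i2" "w \<in> V i2 \<Longrightarrow> P j * w \<in> V i2" for w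
    using P_V[of w i j] P_V[of w i "j + 1"] P_V[of w i1 "j + 1"] P_V[of w i2 j] by (auto simp: i1_def i2_def)
  have YP: "w \<in> V i \<Longrightarrow> Y (j + 1) * (P (j + 1) * w) = P (j + 1) * (Y (j + 1 + 1) * w) + w"
    "w \<in> V i \<Longrightarrow> Y (j + 1 + 1) * (P (j + 1) * w) = P (j + 1) * (Y (j + 1) * w) - w"
    "w \<in> V i1 \<Longrightarrow> Y (j + 1) * (P (j + 1) * w) = P (j + 1) * (Y (j + 1 + 1) * w)"
    "w \<in> V i2 \<Longrightarrow> Y j * (P j * w) = P j * (Y (j + 1) * w) + w" for w
    using Y_P_bb[of w i "j + 1"] Y_P_rb[of w i1 "j + 1" a] Y_P_bb[of w i2 j] i i' e1 e2 j j' by auto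
  have br: "w \<in> V i \<Longrightarrow> P j * (P (j + 1) * (P j * w)) = P (j + 1) * (P j * (P (j + 1) * w))" for w
    using braid_other[of w i j] i by auto
  have \<delta>P: "w \<in> V i \<Longrightarrow> \<delta> (psi (j + 1)) * w = - (Y (j + 1) * (P (j + 1) * w)) - P (j + 1) * (Y (j + 1 + 1) * w)"
    "w \<in> V i \<Longrightarrow> \<delta> (psi j) * w = of_nat a * (P j * (Y (j + 1) * w))"
    "w \<in> V i1 \<Longrightarrow> \<delta> (psi (j + 1)) * w = of_nat a * (P (j + 1) * (Y (j + 1 + 1) * w))"
    "w \<in> V i2 \<Longrightarrow> \<delta> (psi j) * w = - (Y j * (P j * w)) - P j * (Y (j + 1) * w)" for w
    using \<delta>_psi_bb[of w i "j + 1"] \<delta>_psi_rb[of w i j a] \<delta>_psi_rb[of w i1 "j + 1" a] \<delta>_psi_bb[of w i2 j] i i' e1 e2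
    by auto
  note far = Y_P_far_left[of "j + 1 + 1" j] Y_P_far_left[of j "j + 1"]
  show ?thesis
    unfolding \<delta>_PPP
    using v by (simp add: \<delta>P[simplified] YP[simplified] far[simplified] PV[simplified]
        X_V E_V V_add V_diff V_uminus distrib_left right_diff_distrib of_nat_pull)
      (simp add: br[simplified] X_V)
qed

lemma red_red_kill:
  assumes "v \<in> V i" "ent i j \<noteq> Black" "ent i (j + 1) \<noteq> Black"
  shows "P j * v = 0" "\<delta> (psi j) * v = 0"
  using assms P_red_red \<delta>_psi_rr by (metis entry.exhaust)+

lemma \<delta>_braid_red:
  assumes v: "v \<in> V i" and i: "ent i j \<noteq> Black \<and> ent i (j + 1) \<noteq> Black \<or> ent i j \<noteq> Black \<and> ent i (j + 2) \<noteq> Black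
      \<or> ent i (j + 1) \<noteq> Black \<and> ent i (j + 2) \<noteq> Black"
    and j: "1 \<le> j" "j + 2 \<le> length s + n" and l: "length i = length s + n"
  shows "\<delta> (psi j * psi (j + 1) * psi j) * v = 0" "\<delta> (psi (j + 1) * psi j * psi (j + 1)) * v = 0"
proof -
  define i1 where "i1 = swap_entries j i"
  define i2 where "i2 = swap_entries (j + 1) i1"
  define k1 where "k1 = swap_entries (j + 1) i"
  define k2 where "k2 = swap_entries j k1"
  have e1: "ent i1 j = ent i (j + 1)" "ent i1 (j + 1) = ent i j" "ent i1 (j + 1 + 1) = ent i (j + 2)"
      "length i1 = length s + n"
    "ent k1 j = ent i j" "ent k1 (j + 1) = ent i (j + 2)" "ent k1 (j + 1 + 1) = ent i (j + 1)"
      "length k1 = length s + n"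
    using j l by (auto simp: i1_def k1_def ent_swap)
  have e2: "ent i2 j = ent i (j + 1)" "ent i2 (j + 1) = ent i (j + 2)" "ent k2 (j + 1) = ent i j" "ent k2 (j + 1 + 1) = ent i (j + 1)"
    using e1 j by (auto simp: i2_def k2_def ent_swap)
  have V1: "P j * v \<in> V i1" "\<delta> (psi j) * v \<in> V i1" "P (j + 1) * v \<in> V k1" "\<delta> (psi (j + 1)) * v \<in> V k1"
    unfolding i1_def k1_def using v by (auto intro: P_V \<delta>_psi_V)
  have V2: "w \<in> V i1 \<Longrightarrow> P (j + 1) * w \<in> V i2" "w \<in> V i1 \<Longrightarrow> \<delta> (psi (j + 1)) * w \<in> V i2"
    "w \<in> V k1 \<Longrightarrow> P j * w \<in> V k2" "w \<in> V k1 \<Longrightarrow> \<delta> (psi j) * w \<in> V k2" for w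
    unfolding i2_def k2_def by (auto intro: P_V \<delta>_psi_V)
  consider "ent i j \<noteq> Black" "ent i (j + 1) \<noteq> Black" | "ent i j \<noteq> Black" "ent i (j + 2) \<noteq> Black"
    | "ent i (j + 1) \<noteq> Black" "ent i (j + 2) \<noteq> Black" using i by auto
  then have "\<delta> (psi j * psi (j + 1) * psi j) * v = 0 \<and> \<delta> (psi (j + 1) * psi j * psi (j + 1)) * v = 0"
  proof cases
    case 1
    have "w \<in> V k2 \<Longrightarrow> P (j + 1) * w = 0 \<and> \<delta> (psi (j + 1)) * w = 0" for w
      using red_red_kill[of w k2 "j + 1"] e2 1 by simp
    moreover have "P j * v = 0" "\<delta> (psi j) * v = 0"
      using red_red_kill[OF v, of j] 1 by auto
    ultimately show ?thesis by (simp only: \<delta>_PPP V1 V2 mult_zero_right add_0_right simp_thms)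
  next
    case 2
    have "w \<in> V i1 \<Longrightarrow> P (j + 1) * w = 0 \<and> \<delta> (psi (j + 1)) * w = 0"
      "w \<in> V k1 \<Longrightarrow> P j * w = 0 \<and> \<delta> (psi j) * w = 0" for w
      using red_red_kill[of w i1 "j + 1"] red_red_kill[of w k1 j] e1 2 by simp_all
    then show ?thesis by (simp only: \<delta>_PPP V1 V2 mult_zero_right add_0_right simp_thms)
  next
    case 3
    have "w \<in> V i2 \<Longrightarrow> P j * w = 0 \<and> \<delta> (psi j) * w = 0" for w
      using red_red_kill[of w i2 j] e2 3 by simp
    moreover have "P (j + 1) * v = 0" "\<delta> (psi (j + 1)) * v = 0"
      using red_red_kill[OF v, of "j + 1"] 3 by auto
    ultimately show ?thesis by (simp only: \<delta>_PPP V1 V2 mult_zero_right add_0_right simp_thms)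
  qed
  then show "\<delta> (psi j * psi (j + 1) * psi j) * v = 0" "\<delta> (psi (j + 1) * psi j * psi (j + 1)) * v = 0"
    by auto
qed

end

context webster_rep
begin

lemma \<delta>_psi_E:
  assumes v: "v \<in> V i" and d: "1 \<le> d" and j: "1 \<le> j" "j + 1 \<le> length s + n" and l: "length i = length s + n"
  shows "\<delta> (psi j) * (E d j * v) = E d (j + 1) * (\<delta> (psi j) * v)"
    and "\<delta> (psi j) * (E d (j + 1) * v) = E d j * (\<delta> (psi j) * v)"
proof -
  have e: "ent (swap_entries j i) j = ent i (j + 1)" "ent (swap_entries j i) (j + 1) = ent i j"
    using j l by (auto simp: ent_swap)
  have z: "ent i j = Black \<Longrightarrow> E d j * v = 0" "ent i (j + 1) = Black \<Longrightarrow> E d (j + 1) * v = 0"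
    "ent i j = Black \<Longrightarrow> w \<in> V (swap_entries j i) \<Longrightarrow> E d (j + 1) * w = 0"
    "ent i (j + 1) = Black \<Longrightarrow> w \<in> V (swap_entries j i) \<Longrightarrow> E d j * w = 0" for w
    using E_black[OF v _ d] E_black[of w "swap_entries j i" _ d] d e by auto
  note dv = \<delta>_psi_V[OF v, of j]
  show "\<delta> (psi j) * (E d j * v) = E d (j + 1) * (\<delta> (psi j) * v)"
  proof (cases rule: entry_pair_cases[of i j])
    case bb
    with z dv show ?thesis by simp
  next
    case (rb a)
    then show ?thesis
      using \<delta>_psi_rb[OF v] \<delta>_psi_rb[OF E_V[OF v]]
      by (simp only: of_nat_pull E_P_left' E_Y_left_commute)
  next
    case (br a)
    with z dv show ?thesis by simp
  next
    case (rr a b)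
    then show ?thesis
      using \<delta>_psi_rr[OF v, of j] \<delta>_psi_rr[OF E_V[OF v], of j] by simp
  qed
  show "\<delta> (psi j) * (E d (j + 1) * v) = E d j * (\<delta> (psi j) * v)"
  proof (cases rule: entry_pair_cases[of i j])
    case bb
    with z dv show ?thesis by simp
  next
    case (rb a)
    with z dv show ?thesis by simp
  next
    case (br a)
    then show ?thesis
      using \<delta>_psi_br[OF v] \<delta>_psi_br[OF E_V[OF v]]
      by (simp only: E_P_left) (simp only: E_left_commute)
  next
    case (rr a b)
    then show ?thesis
      using \<delta>_psi_rr[OF v, of j] \<delta>_psi_rr[OF E_V[OF v], of j] by simp
  qed
qed

lemma \<delta>_rel_aux_psi_x:
  assumes v: "v \<in> V i" and j: "1 \<le> j" "j + 1 \<le> length s + n"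
  shows "ent i j = Black \<Longrightarrow> ent i (j + 1) = Black \<Longrightarrow>
      \<delta> (vx j * psi j) * v = \<delta> (psi j * vx (j + 1)) * v"
    and "ent i j = Black \<Longrightarrow> ent i (j + 1) = Black \<Longrightarrow>
      \<delta> (psi j * vx j) * v = \<delta> (vx (j + 1) * psi j) * v"
    and "ent i j = Red a \<Longrightarrow> ent i (j + 1) = Black \<Longrightarrow>
      \<delta> (vx j * psi j) * v = \<delta> (psi j * vx (j + 1)) * v"
    and "ent i j = Black \<Longrightarrow> ent i (j + 1) = Red a \<Longrightarrow>
      \<delta> (psi j * vx j) * v = \<delta> (vx (j + 1) * psi j) * v"
proof -
  have m: "\<delta> (x * y) * v = \<delta> x * (h y * v) + h x * (\<delta> y * v)" for x y
    by (simp add: \<delta>_mult distrib_right mult.assoc)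
  have Pm: "P b * (- w) = - (P b * w)" "P b * (w + w') = P b * w + P b * w'"
    "P b * (w - w') = P b * w - P b * w'" for b w w'
    by (simp_all add: distrib_left right_diff_distrib)
  have YY: "Y (Suc j) * (Y j * w) = Y j * (Y (Suc j) * w)" for w
    by (rule Y_left_commute)
  show "\<delta> (vx j * psi j) * v = \<delta> (psi j * vx (j + 1)) * v"
    if "ent i j = Black" "ent i (j + 1) = Black"
    using \<delta>_psi_bb[OF _ that] v by (simp add: m \<delta>_vx X_V mult.assoc right_diff_distrib)
  show "\<delta> (psi j * vx j) * v = \<delta> (vx (j + 1) * psi j) * v"
    if "ent i j = Black" "ent i (j + 1) = Black"
    using \<delta>_psi_bb[OF _ that] Y_P_bb[OF _ that j] v
    by (simp add: m \<delta>_vx X_V mult.assoc right_diff_distrib distrib_left YY)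
  show "\<delta> (vx j * psi j) * v = \<delta> (psi j * vx (j + 1)) * v"
    if "ent i j = Red a" "ent i (j + 1) = Black"
    using \<delta>_psi_rb[OF _ that] Y_P_rb[OF _ that] v
    by (simp add: m \<delta>_vx X_V mult.assoc of_nat_pull)
  show "\<delta> (psi j * vx j) * v = \<delta> (vx (j + 1) * psi j) * v"
    if "ent i j = Black" "ent i (j + 1) = Red a"
    using \<delta>_psi_br[OF _ that] Y_P_br[OF _ that] v
    by (simp add: m \<delta>_vx X_V E_V mult.assoc E_Y_left_commute)
qed

lemma \<delta>_psi_square:
  assumes v: "v \<in> V i" and j: "1 \<le> j" "j + 1 \<le> length s + n" and l: "length i = length s + n"
  shows "ent i j = Black \<Longrightarrow> ent i (j + 1) = Black \<Longrightarrow> \<delta> (psi j ^ 2) * v = 0"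
    and "ent i j = Red a \<Longrightarrow> ent i (j + 1) = Black \<Longrightarrow> \<delta> (psi j ^ 2) * v
      = chi a (\<lambda>d. E d j) (Y (j + 1)) * (E 1 j * v) + of_nat a * (chi a (\<lambda>d. E d j) (Y (j + 1)) * (Y (j + 1) * v))"
    and "ent i j = Black \<Longrightarrow> ent i (j + 1) = Red a \<Longrightarrow> \<delta> (psi j ^ 2) * v
      = chi a (\<lambda>d. E d (j + 1)) (Y j) * (E 1 (j + 1) * v) + of_nat a * (chi a (\<lambda>d. E d (j + 1)) (Y j) * (Y j * v))"
proof -
  have m: "\<delta> (psi j ^ 2) * v = \<delta> (psi j) * (P j * v) + P j * (\<delta> (psi j) * v)"
    by (simp add: power2_eq_square \<delta>_mult distrib_right mult.assoc)
  have e: "ent (swap_entries j i) j = ent i (j + 1)" "ent (swap_entries j i) (j + 1) = ent i j"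
    using j l by (auto simp: ent_swap)
  have P: "P j * v \<in> V (swap_entries j i)" by (rule P_V[OF v])
  show "\<delta> (psi j ^ 2) * v = 0" if i: "ent i j = Black" "ent i (j + 1) = Black"
  proof -
    have "swap_entries j i = i" using i j l by (intro swap_same) auto
    with P have "P j * v \<in> V i" by simp
    then show ?thesis
      using v \<delta>_psi_bb[OF _ i] Y_P_bb[OF _ i j] P_P_bb[OF _ i]
      by (simp add: m X_V distrib_left right_diff_distrib)
  qed
  show "\<delta> (psi j ^ 2) * v
      = chi a (\<lambda>d. E d j) (Y (j + 1)) * (E 1 j * v) + of_nat a * (chi a (\<lambda>d. E d j) (Y (j + 1)) * (Y (j + 1) * v))"
    if i: "ent i j = Red a" "ent i (j + 1) = Black"
    using \<delta>_psi_br[OF P, of j a] \<delta>_psi_rb[OF v i] e i P_P_rb[OF X_V[OF v] i j] P_P_rb[OF E_V[OF v] i j]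
      E_P_left'[of 1 j v]
    by (simp add: m of_nat_pull)
  show "\<delta> (psi j ^ 2) * v
      = chi a (\<lambda>d. E d (j + 1)) (Y j) * (E 1 (j + 1) * v) + of_nat a * (chi a (\<lambda>d. E d (j + 1)) (Y j) * (Y j * v))"
    if i: "ent i j = Black" "ent i (j + 1) = Red a"
    using \<delta>_psi_rb[OF P, of j a] \<delta>_psi_br[OF v i] e i P_P_br[OF X_V[OF v] i j] P_P_br[OF E_V[OF v] i j]
      Y_P_br(2)[OF v i]
    by (simp add: m of_nat_pull add.commute)
qed

lemma \<delta>_E_x: "\<delta> (vE d j * vx l) = \<delta> (vx l * vE d j)"
proof -
  have "E d j * (Y l * Y l) = Y l * Y l * E d j" by (simp add: E_Y_left_commute E_X mult.assoc)
  then show ?thesis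
    using \<delta>_vE_commute[of "vx l" j d] E_X by (simp add: \<delta>_mult \<delta>_vx add.commute)
qed

lemma \<delta>_E_x_pow: "h (vx l ^ k * vE d j) = h (vE d j * vx l ^ k) \<and> \<delta> (vx l ^ k * vE d j) = \<delta> (vE d j * vx l ^ k)"
proof (induction k)
  case (Suc k)
  have "h (vx l ^ Suc k * vE d j) = Y l * h (vE d j * vx l ^ k)"
    using Suc.IH by (simp only: power_Suc mult.assoc h_mult[of "vx l" "_ * _"])
  also have "\<dots> = h (vE d j * vx l ^ Suc k)"
    by (simp only: h_mult E_X power_Suc flip: mult.assoc)
  finally have *: "h (vx l ^ Suc k * vE d j) = h (vE d j * vx l ^ Suc k)" .
  have "\<delta> (vx l ^ Suc k * vE d j) = \<delta> (vx l * (vE d j * vx l ^ k))"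
    using Suc.IH by (simp only: power_Suc mult.assoc \<delta>_mult[of "vx l" "_ * _"])
  also have "\<dots> = \<delta> (vE d j * vx l) * h (vx l ^ k) + h (vE d j * vx l) * \<delta> (vx l ^ k)"
    by (simp only: \<delta>_E_x h_mult E_X \<delta>_mult[of "_ * _" "_ ^ _"] flip: mult.assoc)
  also have "\<dots> = \<delta> (vE d j * vx l ^ Suc k)"
    by (simp only: \<delta>_mult[symmetric] power_Suc mult.assoc)
  finally show ?case using * by simp
qed simp

lemma \<delta>_rel:
  assumes "r \<in> D_rels s n"
  shows "\<delta> r = 0"
  using assms
proof cases
  case (no_gen g)
  then show ?thesis by (simp add: \<delta>_def dD_def der_letter dgen_def h_zero)
next
  case unit
  then show ?thesis by (simp add: \<delta>_diff \<delta>_one \<delta>_sum \<delta>_idem)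
next
  case (idem_idem i i')
  then show ?thesis by (simp add: \<delta>_diff \<delta>_mult \<delta>_idem \<delta>_zero)
next
  case (E_idem i d j)
  then show ?thesis
    using \<delta>_vE_commute[of "idem i" j d] by (simp add: \<delta>_diff \<delta>_mult \<delta>_idem E_e)
next
  case (x_idem i j)
  have "Y j * Y j * e i = Y j * (e i * Y j)" by (simp only: X_e mult.assoc)
  also have "\<dots> = e i * (Y j * Y j)" by (simp only: X_e flip: mult.assoc)
  finally show ?thesis using x_idem by (simp add: \<delta>_diff \<delta>_mult \<delta>_idem \<delta>_vx)
next
  case (psi_idem i j)
  show ?thesis
  proof (rule \<delta>_eq_0I)
    fix i' v assume i': "i' \<in> Seq s n" and v: "v \<in> V i'"
    have "\<delta> (psi j) * v \<in> V (swap_entries j i')" by (rule \<delta>_psi_V[OF v])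
    moreover have "i' \<noteq> i \<Longrightarrow> swap_entries j i' \<noteq> swap_entries j i"
      using swap_swap[of j i] swap_swap[of j i'] length_Seq[OF i'] length_Seq[OF psi_idem(2)] psi_idem(3)
      by (auto simp: is_gen_def)
    ultimately show "\<delta> r * v = 0"
      using v VD e_V_other
      by (cases "i' = i") (simp_all add: psi_idem(1) \<delta>_diff \<delta>_mult \<delta>_idem left_diff_distrib mult.assoc)
  qed
next
  case (E_black i d j)
  then show ?thesis
    using webster_rep.E_black[OF webster_rep_axioms e_V, of i j]
    by (simp add: \<delta>_idem_right \<delta>_vE left_diff_distrib mult.assoc is_gen_def del: of_nat_Suc of_nat_add)
next
  case (E_large i d j a)
  have "E d j * (E 1 j * e i) = 0" "E (d + 1) j * e i = 0"
    using webster_rep.E_large[OF webster_rep_axioms, of _ i j a] e_V E_V[OF e_V] E_large by auto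
  then show ?thesis using E_large
    by (simp add: \<delta>_idem_right \<delta>_vE left_diff_distrib mult.assoc del: of_nat_Suc of_nat_add)
next
  case (x_red i j a)
  then show ?thesis
    using webster_rep.x_red[OF webster_rep_axioms e_V] by (simp add: \<delta>_idem_right \<delta>_vx mult.assoc)
next
  case (psi_red_red i j a b)
  then show ?thesis by (simp add: \<delta>_idem_right \<delta>_psi_rr[OF e_V])
next
  case (x_x j l)
  have "Y j * Y j * Y l = Y l * (Y j * Y j)" "Y j * (Y l * Y l) = Y l * Y l * Y j"
    using X_X by (simp_all add: mult.assoc Y_left_commute)
  then show ?thesis using x_x by (simp add: \<delta>_diff \<delta>_mult \<delta>_vx)
next
  case (E_x d j l)
  then show ?thesis using \<delta>_E_x by (simp add: \<delta>_diff)
next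
  case (E_E d j d' l)
  then show ?thesis
    using \<delta>_vE_commute[of "vE d j" l d'] \<delta>_vE_commute[of "vE d' l" j d] webster_rep.E_E[OF webster_rep_axioms]
    by (simp add: \<delta>_diff \<delta>_mult)
next
  case (psi_x_far j l)
  show ?thesis
  proof (rule \<delta>_eq_0I)
    fix i v assume v: "v \<in> V i"
    have "\<delta> (psi j) * (Y l * v) = Y l * (\<delta> (psi j) * v)"
      by (rule \<delta>_psi_commute[OF v X_V[OF v]]) (use psi_x_far in \<open>auto simp: P_X_far X_X E_X\<close>)
    moreover have "P j * (Y l * (Y l * v)) = Y l * (Y l * (P j * v))"
      using psi_x_far by (simp add: Y_P_far_left)
    ultimately show "\<delta> r * v = 0"
      by (simp add: psi_x_far(1) \<delta>_diff \<delta>_mult \<delta>_vx left_diff_distrib distrib_right mult.assoc)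
  qed
next
  case (psi_E_far j d l)
  show ?thesis
  proof (rule \<delta>_eq_0I)
    fix i v assume v: "v \<in> V i"
    have "\<delta> (psi j) * (E d l * v) = E d l * (\<delta> (psi j) * v)"
      by (rule \<delta>_psi_commute[OF v E_V[OF v]])
        (simp_all only: P_E_far[OF psi_E_far(4,5)] E_X, rule webster_rep.E_E[OF webster_rep_axioms])
    moreover have "P j * (\<delta> (vE d l) * v) = \<delta> (vE d l) * (P j * v)"
    proof -
      have "P j * \<delta> (vE d l) = \<delta> (vE d l) * P j"
        by (rule \<delta>_vE_commute) (rule P_E_far[OF psi_E_far(4,5)])
      then show ?thesis by (simp flip: mult.assoc)
    qed
    ultimately show "\<delta> r * v = 0"
      by (simp add: psi_E_far(1) \<delta>_diff \<delta>_mult left_diff_distrib distrib_right mult.assoc)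
  qed
next
  case (psi_E j d)
  show ?thesis
  proof (rule \<delta>_eq_0I)
    fix i v assume i: "i \<in> Seq s n" and v: "v \<in> V i"
    have "P j * (\<delta> (vE d j) * v) = \<delta> (vE d (j + 1)) * (P j * v)"
      by (simp only: \<delta>_vE left_diff_distrib mult.assoc right_diff_distrib of_nat_pull E_P_left')
    then show "\<delta> r * v = 0"
      using \<delta>_psi_E[OF v psi_E(3)] length_Seq[OF i] psi_E(2)
      by (simp add: psi_E(1) \<delta>_diff \<delta>_mult left_diff_distrib distrib_right mult.assoc is_gen_def)
  qed
next
  case (E_psi j d)
  show ?thesis
  proof (rule \<delta>_eq_0I)
    fix i v assume i: "i \<in> Seq s n" and v: "v \<in> V i"
    have "P j * (\<delta> (vE d (j + 1)) * v) = \<delta> (vE d j) * (P j * v)"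
      by (simp only: \<delta>_vE left_diff_distrib mult.assoc right_diff_distrib of_nat_pull E_P_left)
    then show "\<delta> r * v = 0"
      using \<delta>_psi_E[OF v E_psi(3)] length_Seq[OF i] E_psi(2)
      by (simp add: E_psi(1) \<delta>_diff \<delta>_mult left_diff_distrib distrib_right mult.assoc is_gen_def)
  qed
next
  case (psi_psi_far j l)
  show ?thesis
  proof (rule \<delta>_eq_0I)
    fix i v assume i: "i \<in> Seq s n" and v: "v \<in> V i"
    note l = length_Seq[OF i]
    have "\<delta> (psi j) * (P l * v) = P l * (\<delta> (psi j) * v)"
      by (rule \<delta>_psi_commute[OF v P_V[OF v]])
        (use psi_psi_far l in \<open>auto simp: P_X_far P_E_far P_P_far ent_swap_other is_gen_def\<close>)
    moreover have "\<delta> (psi l) * (P j * v) = P j * (\<delta> (psi l) * v)"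
      by (rule \<delta>_psi_commute[OF v P_V[OF v]])
        (use psi_psi_far l in \<open>auto simp: P_X_far P_E_far P_P_far ent_swap_other is_gen_def\<close>)
    ultimately show "\<delta> r * v = 0"
      by (simp add: psi_psi_far(1) \<delta>_diff \<delta>_mult left_diff_distrib distrib_right mult.assoc)
  qed
next
  case (x_psi_black_black i j)
  then show ?thesis
    using \<delta>_rel_aux_psi_x(1)[OF e_V, of j i] by (simp add: \<delta>_diff \<delta>_idem_right \<delta>_idem is_gen_def)
next
  case (x_psi_red_black i j a)
  then show ?thesis
    using \<delta>_rel_aux_psi_x(3)[OF e_V, of j i a] by (simp add: \<delta>_diff \<delta>_idem_right is_gen_def)
next
  case (psi_x_black_black i j)
  then show ?thesis
    using \<delta>_rel_aux_psi_x(2)[OF e_V, of j i] by (simp add: \<delta>_diff \<delta>_idem_right \<delta>_idem is_gen_def)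
next
  case (psi_x_black_red i j a)
  then show ?thesis
    using \<delta>_rel_aux_psi_x(4)[OF e_V, of j i a] by (simp add: \<delta>_diff \<delta>_idem_right is_gen_def)
next
  case (psi_square_black_black i j)
  then show ?thesis
    using \<delta>_psi_square(1)[OF e_V, of j i] length_Seq[of i s n] by (simp add: \<delta>_idem_right is_gen_def)
next
  case (psi_square_red_black i j a)
  then show ?thesis
    using \<delta>_psi_square(2)[OF e_V, of j i a] length_Seq[of i s n] \<delta>_chi[of i j a "j + 1"]
    by (simp only: \<delta>_diff \<delta>_sum) (simp add: \<delta>_idem_right[of "psi j ^ 2"] is_gen_def)
next
  case (psi_square_black_red i j a)
  have "\<delta> ((-1) ^ d * vx j ^ (a - d) * vE d (j + 1) * idem i)
      = \<delta> ((-1) ^ d * vE d (j + 1) * vx j ^ (a - d) * idem i)" for d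
    using \<delta>_E_x_pow[of j "a - d" d "j + 1"] by (simp only: mult.assoc \<delta>_sign) (simp only: \<delta>_idem_right flip: mult.assoc)
  then show ?thesis
    using \<delta>_psi_square(3)[OF e_V, of j i a] length_Seq[of i s n] \<delta>_chi[of i "j + 1" a j] psi_square_black_red
    by (simp only: \<delta>_diff \<delta>_sum) (simp add: \<delta>_idem_right[of "psi j ^ 2"] is_gen_def)
next
  case (braid_black_red_black i j a)
  then show ?thesis
    using \<delta>_braid_brb[of i j a] \<delta>_dquot[of i j a] length_Seq[of i s n]
    by (simp only: \<delta>_diff \<delta>_sum) (simp add: \<delta>_idem_right[of "_ - _"] \<delta>_diff is_gen_def split_beta)
next
  case (braid_other i j)
  have l: "length i = length s + n" by (rule length_Seq[OF braid_other(2)])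
  have j: "1 \<le> j" "j + 2 \<le> length s + n" using braid_other(3,4) by (auto simp: is_gen_def)
  have "\<delta> (psi j * psi (j + 1) * psi j) * e i = \<delta> (psi (j + 1) * psi j * psi (j + 1)) * e i"
  proof (cases "ent i j \<noteq> Black \<and> ent i (j + 1) \<noteq> Black \<or> ent i j \<noteq> Black \<and> ent i (j + 2) \<noteq> Black
      \<or> ent i (j + 1) \<noteq> Black \<and> ent i (j + 2) \<noteq> Black")
    case True
    from \<delta>_braid_red[OF e_V this j l] show ?thesis by simp
  next
    case False
    with braid_other(5) consider "ent i j = Black" "ent i (j + 1) = Black" "ent i (j + 2) = Black"
      | a where "ent i j = Red a" "ent i (j + 1) = Black" "ent i (j + 2) = Black"
      | a where "ent i j = Black" "ent i (j + 1) = Black" "ent i (j + 2) = Red a"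
      by (metis entry.exhaust)
    then show ?thesis
      by cases (use \<delta>_braid_bbb[OF e_V _ _ _ j l] \<delta>_braid_rbb[OF e_V _ _ _ j l] \<delta>_braid_bbr[OF e_V _ _ _ j l] in auto)
  qed
  then show ?thesis by (simp add: braid_other(1) \<delta>_idem_right \<delta>_diff left_diff_distrib)
qed

end

section \<open>The derivation is p-nilpotent\<close>

lemma webster_rep_proj: "webster_rep s n (proj s n)"
  by standard (use D_rels_subset in \<open>auto simp: proj_add proj_mult proj_eq_0_iff\<close>)

lemma dD_add: "dD s n (a + b) = dD s n a + dD s n b"
  and dD_mult: "dD s n (a * b) = dD s n a * b + a * dD s n b"
  and dD_scal: "dD s n (scal c a) = scal c (dD s n a)"
  and dD_diff: "dD s n (a - b) = dD s n a - dD s n b"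
  and dD_one: "dD s n 1 = 0"
  and dD_zero: "dD s n 0 = 0"
  by (simp_all only: dD_def der_add der_mult der_scal der_diff der_one der_zero)

lemma dD_ideal: "a \<in> D_ideal s n \<Longrightarrow> dD s n a \<in> (D_ideal s n :: 'k::field falg set)"
proof -
  interpret webster_rep s n "proj s n :: 'k falg \<Rightarrow> 'k dw" by (rule webster_rep_proj)
  have "D_ideal s n \<subseteq> {a :: 'k falg. proj s n a = 0 \<and> \<delta> a = 0}"
    by (rule D_ideal_minimal) (auto simp: h_rel \<delta>_rel h_zero \<delta>_zero h_add \<delta>_add h_mult \<delta>_mult)
  then show "a \<in> D_ideal s n \<Longrightarrow> dD s n a \<in> (D_ideal s n :: 'k::field falg set)"
    by (auto simp: \<delta>_def proj_eq_0_iff)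
qed

lemma dD_cong: "proj s n a = proj s n b \<Longrightarrow> proj s n (dD s n a) = proj s n (dD s n b)"
  using dD_ideal[of "a - b" s n] by (simp add: proj_eq_iff dD_diff)

lemma derivation_funpow_mult:
  fixes d :: "'r::ring_1 \<Rightarrow> 'r"
  assumes add: "\<And>a b. d (a + b) = d a + d b" and mult: "\<And>a b. d (a * b) = d a * b + a * d b"
  shows "(d ^^ n) (x * y) = (\<Sum>k\<le>n. of_nat (n choose k) * ((d ^^ k) x * (d ^^ (n - k)) y))"
proof (induction n)
  case (Suc n)
  have zero: "d 0 = 0" using add[of 0 0] by simp
  have of_nat: "d (of_nat c * z) = of_nat c * d z" for c z
    by (induction c) (simp_all add: zero add distrib_right)
  have sum: "d (\<Sum>k\<in>A. f k) = (\<Sum>k\<in>A. d (f k))" for A :: "nat set" and f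
    by (induction A rule: infinite_finite_induct) (simp_all add: zero add)
  define A where "A k = (d ^^ k) x * (d ^^ (Suc n - k)) y" for k
  have "(d ^^ Suc n) (x * y) = (\<Sum>k\<le>n. of_nat (n choose k) * (A (Suc k) + A k))"
    by (simp add: Suc.IH sum of_nat) (simp add: mult A_def Suc_diff_le)
  also have "\<dots> = (\<Sum>k\<le>n. of_nat (n choose k) * A (Suc k)) + (\<Sum>k\<le>n. of_nat (n choose k) * A k)"
    by (simp only: distrib_left sum.distrib)
  also have "(\<Sum>k\<le>n. of_nat (n choose k) * A k) = (\<Sum>k\<le>Suc n. of_nat (n choose k) * A k)"
    by (simp add: binomial_eq_0)
  also have "\<dots> = A 0 + (\<Sum>k\<le>n. of_nat (n choose Suc k) * A (Suc k))"
    by (subst sum.atMost_Suc_shift) simp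
  also have "(\<Sum>k\<le>n. of_nat (n choose k) * A (Suc k)) + (A 0 + (\<Sum>k\<le>n. of_nat (n choose Suc k) * A (Suc k)))
      = A 0 + (\<Sum>k\<le>n. of_nat (Suc n choose Suc k) * A (Suc k))"
    by (simp add: sum.distrib distrib_right)
  also have "\<dots> = (\<Sum>k\<le>Suc n. of_nat (Suc n choose k) * A k)"
    by (subst sum.atMost_Suc_shift) simp
  finally show ?case by (simp only: A_def)
qed simp

lemma of_nat_falg_eq_0: "CHAR('k::field) dvd m \<Longrightarrow> (of_nat m :: 'k falg) = 0"
proof -
  assume "CHAR('k) dvd m"
  then have "(of_nat m :: 'k) = 0" by (simp add: of_nat_eq_0_iff_char_dvd)
  then show ?thesis by (metis single_of_nat single_zero)
qed

lemma dD_pow_p_mult: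
  assumes "CHAR('k::field) = p" and "p > 0"
  shows "(dD s n ^^ p) (a * b) = (dD s n ^^ p) a * b + a * (dD s n ^^ p) (b :: 'k falg)"
proof -
  have "Factorial_Ring.prime p" using assms prime_CHAR_semidom[where 'a = 'k] by simp
  have "(dD s n ^^ p) (a * b)
      = (\<Sum>k\<le>p. of_nat (p choose k) * ((dD s n ^^ k) a * (dD s n ^^ (p - k)) b))"
    by (rule derivation_funpow_mult) (rule dD_add, rule dD_mult)
  also have "\<dots> = (\<Sum>k\<in>{0, p}. of_nat (p choose k) * ((dD s n ^^ k) a * (dD s n ^^ (p - k)) b))"
  proof (rule sum.mono_neutral_right)
    show "\<forall>k\<in>{..p} - {0, p}. of_nat (p choose k) * ((dD s n ^^ k) a * (dD s n ^^ (p - k)) b) = 0"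
    proof
      fix k assume "k \<in> {..p} - {0, p}"
      then have "p dvd (p choose k)"
        using \<open>Factorial_Ring.prime p\<close> by (intro dvd_choose_prime) auto
      with assms(1) of_nat_falg_eq_0[where 'k = 'k]
      show "of_nat (p choose k) * ((dD s n ^^ k) a * (dD s n ^^ (p - k)) b) = 0" by simp
    qed
  qed auto
  finally show ?thesis using assms(2) by (simp add: add.commute)
qed

lemma dvd_prod_shift: "p > 0 \<Longrightarrow> (p :: nat) dvd (\<Prod>t<p. a + t)"
proof -
  assume p: "p > 0"
  define t where "t = (p - a mod p) mod p"
  have "p dvd a + t"
  proof (cases "a mod p = 0")
    case False
    then have "a mod p < p" "t = p - a mod p" using p by (auto simp: t_def)
    then have "a mod p + t = p" by simp
    then have "(a + t) mod p = 0" by (metis mod_add_left_eq mod_self)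
    then show ?thesis by auto
  qed (auto simp: t_def)
  moreover have "a + t dvd (\<Prod>t<p. a + t)"
    by (rule dvd_prodI) (use p in \<open>auto simp: t_def\<close>)
  ultimately show ?thesis by (rule dvd_trans)
qed

function hc :: "nat \<Rightarrow> nat \<Rightarrow> 'k::field falg" where
  "hc j k = (if k = 0 then 1 else \<Sum>r<k. (-1) ^ r * (vE (r + 1) j * hc j (k - 1 - r)))"
  by auto
termination by (relation "measure snd") auto

declare hc.simps [simp del]

context webster_rep
begin

abbreviation "H j k \<equiv> h (hc j k)"

lemma H_0: "H j 0 = h 1"
  by (simp add: hc.simps)

lemma H_Suc: "H j (Suc k) = (\<Sum>r\<le>k. (-1) ^ r * (E (r + 1) j * H j (k - r)))"
  by (subst hc.simps) (simp add: h_sum h_sign lessThan_Suc_atMost, simp add: h_mult)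

lemma H_E: "H j k * E d j = E d j * H j k"
proof (induction k rule: less_induct)
  case (less k)
  show ?case
  proof (cases k)
    case (Suc m)
    have "E (r + 1) j * H j (m - r) * E d j = E d j * (E (r + 1) j * H j (m - r))" for r
      using less[of "m - r"] by (simp add: Suc mult.assoc E_left_commute)
    then have "(-1) ^ r * (E (r + 1) j * H j (m - r)) * E d j = E d j * ((-1) ^ r * (E (r + 1) j * H j (m - r)))" for r
      by (cases "even r") simp_all
    then show ?thesis
      by (simp only: Suc H_Suc sum_distrib_left sum_distrib_right)
  qed (simp add: H_0)
qed

lemma \<delta>_hc: "\<delta> (hc j k) = of_nat (k + 1) * H j (k + 1) - H j k * E 1 j"
proof (induction k rule: less_induct)
  case (less K)
  show ?case
  proof (cases K)
    case 0
    then show ?thesis using \<delta>_one H_Suc[of j 0] by (simp add: H_0 hc.simps)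
  next
    case (Suc k)
    define f where "f r = (-1) ^ r * (E (r + 1) j * H j (K - r))" for r
    define g where "g r = (-1) ^ r * (E (r + 1) j * H j (k - r))" for r
    have "\<delta> (hc j K) = (\<Sum>r\<le>k. (-1) ^ r * (\<delta> (vE (r + 1) j) * H j (k - r) + E (r + 1) j * \<delta> (hc j (k - r))))"
      by (subst hc.simps) (simp add: Suc \<delta>_sum \<delta>_sign lessThan_Suc_atMost, simp add: \<delta>_mult)
    also have "\<dots> = (\<Sum>r\<le>k. of_nat (K - r) * f r + of_nat (r + 2) * f (Suc r))"
    proof (rule sum.cong[OF refl])
      fix r assume "r \<in> {..k}"
      then have r: "r \<le> k" and K: "K - r = k - r + 1" "K - Suc r = k - r" by (auto simp: Suc)
      have IH: "\<delta> (hc j (k - r)) = of_nat (k - r + 1) * H j (k - r + 1) - H j (k - r) * E 1 j"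
        by (rule less) (simp add: Suc)
      have c: "E 1 j * H j (k - r) = H j (k - r) * E 1 j"
        by (rule H_E[symmetric])
      have "\<delta> (vE (r + 1) j) * H j (k - r) + E (r + 1) j * \<delta> (hc j (k - r))
          = of_nat (K - r) * (E (r + 1) j * H j (K - r)) - of_nat (r + 2) * (E (r + 2) j * H j (K - Suc r))"
        unfolding \<delta>_vE IH K
        by (simp only: left_diff_distrib right_diff_distrib mult.assoc c of_nat_left_commute[of _ "E _ _"])
          (simp add: add.commute)
      then have "(-1) ^ r * (\<delta> (vE (r + 1) j) * H j (k - r) + E (r + 1) j * \<delta> (hc j (k - r)))
          = (-1) ^ r * (of_nat (K - r) * (E (r + 1) j * H j (K - r)) - of_nat (r + 2) * (E (r + 2) j * H j (K - Suc r)))"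
        by simp
      also have "\<dots> = of_nat (K - r) * f r + of_nat (r + 2) * f (Suc r)"
        by (cases "even r") (simp_all add: f_def)
      finally show "(-1) ^ r * (\<delta> (vE (r + 1) j) * H j (k - r) + E (r + 1) j * \<delta> (hc j (k - r)))
          = of_nat (K - r) * f r + of_nat (r + 2) * f (Suc r)" .
    qed
    also have "\<dots> = (\<Sum>r\<le>K. of_nat (K - r) * f r) + (\<Sum>r\<le>k. of_nat (Suc r + 1) * f (Suc r))"
      by (simp add: sum.distrib Suc)
    also have "(\<Sum>r\<le>k. of_nat (Suc r + 1) * f (Suc r)) = (\<Sum>r\<le>K. of_nat (r + 1) * f r) - f 0"
      by (simp add: Suc sum.atMost_Suc_shift del: sum.atMost_Suc)
    also have "(\<Sum>r\<le>K. of_nat (K - r) * f r) + ((\<Sum>r\<le>K. of_nat (r + 1) * f r) - f 0)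
        = (\<Sum>r\<le>K. of_nat (K - r) * f r + of_nat (r + 1) * f r) - f 0"
      by (simp only: sum.distrib add_diff_eq)
    also have "(\<Sum>r\<le>K. of_nat (K - r) * f r + of_nat (r + 1) * f r) = (\<Sum>r\<le>K. of_nat (K + 1) * f r)"
      by (rule sum.cong) (auto simp: add.commute simp flip: distrib_right of_nat_add)
    also have "\<dots> = of_nat (K + 1) * H j (K + 1)"
      by (simp add: H_Suc f_def sum_distrib_left)
    finally show ?thesis by (simp add: f_def H_E)
  qed
qed

definition Gc :: "nat \<Rightarrow> nat \<Rightarrow> nat \<Rightarrow> 'k falg" where
  "Gc j d k = (\<Sum>r\<le>k. (-1) ^ r * (of_nat (d + r choose r) * (vE (d + r) j * hc j (k - r))))"

lemma \<delta>_of_nat: "\<delta> (of_nat c * a) = of_nat c * \<delta> a"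
  by (induction c) (auto simp: \<delta>_zero \<delta>_add distrib_right)

lemma \<delta>_Gc: "\<delta> (Gc j d k) = of_nat (1 + k) * h (Gc j d (Suc k))"
proof -
  define f where "f r = (-1) ^ r * (of_nat (d + r choose r) * (E (d + r) j * H j (Suc k - r)))" for r
  have "\<delta> (Gc j d k) = (\<Sum>r\<le>k. (-1) ^ r * (of_nat (d + r choose r)
      * (\<delta> (vE (d + r) j) * H j (k - r) + E (d + r) j * \<delta> (hc j (k - r)))))"
    by (simp only: Gc_def \<delta>_sum \<delta>_sign \<delta>_of_nat) (simp only: \<delta>_mult)
  also have "\<dots> = (\<Sum>r\<le>k. of_nat (Suc k - r) * f r + of_nat (Suc r) * f (Suc r))"
  proof (rule sum.cong[OF refl])
    fix r assume "r \<in> {..k}"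
    then have K: "Suc k - r = k - r + 1" by auto
    have c: "E 1 j * H j (k - r) = H j (k - r) * E 1 j"
      by (rule H_E[symmetric])
    have "\<delta> (vE (d + r) j) * H j (k - r) + E (d + r) j * \<delta> (hc j (k - r))
        = of_nat (Suc k - r) * (E (d + r) j * H j (Suc k - r)) - of_nat (d + r + 1) * (E (d + r + 1) j * H j (k - r))"
      unfolding \<delta>_vE \<delta>_hc K
      by (simp only: left_diff_distrib right_diff_distrib mult.assoc c of_nat_left_commute[of _ "E _ _"]) simp
    then have "of_nat (d + r choose r) * (\<delta> (vE (d + r) j) * H j (k - r) + E (d + r) j * \<delta> (hc j (k - r)))
        = of_nat (Suc k - r) * (of_nat (d + r choose r) * (E (d + r) j * H j (Suc k - r)))
          - of_nat (d + r choose r) * (of_nat (d + r + 1) * (E (d + r + 1) j * H j (k - r)))"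
      by (simp only: right_diff_distrib of_nat_left_commute[of "Suc k - r" "of_nat _"])
    also have "of_nat (d + r choose r) * (of_nat (d + r + 1) * (E (d + r + 1) j * H j (k - r)))
        = of_nat ((d + r choose r) * (d + r + 1)) * (E (d + r + 1) j * H j (k - r))"
      by (simp only: of_nat_mult mult.assoc)
    also have "(d + r choose r) * (d + r + 1) = Suc r * (d + Suc r choose Suc r)"
      using Suc_times_binomial[of r "d + r"] by (simp add: mult.commute)
    finally have *: "of_nat (d + r choose r) * (\<delta> (vE (d + r) j) * H j (k - r) + E (d + r) j * \<delta> (hc j (k - r)))
        = of_nat (Suc k - r) * (of_nat (d + r choose r) * (E (d + r) j * H j (Suc k - r)))
          - of_nat (Suc r) * (of_nat (d + Suc r choose Suc r) * (E (d + r + 1) j * H j (k - r)))"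
      by (simp only: of_nat_mult mult.assoc)
    show "(-1) ^ r * (of_nat (d + r choose r) * (\<delta> (vE (d + r) j) * H j (k - r) + E (d + r) j * \<delta> (hc j (k - r))))
        = of_nat (Suc k - r) * f r + of_nat (Suc r) * f (Suc r)"
      unfolding * by (cases "even r") (simp_all add: f_def del: of_nat_Suc binomial_Suc_Suc)
  qed
  also have "\<dots> = (\<Sum>r\<le>Suc k. of_nat (Suc k - r) * f r) + (\<Sum>r\<le>k. of_nat (Suc r) * f (Suc r))"
    by (simp add: sum.distrib)
  also have "(\<Sum>r\<le>k. of_nat (Suc r) * f (Suc r)) = (\<Sum>r\<le>Suc k. of_nat r * f r)"
    by (simp add: sum.atMost_Suc_shift del: sum.atMost_Suc)
  also have "(\<Sum>r\<le>Suc k. of_nat (Suc k - r) * f r) + (\<Sum>r\<le>Suc k. of_nat r * f r)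
      = (\<Sum>r\<le>Suc k. of_nat (1 + k) * f r)"
    unfolding sum.distrib[symmetric]
    by (rule sum.cong) (auto simp: add.commute simp flip: distrib_right of_nat_add)
  also have "\<dots> = of_nat (1 + k) * h (Gc j d (Suc k))"
    by (simp only: Gc_def f_def sum_distrib_left h_sum h_sign h_of_nat h_mult[of "vE _ _"])
  finally show ?thesis .
qed

lemma \<delta>_vx_pow_Suc: "\<delta> (vx j ^ Suc k) = of_nat (1 + k) * h (vx j ^ Suc (Suc k))"
proof (induction k)
  case 0
  show ?case by (simp add: \<delta>_vx h_mult \<delta>_one)
next
  case (Suc k)
  have "\<delta> (vx j ^ Suc (Suc k)) = Y j * Y j * h (vx j ^ Suc k) + Y j * \<delta> (vx j ^ Suc k)"
    by (simp add: \<delta>_mult \<delta>_vx)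
  also have "Y j * \<delta> (vx j ^ Suc k) = of_nat (1 + k) * h (vx j ^ Suc (Suc (Suc k)))"
    unfolding Suc.IH of_nat_pull by (simp only: power_Suc h_mult)
  also have "Y j * Y j * h (vx j ^ Suc k) = h (vx j ^ Suc (Suc (Suc k)))"
    by (simp add: h_mult mult.assoc)
  finally show ?case by (simp add: distrib_right)
qed

text \<open>
  On each generator the iterates of \<open>dD\<close> form a chain \<open>c 0, c 1, \<dots>\<close> with
  \<open>\<partial> (c k) = (a + k) c (k + 1)\<close>; then the \<open>p\<close>-th iterate carries the coefficient
  \<open>a (a + 1) \<dots> (a + p - 1)\<close>, which is divisible by \<open>p\<close>.
\<close>

lemma psi_chain:
  assumes i: "i \<in> Seq s n" and j: "1 \<le> j" "j + 1 \<le> length s + n"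
  shows "\<exists>a c. h (c 0) = h (psi j * idem i) \<and> (\<forall>k. \<delta> (c k) = of_nat (a + k) * h (c (Suc k)))"
proof (cases rule: entry_pair_cases[of i j])
  case bb
  note dP = \<delta>_psi_bb[OF _ bb]
  define c :: "nat \<Rightarrow> 'k falg" where "c k = (if k = 0 then psi j * idem i
      else if k = 1 then (- (vx j * psi j) - psi j * vx (j + 1)) * idem i
      else if k = 2 then vx j * psi j * vx (j + 1) * idem i else 0)" for k :: nat
  have "\<delta> (c 0) = h (c 1)"
    by (simp add: c_def \<delta>_idem_right dP[OF e_V] h_simps left_diff_distrib mult.assoc)
  moreover have "\<delta> (c 1) = 2 * h (c 2)"
    by (simp add: c_def \<delta>_idem_right \<delta>_diff \<delta>_uminus \<delta>_mult \<delta>_vx h_simps left_diff_distrib distrib_right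
        mult.assoc dP[OF e_V] dP[OF X_V[OF e_V]] right_diff_distrib distrib_left
        \<delta>_idem mult_2)
  moreover have "\<delta> (c 2) = 0"
    by (simp add: c_def \<delta>_idem_right \<delta>_mult \<delta>_vx h_simps distrib_right mult.assoc
        dP[OF X_V[OF e_V]] right_diff_distrib distrib_left \<delta>_idem)
  moreover have "\<delta> (c k) = 0 \<and> h (c k) = 0" if "k \<ge> 3" for k
    using that by (simp add: c_def \<delta>_zero h_zero)
  ultimately have "\<delta> (c k) = of_nat (1 + k) * h (c (Suc k))" for k
    by (cases "k = 0 \<or> k = 1 \<or> k = 2") (auto simp: numeral_2_eq_2)
  then show ?thesis by (intro exI[of _ 1] exI[of _ c]) (simp add: c_def)
next
  case (rb a)
  define c :: "nat \<Rightarrow> 'k falg" where "c k = psi j * vx (j + 1) ^ k * idem i" for k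
  have "\<delta> (c k) = of_nat (a + k) * h (c (Suc k))" for k
  proof -
    have "\<delta> (c k) = \<delta> (psi j) * (Y (j + 1) ^ k * e i) + P j * (of_nat k * (Y (j + 1) ^ (k + 1) * e i))"
      by (simp add: c_def \<delta>_idem_right \<delta>_mult distrib_right mult.assoc h_X_pow[OF e_V] \<delta>_vx_pow[OF e_V]
          h_mult \<delta>_idem del: power_Suc)
    also have "\<dots> = of_nat (a + k) * (P j * (Y (j + 1) ^ Suc k * e i))"
      using \<delta>_psi_rb[OF X_pow_V[OF e_V] rb, of "j + 1" k]
      by (simp add: of_nat_pull distrib_right mult.assoc)
    also have "\<dots> = of_nat (a + k) * h (c (Suc k))"
      by (simp only: c_def h_mult mult.assoc h_X_pow[OF e_V])
    finally show ?thesis .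
  qed
  then show ?thesis by (intro exI[of _ a] exI[of _ c]) (simp add: c_def)
next
  case (br a)
  define c :: "nat \<Rightarrow> 'k falg" where "c k = psi j * hc (j + 1) k * idem i" for k
  have HV: "H (j + 1) k * e i \<in> V i" for k
  proof (induction k rule: less_induct)
    case (less k)
    show ?case
    proof (cases k)
      case (Suc m)
      have "(-1) ^ r * (E (r + 1) (j + 1) * (H (j + 1) (m - r) * e i)) \<in> V i" for r
        using E_V[OF less[of "m - r"], of "r + 1" "j + 1"] V_uminus
        by (cases "even r") (auto simp: Suc)
      then show ?thesis
        by (simp only: Suc H_Suc sum_distrib_right mult.assoc) (rule V_sum)
    qed (simp add: H_0 e_V)
  qed
  have "\<delta> (c k) = of_nat (1 + k) * h (c (Suc k))" for k
  proof -
    have "\<delta> (c k) = \<delta> (psi j) * (H (j + 1) k * e i) + P j * (\<delta> (hc (j + 1) k) * e i)"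
      by (simp add: c_def \<delta>_idem_right \<delta>_mult \<delta>_idem h_mult distrib_right mult.assoc)
    also have "\<dots> = P j * (of_nat (1 + k) * (H (j + 1) (Suc k) * e i))"
      using \<delta>_psi_br[OF HV br, of k]
      by (simp add: \<delta>_hc left_diff_distrib H_E mult.assoc flip: distrib_left)
    also have "\<dots> = of_nat (1 + k) * h (c (Suc k))"
      by (simp only: c_def h_mult mult.assoc of_nat_pull)
    finally show ?thesis .
  qed
  then show ?thesis by (intro exI[of _ 1] exI[of _ c]) (simp add: c_def hc.simps)
next
  case (rr a b)
  then have "h (psi j * idem i) = 0"
    using P_red_red[OF e_V] by (simp add: h_mult)
  then show ?thesis by (intro exI[of _ 0] exI[of _ "\<lambda>_. 0"]) (simp add: \<delta>_zero h_zero)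
qed

end

lemma dD_pow_ideal: "a \<in> D_ideal s n \<Longrightarrow> (dD s n ^^ k) a \<in> D_ideal s n"
  by (induction k) (auto intro: dD_ideal)

lemma dD_pow_zero: "(dD s n ^^ k) 0 = 0"
  by (induction k) (auto simp: dD_zero)

lemma dD_pow_add: "(dD s n ^^ k) (a + b) = (dD s n ^^ k) a + (dD s n ^^ k) b"
  by (induction k) (auto simp: dD_add)

lemma dD_pow_scal: "(dD s n ^^ k) (scal c a) = scal c ((dD s n ^^ k) a)"
  by (induction k) (auto simp: dD_scal)

lemma dD_idem: "dD s n (idem i) = 0"
  by (simp add: dD_def idem_def der_letter dgen_def)

lemma dD_pow_p_ideal:
  assumes p: "CHAR('k::field) = p" "p > 0"
  shows "(dD s n ^^ p) a \<in> (D_ideal s n :: 'k falg set)"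
proof -
  interpret webster_rep s n "proj s n :: 'k falg \<Rightarrow> 'k dw" by (rule webster_rep_proj)
  let ?dp = "dD s n ^^ p :: 'k falg \<Rightarrow> 'k falg"
  have chain: "proj s n (?dp b) = 0"
    if b: "proj s n (c 0) = proj s n b" and c: "\<And>k. \<delta> (c k) = of_nat (a + k) * proj s n (c (Suc k))"
    for a b c
  proof -
    have "proj s n ((dD s n ^^ k) b) = of_nat (\<Prod>t<k. a + t) * proj s n (c k)" for k
    proof (induction k)
      case (Suc k)
      have "proj s n ((dD s n ^^ k) b) = proj s n (of_nat (\<Prod>t<k. a + t) * c k)"
        by (simp only: Suc.IH h_of_nat)
      from dD_cong[OF this] have "proj s n ((dD s n ^^ Suc k) b) = \<delta> (of_nat (\<Prod>t<k. a + t) * c k)"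
        by (simp add: \<delta>_def)
      also have "\<dots> = of_nat (\<Prod>t<Suc k. a + t) * proj s n (c (Suc k))"
        by (simp only: \<delta>_of_nat c prod.lessThan_Suc of_nat_mult mult.assoc)
      finally show ?case .
    qed (simp add: b)
    then have "proj s n (?dp b) = proj s n (of_nat (\<Prod>t<p. a + t) * c p)"
      by (simp only: h_of_nat)
    also have "(of_nat (\<Prod>t<p. a + t) :: 'k falg) = 0"
      using of_nat_falg_eq_0[where 'k = 'k] dvd_prod_shift[OF p(2)] p(1) by blast
    finally show ?thesis by (simp add: h_zero)
  qed
  have mult: "?dp (a * b) = ?dp a * b + a * ?dp b" for a b
    by (rule dD_pow_p_mult[OF p])
  have idem: "?dp (idem i) = 0" for i
    using p(2) dD_pow_zero[of "p - 1" s n] by (cases p) (auto simp: dD_idem funpow_swap1 simp del: funpow.simps(2) simp add: funpow_Suc_right)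
  have gen: "?dp (letter g) \<in> D_ideal s n" for g
  proof (cases "is_gen s n g")
    case False
    then have "letter g \<in> (D_ideal s n :: 'k falg set)"
      using D_rels.no_gen D_rels_subset by blast
    then show ?thesis by (rule dD_pow_ideal)
  next
    case True
    show ?thesis
    proof (cases g)
      case (GI i)
      then show ?thesis using idem[of i] by (simp add: idem_def D_ideal_zero)
    next
      case (GX j)
      have "proj s n (?dp (vx j)) = 0"
        by (rule chain[where c = "\<lambda>k. vx j ^ Suc k" and a = 1]) (simp, rule \<delta>_vx_pow_Suc)
      then show ?thesis by (simp add: GX vx_def proj_eq_0_iff)
    next
      case (GE d j)
      have "proj s n (?dp (vE d j)) = 0"
        by (rule chain[where c = "Gc j d" and a = 1]) (simp add: Gc_def hc.simps, rule \<delta>_Gc)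
      then show ?thesis using True by (simp add: GE vE_def proj_eq_0_iff is_gen_def split: if_splits)
    next
      case (GPsi j)
      have "proj s n (?dp (psi j)) = 0"
      proof (rule h_eq_0I)
        fix i assume i: "i \<in> Seq s n"
        have "?dp (psi j * idem i) = ?dp (psi j) * idem i" by (simp add: mult idem)
        moreover have "proj s n (?dp (psi j * idem i)) = 0"
          using psi_chain[OF i, of j] True chain by (auto simp: GPsi is_gen_def)
        ultimately show "proj s n (?dp (psi j)) * proj s n (idem i) = 0" by (simp flip: h_mult)
      qed
      then show ?thesis by (simp add: GPsi psi_def proj_eq_0_iff)
    qed
  qed
  have dp_one: "?dp 1 = 0"
    using p(2) dD_pow_zero[of "p - 1" s n] by (cases p) (auto simp: dD_one simp del: funpow.simps(2) simp add: funpow_Suc_right)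
  show ?thesis
  proof (induction a rule: falg_induct)
    case (add a b)
    then show ?case by (simp add: dD_pow_add D_ideal_add)
  next
    case (scal c a)
    then show ?case
      unfolding dD_pow_scal by (simp only: scal_conv D_ideal_mult_left)
  next
    case one
    then show ?case by (simp add: dp_one D_ideal_zero)
  next
    case (letter g a)
    then show ?case by (simp add: mult D_ideal_add D_ideal_mult_left D_ideal_mult_right gen)
  qed
qed

section \<open>The grading\<close>

definition psi_deg :: "nat \<Rightarrow> entry list \<Rightarrow> int" where
  "psi_deg j i = (case (ent i j, ent i (j + 1)) of
      (Black, Black) \<Rightarrow> - 2
    | (Red a, Black) \<Rightarrow> int a
    | (Black, Red a) \<Rightarrow> int a
    | (Red a, Red b) \<Rightarrow> 0)"

text \<open>
  \<open>grading s n\<close> is the coaction of the grading: it multiplies a homogeneous element of degree \<open>k\<close>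
  by \<open>q^k\<close>, where the Laurent polynomials in \<open>q\<close> are the finitely supported functions on
  \<^typ>\<open>int\<close>.
\<close>

definition grading_gen :: "nat list \<Rightarrow> nat \<Rightarrow> gen \<Rightarrow> int \<Rightarrow>\<^sub>0 'k::field dw" where
  "grading_gen s n g = (case g of
      GI i \<Rightarrow> Poly_Mapping.single 0 (proj s n (letter g))
    | GX j \<Rightarrow> Poly_Mapping.single 2 (proj s n (letter g))
    | GE d j \<Rightarrow> Poly_Mapping.single (2 * int d) (proj s n (letter g))
    | GPsi j \<Rightarrow> \<Sum>i\<in>Seq s n. Poly_Mapping.single (psi_deg j i) (proj s n (letter g * idem i)))"

definition grading :: "nat list \<Rightarrow> nat \<Rightarrow> 'k::field falg \<Rightarrow> int \<Rightarrow>\<^sub>0 'k dw" where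
  "grading s n = hom_ext (\<lambda>c. Poly_Mapping.single 0 (dw_scal c)) (Poly_Mapping.single 0 (proj s n 1)) (grading_gen s n)"

lemma scalar_hom_dw_scal: "scalar_hom dw_scal"
proof
  fix a :: "'k::field" and q :: "'k dw"
  show "dw_scal a * q = q * dw_scal a"
    by transfer (rule dw_relI, rule scalar_hom.central[OF scalar_hom_single])
qed (transfer; rule dw_relI; simp add: single_add mult_single)+

lemma scalar_hom_grading:
  "scalar_hom (\<lambda>c :: 'k::field. Poly_Mapping.single 0 (dw_scal c) :: int \<Rightarrow>\<^sub>0 'k dw)"
proof -
  interpret scalar_hom "dw_scal :: 'k \<Rightarrow> 'k dw" by (rule scalar_hom_dw_scal)
  show ?thesis
  proof
    show "Poly_Mapping.single 0 (dw_scal a) * q = q * Poly_Mapping.single 0 (dw_scal a)"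
      for a and q :: "int \<Rightarrow>\<^sub>0 'k dw"
      by (rule single_zero_central) (rule central)
  qed (simp_all add: one add mult single_add mult_single)
qed

lemma corner_hom_grading:
  "corner_hom (\<lambda>c :: 'k::field. Poly_Mapping.single 0 (dw_scal c)) (Poly_Mapping.single 0 (proj s n 1))
    (grading_gen s n :: gen \<Rightarrow> int \<Rightarrow>\<^sub>0 'k dw)"
proof -
  interpret webster_rep s n "proj s n :: 'k falg \<Rightarrow> 'k dw" by (rule webster_rep_proj)
  show ?thesis
    by (rule corner_hom.intro[OF scalar_hom_grading], standard)
      (auto simp: mult_single grading_gen_def sum_distrib_left sum_distrib_right split: gen.splits)
qed

lemma poly_mapping_sum_single: "Poly_Mapping.single k (sum f A) = (\<Sum>x\<in>A. Poly_Mapping.single k (f x :: 'a::comm_monoid_add))"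
  by (induction A rule: infinite_finite_induct) (auto simp: single_add)

context
  fixes s :: "nat list" and n :: nat and K :: "'k::field itself"
begin

interpretation webster_rep s n "proj s n :: 'k falg \<Rightarrow> 'k dw" by (rule webster_rep_proj)

interpretation gr: corner_hom "\<lambda>c :: 'k. Poly_Mapping.single 0 (dw_scal c)" "Poly_Mapping.single 0 (proj s n 1)"
    "grading_gen s n :: gen \<Rightarrow> int \<Rightarrow>\<^sub>0 'k dw"
  by (rule corner_hom_grading)

lemma grading_add: "grading s n (a + b) = grading s n a + grading s n b"
  and grading_mult: "grading s n (a * b) = grading s n a * grading s n b"
  and grading_letter: "grading s n (letter g :: 'k falg) = grading_gen s n g"
  and grading_one: "grading s n (1 :: 'k falg) = Poly_Mapping.single 0 (proj s n 1)"
  and grading_scal: "grading s n (scal c a) = Poly_Mapping.single 0 (dw_scal c) * grading s n a"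
  for a b :: "'k falg"
  by (simp_all only: grading_def gr.hom_ext_add gr.hom_ext_mult gr.hom_ext_letter gr.hom_ext_one gr.hom_ext_scal)

lemma grading_zero: "grading s n (0 :: 'k falg) = 0"
  using grading_add[of 0 0] by simp

lemma grading_uminus: "grading s n (- a) = - grading s n (a :: 'k falg)"
  using grading_add[of a "- a"] by (simp add: grading_zero minus_unique)

lemma grading_diff: "grading s n (a - b) = grading s n a - grading s n (b :: 'k falg)"
  using grading_add[of a "- b"] by (simp add: grading_uminus)

lemma grading_sum: "grading s n (sum f A) = (\<Sum>x\<in>A. grading s n (f x :: 'k falg))"
  by (induction A rule: infinite_finite_induct) (auto simp: grading_zero grading_add)

definition hom_on :: "entry list \<Rightarrow> int \<Rightarrow> 'k falg \<Rightarrow> bool" where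
  "hom_on i k a \<longleftrightarrow> grading s n a * Poly_Mapping.single 0 (e i) = Poly_Mapping.single k (proj s n a * e i)"

definition hom_to :: "entry list \<Rightarrow> int \<Rightarrow> entry list \<Rightarrow> 'k falg \<Rightarrow> bool" where
  "hom_to i k i' a \<longleftrightarrow> hom_on i k a \<and> proj s n a * e i \<in> V i'"

lemma hom_toD: "hom_to i k i' a \<Longrightarrow> hom_on i k a"
  by (simp add: hom_to_def)

lemma hom_on_mult:
  assumes "hom_to i k i' a" and "hom_on i' l b" and "m = k + l"
  shows "hom_on i m (b * a)"
proof -
  have v: "e i' * (proj s n a * e i) = proj s n a * e i"
    using assms(1) by (auto simp: hom_to_def dest: VD)
  have "grading s n (b * a) * Poly_Mapping.single 0 (e i) = grading s n b * Poly_Mapping.single k (e i' * (proj s n a * e i))"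
    using assms(1) by (simp add: grading_mult mult.assoc hom_to_def hom_on_def v)
  also have "\<dots> = (grading s n b * Poly_Mapping.single 0 (e i')) * Poly_Mapping.single k (proj s n a * e i)"
    by (simp add: mult_single mult.assoc)
  also have "\<dots> = Poly_Mapping.single m (proj s n (b * a) * e i)"
    using assms(2,3) by (simp add: hom_on_def mult_single h_mult mult.assoc v add.commute)
  finally show ?thesis by (simp add: hom_on_def)
qed

lemma hom_to_mult: "hom_to i k i' a \<Longrightarrow> hom_to i' l i'' b \<Longrightarrow> m = k + l \<Longrightarrow> hom_to i m i'' (b * a)"
proof -
  assume a: "hom_to i k i' a" and b: "hom_to i' l i'' b" and m: "m = k + l"
  have v: "e i' * (proj s n a * e i) = proj s n a * e i"
    using a by (auto simp: hom_to_def dest: VD)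
  have "proj s n b * e i' * (proj s n a * e i) \<in> V i''"
    by (rule V_mult_right) (use b in \<open>simp add: hom_to_def\<close>)
  moreover have "proj s n b * e i' * (proj s n a * e i) = proj s n (b * a) * e i"
    by (simp only: mult.assoc v h_mult)
  moreover have "hom_on i m (b * a)"
    by (rule hom_on_mult[OF a hom_toD[OF b] m])
  ultimately show ?thesis by (simp add: hom_to_def)
qed

lemma hom_on_add: "hom_on i k a \<Longrightarrow> hom_on i k b \<Longrightarrow> hom_on i k (a + b)"
  and hom_on_diff: "hom_on i k a \<Longrightarrow> hom_on i k b \<Longrightarrow> hom_on i k (a - b)"
  and hom_on_uminus: "hom_on i k a \<Longrightarrow> hom_on i k (- a)"
  and hom_on_zero: "hom_on i k 0"
  by (auto simp: hom_on_def grading_add grading_diff grading_uminus grading_zero h_simps distrib_right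
      left_diff_distrib single_add single_diff single_uminus)

lemma hom_on_sum: "(\<And>x. x \<in> A \<Longrightarrow> hom_on i k (f x)) \<Longrightarrow> hom_on i k (sum f A)"
  by (induction A rule: infinite_finite_induct) (auto simp: hom_on_zero hom_on_add)

lemma hom_on_sign: "hom_on i k a \<Longrightarrow> hom_on i k ((-1) ^ d * a)"
  by (cases "even d") (auto simp: hom_on_uminus)

lemma grading_idem: "grading s n (idem i) = Poly_Mapping.single 0 (e i)"
  by (simp add: idem_def grading_letter grading_gen_def)

lemma hom_on_idem: "(i' = i \<Longrightarrow> k = 0) \<Longrightarrow> hom_on i' k (idem i)"
  by (auto simp: hom_on_def grading_idem mult_single e_e)

lemma hom_on_idem_right: "(i' = i \<Longrightarrow> hom_on i k a) \<Longrightarrow> hom_on i' k (a * idem i)"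
  by (auto simp: hom_on_def grading_idem grading_mult mult_single e_e h_mult mult.assoc)

lemma hom_to_vx: "hom_to i 2 i (vx j)"
  using X_V[OF e_V] by (simp add: hom_to_def hom_on_def vx_def grading_letter grading_gen_def mult_single)

lemma hom_to_one: "hom_to i 0 i 1"
  using e_V by (simp add: hom_to_def hom_on_def grading_one mult_single)

lemma hom_to_vE: "hom_to i (2 * int d) i (vE d j)"
  using E_V[OF e_V, of d j i] hom_to_one[of i]
  by (cases "d = 0")
    (auto simp: vE_def hom_to_def hom_on_def grading_letter grading_gen_def mult_single)

lemma hom_to_vx_pow: "hom_to i (2 * int k) i (vx j ^ k)"
proof (induction k)
  case (Suc k)
  then show ?case unfolding power_Suc by (rule hom_to_mult[OF _ hom_to_vx]) simp
qed (simp add: hom_to_one)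

lemma hom_to_psi: "hom_to i (psi_deg j i) (swap_entries j i) (psi j)"
proof (cases "i \<in> Seq s n")
  case True
  have "grading s n (psi j) * Poly_Mapping.single 0 (e i)
      = (\<Sum>i'\<in>Seq s n. if i' = i then Poly_Mapping.single (psi_deg j i) (P j * e i) else 0)"
    by (auto simp: psi_def grading_letter grading_gen_def sum_distrib_right mult_single h_mult mult.assoc e_e
        intro!: sum.cong)
  also have "\<dots> = Poly_Mapping.single (psi_deg j i) (P j * e i)"
    using True by (simp add: finite_Seq)
  finally show ?thesis by (simp add: hom_to_def hom_on_def P_V e_V)
next
  case False
  then show ?thesis by (simp add: hom_to_def hom_on_def e_notin V_zero)
qed

lemmas hom_on_gens = hom_to_vx[THEN hom_toD] hom_to_vE[THEN hom_toD] hom_to_vx_pow[THEN hom_toD] hom_to_psi[THEN hom_toD]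
lemma grading_eq_0I:
  assumes "\<And>i. i \<in> Seq s n \<Longrightarrow> \<exists>k. hom_on i k a" and "proj s n a = 0"
  shows "grading s n a = 0"
proof -
  have z: "grading s n a * Poly_Mapping.single 0 (e i) = 0" if "i \<in> Seq s n" for i
    using assms(1)[OF that] assms(2) by (auto simp: hom_on_def)
  have "grading s n a = grading s n a * grading s n 1"
    by (simp flip: grading_mult)
  also have "\<dots> = 0"
    by (simp add: grading_one unit poly_mapping_sum_single sum_distrib_left z)
  finally show ?thesis .
qed

lemma psi_deg_swap: "1 \<le> j \<Longrightarrow> j < length i \<Longrightarrow> psi_deg j (swap_entries j i) = psi_deg j i"
  by (auto simp: psi_deg_def ent_swap split: entry.splits)

lemma hom_on_rel:
  assumes r: "r \<in> D_rels s n" and i': "i' \<in> Seq s n"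
  shows "\<exists>k. hom_on i' k r"
  using r
proof cases
  case (no_gen g)
  from no_gen(2) have "proj s n (letter g :: 'k falg) = 0"
    by (rule webster_rep.no_gen[OF webster_rep_proj])
  then have "grading s n r = 0" "proj s n r = 0"
    unfolding no_gen(1) by (auto simp: grading_letter grading_gen_def h_mult split: gen.splits)
  then show ?thesis by (simp add: hom_on_def)
next
  case unit
  have "hom_on i' 0 r"
    unfolding unit by (intro hom_on_diff hom_on_sum hom_on_idem hom_toD[OF hom_to_one] refl)
  then show ?thesis ..
next
  case (idem_idem i j)
  have "hom_on i' 0 (idem i * idem j)" by (rule hom_on_idem_right, rule hom_on_idem) simp
  moreover have "hom_on i' 0 (if i = j then idem i else 0)" by (auto intro: hom_on_idem hom_on_zero)
  ultimately have "hom_on i' 0 r" unfolding idem_idem by (rule hom_on_diff)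
  then show ?thesis ..
next
  case (E_idem i d j)
  have "hom_on i' (2 * int d) r"
    unfolding E_idem
    by (intro hom_on_diff hom_on_idem_right hom_on_gens)
      (rule hom_on_mult[OF hom_to_vE hom_on_idem], auto)
  then show ?thesis ..
next
  case (x_idem i j)
  have "hom_on i' 2 r"
    unfolding x_idem
    by (intro hom_on_diff hom_on_idem_right hom_on_gens)
      (rule hom_on_mult[OF hom_to_vx hom_on_idem], auto)
  then show ?thesis ..
next
  case (psi_idem i j)
  have "hom_on i' (psi_deg j i') (psi j * idem i)"
    by (rule hom_on_idem_right) (auto intro: hom_on_gens)
  moreover have "hom_on i' (psi_deg j i') (idem (swap_entries j i) * psi j)"
    by (rule hom_on_mult[OF hom_to_psi hom_on_idem]) auto
  ultimately show ?thesis unfolding psi_idem(1) by (blast intro: hom_on_diff)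
next
  case (E_black i d j)
  then show ?thesis by (auto intro: hom_on_idem_right hom_on_gens)
next
  case (E_large i d j a)
  then show ?thesis by (auto intro: hom_on_idem_right hom_on_gens)
next
  case (x_red i j a)
  then show ?thesis by (auto intro: hom_on_idem_right hom_on_gens)
next
  case (psi_red_red i j a b)
  then show ?thesis by (auto intro: hom_on_idem_right hom_on_gens)
next
  case (x_x j l)
  have "hom_on i' 4 r"
    unfolding x_x by (intro hom_on_diff; rule hom_on_mult[OF hom_to_vx hom_on_gens(1)]) auto
  then show ?thesis ..
next
  case (E_x d j l)
  have "hom_on i' (2 * int d + 2) r"
    unfolding E_x
    by (intro hom_on_diff) (rule hom_on_mult[OF hom_to_vx hom_on_gens(2)], simp,
        rule hom_on_mult[OF hom_to_vE hom_on_gens(1)], simp)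
  then show ?thesis ..
next
  case (E_E d j d' l)
  have "hom_on i' (2 * int d + 2 * int d') r"
    unfolding E_E by (intro hom_on_diff; rule hom_on_mult[OF hom_to_vE hom_on_gens(2)]) auto
  then show ?thesis ..
next
  case (psi_x_far j l)
  have "hom_on i' (psi_deg j i' + 2) r"
    unfolding psi_x_far(1)
    by (intro hom_on_diff) (rule hom_on_mult[OF hom_to_vx hom_on_gens(4)], simp,
        rule hom_on_mult[OF hom_to_psi hom_on_gens(1)], simp)
  then show ?thesis ..
next
  case (psi_E_far j d l)
  have "hom_on i' (psi_deg j i' + 2 * int d) r"
    unfolding psi_E_far(1)
    by (intro hom_on_diff) (rule hom_on_mult[OF hom_to_vE hom_on_gens(4)], simp,
        rule hom_on_mult[OF hom_to_psi hom_on_gens(2)], simp)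
  then show ?thesis ..
next
  case (psi_E j d)
  have "hom_on i' (psi_deg j i' + 2 * int d) r"
    unfolding psi_E(1)
    by (intro hom_on_diff) (rule hom_on_mult[OF hom_to_vE hom_on_gens(4)], simp,
        rule hom_on_mult[OF hom_to_psi hom_on_gens(2)], simp)
  then show ?thesis ..
next
  case (E_psi j d)
  have "hom_on i' (psi_deg j i' + 2 * int d) r"
    unfolding E_psi(1)
    by (intro hom_on_diff) (rule hom_on_mult[OF hom_to_psi hom_on_gens(2)], simp,
        rule hom_on_mult[OF hom_to_vE hom_on_gens(4)], simp)
  then show ?thesis ..
next
  case (psi_psi_far j l)
  have *: "psi_deg j (swap_entries l i') = psi_deg j i'" "psi_deg l (swap_entries j i') = psi_deg l i'"
  proof -
    have "1 \<le> j" "1 \<le> l" using psi_psi_far by (auto simp: is_gen_def)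
    then have "ent (swap_entries l i') j = ent i' j" "ent (swap_entries l i') (j + 1) = ent i' (j + 1)"
      "ent (swap_entries j i') l = ent i' l" "ent (swap_entries j i') (l + 1) = ent i' (l + 1)"
      using psi_psi_far(4) by (intro ent_swap_other; linarith)+
    then show "psi_deg j (swap_entries l i') = psi_deg j i'" "psi_deg l (swap_entries j i') = psi_deg l i'"
      by (simp_all only: psi_deg_def)
  qed
  have "hom_on i' (psi_deg j i' + psi_deg l i') r"
    unfolding psi_psi_far(1)
    by (intro hom_on_diff; rule hom_on_mult[OF hom_to_psi hom_on_gens(4)]) (simp_all add: *)
  then show ?thesis ..
next
  case (x_psi_black_black i j)
  have deg: "psi_deg j i = - 2" using x_psi_black_black by (simp add: psi_deg_def)
  have "hom_on i' 0 r"
    unfolding x_psi_black_black(1) mult.assoc[symmetric]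
    by (intro hom_on_diff hom_on_idem_right hom_on_idem refl)
      (rule hom_on_mult[OF hom_to_psi hom_on_gens(1)] hom_on_mult[OF hom_to_vx hom_on_gens(4)],
        simp add: deg)+
  then show ?thesis ..
next
  case (x_psi_red_black i j a)
  have deg: "psi_deg j i = int a" using x_psi_red_black by (simp add: psi_deg_def)
  have "hom_on i' (int a + 2) r"
    unfolding x_psi_red_black(1)
    by (intro hom_on_diff hom_on_idem_right)
      (rule hom_on_mult[OF hom_to_psi hom_on_gens(1)] hom_on_mult[OF hom_to_vx hom_on_gens(4)],
        simp add: deg)+
  then show ?thesis ..
next
  case (psi_x_black_black i j)
  have deg: "psi_deg j i = - 2" using psi_x_black_black by (simp add: psi_deg_def)
  have "hom_on i' 0 r"
    unfolding psi_x_black_black(1)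
    by (intro hom_on_diff hom_on_idem_right hom_on_idem refl)
      (rule hom_on_mult[OF hom_to_psi hom_on_gens(1)] hom_on_mult[OF hom_to_vx hom_on_gens(4)],
        simp add: deg)+
  then show ?thesis ..
next
  case (psi_x_black_red i j a)
  have deg: "psi_deg j i = int a" using psi_x_black_red by (simp add: psi_deg_def)
  have "hom_on i' (int a + 2) r"
    unfolding psi_x_black_red(1)
    by (intro hom_on_diff hom_on_idem_right)
      (rule hom_on_mult[OF hom_to_psi hom_on_gens(1)] hom_on_mult[OF hom_to_vx hom_on_gens(4)],
        simp add: deg)+
  then show ?thesis ..
next
  case (psi_square_black_black i j)
  show ?thesis
    unfolding psi_square_black_black(1) power2_eq_square
    by (rule exI, rule hom_on_idem_right, rule hom_on_mult[OF hom_to_psi hom_on_gens(4) refl])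
next
  case (psi_square_red_black i j a)
  have "psi_deg j i = int a" "psi_deg j (swap_entries j i) = int a"
    using psi_square_red_black length_Seq[of i s n] psi_deg_swap[of j i] by (auto simp: psi_deg_def is_gen_def)
  then have "hom_on i' (2 * int a) (psi j ^ 2 * idem i)"
    unfolding power2_eq_square
    by (intro hom_on_idem_right) (rule hom_on_mult[OF hom_to_psi hom_on_gens(4)], simp)
  moreover have "hom_on i' (2 * int a) (\<Sum>d = 0..a. (-1) ^ d * vE d j * vx (j + 1) ^ (a - d) * idem i)"
    by (intro hom_on_sum hom_on_idem_right, simp only: mult.assoc, rule hom_on_sign)
      (rule hom_on_mult[OF hom_to_vx_pow hom_on_gens(2)], simp)
  ultimately show ?thesis unfolding psi_square_red_black(1) by (blast intro: hom_on_diff)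
next
  case (psi_square_black_red i j a)
  have "psi_deg j i = int a" "psi_deg j (swap_entries j i) = int a"
    using psi_square_black_red length_Seq[of i s n] psi_deg_swap[of j i] by (auto simp: psi_deg_def is_gen_def)
  then have "hom_on i' (2 * int a) (psi j ^ 2 * idem i)"
    unfolding power2_eq_square
    by (intro hom_on_idem_right) (rule hom_on_mult[OF hom_to_psi hom_on_gens(4)], simp)
  moreover have "hom_on i' (2 * int a) (\<Sum>d = 0..a. (-1) ^ d * vx j ^ (a - d) * vE d (j + 1) * idem i)"
    by (intro hom_on_sum hom_on_idem_right, simp only: mult.assoc, rule hom_on_sign)
      (rule hom_on_mult[OF hom_to_vE hom_on_gens(3)], simp)
  ultimately show ?thesis unfolding psi_square_black_red(1) by (blast intro: hom_on_diff)
next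
  case (braid_black_red_black i j a)
  have l: "1 \<le> j" "j + 1 < length i" using braid_black_red_black length_Seq[of i s n] by (auto simp: is_gen_def)
  have deg: "psi_deg j i = int a" "psi_deg (j + 1) (swap_entries j i) = - 2"
      "psi_deg j (swap_entries (j + 1) (swap_entries j i)) = int a"
    "psi_deg (j + 1) i = int a" "psi_deg j (swap_entries (j + 1) i) = - 2"
      "psi_deg (j + 1) (swap_entries j (swap_entries (j + 1) i)) = int a"
    using braid_black_red_black l by (simp_all add: psi_deg_def ent_swap)
  have "hom_on i' (2 * int a - 2) ((psi j * psi (j + 1) * psi j - psi (j + 1) * psi j * psi (j + 1)) * idem i)"
    unfolding mult.assoc[of "psi _"]
    by (intro hom_on_idem_right hom_on_diff)
      (rule hom_on_mult[OF hom_to_mult[OF hom_to_psi hom_to_psi refl] hom_on_gens(4)], simp add: deg[simplified])+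
  moreover have "hom_on i' (2 * int a - 2) (\<Sum>(d1, d2, d3) \<in> {(d1, d2, d3). d1 + d2 + d3 + 1 = a}.
           (-1) ^ d3 * vx j ^ d1 * vE d3 (j + 1) * vx (j + 2) ^ d2 * idem i)"
    apply (rule hom_on_sum)
    apply (clarsimp simp only: mem_Collect_eq case_prod_conv)
    apply (rule hom_on_idem_right, simp only: mult.assoc, rule hom_on_sign)
    apply (rule hom_on_mult[OF hom_to_mult[OF hom_to_vx_pow hom_to_vE refl] hom_on_gens(3)])
    by auto
  ultimately show ?thesis unfolding braid_black_red_black(1) by (blast intro: hom_on_diff)
next
  case (braid_other i j)
  have l: "1 \<le> j" "j + 1 < length i" using braid_other length_Seq[of i s n] by (auto simp: is_gen_def)
  define k where "k = psi_deg j i + psi_deg (j + 1) (swap_entries j i)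
      + psi_deg j (swap_entries (j + 1) (swap_entries j i))"
  have deg: "psi_deg (j + 1) i + psi_deg j (swap_entries (j + 1) i)
      + psi_deg (j + 1) (swap_entries j (swap_entries (j + 1) i)) = k"
    using l by (auto simp: k_def psi_deg_def ent_swap split: entry.splits)
  have "hom_on i' k ((psi j * psi (j + 1) * psi j - psi (j + 1) * psi j * psi (j + 1)) * idem i)"
    unfolding mult.assoc[of "psi _"]
    by (intro hom_on_idem_right hom_on_diff)
      (rule hom_on_mult[OF hom_to_mult[OF hom_to_psi hom_to_psi refl] hom_on_gens(4)], simp only: k_def,
        rule hom_on_mult[OF hom_to_mult[OF hom_to_psi hom_to_psi refl] hom_on_gens(4)], simp only: deg)
  then show ?thesis unfolding braid_other(1) ..
qed

lemma grading_ideal: "a \<in> D_ideal s n \<Longrightarrow> grading s n (a :: 'k falg) = 0"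
proof -
  have "D_ideal s n \<subseteq> {a :: 'k falg. grading s n a = 0}"
    by (rule D_ideal_minimal)
      (auto simp: grading_zero grading_add grading_mult intro!: grading_eq_0I hom_on_rel h_rel)
  then show "a \<in> D_ideal s n \<Longrightarrow> grading s n (a :: 'k falg) = 0" by auto
qed

lemma grading_cong: "proj s n a = proj s n b \<Longrightarrow> grading s n a = grading s n (b :: 'k falg)"
  using grading_ideal[of "a - b"] by (simp add: proj_eq_iff grading_diff)

lemma grading_homog: "homog s n k a \<Longrightarrow> grading s n (a :: 'k falg) = Poly_Mapping.single k (proj s n a)"
proof (induction rule: homog.induct)
  case (psi_black_black i j)
  with hom_to_psi[of i j] show ?case
    by (simp add: hom_to_def hom_on_def grading_mult grading_idem h_mult psi_deg_def)
next
  case (psi_red_black i j a)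
  with hom_to_psi[of i j] show ?case
    by (simp add: hom_to_def hom_on_def grading_mult grading_idem h_mult psi_deg_def)
next
  case (psi_black_red i j a)
  with hom_to_psi[of i j] show ?case
    by (simp add: hom_to_def hom_on_def grading_mult grading_idem h_mult psi_deg_def)
next
  case (scal k a c)
  then show ?case by (simp only: grading_scal mult_single proj_scal add_0_left)
qed (auto simp: grading_zero grading_add grading_one grading_mult grading_idem h_simps single_add mult_single
    vx_def vE_def grading_letter grading_gen_def is_gen_def)

end

section \<open>Splitting a red entry\<close>

abbreviation is_red :: "entry \<Rightarrow> bool" where "is_red c \<equiv> c \<noteq> Black"

lemma filter_eq_append_ConsD:
  "filter P xs = ys @ z # zs \<Longrightarrow> \<exists>us vs. xs = us @ z # vs \<and> filter P us = ys \<and> filter P vs = zs"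
proof (induction xs arbitrary: ys)
  case (Cons x xs)
  show ?case
  proof (cases "P x")
    case True
    show ?thesis
    proof (cases ys)
      case Nil
      with True Cons.prems show ?thesis by (intro exI[of _ "[]"] exI[of _ xs]) auto
    next
      case (Cons y ys')
      with True Cons.prems have "filter P xs = ys' @ z # zs" and y: "y = x" by auto
      from Cons.IH[OF this(1)] obtain us vs
        where "xs = us @ z # vs" "filter P us = ys'" "filter P vs = zs" by auto
      with True y \<open>ys = y # ys'\<close> show ?thesis by (intro exI[of _ "x # us"] exI[of _ vs]) auto
    qed
  next
    case False
    with Cons.prems Cons.IH[of ys] obtain us vs
      where "xs = us @ z # vs" "filter P us = ys" "filter P vs = zs" by auto
    with False show ?thesis by (intro exI[of _ "x # us"] exI[of _ vs]) auto
  qed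
qed simp

lemma length_filter_ent:
  "k \<le> length i \<Longrightarrow> length (filter (\<lambda>l. is_red (ent i l)) [1..<k + 1]) = length (filter is_red (take k i))"
  by (induction k) (auto simp: ent_def take_Suc_conv_app_nth)

lemma red_pos_eqI:
  assumes "1 \<le> L" "L \<le> length i" "is_red (ent i L)" "length (filter is_red (take (L - 1) i)) = j - 1"
  shows "red_pos j i = L"
proof -
  let ?f = "filter (\<lambda>l. is_red (ent i l))"
  have "[1..<length i + 1] = [1..<L] @ L # [L + 1..<length i + 1]"
    using assms(1,2) upt_add_eq_append[of 1 L "length i + 1 - L"] upt_conv_Cons[of L "length i + 1"] by simp
  then have "?f [1..<length i + 1] = ?f [1..<L] @ L # ?f [L + 1..<length i + 1]"
    using assms(3) by simp
  moreover have "length (?f [1..<L]) = j - 1"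
    using length_filter_ent[of "L - 1" i] assms by simp
  ultimately show ?thesis by (simp add: red_pos_def nth_append)
qed

lemma red_pos_append:
  assumes "is_red c" "length (filter is_red us) = j - 1"
  shows "red_pos j (us @ c # vs) = length us + 1"
  by (rule red_pos_eqI) (use assms in \<open>auto simp: ent_def\<close>)

lemma Seq_decomp:
  assumes "i \<in> Seq s n" "1 \<le> j" "j \<le> length s"
  obtains us vs where "i = us @ Red (s ! (j - 1)) # vs" "filter is_red us = map Red (take (j - 1) s)"
    "filter is_red vs = map Red (drop j s)" "red_pos j i = length us + 1"
proof -
  have "s = take (j - 1) s @ s ! (j - 1) # drop j s"
    using assms id_take_nth_drop[of "j - 1" s] by simp
  then have "map Red s = map Red (take (j - 1) s) @ Red (s ! (j - 1)) # map Red (drop j s)"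
    by (metis list.simps(9) map_append)
  with assms(1) have "filter is_red i = map Red (take (j - 1) s) @ Red (s ! (j - 1)) # map Red (drop j s)"
    by (simp add: Seq_def)
  from filter_eq_append_ConsD[OF this] obtain us vs where i: "i = us @ Red (s ! (j - 1)) # vs"
    and us: "filter is_red us = map Red (take (j - 1) s)" and vs: "filter is_red vs = map Red (drop j s)" by auto
  have "red_pos j i = length us + 1"
    unfolding i by (rule red_pos_append) (use assms us in auto)
  with i us vs that show thesis by blast
qed

lemma swap_Seq:
  assumes i: "i \<in> Seq s n" and l: "1 \<le> l" "l < length i" and b: "ent i l = Black \<or> ent i (l + 1) = Black"
  shows "swap_entries l i \<in> Seq s n"
proof -
  define us where "us = take (l - 1) i"
  define vs where "vs = drop (l + 1) i"
  have "i = take (l - 1) i @ ent i l # drop (Suc (l - 1)) i"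
    unfolding ent_def by (rule id_take_nth_drop) (use l in auto)
  also have "drop (Suc (l - 1)) i = ent i (l + 1) # drop (l + 1) i"
    using l Cons_nth_drop_Suc[of l i] by (simp add: ent_def)
  finally have i_eq: "i = us @ [ent i l, ent i (l + 1)] @ vs" by (simp add: us_def vs_def)
  have len: "length us = l - 1" using l by (simp add: us_def)
  have "swap_entries l i = us @ [ent i (l + 1), ent i l] @ vs"
  proof -
    have "swap_entries l (us @ [x, y] @ vs) = us @ [y, x] @ vs" for x y
      using len l by (cases l) (auto simp: swap_entries_def ent_def nth_append list_update_append)
    then show ?thesis by (subst (1) i_eq)
  qed
  moreover have "us @ [ent i l, ent i (l + 1)] @ vs \<in> Seq s n" using i i_eq by simp
  ultimately show ?thesis using b by (auto simp: Seq_def split: if_splits)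
qed

locale splitting =
  fixes s :: "nat list" and n j a :: nat
  assumes j: "1 \<le> j" "j \<le> length s" and a: "a \<le> s ! (j - 1)"
begin

abbreviation "L \<equiv> red_pos j"
abbreviation "sp \<equiv> split_seq s j a"
abbreviation "t \<equiv> split_list j a s"

lemma length_t: "length t = length s + 1"
  using j by (simp add: split_list_def)

lemma sp_append:
  assumes "filter is_red us = map Red (take (j - 1) s)"
  shows "sp (us @ Red b # vs) = us @ [Red (s ! (j - 1) - a), Red a] @ vs"
proof -
  have "L (us @ Red b # vs) = length us + 1"
    by (rule red_pos_append) (use assms j in auto)
  then show ?thesis by (simp add: split_seq_def)
qed

lemma L_bounds:
  assumes "i \<in> Seq s n"
  shows "1 \<le> L i" "L i \<le> length s + n" "L i \<le> length i" "ent i (L i) = Red (s ! (j - 1))"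
proof -
  obtain us vs where "i = us @ Red (s ! (j - 1)) # vs" "L i = length us + 1"
    by (rule Seq_decomp[OF assms j])
  with length_Seq[OF assms] show "1 \<le> L i" "L i \<le> length s + n" "L i \<le> length i" "ent i (L i) = Red (s ! (j - 1))"
    by (auto simp: ent_def)
qed

lemma count_before_L: "i \<in> Seq s n \<Longrightarrow> length (filter is_red (take (L i - 1) i)) = j - 1"
  by (erule Seq_decomp[OF _ j]) (use j in simp)

lemma length_sp: "i \<in> Seq s n \<Longrightarrow> length (sp i) = length s + n + 1"
  using L_bounds[of i] length_Seq[of i] by (auto simp: split_seq_def)

lemma ent_sp:
  assumes i: "i \<in> Seq s n" and q: "1 \<le> q"
  shows "ent (sp i) q = (if q < L i then ent i q else if q = L i then Red (s ! (j - 1) - a)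
    else if q = L i + 1 then Red a else ent i (q - 1))"
proof -
  obtain us vs where d: "i = us @ Red (s ! (j - 1)) # vs" "filter is_red us = map Red (take (j - 1) s)" "L i = length us + 1"
    by (rule Seq_decomp[OF i j])
  have sp: "sp i = us @ [Red (s ! (j - 1) - a), Red a] @ vs"
    unfolding d(1) by (rule sp_append[OF d(2)])
  consider "q < L i" | "q = L i" | "q = L i + 1" | "q > L i + 1" by linarith
  then show ?thesis
  proof cases
    case 1
    then have "q - 1 < length us" using d(3) q by auto
    then have "ent (sp i) q = us ! (q - 1)" "ent i q = us ! (q - 1)"
      unfolding sp by (auto simp: d(1) ent_def nth_append)
    with 1 show ?thesis by simp
  next
    case 4
    then obtain k where k: "q = length us + 3 + k" using d(3) less_iff_Suc_add by auto
    then have "ent (sp i) q = vs ! k" "ent i (q - 1) = vs ! k"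
      unfolding sp by (auto simp: d(1) ent_def nth_append)
    with 4 show ?thesis by simp
  qed (auto simp: sp ent_def d(3) nth_append)
qed

lemma sp_Seq:
  assumes i: "i \<in> Seq s n"
  shows "sp i \<in> Seq t n"
proof -
  obtain us vs where d: "i = us @ Red (s ! (j - 1)) # vs" "filter is_red us = map Red (take (j - 1) s)"
    "filter is_red vs = map Red (drop j s)" "L i = length us + 1"
    by (rule Seq_decomp[OF i j])
  have sp: "sp i = us @ [Red (s ! (j - 1) - a), Red a] @ vs"
    unfolding d(1) by (rule sp_append[OF d(2)])
  have "filter is_red (sp i) = map Red t"
    unfolding sp by (simp add: d split_list_def)
  moreover have "count_list (sp i) Black = n"
    using i unfolding sp by (simp add: Seq_def d(1))
  ultimately show ?thesis by (simp add: Seq_def)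
qed

lemma L_sp:
  assumes i: "i \<in> Seq s n"
  shows "red_pos j (sp i) = L i" "red_pos (j + 1) (sp i) = L i + 1"
proof -
  obtain us vs where d: "i = us @ Red (s ! (j - 1)) # vs" "filter is_red us = map Red (take (j - 1) s)"
    "filter is_red vs = map Red (drop j s)" "L i = length us + 1"
    by (rule Seq_decomp[OF i j])
  have sp: "sp i = us @ [Red (s ! (j - 1) - a), Red a] @ vs"
    unfolding d(1) by (rule sp_append[OF d(2)])
  show "red_pos j (sp i) = L i"
    unfolding d(4) sp append_Cons by (rule red_pos_append) (use d j in auto)
  have "red_pos (j + 1) ((us @ [Red (s ! (j - 1) - a)]) @ Red a # vs) = length (us @ [Red (s ! (j - 1) - a)]) + 1"
    by (rule red_pos_append) (use d j in auto)
  then show "red_pos (j + 1) (sp i) = L i + 1" by (simp add: sp d(4))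
qed

lemma sp_inj: "inj_on sp (Seq s n)"
proof (rule inj_onI)
  fix i k assume i: "i \<in> Seq s n" and k: "k \<in> Seq s n" and eq: "sp i = sp k"
  have L: "L i = L k" using L_sp(1)[OF i] L_sp(1)[OF k] eq by simp
  show "i = k"
  proof (rule ent_eqI)
    fix q assume q: "1 \<le> q" "q \<le> length i"
    consider "q < L i" | "q = L i" | "q > L i" by linarith
    then show "ent i q = ent k q"
    proof cases
      case 1
      with ent_sp[OF i q(1)] ent_sp[OF k q(1)] eq L show ?thesis by simp
    next
      case 2
      with L_bounds[OF i] L_bounds[OF k] L show ?thesis by simp
    next
      case 3
      with ent_sp[OF i, of "q + 1"] ent_sp[OF k, of "q + 1"] eq L show ?thesis by simp
    qed
  qed (simp add: length_Seq[OF i] length_Seq[OF k])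
qed

lemma adjacent_Seq_eq: "adjacent_Seq t n j = sp ` Seq s n"
proof
  show "sp ` Seq s n \<subseteq> adjacent_Seq t n j"
    using sp_Seq L_sp by (auto simp: adjacent_Seq_def)
  show "adjacent_Seq t n j \<subseteq> sp ` Seq s n"
  proof
    fix k assume "k \<in> adjacent_Seq t n j"
    then have k: "k \<in> Seq t n" and adj: "red_pos (j + 1) k = red_pos j k + 1"
      by (auto simp: adjacent_Seq_def)
    have tj: "t ! (j - 1) = s ! (j - 1) - a" "t ! j = a" "take (j - 1) t = take (j - 1) s" "drop (j + 1) t = drop j s"
      "take j t = take (j - 1) s @ [s ! (j - 1) - a]" "drop j t = a # drop j s"
      using j by (auto simp: split_list_def nth_append min_def take_Cons' Suc_diff_le)
    obtain us vs where d: "k = us @ Red (s ! (j - 1) - a) # vs" "filter is_red us = map Red (take (j - 1) s)"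
      "filter is_red vs = Red a # map Red (drop j s)" "red_pos j k = length us + 1"
    proof (rule Seq_decomp[OF k j(1)])
      show "j \<le> length t" using j length_t by simp
    qed (use that tj in auto)
    obtain us' vs' where d': "k = us' @ Red a # vs'" "filter is_red vs' = map Red (drop j s)" "red_pos (j + 1) k = length us' + 1"
    proof (rule Seq_decomp[OF k, of "j + 1"])
      show "j + 1 \<le> length t" using j length_t by simp
    qed (use that tj in auto)
    have len: "length us' = length us + 1" using adj d(4) d'(3) by simp
    have "drop (length us + 1) k = vs" by (simp add: d(1))
    moreover have "drop (length us') k = Red a # vs'" by (simp add: d'(1))
    ultimately have vs: "vs = Red a # vs'" by (simp add: len)
    define i where "i = us @ Red (s ! (j - 1)) # vs'"
    have "map Red s = map Red (take (j - 1) s) @ Red (s ! (j - 1)) # map Red (drop j s)"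
    proof -
      have "s = take (j - 1) s @ s ! (j - 1) # drop j s"
        using j id_take_nth_drop[of "j - 1" s] by simp
      then show ?thesis by (metis list.simps(9) map_append)
    qed
    then have "filter is_red i = map Red s" using d(2) d'(2) by (simp add: i_def)
    moreover have "count_list i Black = n" using k by (simp add: i_def Seq_def d(1) vs)
    ultimately have "i \<in> Seq s n" by (simp add: Seq_def)
    moreover have "sp i = k" unfolding i_def d(1) vs by (simp add: sp_append[OF d(2)])
    ultimately show "k \<in> sp ` Seq s n" by blast
  qed
qed

lemma L_swap:
  assumes i: "i \<in> Seq s n" and l: "1 \<le> l" "l < length i" and b: "ent i l = Black \<or> ent i (l + 1) = Black"
  shows "L (swap_entries l i) = (if l + 1 = L i then l else if l = L i then l + 1 else L i)"
proof -
  have k: "swap_entries l i \<in> Seq s n" by (rule swap_Seq[OF i l b])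
  note L = L_bounds[OF i] and c = count_before_L[OF i]
  have red: "is_red (ent i (L i))" using L by simp
  show ?thesis
  proof (rule red_pos_eqI)
    let ?L = "if l + 1 = L i then l else if l = L i then l + 1 else L i"
    show "1 \<le> ?L" "?L \<le> length (swap_entries l i)" using l L by auto
    show "is_red (ent (swap_entries l i) ?L)"
      using l L red by (auto simp: ent_swap)
    consider "l + 1 < L i" | "l + 1 = L i" | "l = L i" | "L i < l" by linarith
    then show "length (filter is_red (take (?L - 1) (swap_entries l i))) = j - 1"
    proof cases
      case 1
      have "take (L i - 1) (swap_entries l i) = swap_entries l (take (L i - 1) i)"
        using 1 l by (auto simp: swap_entries_def ent_def take_update_swap)
      moreover have "mset (swap_entries l xs) = mset xs" if "l < length xs" for xs
        using that by (auto simp: swap_entries_def ent_def mset_swap)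
      ultimately have "mset (take (L i - 1) (swap_entries l i)) = mset (take (L i - 1) i)"
        using 1 L by simp
      then have "size (filter_mset is_red (mset (take (L i - 1) (swap_entries l i))))
          = size (filter_mset is_red (mset (take (L i - 1) i)))" by simp
      then have "length (filter is_red (take (L i - 1) (swap_entries l i))) = length (filter is_red (take (L i - 1) i))"
        by (simp flip: mset_filter)
      with 1 c show ?thesis by simp
    next
      case 2
      have "ent i l = Black" using b red 2 by auto
      moreover have "take (L i - 1) i = take (l - 1) i @ [ent i l]"
        using 2 l take_Suc_conv_app_nth[of "l - 1" i] by (simp add: ent_def flip: 2)
      moreover have "take (l - 1) (swap_entries l i) = take (l - 1) i"
        by (simp add: swap_entries_def)
      ultimately show ?thesis using 2 c by simp
    next
      case 3
      have "ent i (l + 1) = Black" using b red 3 by auto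
      then have "take l (swap_entries l i) = take (l - 1) i @ [Black]"
        using l take_Suc_conv_app_nth[of "l - 1" "swap_entries l i"] by (simp add: swap_entries_def ent_def)
      with 3 c show ?thesis by simp
    next
      case 4
      have "take (L i - 1) (swap_entries l i) = take (L i - 1) i"
        using 4 by (simp add: swap_entries_def)
      with 4 c show ?thesis by simp
    qed
  qed
qed

lemma sp_swap:
  assumes i: "i \<in> Seq s n" and l: "1 \<le> l" "l + 1 \<le> length s + n" and b: "ent i l = Black \<or> ent i (l + 1) = Black"
  shows "l + 1 < L i \<Longrightarrow> sp (swap_entries l i) = swap_entries l (sp i)"
    and "l + 1 = L i \<Longrightarrow> sp (swap_entries l i) = swap_entries (l + 1) (swap_entries l (sp i))"
    and "l = L i \<Longrightarrow> sp (swap_entries l i) = swap_entries l (swap_entries (l + 1) (sp i))"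
    and "L i < l \<Longrightarrow> sp (swap_entries l i) = swap_entries (l + 1) (sp i)"
proof -
  have l': "l < length i" using l length_Seq[OF i] by simp
  have k: "swap_entries l i \<in> Seq s n" by (rule swap_Seq[OF i l(1) l' b])
  note len = length_sp[OF k] length_sp[OF i] length_Seq[OF i]
  note simps = ent_sp[OF k] L_swap[OF i l(1) l' b] ent_swap ent_sp[OF i] L_bounds[OF i]
  show "sp (swap_entries l i) = swap_entries l (sp i)" if "l + 1 < L i"
    by (rule ent_eqI) (use that l l' len in \<open>auto simp: simps\<close>)
  show "sp (swap_entries l i) = swap_entries (l + 1) (swap_entries l (sp i))" if "l + 1 = L i"
    by (rule ent_eqI) (use that l l' len in \<open>auto simp: simps\<close>)
  show "sp (swap_entries l i) = swap_entries l (swap_entries (l + 1) (sp i))" if "l = L i"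
  proof (rule ent_eqI)
    have Ll: "L i = l" using that by simp
    fix q assume q: "1 \<le> q" "q \<le> length (sp (swap_entries l i))"
    have "q < l \<or> q = l \<or> q = l + 1 \<or> q = l + 2 \<or> (\<exists>r. q = Suc (Suc (Suc (l + r))))" by presburger
    then consider "q < l" | "q = l" | "q = l + 1" | "q = l + 2" | r where "q = Suc (Suc (Suc (l + r)))" by blast
    then show "ent (sp (swap_entries l i)) q = ent (swap_entries l (swap_entries (l + 1) (sp i))) q"
      by cases (use q l l' len simps Ll in simp_all)
  qed (use len in simp)
  show "sp (swap_entries l i) = swap_entries (l + 1) (sp i)" if "L i < l"
    by (rule ent_eqI) (use that l l' len in \<open>auto simp: simps\<close>)
qed

end

section \<open>Products of characteristic polynomials\<close>

definition conv :: "(nat \<Rightarrow> 'q::ring_1) \<Rightarrow> (nat \<Rightarrow> 'q) \<Rightarrow> nat \<Rightarrow> 'q" where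
  "conv F G d = (\<Sum>k\<le>d. F k * G (d - k))"

text \<open>\<open>hs k x y\<close> is \<open>(x^k - y^k) / (x - y)\<close>.\<close>

definition hs :: "nat \<Rightarrow> 'q::ring_1 \<Rightarrow> 'q \<Rightarrow> 'q" where
  "hs k x y = (if k = 0 then 0 else hsum (k - 1) x y)"

lemma dquot_hs: "dquot a F x y = (\<Sum>d\<le>a. (-1) ^ d * (F d * hs (a - d) x y))"
proof -
  have "(\<Sum>d\<le>a. (-1) ^ d * (F d * hs (a - d) x y)) = (\<Sum>d<a. (-1) ^ d * (F d * hs (a - d) x y))"
    by (simp add: hs_def flip: lessThan_Suc_atMost)
  also have "\<dots> = dquot a F x y"
    unfolding dquot_def by (rule sum.cong) (auto simp: hs_def mult.assoc)
  finally show ?thesis by simp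
qed

lemma hs_Suc: "hs (Suc k) x y = hs k x y * y + x ^ k"
proof (cases k)
  case 0
  then show ?thesis by (simp add: hs_def hsum_def)
next
  case (Suc m)
  then show ?thesis using hsum_Suc[of m x y] by (simp add: hs_def)
qed

lemma hs_add: "hs (p + q) x y = x ^ p * hs q x y + hs p x y * y ^ q"
proof (induction q)
  case 0
  show ?case by (simp add: hs_def)
next
  case (Suc q)
  then show ?case
    by (simp only: add_Suc_right hs_Suc distrib_left distrib_right mult.assoc power_add power_Suc2 ac_simps(1-3))
qed

lemma sum_triangle_rect:
  fixes g :: "nat \<Rightarrow> nat \<Rightarrow> 'q::comm_monoid_add"
  assumes "\<And>k m. k > b1 \<Longrightarrow> g k m = 0" and "\<And>k m. m > b2 \<Longrightarrow> g k m = 0"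
  shows "(\<Sum>d\<le>b1 + b2. \<Sum>k\<le>d. g k (d - k)) = (\<Sum>k\<le>b1. \<Sum>m\<le>b2. g k m)"
proof -
  have "(\<Sum>d\<le>b1 + b2. \<Sum>k\<le>d. g k (d - k)) = (\<Sum>(d, k)\<in>(SIGMA d:{..b1 + b2}. {..d}). g k (d - k))"
    by (rule sum.Sigma) auto
  also have "\<dots> = (\<Sum>(k, m)\<in>{(k, m). k + m \<le> b1 + b2}. g k m)"
    by (rule sum.reindex_bij_witness[of _ "\<lambda>(k, m). (k + m, k)" "\<lambda>(d, k). (k, d - k)"]) auto
  also have "\<dots> = (\<Sum>(k, m)\<in>{..b1} \<times> {..b2}. g k m)"
  proof (rule sum.mono_neutral_right)
    show "finite {(k, m). k + m \<le> b1 + b2}"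
      by (rule finite_subset[of _ "{..b1 + b2} \<times> {..b1 + b2}"]) auto
    show "\<forall>x\<in>{(k, m). k + m \<le> b1 + b2} - {..b1} \<times> {..b2}. (case x of (k, m) \<Rightarrow> g k m) = 0"
      using assms by (auto, meson not_le)+
  qed auto
  also have "\<dots> = (\<Sum>k\<le>b1. \<Sum>m\<le>b2. g k m)"
    by (simp add: sum.cartesian_product)
  finally show ?thesis .
qed

lemma chi_atMost: "chi a F x = (\<Sum>d\<le>a. (-1) ^ d * (F d * x ^ (a - d)))"
  by (simp add: chi_def atLeast0AtMost mult.assoc)

lemma sign_pull: "x * ((-1) ^ k * y) = (-1) ^ k * (x * (y :: 'q::ring_1))"
  by (rule sign_left_commute[symmetric])

lemma chi_conv:
  assumes comm: "\<And>m. x * G m = G m * (x :: 'q::ring_1)"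
    and F0: "\<And>k m r. b1 < k \<Longrightarrow> F k * (G m * (x ^ r * v)) = 0"
    and G0: "\<And>k m r. b2 < m \<Longrightarrow> F k * (G m * (x ^ r * v)) = 0"
  shows "chi (b1 + b2) (conv F G) x * v = chi b1 F x * (chi b2 G x * v)"
proof -
  have c: "x ^ r * (G m * z) = G m * (x ^ r * z)" for r m z
    by (simp only: power_commuting_commutes[OF comm] flip: mult.assoc)
  define g where "g k m = (-1) ^ (k + m) * (F k * (G m * (x ^ (b1 + b2 - (k + m)) * v)))" for k m
  have "chi (b1 + b2) (conv F G) x * v = (\<Sum>d\<le>b1 + b2. \<Sum>k\<le>d. g k (d - k))"
    by (simp add: chi_atMost conv_def g_def sum_distrib_left sum_distrib_right mult.assoc)
  also have "\<dots> = (\<Sum>k\<le>b1. \<Sum>m\<le>b2. g k m)"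
    by (rule sum_triangle_rect) (auto simp: g_def F0 G0)
  also have "\<dots> = (\<Sum>k\<le>b1. \<Sum>m\<le>b2. (-1) ^ k * (F k * (x ^ (b1 - k) * ((-1) ^ m * (G m * (x ^ (b2 - m) * v))))))"
  proof (intro sum.cong refl)
    fix k m assume "k \<in> {..b1}" "m \<in> {..b2}"
    then have e: "b1 + b2 - (k + m) = (b1 - k) + (b2 - m)" by simp
    show "g k m = (-1) ^ k * (F k * (x ^ (b1 - k) * ((-1) ^ m * (G m * (x ^ (b2 - m) * v)))))"
      unfolding g_def e power_add by (cases "even k"; cases "even m") (simp_all add: mult.assoc c)
  qed
  also have "\<dots> = chi b1 F x * (chi b2 G x * v)"
    unfolding chi_atMost by (subst sum.swap) (simp only: sum_distrib_left sum_distrib_right mult.assoc)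
  finally show ?thesis .
qed

lemma dquot_conv:
  assumes comm: "\<And>m. x * G m = G m * (x :: 'q::ring_1)" "\<And>m. y * G m = G m * y"
    "\<And>m. x * F m = F m * x" "\<And>m. y * F m = F m * y" "\<And>m k. G m * F k = F k * G m" "x * y = y * x"
    and F0: "\<And>k m r. b1 < k \<Longrightarrow> F k * (G m * (hs r x y * v)) = 0"
    and G0: "\<And>k m r. b2 < m \<Longrightarrow> F k * (G m * (hs r x y * v)) = 0"
  shows "dquot (b1 + b2) (conv F G) x y * v
    = dquot b2 G x y * (chi b1 F x * v) + dquot b1 F x y * (chi b2 G y * v)"
proof -
  have cx: "x ^ r * (G m * z) = G m * (x ^ r * z)" "x ^ r * (F m * z) = F m * (x ^ r * z)"
    "y ^ r * (G m * z) = G m * (y ^ r * z)" "y ^ r * (F m * z) = F m * (y ^ r * z)" for r m z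
    by (simp_all only: power_commuting_commutes[OF comm(1)] power_commuting_commutes[OF comm(2)]
        power_commuting_commutes[OF comm(3)] power_commuting_commutes[OF comm(4)] flip: mult.assoc)
  have GF: "G m * (F k * z) = F k * (G m * z)" for m k z
    by (simp only: comm(5) flip: mult.assoc)
  have ch: "hs r x y * (G m * z) = G m * (hs r x y * z)" "hs r x y * (F m * z) = F m * (hs r x y * z)" for r m z
    by (auto simp: hs_def hsum_def sum_distrib_right sum_distrib_left mult.assoc cx)
  have xy: "hs r x y * (x ^ k * z) = x ^ k * (hs r x y * z)" for r k z
  proof -
    have "y ^ m * x ^ k = x ^ k * y ^ m" for m
      by (metis comm(6) power_commuting_commutes)
    then have "x ^ l * y ^ m * x ^ k = x ^ k * (x ^ l * y ^ m)" for l m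
      by (metis mult.assoc power_add add.commute)
    then have "hs r x y * x ^ k = x ^ k * hs r x y"
      by (simp add: hs_def hsum_def sum_distrib_right sum_distrib_left)
    then show ?thesis by (simp flip: mult.assoc)
  qed
  define g where "g k m = (-1) ^ (k + m) * (F k * (G m * (hs (b1 + b2 - (k + m)) x y * v)))" for k m
  have "dquot (b1 + b2) (conv F G) x y * v = (\<Sum>d\<le>b1 + b2. \<Sum>k\<le>d. g k (d - k))"
    by (simp add: dquot_hs conv_def g_def sum_distrib_left sum_distrib_right mult.assoc)
  also have "\<dots> = (\<Sum>k\<le>b1. \<Sum>m\<le>b2. g k m)"
    by (rule sum_triangle_rect) (auto simp: g_def F0 G0)
  also have "\<dots> = (\<Sum>k\<le>b1. \<Sum>m\<le>b2.
      (-1) ^ m * (G m * (hs (b2 - m) x y * ((-1) ^ k * (F k * (x ^ (b1 - k) * v)))))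
      + (-1) ^ k * (F k * (hs (b1 - k) x y * ((-1) ^ m * (G m * (y ^ (b2 - m) * v))))))"
  proof (intro sum.cong refl)
    fix k m assume "k \<in> {..b1}" "m \<in> {..b2}"
    then have e: "b1 + b2 - (k + m) = (b1 - k) + (b2 - m)" by simp
    show "g k m = (-1) ^ m * (G m * (hs (b2 - m) x y * ((-1) ^ k * (F k * (x ^ (b1 - k) * v)))))
      + (-1) ^ k * (F k * (hs (b1 - k) x y * ((-1) ^ m * (G m * (y ^ (b2 - m) * v)))))"
      unfolding g_def e hs_add power_add
      by (cases "even k"; cases "even m") (simp_all add: mult.assoc distrib_left distrib_right cx ch GF xy)
  qed
  also have "\<dots> = (\<Sum>k\<le>b1. \<Sum>m\<le>b2. (-1) ^ m * (G m * (hs (b2 - m) x y * ((-1) ^ k * (F k * (x ^ (b1 - k) * v))))))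
      + (\<Sum>k\<le>b1. \<Sum>m\<le>b2. (-1) ^ k * (F k * (hs (b1 - k) x y * ((-1) ^ m * (G m * (y ^ (b2 - m) * v))))))"
    by (simp only: sum.distrib)
  also have "(\<Sum>k\<le>b1. \<Sum>m\<le>b2. (-1) ^ m * (G m * (hs (b2 - m) x y * ((-1) ^ k * (F k * (x ^ (b1 - k) * v))))))
      = dquot b2 G x y * (chi b1 F x * v)"
    unfolding chi_atMost dquot_hs by (simp only: sum_distrib_left sum_distrib_right mult.assoc)
  also have "(\<Sum>k\<le>b1. \<Sum>m\<le>b2. (-1) ^ k * (F k * (hs (b1 - k) x y * ((-1) ^ m * (G m * (y ^ (b2 - m) * v))))))
      = dquot b1 F x y * (chi b2 G y * v)"
    unfolding chi_atMost dquot_hs by (subst sum.swap) (simp only: sum_distrib_left sum_distrib_right mult.assoc)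
  finally show ?thesis .
qed

lemma intertwine_power:
  assumes "\<And>w. w \<in> Z \<Longrightarrow> A * (x * w) = x' * (A * w)" "\<And>w. w \<in> Z \<Longrightarrow> x * w \<in> Z" "v \<in> Z"
  shows "A * (x ^ k * v) = x' ^ k * (A * (v :: 'q::ring_1))" "x ^ k * v \<in> Z"
  by (induction k) (auto simp: assms mult.assoc)

lemma intertwine_chi:
  assumes F: "\<And>d w. w \<in> Z \<Longrightarrow> A * (F d * w) = G d * (A * w)"
    and x: "\<And>w. w \<in> Z \<Longrightarrow> A * (x * w) = x' * (A * w)" "\<And>w. w \<in> Z \<Longrightarrow> x * w \<in> Z" and v: "v \<in> Z"
  shows "A * (chi a F x * v) = chi a G x' * (A * (v :: 'q::ring_1))"
  unfolding chi_atMost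
  by (simp only: sum_distrib_left sum_distrib_right mult.assoc sign_pull F[OF intertwine_power(2)[OF x v]]
      intertwine_power(1)[OF x v])

lemma intertwine_dquot:
  assumes F: "\<And>d w. w \<in> Z \<Longrightarrow> A * (F d * w) = G d * (A * w)"
    and x: "\<And>w. w \<in> Z \<Longrightarrow> A * (x * w) = x' * (A * w)" "\<And>w. w \<in> Z \<Longrightarrow> x * w \<in> Z"
    and y: "\<And>w. w \<in> Z \<Longrightarrow> A * (y * w) = y' * (A * w)" "\<And>w. w \<in> Z \<Longrightarrow> y * w \<in> Z"
    and add: "\<And>v w. v \<in> Z \<Longrightarrow> w \<in> Z \<Longrightarrow> v + w \<in> Z" "0 \<in> Z" and v: "v \<in> Z"
  shows "A * (dquot a F x y * v) = dquot a G x' y' * (A * (v :: 'q::ring_1))"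
proof -
  have m: "x ^ i * (y ^ k * v) \<in> Z" "A * (x ^ i * (y ^ k * v)) = x' ^ i * (y' ^ k * (A * v))" for i k
    using intertwine_power[OF x intertwine_power(2)[OF y v]] intertwine_power(1)[OF y v] by auto
  have s: "sum f B \<in> Z" if "\<And>i. i \<in> B \<Longrightarrow> f i \<in> Z" for f :: "nat \<Rightarrow> 'q" and B
    using that by (induction B rule: infinite_finite_induct) (auto simp: add)
  have h1: "hs k x y * v \<in> Z" and h2: "A * (hs k x y * v) = hs k x' y' * (A * v)" for k
    by (auto simp: hs_def hsum_def sum_distrib_right sum_distrib_left mult.assoc m add(2) intro!: s)
  show ?thesis
    unfolding dquot_hs
    by (simp only: sum_distrib_left sum_distrib_right mult.assoc sign_pull F[OF h1] h2)
qed

section \<open>The inclusion map\<close>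

lemma sum_pairs:
  fixes g :: "nat \<Rightarrow> nat \<Rightarrow> 'q::comm_monoid_add"
  shows "(\<Sum>(d1, d2) \<in> {(d1, d2). d1 + d2 = d}. g d1 d2) = (\<Sum>k\<le>d. g k (d - k))"
  by (rule sum.reindex_bij_witness[of _ "\<lambda>k. (k, d - k)" "\<lambda>(k, m). k"]) auto

context splitting
begin

definition op_x :: "nat \<Rightarrow> entry list \<Rightarrow> 'k::field falg" where
  "op_x l i = (if l < L i then vx l else if l = L i then 0 else vx (l + 1))"

definition op_E :: "nat \<Rightarrow> nat \<Rightarrow> entry list \<Rightarrow> 'k::field falg" where
  "op_E d l i = (if l < L i then vE d l
    else if l = L i then \<Sum>(d1, d2) \<in> {(d1, d2). d1 + d2 = d}. vE d1 l * vE d2 (l + 1) else vE d (l + 1))"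

definition op_psi :: "nat \<Rightarrow> entry list \<Rightarrow> 'k::field falg" where
  "op_psi l i = (if l + 1 < L i then psi l
    else if l + 1 = L i then (if ent i l = Black then psi (l + 1) * psi l else 0)
    else if l = L i then (if ent i (l + 1) = Black then psi l * psi (l + 1) else 0)
    else psi (l + 1))"

definition phi_gen :: "gen \<Rightarrow> 'k::field falg" where
  "phi_gen g = (if is_gen s n g then (case g of
      GI i \<Rightarrow> idem (sp i)
    | GX l \<Rightarrow> \<Sum>i\<in>Seq s n. op_x l i * idem (sp i)
    | GE d l \<Rightarrow> \<Sum>i\<in>Seq s n. op_E d l i * idem (sp i)
    | GPsi l \<Rightarrow> \<Sum>i\<in>Seq s n. op_psi l i * idem (sp i)) else 0)"

end

locale phi_base = splitting s n j a + webster_rep "split_list j a s" n h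
  for s n j a and h :: "'k::field falg \<Rightarrow> 'q::ring_1"
begin

abbreviation "b1 \<equiv> s ! (j - 1) - a"
abbreviation "W i \<equiv> V (sp i)"
abbreviation "E2 d l \<equiv> conv (\<lambda>d. E d l) (\<lambda>d. E d (l + 1)) d"

lemma act_sum:
  assumes i: "i \<in> Seq s n" and v: "v \<in> W i"
  shows "h (\<Sum>k\<in>Seq s n. f k * idem (sp k)) * v = h (f i) * v"
proof -
  have "h (\<Sum>k\<in>Seq s n. f k * idem (sp k)) * v = (\<Sum>k\<in>Seq s n. if k = i then h (f i) * v else 0)"
    unfolding h_sum sum_distrib_right
  proof (rule sum.cong[OF refl])
    fix k assume k: "k \<in> Seq s n"
    have "k \<noteq> i \<Longrightarrow> sp i \<noteq> sp k" using inj_onD[OF sp_inj _ i k] by blast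
    then show "h (f k * idem (sp k)) * v = (if k = i then h (f i) * v else 0)"
      using VD[OF v] e_V_other[OF v] by (simp add: h_mult mult.assoc)
  qed
  then show ?thesis using i by (simp add: finite_Seq)
qed

lemma h_op_E_eq: "l = L i \<Longrightarrow> h (op_E d l i) = E2 d l"
  by (simp add: op_E_def sum_pairs h_sum h_mult conv_def)

lemma E2_commute:
  assumes "\<And>k. A * E k l = E k l * A" "\<And>k. A * E k (l + 1) = E k (l + 1) * A"
  shows "A * E2 d l = E2 d l * A"
proof -
  have "A * (E k l * E m (l + 1)) = E k l * E m (l + 1) * A" for k m
  proof -
    have "A * (E k l * E m (l + 1)) = A * E k l * E m (l + 1)" by (simp only: mult.assoc)
    also have "\<dots> = E k l * (A * E m (l + 1))" by (simp only: assms(1) mult.assoc)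
    also have "\<dots> = E k l * E m (l + 1) * A" by (simp only: assms(2) mult.assoc)
    finally show ?thesis .
  qed
  then show ?thesis by (simp add: conv_def sum_distrib_left sum_distrib_right)
qed

lemma E2_left_commute:
  assumes "\<And>k. A * E k l = E k l * A" "\<And>k. A * E k (l + 1) = E k (l + 1) * A"
  shows "A * (E2 d l * w) = E2 d l * (A * w)"
  using E2_commute[OF assms, of d] by (simp flip: mult.assoc)

lemma P_P_E2:
  "P l * (P (l + 1) * (E2 d l * w)) = E2 d (l + 1) * (P l * (P (l + 1) * w))"
  "P (l + 1) * (P l * (E2 d (l + 1) * w)) = E2 d l * (P (l + 1) * (P l * w))"
proof -
  have "P l * (P (l + 1) * (E k l * (E m (l + 1) * w))) = E k (l + 1) * (E m (l + 1 + 1) * (P l * (P (l + 1) * w)))"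
    "P (l + 1) * (P l * (E k (l + 1) * (E m (l + 1 + 1) * w))) = E k l * (E m (l + 1) * (P (l + 1) * (P l * w)))" for k m
    using E_P_far_left[of l "l + 1"] E_P_far_left[of "l + 1 + 1" l] by (simp_all only: E_P_left E_P_left')
  then show "P l * (P (l + 1) * (E2 d l * w)) = E2 d (l + 1) * (P l * (P (l + 1) * w))"
    "P (l + 1) * (P l * (E2 d (l + 1) * w)) = E2 d l * (P (l + 1) * (P l * w))"
    by (simp_all only: conv_def sum_distrib_left sum_distrib_right mult.assoc)
qed

lemma E2_V: "v \<in> V k \<Longrightarrow> E2 d l * v \<in> V k"
  by (simp only: conv_def sum_distrib_right mult.assoc) (intro V_sum E_V)

lemma op_x_V: "v \<in> V k \<Longrightarrow> h (op_x l i) * v \<in> V k"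
  by (auto simp: op_x_def h_zero V_zero X_V)

lemma op_E_V: "v \<in> V k \<Longrightarrow> h (op_E d l i) * v \<in> V k"
proof (cases "l = L i")
  case True
  then show "v \<in> V k \<Longrightarrow> ?thesis" by (simp only: h_op_E_eq E2_V)
qed (auto simp: op_E_def E_V)

lemma op_E_x: "h (op_E d l i) * h (op_x m i) = h (op_x m i) * h (op_E d l i)"
proof -
  have "E2 d l * Y r = Y r * E2 d l" for r
    by (rule E2_commute[symmetric]) (rule E_X[symmetric])+
  moreover have "E d l * Y r = Y r * E d l" for d l r by (rule E_X)
  ultimately show ?thesis
    using h_op_E_eq[of l i d] by (cases "l = L i") (auto simp: op_x_def op_E_def h_zero)
qed

lemma op_x_x: "h (op_x l i) * h (op_x m i) = h (op_x m i) * h (op_x l i)"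
  by (auto simp: op_x_def h_zero intro: X_X)

lemma op_E_E: "h (op_E d l i) * h (op_E d' m i) = h (op_E d' m i) * h (op_E d l i)"
proof -
  have 1: "E k r * h (op_E d' m i) = h (op_E d' m i) * E k r" for k r
  proof (cases "m = L i")
    case True
    show ?thesis unfolding h_op_E_eq[OF True] by (rule E2_commute) (rule webster_rep.E_E[OF webster_rep_axioms])+
  next
    case False
    then show ?thesis
      using webster_rep.E_E[OF webster_rep_axioms] by (auto simp: op_E_def)
  qed
  show ?thesis
  proof (cases "l = L i")
    case True
    show ?thesis unfolding h_op_E_eq[OF True] by (rule E2_commute[symmetric]) (rule 1[symmetric])+
  next
    case False
    then show ?thesis using 1 by (auto simp: op_E_def)
  qed
qed

lemma op_psi_rr:
  assumes i: "i \<in> Seq s n" and v: "v \<in> W i" and l: "1 \<le> l" and r: "is_red (ent i l)" "is_red (ent i (l + 1))"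
  shows "h (op_psi l i) * v = 0"
proof -
  consider "l + 1 < L i" | "l + 1 = L i" | "l = L i" | "L i < l" by linarith
  then show ?thesis
  proof cases
    case 1
    then have "ent (sp i) l = ent i l" "ent (sp i) (l + 1) = ent i (l + 1)" using ent_sp[OF i] l by auto
    with red_red_kill(1)[OF v, of l] r 1 show ?thesis by (simp add: op_psi_def)
  next
    case 4
    then have "ent (sp i) (l + 1) = ent i l \<or> l = L i + 0" "ent (sp i) (l + 1 + 1) = ent i (l + 1)"
      using ent_sp[OF i, of "l + 1"] ent_sp[OF i, of "l + 1 + 1"] by auto
    with red_red_kill(1)[OF v, of "l + 1"] r 4 show ?thesis by (simp add: op_psi_def)
  qed (use r in \<open>simp_all add: op_psi_def h_zero\<close>)
qed

lemma op_psi_W: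
  assumes i: "i \<in> Seq s n" and v: "v \<in> W i" and l: "1 \<le> l" "l + 1 \<le> length s + n"
    and b: "ent i l = Black \<or> ent i (l + 1) = Black"
  shows "h (op_psi l i) * v \<in> W (swap_entries l i)"
proof -
  note sw = sp_swap[OF i l b]
  have red: "is_red (ent i (L i))" using L_bounds[OF i] by simp
  consider "l + 1 < L i" | "l + 1 = L i" | "l = L i" | "L i < l" by linarith
  then show ?thesis
  proof cases
    case 1
    with sw P_V[OF v] show ?thesis by (simp add: op_psi_def)
  next
    case 2
    with b red have "ent i l = Black" by auto
    with 2 sw P_V[OF P_V[OF v]] show ?thesis by (simp add: op_psi_def h_mult mult.assoc)
  next
    case 3
    with b red have "ent i (l + 1) = Black" by auto
    with 3 sw(3)[OF 3] P_V[OF P_V[OF v]] show ?thesis by (simp add: op_psi_def h_mult mult.assoc)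
  next
    case 4
    with sw P_V[OF v] show ?thesis by (simp add: op_psi_def)
  qed
qed

end

locale phi_rep = phi_base s n j a h
  for s n j a and h :: "'k::field falg \<Rightarrow> 'q::ring_1" +
  fixes \<phi> :: "'k falg \<Rightarrow> 'q"
  assumes \<phi>_add: "\<phi> (b + c) = \<phi> b + \<phi> c" and \<phi>_mult: "\<phi> (b * c) = \<phi> b * \<phi> c"
    and \<phi>_letter: "\<phi> (letter g) = h (phi_gen g)" and \<phi>_one: "\<phi> 1 = (\<Sum>i\<in>Seq s n. e (sp i))"
begin

lemma \<phi>_zero: "\<phi> 0 = 0"
  using \<phi>_add[of 0 0] by simp

lemma \<phi>_uminus: "\<phi> (- r) = - \<phi> r"
  using \<phi>_add[of r "- r"] by (simp add: \<phi>_zero minus_unique)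

lemma \<phi>_diff: "\<phi> (q - r) = \<phi> q - \<phi> r"
  using \<phi>_add[of q "- r"] by (simp add: \<phi>_uminus)

lemma \<phi>_sum: "\<phi> (sum f A) = (\<Sum>x\<in>A. \<phi> (f x))"
  by (induction A rule: infinite_finite_induct) (auto simp: \<phi>_zero \<phi>_add)

lemma \<phi>_sign: "\<phi> ((-1) ^ d * r) = (-1) ^ d * \<phi> r"
  by (cases "even d") (auto simp: \<phi>_uminus)

lemma act_one: "i \<in> Seq s n \<Longrightarrow> v \<in> W i \<Longrightarrow> \<phi> 1 * v = v"
  using act_sum[of i v "\<lambda>_. 1"] by (simp add: \<phi>_one h_sum)

lemma \<phi>_idem: "i \<in> Seq s n \<Longrightarrow> \<phi> (idem i) = e (sp i)"
  by (simp add: idem_def \<phi>_letter phi_gen_def is_gen_def)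

lemma act_idem: "i \<in> Seq s n \<Longrightarrow> k \<in> Seq s n \<Longrightarrow> v \<in> W i \<Longrightarrow> \<phi> (idem k) * v = (if k = i then v else 0)"
proof -
  assume i: "i \<in> Seq s n" and k: "k \<in> Seq s n" and v: "v \<in> W i"
  show ?thesis
  proof (cases "k = i")
    case False
    then have "sp i \<noteq> sp k" using inj_onD[OF sp_inj _ i k] by blast
    with False k e_V_other[OF v] show ?thesis by (simp add: \<phi>_idem)
  qed (use i VD[OF v] in \<open>simp add: \<phi>_idem\<close>)
qed

lemma act_x: "i \<in> Seq s n \<Longrightarrow> v \<in> W i \<Longrightarrow> 1 \<le> l \<Longrightarrow> l \<le> length s + n \<Longrightarrow> \<phi> (vx l) * v = h (op_x l i) * v"
  by (simp add: vx_def \<phi>_letter phi_gen_def is_gen_def act_sum)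

lemma act_E: "i \<in> Seq s n \<Longrightarrow> v \<in> W i \<Longrightarrow> 1 \<le> l \<Longrightarrow> l \<le> length s + n \<Longrightarrow> \<phi> (vE d l) * v = h (op_E d l i) * v"
proof (cases "d = 0")
  case True
  assume "i \<in> Seq s n" "v \<in> W i"
  moreover have "conv (\<lambda>d. E d l) (\<lambda>d. E d (l + 1)) 0 * v = v"
    using \<open>v \<in> W i\<close> by (simp add: conv_def E_zero mult.assoc)
  ultimately show ?thesis
    using h_op_E_eq[of l i 0] by (cases "l = L i") (auto simp: True op_E_def vE_def act_one)
qed (simp add: vE_def \<phi>_letter phi_gen_def is_gen_def act_sum)

lemma act_psi: "i \<in> Seq s n \<Longrightarrow> v \<in> W i \<Longrightarrow> 1 \<le> l \<Longrightarrow> l + 1 \<le> length s + n \<Longrightarrow> \<phi> (psi l) * v = h (op_psi l i) * v"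
  by (simp add: psi_def \<phi>_letter phi_gen_def is_gen_def act_sum)

lemma act_x_pow: "i \<in> Seq s n \<Longrightarrow> v \<in> W i \<Longrightarrow> 1 \<le> l \<Longrightarrow> l \<le> length s + n \<Longrightarrow>
    \<phi> (vx l ^ k) * v = h (op_x l i) ^ k * v \<and> h (op_x l i) ^ k * v \<in> W i"
proof (induction k)
  case (Suc k)
  then show ?case using act_x[of i "h (op_x l i) ^ k * v" l] op_x_V[of "h (op_x l i) ^ k * v" "sp i" l i]
    by (simp add: \<phi>_mult mult.assoc)
qed (simp add: act_one)

lemma \<phi>_eq_0I:
  assumes "\<And>i v. i \<in> Seq s n \<Longrightarrow> v \<in> W i \<Longrightarrow> \<phi> r * v = 0"
  shows "\<phi> r = 0"
proof -
  have "\<phi> r = \<phi> r * \<phi> 1" by (simp flip: \<phi>_mult)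
  also have "\<dots> = 0" by (simp add: \<phi>_one sum_distrib_left assms e_V)
  finally show ?thesis .
qed

lemma op_psi_simps:
  "l + 1 < L i \<Longrightarrow> h (op_psi l i) = P l"
  "l + 1 = L i \<Longrightarrow> ent i l = Black \<Longrightarrow> h (op_psi l i) = P (l + 1) * P l"
  "l = L i \<Longrightarrow> ent i (l + 1) = Black \<Longrightarrow> h (op_psi l i) = P l * P (l + 1)"
  "L i < l \<Longrightarrow> h (op_psi l i) = P (l + 1)"
  by (simp_all add: op_psi_def h_mult)

lemma op_x_simps:
  "l < L i \<Longrightarrow> h (op_x l i) = Y l" "l = L i \<Longrightarrow> h (op_x l i) = 0" "L i < l \<Longrightarrow> h (op_x l i) = Y (l + 1)"
  by (simp_all add: op_x_def h_zero)

lemma op_E_simps: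
  "l < L i \<Longrightarrow> h (op_E d l i) = E d l" "L i < l \<Longrightarrow> h (op_E d l i) = E d (l + 1)"
  by (simp_all add: op_E_def)

context
  fixes i l
  assumes i: "i \<in> Seq s n" and l: "1 \<le> l" "l + 1 \<le> length s + n"
    and b: "ent i l = Black \<or> ent i (l + 1) = Black"
begin

lemma swapped:
  "swap_entries l i \<in> Seq s n"
  "l + 1 < L i \<Longrightarrow> L (swap_entries l i) = L i" "l + 1 = L i \<Longrightarrow> L (swap_entries l i) = l"
  "l = L i \<Longrightarrow> L (swap_entries l i) = l + 1" "L i < l \<Longrightarrow> L (swap_entries l i) = L i"
  using swap_Seq[OF i l(1) _ b] L_swap[OF i l(1) _ b] l length_Seq[OF i] by auto

lemma L_cases:
  obtains (lt) "l + 1 < L i" | (left) "l + 1 = L i" "ent i l = Black" | (right) "l = L i" "ent i (l + 1) = Black"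
    | (gt) "L i < l"
proof -
  have "is_red (ent i (L i))" using L_bounds[OF i] by simp
  then have "l + 1 = L i \<Longrightarrow> ent i l = Black" "l = L i \<Longrightarrow> ent i (l + 1) = Black" using b by auto
  moreover have "l + 1 < L i \<or> l + 1 = L i \<or> l = L i \<or> L i < l" by linarith
  ultimately show thesis using that by blast
qed

lemma psi_x_far_op:
  assumes m: "m \<noteq> l" "m \<noteq> l + 1"
  shows "h (op_psi l i) * (h (op_x m i) * w) = h (op_x m (swap_entries l i)) * (h (op_psi l i) * w)"
proof (cases rule: L_cases)
  case lt
  consider "m < L i" | "m = L i" | "L i < m" by linarith
  then show ?thesis
    by cases (use lt m swapped(2)[OF lt] Y_P_far_left in \<open>simp_all add: op_psi_simps op_x_simps\<close>)
next
  case left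
  consider "m < l" | "L i < m" using m left by linarith
  then show ?thesis
    by cases (use left m swapped(3)[OF left(1)] Y_P_far_left in \<open>simp_all add: op_psi_simps op_x_simps mult.assoc\<close>)
next
  case right
  consider "m < L i" | "l + 1 < m" using m right by linarith
  then show ?thesis
    by cases (use right m swapped(4)[OF right(1)] Y_P_far_left in \<open>simp_all add: op_psi_simps op_x_simps mult.assoc\<close>)
next
  case gt
  consider "m < L i" | "m = L i" | "L i < m" by linarith
  then show ?thesis
    by cases (use gt m swapped(5)[OF gt] Y_P_far_left in \<open>simp_all add: op_psi_simps op_x_simps\<close>)
qed

lemma psi_E_far_op:
  assumes m: "m \<noteq> l" "m \<noteq> l + 1"
  shows "h (op_psi l i) * (h (op_E d m i) * w) = h (op_E d m (swap_entries l i)) * (h (op_psi l i) * w)"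
proof (cases rule: L_cases)
  case lt
  consider "m < L i" | "m = L i" | "L i < m" by linarith
  then show ?thesis
  proof cases
    case 2
    have "P l * (E2 d m * w) = E2 d m * (P l * w)"
      by (rule E2_left_commute) (use P_E_far lt 2 in auto)
    with 2 lt swapped(2)[OF lt] show ?thesis by (simp add: op_psi_simps h_op_E_eq)
  qed (use lt m swapped(2)[OF lt] E_P_far_left in \<open>simp_all add: op_psi_simps op_E_simps\<close>)
next
  case left
  consider "m < l" | "L i < m" using m left by linarith
  then show ?thesis
    by cases (use left m swapped(3)[OF left(1)] E_P_far_left in \<open>simp_all add: op_psi_simps op_E_simps mult.assoc\<close>)
next
  case right
  consider "m < L i" | "l + 1 < m" using m right by linarith
  then show ?thesis
    by cases (use right m swapped(4)[OF right(1)] E_P_far_left in \<open>simp_all add: op_psi_simps op_E_simps mult.assoc\<close>)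
next
  case gt
  consider "m < L i" | "m = L i" | "L i < m" by linarith
  then show ?thesis
  proof cases
    case 2
    have "P (l + 1) * (E2 d m * w) = E2 d m * (P (l + 1) * w)"
      by (rule E2_left_commute) (use P_E_far gt 2 in auto)
    with 2 gt swapped(5)[OF gt] show ?thesis by (simp add: op_psi_simps h_op_E_eq)
  qed (use gt m swapped(5)[OF gt] E_P_far_left in \<open>simp_all add: op_psi_simps op_E_simps\<close>)
qed

lemma psi_E_op:
  "h (op_psi l i) * (h (op_E d l i) * w) = h (op_E d (l + 1) (swap_entries l i)) * (h (op_psi l i) * w)" (is ?A)
  "h (op_psi l i) * (h (op_E d (l + 1) i) * w) = h (op_E d l (swap_entries l i)) * (h (op_psi l i) * w)" (is ?B)
proof -
  have "?A \<and> ?B"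
  proof (cases rule: L_cases)
    case lt
    then show ?thesis
      using swapped(2)[OF lt] E_P_left[of d l w] E_P_left'[of d l w] by (simp add: op_psi_simps op_E_simps)
  next
    case left
    have "P (l + 1) * (P l * (E d l * w)) = E d (l + 1 + 1) * (P (l + 1) * (P l * w))"
      by (simp only: E_P_left')
    with left show ?thesis
      using swapped(3)[OF left(1)] P_P_E2(2)[of l d w] h_op_E_eq[of "l + 1" i] h_op_E_eq[of l "swap_entries l i"]
      by (simp add: op_psi_simps op_E_simps mult.assoc)
  next
    case right
    have "P l * (P (l + 1) * (E d (l + 1 + 1) * w)) = E d l * (P l * (P (l + 1) * w))"
      by (simp only: E_P_left)
    with right(2) show ?thesis
      using swapped(4)[OF right(1)] P_P_E2(1)[of l d w] h_op_E_eq[of l i] h_op_E_eq[of "l + 1" "swap_entries l i"] right(1)[symmetric]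
      by (simp add: op_psi_simps op_E_simps mult.assoc)
  next
    case gt
    then show ?thesis
      using swapped(5)[OF gt] E_P_left[of d "l + 1" w] E_P_left'[of d "l + 1" w] by (simp add: op_psi_simps op_E_simps)
  qed
  then show ?A ?B by auto
qed

end

lemma P_P_far_left: "l + 1 < m \<Longrightarrow> P m * (P l * w) = P l * (P m * w)"
  using P_P_far[of m l] by (simp flip: mult.assoc)

lemma psi_psi_far_op:
  assumes i: "i \<in> Seq s n" and l: "1 \<le> l" "l + 1 < m" "m + 1 \<le> length s + n"
    and b: "ent i l = Black \<or> ent i (l + 1) = Black" "ent i m = Black \<or> ent i (m + 1) = Black"
  shows "h (op_psi l (swap_entries m i)) * (h (op_psi m i) * w) = h (op_psi m (swap_entries l i)) * (h (op_psi l i) * w)"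
proof -
  have l': "l + 1 \<le> length s + n" "1 \<le> m" using l by auto
  note sl = swapped[OF i l(1) l'(1) b(1)] and sm = swapped[OF i l'(2) l(3) b(2)]
  have ent: "ent (swap_entries m i) l = ent i l" "ent (swap_entries m i) (l + 1) = ent i (l + 1)"
    "ent (swap_entries l i) m = ent i m" "ent (swap_entries l i) (m + 1) = ent i (m + 1)"
    using l by (intro ent_swap_other; linarith)+
  note far = P_P_far_left[of l m] P_P_far_left[of l "m + 1"] P_P_far_left[of "l + 1" "m + 1"]
    P_P_far_left[of "l" "m + 1"]
  show ?thesis
  proof (cases rule: L_cases[OF i l(1) l'(1) b(1), case_names lt left right gt])
    case lt
    show ?thesis
    proof (cases rule: L_cases[OF i l'(2) l(3) b(2), case_names lt left right gt])
      case lt': lt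
      show ?thesis using sl(2)[OF lt] sm(2)[OF lt'] lt lt' far l by (simp add: op_psi_simps)
    next
      case left
      show ?thesis using sl(2)[OF lt] sm(3)[OF left(1)] lt left far l ent by (simp add: op_psi_simps mult.assoc)
    next
      case right
      show ?thesis using sl(2)[OF lt] sm(4)[OF right(1)] lt right(1)[symmetric] right(2) far l ent by (simp add: op_psi_simps mult.assoc)
    next
      case gt
      show ?thesis using sl(2)[OF lt] sm(5)[OF gt] lt gt far l by (simp add: op_psi_simps)
    qed
  next
    case left
    then have gt: "L i < m" using l by simp
    show ?thesis using sl(3)[OF left(1)] sm(5)[OF gt] left gt far l ent by (simp add: op_psi_simps mult.assoc)
  next
    case right
    then have gt: "L i < m" using l by simp
    show ?thesis using sl(4)[OF right(1)] sm(5)[OF gt] right(1)[symmetric] right(2) gt far l ent by (simp add: op_psi_simps mult.assoc)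
  next
    case gt
    then have gt': "L i < m" using l by simp
    show ?thesis using sl(5)[OF gt] sm(5)[OF gt'] gt gt' far l by (simp add: op_psi_simps)
  qed
qed

lemma ent_sp_lt: "i \<in> Seq s n \<Longrightarrow> 1 \<le> q \<Longrightarrow> q < L i \<Longrightarrow> ent (sp i) q = ent i q"
  and ent_sp_gt: "i \<in> Seq s n \<Longrightarrow> L i < q \<Longrightarrow> ent (sp i) (q + 1) = ent i q"
  and ent_sp_L: "i \<in> Seq s n \<Longrightarrow> ent (sp i) (L i) = Red b1" "i \<in> Seq s n \<Longrightarrow> ent (sp i) (L i + 1) = Red a"
  using ent_sp[of i q] ent_sp[of i "q + 1"] ent_sp[of i "L i"] ent_sp[of i "L i + 1"] L_bounds(1)[of i] by auto

lemma psi_x_bb_op: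
  assumes i: "i \<in> Seq s n" and v: "v \<in> W i" and l: "1 \<le> l" "l + 1 \<le> length s + n"
    and b: "ent i l = Black" "ent i (l + 1) = Black"
  shows "h (op_x l (swap_entries l i)) * (h (op_psi l i) * v) = h (op_psi l i) * (h (op_x (l + 1) i) * v) + v" (is ?A)
    "h (op_psi l i) * (h (op_x l i) * v) = h (op_x (l + 1) (swap_entries l i)) * (h (op_psi l i) * v) + v" (is ?B)
proof -
  have red: "is_red (ent i (L i))" using L_bounds[OF i] by simp
  then have ne: "l \<noteq> L i" "l + 1 \<noteq> L i" using b by auto
  then consider "l + 1 < L i" | "L i < l" by linarith
  then have "?A \<and> ?B"
  proof cases
    case 1
    then show ?thesis
      using swapped(2)[OF i l _ 1] b X_P_bb[OF v, of l] P_X_bb[OF v, of l] ent_sp_lt[OF i, of l] ent_sp_lt[OF i, of "l + 1"] l length_t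
      by (simp add: op_psi_simps op_x_simps)
  next
    case 2
    then show ?thesis
      using swapped(5)[OF i l _ 2] b X_P_bb[OF v, of "l + 1"] P_X_bb[OF v, of "l + 1"]
        ent_sp_gt[OF i, of l] ent_sp_gt[OF i, of "l + 1"] l length_t
      by (simp add: op_psi_simps op_x_simps)
  qed
  then show ?A ?B by auto
qed

lemma psi_x_rb_op:
  assumes i: "i \<in> Seq s n" and v: "v \<in> W i" and l: "1 \<le> l" "l + 1 \<le> length s + n"
    and b: "ent i l = Red c" "ent i (l + 1) = Black"
  shows "h (op_x l (swap_entries l i)) * (h (op_psi l i) * v) = h (op_psi l i) * (h (op_x (l + 1) i) * v)"
proof (cases rule: L_cases[OF i l disjI2[OF b(2)], case_names lt left right gt])
  case lt
  then show ?thesis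
    using swapped(2)[OF i l _ lt] b X_P_rb[OF v, of l] ent_sp_lt[OF i, of l] ent_sp_lt[OF i, of "l + 1"] l
    by (simp add: op_psi_simps op_x_simps)
next
  case right
  have e: "ent (sp i) (l + 1) = Red a" "ent (sp i) (l + 1 + 1) = Black"
    using ent_sp_L[OF i] ent_sp_gt[OF i, of "l + 1"] right by auto
  have w: "P (l + 1) * v \<in> V (swap_entries (l + 1) (sp i))" by (rule P_V[OF v])
  have e': "ent (swap_entries (l + 1) (sp i)) l = Red b1" "ent (swap_entries (l + 1) (sp i)) (l + 1) = Black"
    using ent_sp_L[OF i] right e l length_sp[OF i] by (simp_all add: ent_swap)
  show ?thesis
    using swapped(4)[OF i l _ right(1)] right(1)[symmetric] right(2) b X_P_rb[OF w e'] X_P_rb[OF v e]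
    by (simp add: op_psi_simps op_x_simps mult.assoc)
next
  case gt
  then show ?thesis
    using swapped(5)[OF i l _ gt] b X_P_rb[OF v, of "l + 1"] ent_sp_gt[OF i, of l] ent_sp_gt[OF i, of "l + 1"] l
    by (simp add: op_psi_simps op_x_simps)
qed (use b in simp)

lemma psi_x_br_op:
  assumes i: "i \<in> Seq s n" and v: "v \<in> W i" and l: "1 \<le> l" "l + 1 \<le> length s + n"
    and b: "ent i l = Black" "ent i (l + 1) = Red c"
  shows "h (op_psi l i) * (h (op_x l i) * v) = h (op_x (l + 1) (swap_entries l i)) * (h (op_psi l i) * v)"
proof (cases rule: L_cases[OF i l disjI1[OF b(1)], case_names lt left right gt])
  case lt
  then show ?thesis
    using swapped(2)[OF i l _ lt] b P_X_br[OF v, of l] ent_sp_lt[OF i, of l] ent_sp_lt[OF i, of "l + 1"] l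
    by (simp add: op_psi_simps op_x_simps)
next
  case left
  have e: "ent (sp i) l = Black" "ent (sp i) (l + 1) = Red b1"
    using ent_sp_L[OF i] ent_sp_lt[OF i, of l] left l by auto
  have w: "P l * v \<in> V (swap_entries l (sp i))" by (rule P_V[OF v])
  have e': "ent (swap_entries l (sp i)) (l + 1) = Black" "ent (swap_entries l (sp i)) (l + 1 + 1) = Red a"
    using ent_sp_L[OF i] left e l length_sp[OF i] by (simp_all add: ent_swap)
  show ?thesis
    using swapped(3)[OF i l _ left(1)] left b P_X_br[OF w e'] P_X_br[OF v e]
    by (simp add: op_psi_simps op_x_simps mult.assoc)
next
  case gt
  then show ?thesis
    using swapped(5)[OF i l _ gt] b P_X_br[OF v, of "l + 1"] ent_sp_gt[OF i, of l] ent_sp_gt[OF i, of "l + 1"] l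
    by (simp add: op_psi_simps op_x_simps)
qed (use b in simp)

end

context phi_rep
begin

lemma chi_commute:
  assumes "\<And>d. A * F d = F d * A" "A * x = x * A"
  shows "A * (chi c F x * w) = chi c F x * (A * (w :: 'q))"
  by (rule intertwine_chi[where Z = UNIV]) (simp_all only: assms mult.assoc[symmetric] UNIV_I)

lemma chi_chi_commute: "chi c (\<lambda>d. E d p) (Y q) * (chi c' (\<lambda>d. E d p') (Y q) * w)
    = chi c' (\<lambda>d. E d p') (Y q) * (chi c (\<lambda>d. E d p) (Y q) * w)"
proof -
  have "E d r * chi c (\<lambda>d. E d p) (Y q) = chi c (\<lambda>d. E d p) (Y q) * E d r" for d r
    using chi_commute[of "E d r" "\<lambda>d. E d p" "Y q" c 1] webster_rep.E_E[OF webster_rep_axioms] E_X by simp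
  moreover have "Y q * chi c (\<lambda>d. E d p) (Y q) = chi c (\<lambda>d. E d p) (Y q) * Y q"
    using chi_commute[of "Y q" "\<lambda>d. E d p" "Y q" c 1] E_X by simp
  ultimately show ?thesis by (intro chi_commute) simp_all
qed

lemma hs_V: "v \<in> V k \<Longrightarrow> hs r (Y p) (Y q) * v \<in> V k"
  by (auto simp: hs_def hsum_def sum_distrib_right mult.assoc intro!: V_sum X_pow_V V_zero)

lemma E_E_zero:
  assumes "w \<in> V k" "ent k p = Red c1" "ent k q = Red c2"
  shows "c1 < d \<Longrightarrow> E d p * (E d' q * w) = 0" "c2 < d' \<Longrightarrow> E d p * (E d' q * w) = 0"
  using E_large[OF E_V[OF assms(1)] assms(2)] E_large[OF assms(1,3)] by auto

lemma chi_E2: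
  assumes "v \<in> V k" "ent k l = Red c1" "ent k (l + 1) = Red c2"
  shows "chi (c1 + c2) (\<lambda>d. E2 d l) (Y p) * v
    = chi c1 (\<lambda>d. E d l) (Y p) * (chi c2 (\<lambda>d. E d (l + 1)) (Y p) * v)"
  using E_E_zero[OF X_pow_V[OF assms(1)] assms(2,3)] by (intro chi_conv) (simp_all add: E_X)

lemma dquot_E2:
  assumes "v \<in> V k" "ent k l = Red c1" "ent k (l + 1) = Red c2"
  shows "dquot (c1 + c2) (\<lambda>d. E2 d l) (Y p) (Y q) * v
    = dquot c2 (\<lambda>d. E d (l + 1)) (Y p) (Y q) * (chi c1 (\<lambda>d. E d l) (Y p) * v)
      + dquot c1 (\<lambda>d. E d l) (Y p) (Y q) * (chi c2 (\<lambda>d. E d (l + 1)) (Y q) * v)"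
  using E_E_zero[OF hs_V[OF assms(1)] assms(2,3)]
  by (intro dquot_conv) (simp_all add: E_X X_X webster_rep.E_E[OF webster_rep_axioms, of _ "l + 1" _ l, simplified])

lemma merged: "i \<in> Seq s n \<Longrightarrow> l = L i \<Longrightarrow> ent i l = Red c \<Longrightarrow> c = b1 + a"
  using L_bounds(4)[of i] local.a by simp

lemma psi_sq_bb_op:
  assumes i: "i \<in> Seq s n" and v: "v \<in> W i" and l: "1 \<le> l" "l + 1 \<le> length s + n"
    and b: "ent i l = Black" "ent i (l + 1) = Black"
  shows "h (op_psi l (swap_entries l i)) * (h (op_psi l i) * v) = 0"
proof -
  have red: "is_red (ent i (L i))" using L_bounds[OF i] by simp
  then have ne: "l \<noteq> L i" "l + 1 \<noteq> L i" using b by auto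
  then consider "l + 1 < L i" | "L i < l" by linarith
  then show ?thesis
  proof cases
    case 1
    then show ?thesis
      using swapped(2)[OF i l _ 1] b P_P_bb[OF v, of l] ent_sp_lt[OF i, of l] ent_sp_lt[OF i, of "l + 1"] l
      by (simp add: op_psi_simps)
  next
    case 2
    then show ?thesis
      using swapped(5)[OF i l _ 2] b P_P_bb[OF v, of "l + 1"] ent_sp_gt[OF i, of l] ent_sp_gt[OF i, of "l + 1"] l
      by (simp add: op_psi_simps)
  qed
qed

lemma psi_sq_rb_op:
  assumes i: "i \<in> Seq s n" and v: "v \<in> W i" and l: "1 \<le> l" "l + 1 \<le> length s + n"
    and b: "ent i l = Red c" "ent i (l + 1) = Black"
  shows "h (op_psi l (swap_entries l i)) * (h (op_psi l i) * v)
    = chi c (\<lambda>d. h (op_E d l i)) (h (op_x (l + 1) i)) * v"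
proof (cases rule: L_cases[OF i l disjI2[OF b(2)], case_names lt left right gt])
  case lt
  then show ?thesis
    using swapped(2)[OF i l _ lt] b P_P_rb[OF v, of l c] ent_sp_lt[OF i, of l] ent_sp_lt[OF i, of "l + 1"] l length_t
    by (simp add: op_psi_simps op_x_simps op_E_simps)
next
  case right
  define i1 where "i1 = swap_entries (l + 1) (sp i)"
  have len: "l + 1 + 1 \<le> length t + n" "l + 1 \<le> length t + n" using l length_t by auto
  have e: "ent (sp i) l = Red b1" "ent (sp i) (l + 1) = Red a" "ent (sp i) (l + 1 + 1) = Black"
    using ent_sp_L[OF i] ent_sp_gt[OF i, of "l + 1"] right by auto
  have e1: "ent i1 l = Red b1" "ent i1 (l + 1) = Black" "ent i1 (l + 1 + 1) = Red a"
    using e l length_sp[OF i] unfolding i1_def by (simp_all add: ent_swap)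
  have w: "P (l + 1) * v \<in> V i1" unfolding i1_def by (rule P_V[OF v])
  have k: "ent (swap_entries l i) l = Black" using b l length_Seq[OF i] by (simp add: ent_swap)
  have "h (op_psi l (swap_entries l i)) * (h (op_psi l i) * v) = P (l + 1) * (P l * (P l * (P (l + 1) * v)))"
    using swapped(4)[OF i l _ right(1)] b right(1)[symmetric] right(2) k
    by (simp add: op_psi_simps mult.assoc)
  also have "\<dots> = P (l + 1) * (chi b1 (\<lambda>d. E d l) (Y (l + 1)) * (P (l + 1) * v))"
    by (simp only: P_P_rb[OF w e1(1,2) l(1) len(2)])
  also have "\<dots> = chi b1 (\<lambda>d. E d l) (Y (l + 1 + 1)) * (P (l + 1) * (P (l + 1) * v))"
  proof (rule intertwine_chi[where Z = "V i1"])
    show "P (l + 1) * (E d l * w) = E d l * (P (l + 1) * w)" for d w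
      using E_P_far_left[of l "l + 1"] by simp
    show "P (l + 1) * (Y (l + 1) * w) = Y (l + 1 + 1) * (P (l + 1) * w)" if "w \<in> V i1" for w
      by (rule P_X_br[OF that e1(2,3)])
  qed (use w in \<open>auto intro: X_V\<close>)
  also have "P (l + 1) * (P (l + 1) * v) = chi a (\<lambda>d. E d (l + 1)) (Y (l + 1 + 1)) * v"
    by (rule P_P_rb[OF v e(2,3) _ len(1)]) simp
  also have "chi b1 (\<lambda>d. E d l) (Y (l + 1 + 1)) * \<dots> = chi (b1 + a) (\<lambda>d. E2 d l) (Y (l + 1 + 1)) * v"
    by (rule chi_E2[OF v e(1,2), symmetric])
  finally show ?thesis
    using merged[OF i right(1) b(1)] right(1) h_op_E_eq[OF right(1)] by (simp add: op_x_simps)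
next
  case gt
  then show ?thesis
    using swapped(5)[OF i l _ gt] b P_P_rb[OF v, of "l + 1" c] ent_sp_gt[OF i, of l] ent_sp_gt[OF i, of "l + 1"] l length_t
    by (simp add: op_psi_simps op_x_simps op_E_simps)
qed (use b in simp)

lemma psi_sq_br_op:
  assumes i: "i \<in> Seq s n" and v: "v \<in> W i" and l: "1 \<le> l" "l + 1 \<le> length s + n"
    and b: "ent i l = Black" "ent i (l + 1) = Red c"
  shows "h (op_psi l (swap_entries l i)) * (h (op_psi l i) * v)
    = chi c (\<lambda>d. h (op_E d (l + 1) i)) (h (op_x l i)) * v"
proof (cases rule: L_cases[OF i l disjI1[OF b(1)], case_names lt left right gt])
  case lt
  then show ?thesis
    using swapped(2)[OF i l _ lt] b P_P_br[OF v, of l c] ent_sp_lt[OF i, of l] ent_sp_lt[OF i, of "l + 1"] l length_t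
    by (simp add: op_psi_simps op_x_simps op_E_simps)
next
  case left
  define i1 where "i1 = swap_entries l (sp i)"
  have len: "l + 1 + 1 \<le> length t + n" "l + 1 \<le> length t + n" using l length_t by auto
  have e: "ent (sp i) l = Black" "ent (sp i) (l + 1) = Red b1" "ent (sp i) (l + 1 + 1) = Red a"
    using ent_sp_L[OF i] ent_sp_lt[OF i, of l] left l by auto
  have e1: "ent i1 l = Red b1" "ent i1 (l + 1) = Black" "ent i1 (l + 1 + 1) = Red a"
    using e l length_sp[OF i] unfolding i1_def by (simp_all add: ent_swap)
  have w: "P l * v \<in> V i1" unfolding i1_def by (rule P_V[OF v])
  have k: "ent (swap_entries l i) (l + 1) = Black" using b l length_Seq[OF i] by (simp add: ent_swap)
  have "h (op_psi l (swap_entries l i)) * (h (op_psi l i) * v) = P l * (P (l + 1) * (P (l + 1) * (P l * v)))"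
    using swapped(3)[OF i l _ left(1)] b left k by (simp add: op_psi_simps mult.assoc)
  also have "\<dots> = P l * (chi a (\<lambda>d. E d (l + 1 + 1)) (Y (l + 1)) * (P l * v))"
    by (subst P_P_br[OF w e1(2,3) _ len(1)]) simp_all
  also have "\<dots> = chi a (\<lambda>d. E d (l + 1 + 1)) (Y l) * (P l * (P l * v))"
  proof (rule intertwine_chi[where Z = "V i1"])
    show "P l * (E d (l + 1 + 1) * w) = E d (l + 1 + 1) * (P l * w)" for d w
      using E_P_far_left[of "l + 1 + 1" l] by simp
    show "P l * (Y (l + 1) * w) = Y l * (P l * w)" if "w \<in> V i1" for w
      by (rule X_P_rb[OF that e1(1,2), symmetric])
  qed (use w in \<open>auto intro: X_V\<close>)
  also have "P l * (P l * v) = chi b1 (\<lambda>d. E d (l + 1)) (Y l) * v"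
    by (rule P_P_br[OF v e(1,2) l(1) len(2)])
  also have "chi a (\<lambda>d. E d (l + 1 + 1)) (Y l) * \<dots> = chi b1 (\<lambda>d. E d (l + 1)) (Y l) * (chi a (\<lambda>d. E d (l + 1 + 1)) (Y l) * v)"
    by (rule chi_chi_commute)
  also have "\<dots> = chi (b1 + a) (\<lambda>d. E2 d (l + 1)) (Y l) * v"
    by (rule chi_E2[OF v e(2,3), symmetric])
  finally show ?thesis
    using merged[OF i left(1) b(2)] left(1) h_op_E_eq[OF left(1)] by (simp add: op_x_simps)
next
  case gt
  then show ?thesis
    using swapped(5)[OF i l _ gt] b P_P_br[OF v, of "l + 1" c] ent_sp_gt[OF i, of l] ent_sp_gt[OF i, of "l + 1"] l length_t
    by (simp add: op_psi_simps op_x_simps op_E_simps)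
qed (use b in simp)

lemma act_psi_rr:
  "i \<in> Seq s n \<Longrightarrow> v \<in> W i \<Longrightarrow> 1 \<le> l \<Longrightarrow> l + 1 \<le> length s + n \<Longrightarrow> is_red (ent i l) \<Longrightarrow> is_red (ent i (l + 1)) \<Longrightarrow>
    \<phi> (psi l) * v = 0"
  by (simp add: act_psi op_psi_rr)

lemma act_psi_W:
  "i \<in> Seq s n \<Longrightarrow> v \<in> W i \<Longrightarrow> 1 \<le> l \<Longrightarrow> l + 1 \<le> length s + n \<Longrightarrow> ent i l = Black \<or> ent i (l + 1) = Black \<Longrightarrow>
    \<phi> (psi l) * v \<in> W (swap_entries l i)"
  by (simp only: act_psi op_psi_W)

lemma \<phi>_PPP: "\<phi> (psi k * psi l * psi m) * v = \<phi> (psi k) * (\<phi> (psi l) * (\<phi> (psi m) * v))"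
  by (simp add: \<phi>_mult mult.assoc)

context
  fixes i l v
  assumes i: "i \<in> Seq s n" and v: "v \<in> W i" and l: "1 \<le> l" "l + 2 \<le> length s + n"
begin

lemma lens: "l < length i" "l + 1 < length i" "length i = length s + n" "l + 1 \<le> length s + n" "l + 1 + 1 \<le> length s + n"
  "length (sp i) = length s + n + 1" "l + 2 \<le> length t + n"  "l + 3 \<le> length t + n"
  using l length_Seq[OF i] length_sp[OF i] length_t by auto

lemma phi_braid_lt:
  assumes lt: "l + 2 < L i"
  shows "\<phi> (psi l * psi (l + 1) * psi l) * v = P l * (P (l + 1) * (P l * v))"
    "\<phi> (psi (l + 1) * psi l * psi (l + 1)) * v = P (l + 1) * (P l * (P (l + 1) * v))"
proof -
  define Z where "Z = {w. \<exists>k\<in>Seq s n. w \<in> W k \<and> l + 2 < L k}"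
  have Z: "\<phi> (psi q) * w = P q * w \<and> P q * w \<in> Z" if "w \<in> Z" "q = l \<or> q = l + 1" for w q
  proof -
    from that obtain k where k: "k \<in> Seq s n" "w \<in> W k" "l + 2 < L k" by (auto simp: Z_def)
    have q: "1 \<le> q" "q + 1 \<le> length s + n" "q + 1 < L k" using that(2) l k(3) by auto
    have *: "\<phi> (psi q) * w = P q * w" using act_psi[OF k(1,2) q(1,2)] q(3) by (simp add: op_psi_simps)
    show ?thesis
    proof (cases "ent k q = Black \<or> ent k (q + 1) = Black")
      case True
      have "\<phi> (psi q) * w \<in> W (swap_entries q k)" by (rule act_psi_W[OF k(1,2) q(1,2) True])
      with * swapped(1,2)[OF k(1) q(1,2) True] q(3) k(3) show ?thesis by (auto simp: Z_def)
    next
      case False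
      then have "\<phi> (psi q) * w = 0" using act_psi_rr[OF k(1,2) q(1,2)] by auto
      with * k V_zero show ?thesis by (auto simp: Z_def)
    qed
  qed
  have "v \<in> Z" using i v lt by (auto simp: Z_def)
  then show "\<phi> (psi l * psi (l + 1) * psi l) * v = P l * (P (l + 1) * (P l * v))"
    "\<phi> (psi (l + 1) * psi l * psi (l + 1)) * v = P (l + 1) * (P l * (P (l + 1) * v))"
    by (simp_all add: \<phi>_PPP Z)
qed

lemma phi_braid_gt:
  assumes gt: "L i < l"
  shows "\<phi> (psi l * psi (l + 1) * psi l) * v = P (l + 1) * (P (l + 2) * (P (l + 1) * v))"
    "\<phi> (psi (l + 1) * psi l * psi (l + 1)) * v = P (l + 2) * (P (l + 1) * (P (l + 2) * v))"
proof -
  define Z where "Z = {w. \<exists>k\<in>Seq s n. w \<in> W k \<and> L k < l}"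
  have Z: "\<phi> (psi q) * w = P (q + 1) * w \<and> P (q + 1) * w \<in> Z" if "w \<in> Z" "q = l \<or> q = l + 1" for w q
  proof -
    from that obtain k where k: "k \<in> Seq s n" "w \<in> W k" "L k < l" by (auto simp: Z_def)
    have q: "1 \<le> q" "q + 1 \<le> length s + n" "L k < q" using that(2) l k(3) by auto
    have *: "\<phi> (psi q) * w = P (q + 1) * w" using act_psi[OF k(1,2) q(1,2)] q(3) by (simp add: op_psi_simps)
    show ?thesis
    proof (cases "ent k q = Black \<or> ent k (q + 1) = Black")
      case True
      have "\<phi> (psi q) * w \<in> W (swap_entries q k)" by (rule act_psi_W[OF k(1,2) q(1,2) True])
      with * swapped(1,5)[OF k(1) q(1,2) True] q(3) k(3) show ?thesis by (auto simp: Z_def)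
    next
      case False
      then have "\<phi> (psi q) * w = 0" using act_psi_rr[OF k(1,2) q(1,2)] by auto
      with * k V_zero show ?thesis by (auto simp: Z_def)
    qed
  qed
  have "v \<in> Z" using i v gt by (auto simp: Z_def)
  then show "\<phi> (psi l * psi (l + 1) * psi l) * v = P (l + 1) * (P (l + 2) * (P (l + 1) * v))"
    "\<phi> (psi (l + 1) * psi l * psi (l + 1)) * v = P (l + 2) * (P (l + 1) * (P (l + 2) * v))"
    using Z[of _ l] Z[of _ "l + 1"] by (simp_all add: \<phi>_PPP)
qed

lemma phi_braid_red:
  assumes r: "is_red (ent i l) \<and> is_red (ent i (l + 1)) \<or> is_red (ent i l) \<and> is_red (ent i (l + 2))
      \<or> is_red (ent i (l + 1)) \<and> is_red (ent i (l + 2))"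
  shows "\<phi> (psi l * psi (l + 1) * psi l) * v = 0" "\<phi> (psi (l + 1) * psi l * psi (l + 1)) * v = 0"
proof -
  define i1 where "i1 = swap_entries l i"
  define i2 where "i2 = swap_entries (l + 1) i1"
  define k1 where "k1 = swap_entries (l + 1) i"
  define k2 where "k2 = swap_entries l k1"
  have e1: "ent i1 l = ent i (l + 1)" "ent i1 (l + 1) = ent i l" "ent i1 (l + 1 + 1) = ent i (l + 2)"
    "ent k1 l = ent i l" "ent k1 (l + 1) = ent i (l + 2)" "ent k1 (l + 1 + 1) = ent i (l + 1)"
    using lens l by (auto simp: i1_def k1_def ent_swap)
  have l1: "length i1 = length i" "length k1 = length i" by (simp_all add: i1_def k1_def)
  have e2: "ent i2 l = ent i (l + 1)" "ent i2 (l + 1) = ent i (l + 2)" "ent k2 (l + 1) = ent i l" "ent k2 (l + 1 + 1) = ent i (l + 1)"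
    using lens l e1 l1 by (auto simp: i2_def k2_def ent_swap)
  have step: "\<phi> (psi q) * w = 0 \<or> swap_entries q k \<in> Seq s n \<and> \<phi> (psi q) * w \<in> W (swap_entries q k)"
    if "k \<in> Seq s n" "w \<in> W k" "q = l \<or> q = l + 1" for k w q
  proof -
    have q: "1 \<le> q" "q + 1 \<le> length s + n" using that(3) l by auto
    show ?thesis
      using act_psi_rr[OF that(1,2) q] act_psi_W[OF that(1,2) q] swapped(1)[OF that(1) q] by blast
  qed
  have kill: "\<phi> (psi q) * w = 0" if "k \<in> Seq s n" "w \<in> W k" "q = l \<or> q = l + 1" "is_red (ent k q)" "is_red (ent k (q + 1))" for k w q
    by (rule act_psi_rr[OF that(1,2) _ _ that(4,5)]) (use that(3) l in auto)
  have "\<phi> (psi l) * (\<phi> (psi (l + 1)) * (\<phi> (psi l) * v)) = 0"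
  proof (cases "\<phi> (psi l) * v = 0")
    case False
    then have s1: "i1 \<in> Seq s n" "\<phi> (psi l) * v \<in> W i1" using step[OF i v, of l] by (auto simp: i1_def)
    show ?thesis
    proof (cases "\<phi> (psi (l + 1)) * (\<phi> (psi l) * v) = 0")
      case F2: False
      then have s2: "i2 \<in> Seq s n" "\<phi> (psi (l + 1)) * (\<phi> (psi l) * v) \<in> W i2"
        using step[OF s1, of "l + 1"] by (auto simp: i2_def)
      have "\<not> (is_red (ent i l) \<and> is_red (ent i (l + 1)))" using kill[OF i v, of l] False by auto
      moreover have "\<not> (is_red (ent i l) \<and> is_red (ent i (l + 2)))" using kill[OF s1, of "l + 1"] F2 e1 by auto
      ultimately show ?thesis using kill[OF s2, of l] r e2 by auto
    qed simp
  qed simp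
  then show "\<phi> (psi l * psi (l + 1) * psi l) * v = 0" by (simp only: \<phi>_PPP)
  have "\<phi> (psi (l + 1)) * (\<phi> (psi l) * (\<phi> (psi (l + 1)) * v)) = 0"
  proof (cases "\<phi> (psi (l + 1)) * v = 0")
    case False
    then have s1: "k1 \<in> Seq s n" "\<phi> (psi (l + 1)) * v \<in> W k1" using step[OF i v, of "l + 1"] by (auto simp: k1_def)
    show ?thesis
    proof (cases "\<phi> (psi l) * (\<phi> (psi (l + 1)) * v) = 0")
      case F2: False
      then have s2: "k2 \<in> Seq s n" "\<phi> (psi l) * (\<phi> (psi (l + 1)) * v) \<in> W k2"
        using step[OF s1, of l] by (auto simp: k2_def)
      have "\<not> (is_red (ent i (l + 1)) \<and> is_red (ent i (l + 2)))" using kill[OF i v, of "l + 1"] False by auto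
      moreover have "\<not> (is_red (ent i l) \<and> is_red (ent i (l + 2)))" using kill[OF s1, of l] F2 e1 by auto
      ultimately show ?thesis using kill[OF s2, of "l + 1"] r e2 by auto
    qed simp
  qed simp
  then show "\<phi> (psi (l + 1) * psi l * psi (l + 1)) * v = 0" by (simp only: \<phi>_PPP)
qed

lemma phi_braid_words:
  shows "L i = l \<Longrightarrow> ent i (l + 1) = Black \<Longrightarrow> ent i (l + 2) = Black \<Longrightarrow>
      \<phi> (psi l * psi (l + 1) * psi l) * v = P l * (P (l + 1) * (P (l + 2) * (P l * (P (l + 1) * v)))) \<and>
      \<phi> (psi (l + 1) * psi l * psi (l + 1)) * v = P (l + 1) * (P (l + 2) * (P l * (P (l + 1) * (P (l + 2) * v))))"
    and "L i = l + 2 \<Longrightarrow> ent i l = Black \<Longrightarrow> ent i (l + 1) = Black \<Longrightarrow>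
      \<phi> (psi l * psi (l + 1) * psi l) * v = P (l + 1) * (P l * (P (l + 2) * (P (l + 1) * (P l * v)))) \<and>
      \<phi> (psi (l + 1) * psi l * psi (l + 1)) * v = P (l + 2) * (P (l + 1) * (P l * (P (l + 2) * (P (l + 1) * v))))"
    and "L i = l + 1 \<Longrightarrow> ent i l = Black \<Longrightarrow> ent i (l + 2) = Black \<Longrightarrow>
      \<phi> (psi l * psi (l + 1) * psi l) * v = P l * (P (l + 1) * (P (l + 2) * (P (l + 1) * (P l * v)))) \<and>
      \<phi> (psi (l + 1) * psi l * psi (l + 1)) * v = P (l + 2) * (P (l + 1) * (P l * (P (l + 1) * (P (l + 2) * v))))"
proof -
  define i1 where "i1 = swap_entries l i"
  define i2 where "i2 = swap_entries (l + 1) i1"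
  define k1 where "k1 = swap_entries (l + 1) i"
  define k2 where "k2 = swap_entries l k1"
  have e1: "ent i1 l = ent i (l + 1)" "ent i1 (l + 1) = ent i l" "ent i1 (l + 1 + 1) = ent i (l + 1 + 1)"
    "ent k1 l = ent i l" "ent k1 (l + 1) = ent i (l + 1 + 1)" "ent k1 (l + 1 + 1) = ent i (l + 1)"
    using lens l by (auto simp: i1_def k1_def ent_swap)
  have l1: "length i1 = length i" "length k1 = length i" by (simp_all add: i1_def k1_def)
  have e2: "ent i2 l = ent i (l + 1)" "ent i2 (l + 1) = ent i (l + 1 + 1)" "ent i2 (l + 1 + 1) = ent i l"
    "ent k2 l = ent i (l + 1 + 1)" "ent k2 (l + 1) = ent i l" "ent k2 (l + 1 + 1) = ent i (l + 1)"
    using lens l e1 l1 by (auto simp: i2_def k2_def ent_swap)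
  have q: "1 \<le> l + 1" by simp
  note A = act_psi[OF _ _ l(1) lens(4)] act_psi[OF _ _ q lens(5)]
  have two: "l + 2 = l + 1 + 1" by simp
  have main: "\<phi> (psi l * psi (l + 1) * psi l) * v = h (op_psi l i2) * (h (op_psi (l + 1) i1) * (h (op_psi l i) * v))"
      "\<phi> (psi (l + 1) * psi l * psi (l + 1)) * v = h (op_psi (l + 1) k2) * (h (op_psi l k1) * (h (op_psi (l + 1) i) * v))"
    and L1: "l + 1 < L i \<Longrightarrow> L i1 = L i" "l + 1 = L i \<Longrightarrow> L i1 = l" "l = L i \<Longrightarrow> L i1 = l + 1"
      "l + 1 + 1 = L i \<Longrightarrow> L k1 = l + 1" "l + 1 = L i \<Longrightarrow> L k1 = l + 1 + 1" "L i < l + 1 \<Longrightarrow> L k1 = L i"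
    and L2: "l + 1 + 1 = L i1 \<Longrightarrow> L i2 = l + 1" "l + 1 = L i1 \<Longrightarrow> L i2 = l + 1 + 1" "L i1 < l + 1 \<Longrightarrow> L i2 = L i1"
      "l + 1 < L k1 \<Longrightarrow> L k2 = L k1" "l + 1 = L k1 \<Longrightarrow> L k2 = l" "l = L k1 \<Longrightarrow> L k2 = l + 1"
    if b: "ent i l = Black \<or> ent i (l + 1) = Black" "ent i l = Black \<or> ent i (l + 1 + 1) = Black"
      "ent i (l + 1) = Black \<or> ent i (l + 1 + 1) = Black"
  proof -
    have b1: "ent i1 (l + 1) = Black \<or> ent i1 (l + 1 + 1) = Black" using b e1 by simp
    have c1: "ent k1 l = Black \<or> ent k1 (l + 1) = Black" using b e1 by simp
    note s1 = swapped[OF i l(1) lens(4) b(1), folded i1_def] and t1 = swapped[OF i q lens(5) b(3), folded k1_def]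
    have w1: "h (op_psi l i) * v \<in> W i1" unfolding i1_def by (rule op_psi_W[OF i v l(1) lens(4) b(1)])
    have x1: "h (op_psi (l + 1) i) * v \<in> W k1" unfolding k1_def by (rule op_psi_W[OF i v q lens(5) b(3)])
    note s2 = swapped[OF s1(1) q lens(5) b1, folded i2_def] and t2 = swapped[OF t1(1) l(1) lens(4) c1, folded k2_def]
    have w2: "h (op_psi (l + 1) i1) * (h (op_psi l i) * v) \<in> W i2"
      unfolding i2_def by (rule op_psi_W[OF s1(1) w1 q lens(5) b1])
    have x2: "h (op_psi l k1) * (h (op_psi (l + 1) i) * v) \<in> W k2"
      unfolding k2_def by (rule op_psi_W[OF t1(1) x1 l(1) lens(4) c1])
    show "\<phi> (psi l * psi (l + 1) * psi l) * v = h (op_psi l i2) * (h (op_psi (l + 1) i1) * (h (op_psi l i) * v))"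
      by (simp only: \<phi>_PPP A(1)[OF i v] A(2)[OF s1(1) w1] A(1)[OF s2(1) w2])
    show "\<phi> (psi (l + 1) * psi l * psi (l + 1)) * v = h (op_psi (l + 1) k2) * (h (op_psi l k1) * (h (op_psi (l + 1) i) * v))"
      by (simp only: \<phi>_PPP A(2)[OF i v] A(1)[OF t1(1) x1] A(2)[OF t2(1) x2])
    show "l + 1 < L i \<Longrightarrow> L i1 = L i" "l + 1 = L i \<Longrightarrow> L i1 = l" "l = L i \<Longrightarrow> L i1 = l + 1"
      "l + 1 + 1 = L i \<Longrightarrow> L k1 = l + 1" "l + 1 = L i \<Longrightarrow> L k1 = l + 1 + 1" "L i < l + 1 \<Longrightarrow> L k1 = L i"
      by (fact s1(2-4) t1(3-5))+
    show "l + 1 + 1 = L i1 \<Longrightarrow> L i2 = l + 1" "l + 1 = L i1 \<Longrightarrow> L i2 = l + 1 + 1" "L i1 < l + 1 \<Longrightarrow> L i2 = L i1"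
      "l + 1 < L k1 \<Longrightarrow> L k2 = L k1" "l + 1 = L k1 \<Longrightarrow> L k2 = l" "l = L k1 \<Longrightarrow> L k2 = l + 1"
      by (fact s2(3-5) t2(2-4))+
  qed
  show "\<phi> (psi l * psi (l + 1) * psi l) * v = P l * (P (l + 1) * (P (l + 2) * (P l * (P (l + 1) * v)))) \<and>
      \<phi> (psi (l + 1) * psi l * psi (l + 1)) * v = P (l + 1) * (P (l + 2) * (P l * (P (l + 1) * (P (l + 2) * v))))"
    if "L i = l" "ent i (l + 1) = Black" "ent i (l + 2) = Black"
  proof -
    have b: "ent i l = Black \<or> ent i (l + 1) = Black" "ent i l = Black \<or> ent i (l + 1 + 1) = Black"
      "ent i (l + 1) = Black \<or> ent i (l + 1 + 1) = Black" using that by simp_all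
    have Ls: "L i1 = l + 1" "L k1 = l" using L1(3,6)[OF b] that(1) by auto
    then have Ls': "L i2 = l + 1 + 1" "L k2 = l + 1" using L2(2,6)[OF b] by auto
    have "h (op_psi l i) = P l * P (l + 1)" "h (op_psi (l + 1) i1) = P (l + 1) * P (l + 1 + 1)" "h (op_psi l i2) = P l"
      "h (op_psi (l + 1) i) = P (l + 1 + 1)" "h (op_psi l k1) = P l * P (l + 1)" "h (op_psi (l + 1) k2) = P (l + 1) * P (l + 1 + 1)"
      by (rule op_psi_simps; use that Ls Ls' e1 e2 in simp)+
    then show ?thesis using main[OF b] by (simp add: mult.assoc)
  qed
  show "\<phi> (psi l * psi (l + 1) * psi l) * v = P (l + 1) * (P l * (P (l + 2) * (P (l + 1) * (P l * v)))) \<and>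
      \<phi> (psi (l + 1) * psi l * psi (l + 1)) * v = P (l + 2) * (P (l + 1) * (P l * (P (l + 2) * (P (l + 1) * v))))"
    if "L i = l + 2" "ent i l = Black" "ent i (l + 1) = Black"
  proof -
    have b: "ent i l = Black \<or> ent i (l + 1) = Black" "ent i l = Black \<or> ent i (l + 1 + 1) = Black"
      "ent i (l + 1) = Black \<or> ent i (l + 1 + 1) = Black" using that by simp_all
    have Ls: "L i1 = l + 1 + 1" "L k1 = l + 1" using L1(1,4)[OF b] that(1) by auto
    then have Ls': "L i2 = l + 1" "L k2 = l" using L2(1,5)[OF b] by auto
    have "h (op_psi l i) = P l" "h (op_psi (l + 1) i1) = P (l + 1 + 1) * P (l + 1)" "h (op_psi l i2) = P (l + 1) * P l"
      "h (op_psi (l + 1) i) = P (l + 1 + 1) * P (l + 1)" "h (op_psi l k1) = P (l + 1) * P l" "h (op_psi (l + 1) k2) = P (l + 1 + 1)"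
      by (rule op_psi_simps; use that Ls Ls' e1 e2 in simp)+
    then show ?thesis using main[OF b] by (simp add: mult.assoc)
  qed
  show "\<phi> (psi l * psi (l + 1) * psi l) * v = P l * (P (l + 1) * (P (l + 2) * (P (l + 1) * (P l * v)))) \<and>
      \<phi> (psi (l + 1) * psi l * psi (l + 1)) * v = P (l + 2) * (P (l + 1) * (P l * (P (l + 1) * (P (l + 2) * v))))"
    if "L i = l + 1" "ent i l = Black" "ent i (l + 2) = Black"
  proof -
    have b: "ent i l = Black \<or> ent i (l + 1) = Black" "ent i l = Black \<or> ent i (l + 1 + 1) = Black"
      "ent i (l + 1) = Black \<or> ent i (l + 1 + 1) = Black" using that by simp_all
    have Ls: "L i1 = l" "L k1 = l + 1 + 1" using L1(2,5)[OF b] that(1) by auto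
    then have Ls': "L i2 = l" "L k2 = l + 1 + 1" using L2(3,4)[OF b] by auto
    have "h (op_psi l i) = P (l + 1) * P l" "h (op_psi (l + 1) i1) = P (l + 1 + 1)" "h (op_psi l i2) = P l * P (l + 1)"
      "h (op_psi (l + 1) i) = P (l + 1) * P (l + 1 + 1)" "h (op_psi l k1) = P l" "h (op_psi (l + 1) k2) = P (l + 1 + 1) * P (l + 1)"
      by (rule op_psi_simps; use that Ls Ls' e1 e2 in simp)+
    then show ?thesis using main[OF b] by (simp add: mult.assoc)
  qed
qed

end

end

context phi_rep
begin

lemma phi_chi:
  assumes i: "i \<in> Seq s n" and l: "1 \<le> l" "l \<le> length s + n" "1 \<le> m" "m \<le> length s + n"
  shows "\<phi> (\<Sum>d=0..c. (-1) ^ d * vE d l * vx m ^ (c - d) * idem i)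
      = chi c (\<lambda>d. h (op_E d l i)) (h (op_x m i)) * e (sp i)"
    and "\<phi> (\<Sum>d=0..c. (-1) ^ d * vx m ^ (c - d) * vE d l * idem i)
      = chi c (\<lambda>d. h (op_E d l i)) (h (op_x m i)) * e (sp i)"
proof -
  have v: "e (sp i) \<in> W i" by (rule e_V)
  have xE: "h (op_x m i) ^ k * (h (op_E d l i) * w) = h (op_E d l i) * (h (op_x m i) ^ k * w)" for k d w
    using power_commuting_commutes[of "h (op_x m i)" "h (op_E d l i)" k] op_E_x[of d l i m]
    by (simp flip: mult.assoc)
  have 1: "\<phi> ((-1) ^ d * vE d l * vx m ^ k * idem i) = (-1) ^ d * h (op_E d l i) * h (op_x m i) ^ k * e (sp i)" for d k
    using act_x_pow[OF i v l(3,4), of k] act_E[OF i _ l(1,2)]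
    by (simp only: mult.assoc \<phi>_sign) (simp add: \<phi>_mult \<phi>_idem[OF i])
  have 2: "\<phi> ((-1) ^ d * vx m ^ k * vE d l * idem i) = (-1) ^ d * h (op_E d l i) * h (op_x m i) ^ k * e (sp i)" for d k
    using act_x_pow[OF i op_E_V[OF v] l(3,4), of k d l] act_E[OF i v l(1,2), of d] xE
    by (simp only: mult.assoc \<phi>_sign) (simp add: \<phi>_mult \<phi>_idem[OF i])
  show "\<phi> (\<Sum>d=0..c. (-1) ^ d * vE d l * vx m ^ (c - d) * idem i)
      = chi c (\<lambda>d. h (op_E d l i)) (h (op_x m i)) * e (sp i)"
    "\<phi> (\<Sum>d=0..c. (-1) ^ d * vx m ^ (c - d) * vE d l * idem i)
      = chi c (\<lambda>d. h (op_E d l i)) (h (op_x m i)) * e (sp i)"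
    by (simp_all only: \<phi>_sum 1 2 chi_def sum_distrib_right)
qed

lemma phi_dquot:
  assumes i: "i \<in> Seq s n" and l: "1 \<le> l" "l + 2 \<le> length s + n"
  shows "\<phi> (\<Sum>(d1, d2, d3) \<in> {(d1, d2, d3). d1 + d2 + d3 + 1 = c}.
        (-1) ^ d3 * vx l ^ d1 * vE d3 (l + 1) * vx (l + 2) ^ d2 * idem i)
      = dquot c (\<lambda>d. h (op_E d (l + 1) i)) (h (op_x l i)) (h (op_x (l + 2) i)) * e (sp i)"
proof -
  let ?x = "h (op_x l i)" and ?y = "h (op_x (l + 2) i)" and ?F = "\<lambda>d. h (op_E d (l + 1) i)"
  have v: "e (sp i) \<in> W i" by (rule e_V)
  have xE: "?x ^ k * (?F d * w) = ?F d * (?x ^ k * w)" for k d w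
    using power_commuting_commutes[of ?x "?F d" k] op_E_x[of d "l + 1" i l] by (simp flip: mult.assoc)
  have t: "\<phi> ((-1) ^ d3 * vx l ^ d1 * vE d3 (l + 1) * vx (l + 2) ^ d2 * idem i)
      = (-1) ^ d3 * ?F d3 * (?x ^ d1 * ?y ^ d2) * e (sp i)" for d1 d2 d3
  proof -
    have y: "\<phi> (vx (l + 2) ^ d2) * e (sp i) = ?y ^ d2 * e (sp i)" "?y ^ d2 * e (sp i) \<in> W i"
      using act_x_pow[OF i v, of "l + 2" d2] l by auto
    have E: "\<phi> (vE d3 (l + 1)) * (?y ^ d2 * e (sp i)) = ?F d3 * (?y ^ d2 * e (sp i))"
      using act_E[OF i y(2), of "l + 1" d3] l by simp
    have x: "\<phi> (vx l ^ d1) * (?F d3 * (?y ^ d2 * e (sp i))) = ?x ^ d1 * (?F d3 * (?y ^ d2 * e (sp i)))"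
      using act_x_pow[OF i op_E_V[OF y(2)], of l d1 d3 "l + 1"] l by auto
    show ?thesis
      by (simp only: mult.assoc \<phi>_sign) (simp only: \<phi>_mult \<phi>_idem[OF i] y(1) E x xE)
  qed
  show ?thesis
    by (simp only: \<phi>_sum sum_triples t) (simp add: dquot_def hsum_def sum_distrib_right sum_distrib_left mult.assoc)
qed

context
  fixes i l v
  assumes i: "i \<in> Seq s n" and v: "v \<in> W i" and l: "1 \<le> l" "l + 2 \<le> length s + n"
begin

private lemma lens': "length (sp i) = length s + n + 1" "l + 2 \<le> length t + n" "l + 1 + 2 \<le> length t + n"
  "l + 1 \<le> length t + n" "l + 2 + 1 \<le> length t + n"
  using l length_sp[OF i] length_t by auto

lemma phi_braid_other:
  assumes b: "\<not> (ent i l = Black \<and> is_red (ent i (l + 1)) \<and> ent i (l + 2) = Black)"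
  shows "\<phi> (psi l * psi (l + 1) * psi l) * v = \<phi> (psi (l + 1) * psi l * psi (l + 1)) * v"
proof (cases "is_red (ent i l) \<and> is_red (ent i (l + 1)) \<or> is_red (ent i l) \<and> is_red (ent i (l + 2))
      \<or> is_red (ent i (l + 1)) \<and> is_red (ent i (l + 2))")
  case True
  from phi_braid_red[OF i v l this] show ?thesis by simp
next
  case False
  have red: "is_red (ent i (L i))" using L_bounds[OF i] by simp
  then have "L i \<noteq> l + 1" using b False by metis
  then consider "L i < l" | "l + 2 < L i" | "L i = l" | "L i = l + 2" by linarith
  then show ?thesis
  proof cases
    case 1
    then have "ent (sp i) (l + 1) = ent i l" "ent (sp i) (l + 1 + 1) = ent i (l + 1)" "ent (sp i) (l + 1 + 2) = ent i (l + 2)"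
      using ent_sp_gt[OF i, of l] ent_sp_gt[OF i, of "l + 1"] ent_sp_gt[OF i, of "l + 2"] by simp_all
    then show ?thesis
      using phi_braid_gt[OF i v l 1] braid_other[OF v, of "l + 1"] b by simp
  next
    case 2
    then have "ent (sp i) l = ent i l" "ent (sp i) (l + 1) = ent i (l + 1)" "ent (sp i) (l + 2) = ent i (l + 2)"
      using ent_sp_lt[OF i] l by simp_all
    then show ?thesis
      using phi_braid_lt[OF i v l 2] braid_other[OF v, of l] b by simp
  next
    case 3
    with red False have B: "ent i (l + 1) = Black" "ent i (l + 2) = Black" by auto
    have e: "ent (sp i) l = Red b1" "ent (sp i) (l + 1) = Red a" "ent (sp i) (l + 1 + 1) = Black" "ent (sp i) (l + 1 + 2) = Black"
      using ent_sp_L[OF i] ent_sp_gt[OF i, of "l + 1"] ent_sp_gt[OF i, of "l + 2"] 3 B by auto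
    define k where "k = swap_entries (l + 1 + 1) (swap_entries (l + 1) (sp i))"
    have ek: "ent k (l + 1) = Black"
      using e l lens' unfolding k_def by (simp add: ent_swap)
    have w: "P (l + 1 + 1) * (P (l + 1) * v) \<in> V k" unfolding k_def by (intro P_V v)
    have "P l * (P (l + 1) * (P (l + 2) * (P l * (P (l + 1) * v))))
        = P l * (P (l + 1) * (P l * (P (l + 1 + 1) * (P (l + 1) * v))))"
      using P_P_far_left[of l "l + 2"] by simp
    also have "\<dots> = P (l + 1) * (P l * (P (l + 1) * (P (l + 1 + 1) * (P (l + 1) * v))))"
      by (rule braid_other[OF w]) (use ek in simp)
    also have "P (l + 1) * (P (l + 1 + 1) * (P (l + 1) * v)) = P (l + 1 + 1) * (P (l + 1) * (P (l + 1 + 1) * v))"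
      by (rule braid_other[OF v]) (use e in simp)
    also have "P (l + 1) * (P l * \<dots>) = P (l + 1) * (P (l + 2) * (P l * (P (l + 1) * (P (l + 2) * v))))"
      using P_P_far_left[of l "l + 2"] by simp
    finally show ?thesis using phi_braid_words(1)[OF i v l 3 B] by simp
  next
    case 4
    with red False have B: "ent i l = Black" "ent i (l + 1) = Black" by auto
    have e: "ent (sp i) l = Black" "ent (sp i) (l + 1) = Black" "ent (sp i) (l + 1 + 1) = Red b1" "ent (sp i) (l + 1 + 2) = Red a"
      using ent_sp_L[OF i] ent_sp_lt[OF i, of "l + 1"] ent_sp_lt[OF i, of l] 4 B l by auto
    define k where "k = swap_entries l (swap_entries (l + 1) (sp i))"
    have ek: "ent k (l + 1 + 1) = Black"
      using e l lens' unfolding k_def by (simp add: ent_swap)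
    have w: "P l * (P (l + 1) * v) \<in> V k" unfolding k_def by (intro P_V v)
    have "P (l + 1) * (P l * (P (l + 2) * (P (l + 1) * (P l * v))))
        = P (l + 1) * (P (l + 2) * (P l * (P (l + 1) * (P l * v))))"
      using P_P_far_left[of l "l + 2"] by simp
    also have "P l * (P (l + 1) * (P l * v)) = P (l + 1) * (P l * (P (l + 1) * v))"
      by (rule braid_other[OF v]) (use e in simp)
    also have "P (l + 1) * (P (l + 2) * \<dots>) = P (l + 1 + 1) * (P (l + 1) * (P (l + 1 + 1) * (P l * (P (l + 1) * v))))"
      using braid_other[OF w, of "l + 1"] ek by simp
    also have "\<dots> = P (l + 2) * (P (l + 1) * (P l * (P (l + 2) * (P (l + 1) * v))))"
      using P_P_far_left[of l "l + 2"] by simp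
    finally show ?thesis using phi_braid_words(2)[OF i v l 4 B] by simp
  qed
qed

lemma phi_braid_brb:
  assumes b: "ent i l = Black" "ent i (l + 1) = Red c" "ent i (l + 2) = Black"
  shows "\<phi> (psi l * psi (l + 1) * psi l) * v = \<phi> (psi (l + 1) * psi l * psi (l + 1)) * v
    + dquot c (\<lambda>d. h (op_E d (l + 1) i)) (h (op_x l i)) (h (op_x (l + 2) i)) * v"
proof -
  have red: "is_red (ent i (L i))" using L_bounds[OF i] by simp
  then have "L i \<noteq> l" "L i \<noteq> l + 2" using b by metis+
  then consider "L i < l" | "l + 2 < L i" | "L i = l + 1" by linarith
  then show ?thesis
  proof cases
    case 1
    then have "ent (sp i) (l + 1) = Black" "ent (sp i) (l + 1 + 1) = Red c" "ent (sp i) (l + 1 + 2) = Black"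
      using ent_sp_gt[OF i, of l] ent_sp_gt[OF i, of "l + 1"] ent_sp_gt[OF i, of "l + 2"] b by simp_all
    from braid_brb[OF v this _ lens'(3)] show ?thesis
      using phi_braid_gt[OF i v l 1] 1 by (simp add: op_x_simps op_E_simps)
  next
    case 2
    then have "ent (sp i) l = Black" "ent (sp i) (l + 1) = Red c" "ent (sp i) (l + 2) = Black"
      using ent_sp_lt[OF i] l b by simp_all
    from braid_brb[OF v this l(1) lens'(2)] show ?thesis
      using phi_braid_lt[OF i v l 2] 2 by (simp add: op_x_simps op_E_simps)
  next
    case 3
    have e: "ent (sp i) l = Black" "ent (sp i) (l + 1) = Red b1" "ent (sp i) (l + 2) = Red a" "ent (sp i) (l + 2 + 1) = Black"
      using ent_sp_L[OF i] ent_sp_lt[OF i, of l] ent_sp_gt[OF i, of "l + 2"] 3 b l by auto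
    have two: "l + 1 + 1 = l + 2" "l + 1 + 2 = l + 2 + 1" by simp_all
    define k1 where "k1 = swap_entries l (sp i)"
    define k2 where "k2 = swap_entries (l + 2) (sp i)"
    have e1: "ent k1 l = Red b1" "ent k1 (l + 1) = Black" "ent k1 (l + 2) = Red a" "ent k1 (l + 2 + 1) = Black"
      and e2: "ent k2 l = Black" "ent k2 (l + 1) = Red b1" "ent k2 (l + 2) = Black" "ent k2 (l + 2 + 1) = Red a"
      using e l lens' unfolding k1_def k2_def by (simp_all add: ent_swap)
    have w1: "P l * v \<in> V k1" unfolding k1_def by (rule P_V[OF v])
    have w2: "P (l + 2) * v \<in> V k2" unfolding k2_def by (rule P_V[OF v])
    let ?Q1 = "dquot b1 (\<lambda>d. E d (l + 1))" and ?Q2 = "dquot a (\<lambda>d. E d (l + 2))"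
    have far: "P (l + 2) * (P l * w) = P l * (P (l + 2) * w)" for w
      by (rule P_P_far_left) simp
    have "P (l + 1) * (P (l + 2) * (P (l + 1) * (P l * v)))
        = P (l + 2) * (P (l + 1) * (P (l + 2) * (P l * v))) + ?Q2 (Y (l + 1)) (Y (l + 2 + 1)) * (P l * v)"
      using braid_brb[OF w1 e1(2) _ _ _ lens'(3), of a] e1 by (simp add: two)
    then have "P l * (P (l + 1) * (P (l + 2) * (P (l + 1) * (P l * v))))
        = P (l + 2) * (P l * (P (l + 1) * (P l * (P (l + 2) * v)))) + P l * (?Q2 (Y (l + 1)) (Y (l + 2 + 1)) * (P l * v))"
      by (simp only: distrib_left far)
    also have "P l * (P (l + 1) * (P l * (P (l + 2) * v)))
        = P (l + 1) * (P l * (P (l + 1) * (P (l + 2) * v))) + ?Q1 (Y l) (Y (l + 2)) * (P (l + 2) * v)"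
      by (rule braid_brb[OF w2 e2(1,2,3) l(1) lens'(2)])
    also have "P (l + 2) * (P (l + 1) * (P l * (P (l + 1) * (P (l + 2) * v))) + ?Q1 (Y l) (Y (l + 2)) * (P (l + 2) * v))
        = P (l + 2) * (P (l + 1) * (P l * (P (l + 1) * (P (l + 2) * v)))) + P (l + 2) * (?Q1 (Y l) (Y (l + 2)) * (P (l + 2) * v))"
      by (rule distrib_left)
    also have "P l * (?Q2 (Y (l + 1)) (Y (l + 2 + 1)) * (P l * v)) = ?Q2 (Y l) (Y (l + 2 + 1)) * (P l * (P l * v))"
    proof (rule intertwine_dquot[where Z = "V k1"])
      show "P l * (E d (l + 2) * w) = E d (l + 2) * (P l * w)" for d w
        by (rule E_P_far_left[symmetric]) simp_all
      show "P l * (Y (l + 1) * w) = Y l * (P l * w)" if "w \<in> V k1" for w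
        by (rule X_P_rb[OF that e1(1,2), symmetric])
      show "P l * (Y (l + 2 + 1) * w) = Y (l + 2 + 1) * (P l * w)" for w
        by (rule Y_P_far_left[symmetric]) simp_all
    qed (use w1 in \<open>auto intro: X_V V_add V_zero\<close>)
    also have "P l * (P l * v) = chi b1 (\<lambda>d. E d (l + 1)) (Y l) * v"
      by (rule P_P_br[OF v e(1,2) l(1) lens'(4)])
    also have "P (l + 2) * (?Q1 (Y l) (Y (l + 2)) * (P (l + 2) * v)) = ?Q1 (Y l) (Y (l + 2 + 1)) * (P (l + 2) * (P (l + 2) * v))"
    proof (rule intertwine_dquot[where Z = "V k2"])
      show "P (l + 2) * (E d (l + 1) * w) = E d (l + 1) * (P (l + 2) * w)" for d w
        by (rule E_P_far_left[symmetric]) simp_all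
      show "P (l + 2) * (Y (l + 2) * w) = Y (l + 2 + 1) * (P (l + 2) * w)" if "w \<in> V k2" for w
        by (rule P_X_br[OF that e2(3,4)])
      show "P (l + 2) * (Y l * w) = Y l * (P (l + 2) * w)" for w
        by (rule Y_P_far_left[symmetric]) simp_all
    qed (use w2 in \<open>auto intro: X_V V_add V_zero\<close>)
    also have "P (l + 2) * (P (l + 2) * v) = chi a (\<lambda>d. E d (l + 2)) (Y (l + 2 + 1)) * v"
      by (rule P_P_rb[OF v e(3,4) _ lens'(5)]) simp
    finally have "P l * (P (l + 1) * (P (l + 2) * (P (l + 1) * (P l * v))))
        = P (l + 2) * (P (l + 1) * (P l * (P (l + 1) * (P (l + 2) * v))))
          + dquot (b1 + a) (\<lambda>d. E2 d (l + 1)) (Y l) (Y (l + 2 + 1)) * v"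
      using dquot_E2[OF v e(2), of a l "l + 2 + 1"] e(3) by (simp add: two ac_simps)
    then show ?thesis
      using phi_braid_words(3)[OF i v l 3 b(1,3)] merged[OF i 3[symmetric] b(2)] h_op_E_eq[of "l + 1" i] 3
      by (simp add: op_x_simps)
  qed
qed

end

lemma op_op_left: "x * y = y * x \<Longrightarrow> x * (y * w) = y * (x * (w :: 'q))"
  by (simp flip: mult.assoc)

lemma phi_rel:
  assumes "r \<in> D_rels s n"
  shows "\<phi> r = 0"
  using assms
proof cases
  case (no_gen g)
  then show ?thesis by (simp add: \<phi>_letter phi_gen_def h_zero)
next
  case unit
  then show ?thesis by (simp add: \<phi>_diff \<phi>_one \<phi>_sum \<phi>_idem)
next
  case (idem_idem i i')
  then show ?thesis
    using act_idem[OF idem_idem(3,2) e_V] by (auto simp: \<phi>_diff \<phi>_mult \<phi>_idem \<phi>_zero)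
next
  case (E_idem k d l)
  show ?thesis
  proof (rule \<phi>_eq_0I)
    fix i v assume i: "i \<in> Seq s n" and v: "v \<in> W i"
    show "\<phi> r * v = 0"
      using act_E[OF i v, of l d] act_idem[OF i E_idem(2) v] act_idem[OF i E_idem(2) op_E_V[OF v], of d l] E_idem(3)
      by (auto simp: E_idem(1) \<phi>_diff \<phi>_mult left_diff_distrib mult.assoc is_gen_def)
  qed
next
  case (x_idem k l)
  show ?thesis
  proof (rule \<phi>_eq_0I)
    fix i v assume i: "i \<in> Seq s n" and v: "v \<in> W i"
    show "\<phi> r * v = 0"
      using act_x[OF i v, of l] act_idem[OF i x_idem(2) v] act_idem[OF i x_idem(2) op_x_V[OF v], of l] x_idem(3)
      by (auto simp: x_idem(1) \<phi>_diff \<phi>_mult left_diff_distrib mult.assoc is_gen_def)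
  qed
next
  case (psi_idem k l)
  show ?thesis
  proof (rule \<phi>_eq_0I)
    fix i v assume i: "i \<in> Seq s n" and v: "v \<in> W i"
    have l: "1 \<le> l" "l + 1 \<le> length s + n" using psi_idem(3) by (auto simp: is_gen_def)
    show "\<phi> r * v = 0"
    proof (cases "ent i l = Black \<or> ent i (l + 1) = Black")
      case True
      have w: "\<phi> (psi l) * v \<in> W (swap_entries l i)" by (rule act_psi_W[OF i v l True])
      have "swap_entries l i = swap_entries l k \<longleftrightarrow> i = k"
      proof -
        have "swap_entries l (swap_entries l i) = i" "swap_entries l (swap_entries l k) = k"
          by (rule swap_swap; use l length_Seq[OF i] length_Seq[OF psi_idem(2)] in simp)+
        then show ?thesis by metis
      qed
      moreover have "\<phi> (idem (swap_entries l k)) = 0" if "swap_entries l k \<notin> Seq s n"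
        using that by (simp add: idem_def \<phi>_letter phi_gen_def is_gen_def h_zero)
      ultimately have "\<phi> (idem (swap_entries l k)) * (\<phi> (psi l) * v) = (if i = k then \<phi> (psi l) * v else 0)"
        using act_idem[OF swapped(1)[OF i l True] _ w] swapped(1)[OF i l True]
        by (cases "swap_entries l k \<in> Seq s n") auto
      then show ?thesis
        using act_idem[OF i psi_idem(2) v] by (auto simp: psi_idem(1) \<phi>_diff \<phi>_mult left_diff_distrib mult.assoc)
    next
      case False
      then have "\<phi> (psi l) * v = 0" using act_psi_rr[OF i v l] by auto
      then show ?thesis
        using act_idem[OF i psi_idem(2) v] by (auto simp: psi_idem(1) \<phi>_diff \<phi>_mult left_diff_distrib mult.assoc)
    qed
  qed
next
  case (E_black i d l)
  have "h (op_E d l i) * e (sp i) = 0"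
  proof -
    have "l \<noteq> L i" using L_bounds(4)[OF E_black(2)] E_black(4) by auto
    then show ?thesis
      using webster_rep.E_black[OF webster_rep_axioms e_V] ent_sp_lt[OF E_black(2), of l] ent_sp_gt[OF E_black(2), of l] E_black(3,4)
      by (cases "l < L i") (auto simp: op_E_simps is_gen_def)
  qed
  then show ?thesis
    using act_E[OF E_black(2) e_V, of l d] E_black by (simp add: \<phi>_mult \<phi>_idem is_gen_def)
next
  case (E_large i d l c)
  have "h (op_E d l i) * e (sp i) = 0"
  proof (cases "l = L i")
    case True
    have c: "c = b1 + a" by (rule merged[OF E_large(2) True E_large(4)])
    have "E k l * (E (d - k) (l + 1) * e (sp i)) = 0" if "k \<le> d" for k
    proof -
      have e: "ent (sp i) l = Red b1" "ent (sp i) (l + 1) = Red a" using ent_sp_L[OF E_large(2)] True by simp_all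
      have "b1 < k \<or> a < d - k" using E_large(5) c by linarith
      then show ?thesis using E_E_zero[OF e_V e] by blast
    qed
    then show ?thesis
      unfolding h_op_E_eq[OF True] by (simp add: conv_def sum_distrib_right mult.assoc)
  next
    case False
    then show ?thesis
      using webster_rep.E_large[OF webster_rep_axioms e_V] ent_sp_lt[OF E_large(2), of l] ent_sp_gt[OF E_large(2), of l] E_large(3,4,5)
      by (cases "l < L i") (auto simp: op_E_simps is_gen_def)
  qed
  then show ?thesis
    using act_E[OF E_large(2) e_V, of l d] E_large by (simp add: \<phi>_mult \<phi>_idem is_gen_def)
next
  case (x_red i l c)
  have "h (op_x l i) * e (sp i) = 0"
  proof (cases "l = L i")
    case False
    then show ?thesis
      using webster_rep.x_red[OF webster_rep_axioms e_V] ent_sp_lt[OF x_red(2), of l] ent_sp_gt[OF x_red(2), of l] x_red(3,4)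
      by (cases "l < L i") (auto simp: op_x_simps is_gen_def)
  qed (simp add: op_x_simps)
  then show ?thesis
    using act_x[OF x_red(2) e_V, of l] x_red by (simp add: \<phi>_mult \<phi>_idem is_gen_def)
next
  case (psi_red_red i l c c')
  then show ?thesis
    using act_psi_rr[OF psi_red_red(2) e_V, of l] by (simp add: \<phi>_mult \<phi>_idem is_gen_def)
next
  case (x_x l m)
  show ?thesis
  proof (rule \<phi>_eq_0I)
    fix i v assume i: "i \<in> Seq s n" and v: "v \<in> W i"
    show "\<phi> r * v = 0"
      using act_x[OF i] op_x_V[OF v] v op_op_left[OF op_x_x[of l i m]] x_x(2,3)
      by (simp add: x_x(1) \<phi>_diff \<phi>_mult left_diff_distrib mult.assoc is_gen_def)
  qed
next
  case (E_x d l m)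
  show ?thesis
  proof (rule \<phi>_eq_0I)
    fix i v assume i: "i \<in> Seq s n" and v: "v \<in> W i"
    show "\<phi> r * v = 0"
      using act_x[OF i] act_E[OF i] op_x_V[OF v] op_E_V[OF v] v op_op_left[OF op_E_x[of d l i m]] E_x(2,3)
      by (simp add: E_x(1) \<phi>_diff \<phi>_mult left_diff_distrib mult.assoc is_gen_def)
  qed
next
  case (E_E d l d' m)
  show ?thesis
  proof (rule \<phi>_eq_0I)
    fix i v assume i: "i \<in> Seq s n" and v: "v \<in> W i"
    show "\<phi> r * v = 0"
      using act_E[OF i] op_E_V[OF v] v op_op_left[OF op_E_E[of d l i d' m]] E_E(2,3)
      by (simp add: E_E(1) \<phi>_diff \<phi>_mult left_diff_distrib mult.assoc is_gen_def)
  qed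
next
  case (psi_x_far l m)
  show ?thesis
  proof (rule \<phi>_eq_0I)
    fix i v assume i: "i \<in> Seq s n" and v: "v \<in> W i"
    have l: "1 \<le> l" "l + 1 \<le> length s + n" "1 \<le> m" "m \<le> length s + n" using psi_x_far by (auto simp: is_gen_def)
    have "\<phi> (psi l) * (\<phi> (vx m) * v) = \<phi> (vx m) * (\<phi> (psi l) * v)"
    proof (cases "ent i l = Black \<or> ent i (l + 1) = Black")
      case True
      show ?thesis
        using psi_x_far_op[OF i l(1,2) True psi_x_far(4,5)] act_x[OF i v l(3,4)] act_psi[OF i op_x_V[OF v] l(1,2)]
          act_psi[OF i v l(1,2)] act_x[OF swapped(1)[OF i l(1,2) True] op_psi_W[OF i v l(1,2) True] l(3,4)]
        by simp
    next
      case False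
      then show ?thesis
        using act_psi_rr[OF i v l(1,2)] act_psi_rr[OF i op_x_V[OF v] l(1,2)] act_x[OF i v l(3,4)] by simp
    qed
    then show "\<phi> r * v = 0" by (simp add: psi_x_far(1) \<phi>_diff \<phi>_mult left_diff_distrib mult.assoc)
  qed
next
  case (psi_E_far l d m)
  show ?thesis
  proof (rule \<phi>_eq_0I)
    fix i v assume i: "i \<in> Seq s n" and v: "v \<in> W i"
    have l: "1 \<le> l" "l + 1 \<le> length s + n" "1 \<le> m" "m \<le> length s + n" using psi_E_far by (auto simp: is_gen_def)
    have "\<phi> (psi l) * (\<phi> (vE d m) * v) = \<phi> (vE d m) * (\<phi> (psi l) * v)"
    proof (cases "ent i l = Black \<or> ent i (l + 1) = Black")
      case True
      show ?thesis
        using psi_E_far_op[OF i l(1,2) True psi_E_far(4,5)] act_E[OF i v l(3,4)] act_psi[OF i op_E_V[OF v] l(1,2)]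
          act_psi[OF i v l(1,2)] act_E[OF swapped(1)[OF i l(1,2) True] op_psi_W[OF i v l(1,2) True] l(3,4)]
        by simp
    next
      case False
      then show ?thesis
        using act_psi_rr[OF i v l(1,2)] act_psi_rr[OF i op_E_V[OF v] l(1,2)] act_E[OF i v l(3,4)] by simp
    qed
    then show "\<phi> r * v = 0" by (simp add: psi_E_far(1) \<phi>_diff \<phi>_mult left_diff_distrib mult.assoc)
  qed
next
  case (psi_E l d)
  show ?thesis
  proof (rule \<phi>_eq_0I)
    fix i v assume i: "i \<in> Seq s n" and v: "v \<in> W i"
    have l: "1 \<le> l" "l + 1 \<le> length s + n" "l \<le> length s + n" "1 \<le> l + 1" using psi_E by (auto simp: is_gen_def)
    have "\<phi> (psi l) * (\<phi> (vE d l) * v) = \<phi> (vE d (l + 1)) * (\<phi> (psi l) * v)"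
    proof (cases "ent i l = Black \<or> ent i (l + 1) = Black")
      case True
      show ?thesis
        using psi_E_op(1)[OF i l(1,2) True] act_E[OF i v l(1,3)] act_psi[OF i op_E_V[OF v] l(1,2)]
          act_psi[OF i v l(1,2)] act_E[OF swapped(1)[OF i l(1,2) True] op_psi_W[OF i v l(1,2) True] l(4,2)]
        by simp
    next
      case False
      then show ?thesis
        using act_psi_rr[OF i v l(1,2)] act_psi_rr[OF i op_E_V[OF v] l(1,2)] act_E[OF i v l(1,3)] by simp
    qed
    then show "\<phi> r * v = 0" by (simp add: psi_E(1) \<phi>_diff \<phi>_mult left_diff_distrib mult.assoc)
  qed
next
  case (E_psi l d)
  show ?thesis
  proof (rule \<phi>_eq_0I)
    fix i v assume i: "i \<in> Seq s n" and v: "v \<in> W i"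
    have l: "1 \<le> l" "l + 1 \<le> length s + n" "l \<le> length s + n" "1 \<le> l + 1" using E_psi by (auto simp: is_gen_def)
    have "\<phi> (psi l) * (\<phi> (vE d (l + 1)) * v) = \<phi> (vE d l) * (\<phi> (psi l) * v)"
    proof (cases "ent i l = Black \<or> ent i (l + 1) = Black")
      case True
      show ?thesis
        using psi_E_op(2)[OF i l(1,2) True] act_E[OF i v l(4,2)] act_psi[OF i op_E_V[OF v] l(1,2)]
          act_psi[OF i v l(1,2)] act_E[OF swapped(1)[OF i l(1,2) True] op_psi_W[OF i v l(1,2) True] l(1,3)]
        by simp
    next
      case False
      then show ?thesis
        using act_psi_rr[OF i v l(1,2)] act_psi_rr[OF i op_E_V[OF v] l(1,2)] act_E[OF i v l(4,2)] by simp
    qed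
    then show "\<phi> r * v = 0" by (simp add: E_psi(1) \<phi>_diff \<phi>_mult left_diff_distrib mult.assoc)
  qed
next
  case (psi_psi_far l m)
  show ?thesis
  proof (rule \<phi>_eq_0I)
    fix i v assume i: "i \<in> Seq s n" and v: "v \<in> W i"
    have far: "\<phi> (psi l) * (\<phi> (psi m) * v) = \<phi> (psi m) * (\<phi> (psi l) * v)"
      if lm: "1 \<le> l" "l + 1 < m" "m + 1 \<le> length s + n" for l m
    proof -
      have l: "1 \<le> l" "l + 1 \<le> length s + n" "1 \<le> m" "m + 1 \<le> length s + n" using lm by auto
      have ent: "ent (swap_entries m i) l = ent i l" "ent (swap_entries m i) (l + 1) = ent i (l + 1)"
        "ent (swap_entries l i) m = ent i m" "ent (swap_entries l i) (m + 1) = ent i (m + 1)"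
        using lm by (intro ent_swap_other; linarith)+
      have zl: "\<phi> (psi l) * w = 0" if "k \<in> Seq s n" "w \<in> W k" "is_red (ent k l)" "is_red (ent k (l + 1))" for k w
        by (rule act_psi_rr[OF that(1,2) l(1,2) that(3,4)])
      have zm: "\<phi> (psi m) * w = 0" if "k \<in> Seq s n" "w \<in> W k" "is_red (ent k m)" "is_red (ent k (m + 1))" for k w
        by (rule act_psi_rr[OF that(1,2) l(3,4) that(3,4)])
      show ?thesis
      proof (cases "ent i l = Black \<or> ent i (l + 1) = Black")
        case Tl: True
        note sl = swapped(1)[OF i l(1,2) Tl] and wl = op_psi_W[OF i v l(1,2) Tl] and al = act_psi[OF i v l(1,2)]
        show ?thesis
        proof (cases "ent i m = Black \<or> ent i (m + 1) = Black")
          case Tm: True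
          note sm = swapped(1)[OF i l(3,4) Tm] and wm = op_psi_W[OF i v l(3,4) Tm] and am = act_psi[OF i v l(3,4)]
          show ?thesis
            using psi_psi_far_op[OF i lm Tl Tm] al am act_psi[OF sl wl l(3,4)] act_psi[OF sm wm l(1,2)] by simp
        next
          case False
          then show ?thesis using zm[OF i v] zm[OF sl wl] al ent by simp
        qed
      next
        case False
        then have z: "\<phi> (psi l) * v = 0" using zl[OF i v] by simp
        show ?thesis
        proof (cases "ent i m = Black \<or> ent i (m + 1) = Black")
          case Tm: True
          then show ?thesis
            using zl[OF swapped(1)[OF i l(3,4) Tm] op_psi_W[OF i v l(3,4) Tm]] act_psi[OF i v l(3,4)] ent False z by simp
        next
          case F2: False
          then show ?thesis using zm[OF i v] z by simp
        qed
      qed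
    qed
    have "\<phi> (psi l) * (\<phi> (psi m) * v) = \<phi> (psi m) * (\<phi> (psi l) * v)"
      using psi_psi_far(2-4) far[of l m] far[of m l] by (auto simp: is_gen_def)
    then show "\<phi> r * v = 0" by (simp add: psi_psi_far(1) \<phi>_diff \<phi>_mult left_diff_distrib mult.assoc)
  qed
next
  case (x_psi_black_black i l)
  then have l: "1 \<le> l" "l + 1 \<le> length s + n" "l \<le> length s + n" "1 \<le> l + 1" by (auto simp: is_gen_def)
  note i = x_psi_black_black(2) and b = disjI1[OF x_psi_black_black(4), of "ent i (l + 1) = Black"]
  show ?thesis
    using psi_x_bb_op(1)[OF i e_V l(1,2) x_psi_black_black(4,5)] act_psi[OF i e_V l(1,2)] act_x[OF i e_V l(4,2)]
      act_psi[OF i op_x_V[OF e_V] l(1,2)] act_x[OF swapped(1)[OF i l(1,2) b] op_psi_W[OF i e_V l(1,2) b] l(1,3)]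
    by (simp add: x_psi_black_black(1) \<phi>_diff \<phi>_mult \<phi>_idem[OF i] mult.assoc)
next
  case (x_psi_red_black i l c)
  then have l: "1 \<le> l" "l + 1 \<le> length s + n" "l \<le> length s + n" "1 \<le> l + 1" by (auto simp: is_gen_def)
  note i = x_psi_red_black(2) and b = disjI2[OF x_psi_red_black(5), of "ent i l = Black"]
  show ?thesis
    using psi_x_rb_op[OF i e_V l(1,2) x_psi_red_black(4,5)] act_psi[OF i e_V l(1,2)] act_x[OF i e_V l(4,2)]
      act_psi[OF i op_x_V[OF e_V] l(1,2)] act_x[OF swapped(1)[OF i l(1,2) b] op_psi_W[OF i e_V l(1,2) b] l(1,3)]
    by (simp add: x_psi_red_black(1) \<phi>_diff \<phi>_mult \<phi>_idem[OF i] mult.assoc)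
next
  case (psi_x_black_black i l)
  then have l: "1 \<le> l" "l + 1 \<le> length s + n" "l \<le> length s + n" "1 \<le> l + 1" by (auto simp: is_gen_def)
  note i = psi_x_black_black(2) and b = disjI1[OF psi_x_black_black(4), of "ent i (l + 1) = Black"]
  show ?thesis
    using psi_x_bb_op(2)[OF i e_V l(1,2) psi_x_black_black(4,5)] act_psi[OF i e_V l(1,2)] act_x[OF i e_V l(1,3)]
      act_psi[OF i op_x_V[OF e_V] l(1,2)] act_x[OF swapped(1)[OF i l(1,2) b] op_psi_W[OF i e_V l(1,2) b] l(4,2)]
    by (simp add: psi_x_black_black(1) \<phi>_diff \<phi>_mult \<phi>_idem[OF i] mult.assoc)
next
  case (psi_x_black_red i l c)
  then have l: "1 \<le> l" "l + 1 \<le> length s + n" "l \<le> length s + n" "1 \<le> l + 1" by (auto simp: is_gen_def)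
  note i = psi_x_black_red(2) and b = disjI1[OF psi_x_black_red(4), of "ent i (l + 1) = Black"]
  show ?thesis
    using psi_x_br_op[OF i e_V l(1,2) psi_x_black_red(4,5)] act_psi[OF i e_V l(1,2)] act_x[OF i e_V l(1,3)]
      act_psi[OF i op_x_V[OF e_V] l(1,2)] act_x[OF swapped(1)[OF i l(1,2) b] op_psi_W[OF i e_V l(1,2) b] l(4,2)]
    by (simp add: psi_x_black_red(1) \<phi>_diff \<phi>_mult \<phi>_idem[OF i] mult.assoc)
next
  case (psi_square_black_black i l)
  then have l: "1 \<le> l" "l + 1 \<le> length s + n" by (auto simp: is_gen_def)
  note i = psi_square_black_black(2) and b = disjI1[OF psi_square_black_black(4), of "ent i (l + 1) = Black"]
  show ?thesis
    using psi_sq_bb_op[OF i e_V l psi_square_black_black(4,5)] act_psi[OF i e_V l]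
      act_psi[OF swapped(1)[OF i l b] op_psi_W[OF i e_V l b] l]
    by (simp add: psi_square_black_black(1) power2_eq_square \<phi>_mult \<phi>_idem[OF i] mult.assoc)
next
  case (psi_square_red_black i l c)
  then have l: "1 \<le> l" "l + 1 \<le> length s + n" "l \<le> length s + n" "1 \<le> l + 1" by (auto simp: is_gen_def)
  note i = psi_square_red_black(2) and b = disjI2[OF psi_square_red_black(5), of "ent i l = Black"]
  have "\<phi> (psi l ^ 2 * idem i) = chi c (\<lambda>d. h (op_E d l i)) (h (op_x (l + 1) i)) * e (sp i)"
    using psi_sq_rb_op[OF i e_V l(1,2) psi_square_red_black(4,5)] act_psi[OF i e_V l(1,2)]
      act_psi[OF swapped(1)[OF i l(1,2) b] op_psi_W[OF i e_V l(1,2) b] l(1,2)]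
    by (simp add: power2_eq_square \<phi>_mult \<phi>_idem[OF i] mult.assoc)
  then show ?thesis
    by (simp only: psi_square_red_black(1) \<phi>_diff phi_chi(1)[OF i l(1,3,4,2)] diff_self)
next
  case (psi_square_black_red i l c)
  then have l: "1 \<le> l" "l + 1 \<le> length s + n" "l \<le> length s + n" "1 \<le> l + 1" by (auto simp: is_gen_def)
  note i = psi_square_black_red(2) and b = disjI1[OF psi_square_black_red(4), of "ent i (l + 1) = Black"]
  have "\<phi> (psi l ^ 2 * idem i) = chi c (\<lambda>d. h (op_E d (l + 1) i)) (h (op_x l i)) * e (sp i)"
    using psi_sq_br_op[OF i e_V l(1,2) psi_square_black_red(4,5)] act_psi[OF i e_V l(1,2)]
      act_psi[OF swapped(1)[OF i l(1,2) b] op_psi_W[OF i e_V l(1,2) b] l(1,2)]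
    by (simp add: power2_eq_square \<phi>_mult \<phi>_idem[OF i] mult.assoc)
  then show ?thesis
    by (simp only: psi_square_black_red(1) \<phi>_diff phi_chi(2)[OF i l(4,2,1,3)] diff_self)
next
  case (braid_black_red_black i l c)
  then have l: "1 \<le> l" "l + 2 \<le> length s + n" by (auto simp: is_gen_def)
  note i = braid_black_red_black(2)
  have "\<phi> ((psi l * psi (l + 1) * psi l - psi (l + 1) * psi l * psi (l + 1)) * idem i)
      = dquot c (\<lambda>d. h (op_E d (l + 1) i)) (h (op_x l i)) (h (op_x (l + 2) i)) * e (sp i)"
    using phi_braid_brb[OF i e_V l braid_black_red_black(5-7)]
    by (simp only: \<phi>_mult[of _ "idem i"] \<phi>_diff \<phi>_idem[OF i] left_diff_distrib) simp
  then show ?thesis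
    by (simp only: braid_black_red_black(1) \<phi>_diff[of _ "sum _ _"] phi_dquot[OF i l] diff_self)
next
  case (braid_other i l)
  then have l: "1 \<le> l" "l + 2 \<le> length s + n" by (auto simp: is_gen_def)
  note i = braid_other(2)
  show ?thesis
    using phi_braid_other[OF i e_V l braid_other(5)]
    by (simp only: braid_other(1) \<phi>_mult[of _ "idem i"] \<phi>_diff \<phi>_idem[OF i] left_diff_distrib) simp
qed

end

section \<open>Transport of graded structures\<close>

lemma cring_field: "cring (ring_of_type_algebra :: 'k::field ring)"
  by (rule cring_from_type_algebra)

lemma type_algebra_simps:
  "carrier (ring_of_type_algebra :: 'k::field ring) = UNIV"
  "x \<oplus>\<^bsub>ring_of_type_algebra\<^esub> y = x + (y :: 'k)"
  "x \<otimes>\<^bsub>ring_of_type_algebra\<^esub> y = x * (y :: 'k)"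
  "\<one>\<^bsub>ring_of_type_algebra\<^esub> = (1 :: 'k)"
  "\<zero>\<^bsub>ring_of_type_algebra\<^esub> = (0 :: 'k)"
  by (simp_all add: ring_of_type_algebra_def)

lemma additive_finsum:
  assumes M: "abelian_monoid M" and T: "abelian_monoid T"
    and "\<theta> \<in> carrier M \<rightarrow> carrier T" and "\<theta> \<zero>\<^bsub>M\<^esub> = \<zero>\<^bsub>T\<^esub>"
    and "\<And>x y. x \<in> carrier M \<Longrightarrow> y \<in> carrier M \<Longrightarrow> \<theta> (x \<oplus>\<^bsub>M\<^esub> y) = \<theta> x \<oplus>\<^bsub>T\<^esub> \<theta> y"
    and "finite K" and "f \<in> K \<rightarrow> carrier M"
  shows "\<theta> (finsum M f K) = finsum T (\<lambda>k. \<theta> (f k)) K"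
  using assms(6,7)
proof (induction K rule: finite_induct)
  case empty
  then show ?case using assms(4) by (simp add: abelian_monoid.finsum_empty[OF M] abelian_monoid.finsum_empty[OF T])
next
  case (insert k K)
  have *: "finsum M f (insert k K) = f k \<oplus>\<^bsub>M\<^esub> finsum M f K"
    using insert by (intro abelian_monoid.finsum_insert[OF M]) auto
  have "finsum T (\<lambda>k. \<theta> (f k)) (insert k K) = \<theta> (f k) \<oplus>\<^bsub>T\<^esub> finsum T (\<lambda>k. \<theta> (f k)) K"
    using insert assms(3) by (intro abelian_monoid.finsum_insert[OF T]) auto
  moreover have "f k \<in> carrier M" "finsum M f K \<in> carrier M" "\<theta> (finsum M f K) = finsum T (\<lambda>k. \<theta> (f k)) K"
    using insert by (auto intro: abelian_monoid.finsum_closed[OF M])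
  ultimately show ?case using assms(5) by (simp add: *)
qed

definition is_decomp :: "('k, 'v, 'z) graded_scheme \<Rightarrow> 'v \<Rightarrow> (int \<Rightarrow> 'v) \<Rightarrow> bool" where
  "is_decomp V x f \<longleftrightarrow> (\<forall>k. f k \<in> hom_part V k) \<and> finite {k. f k \<noteq> \<zero>\<^bsub>V\<^esub>}
     \<and> x = (\<Oplus>\<^bsub>V\<^esub>k\<in>{k. f k \<noteq> \<zero>\<^bsub>V\<^esub>}. f k)"

context graded_space
begin

lemma decomp: "x \<in> carrier V \<Longrightarrow> \<exists>!f. is_decomp V x f"
  unfolding is_decomp_def by (rule hom_part_decomposition)

lemma hom_part_carrier: "x \<in> hom_part V k \<Longrightarrow> x \<in> carrier V"
  and hom_part_zero: "\<zero>\<^bsub>V\<^esub> \<in> hom_part V k"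
  and hom_part_add: "x \<in> hom_part V k \<Longrightarrow> y \<in> hom_part V k \<Longrightarrow> x \<oplus>\<^bsub>V\<^esub> y \<in> hom_part V k"
  and hom_part_smult: "x \<in> hom_part V k \<Longrightarrow> c \<odot>\<^bsub>V\<^esub> x \<in> hom_part V k"
  using submodule.axioms[OF hom_part_submodule[of k]] subgroup.subset[of "hom_part V k" "add_monoid V"]
    subgroup.one_closed[of "hom_part V k" "add_monoid V"] subgroup.m_closed[of "hom_part V k" "add_monoid V"]
  by (auto simp: type_algebra_simps submodule_axioms_def)

lemma smult_zero: "0 \<odot>\<^bsub>V\<^esub> x = \<zero>\<^bsub>V\<^esub>" if "x \<in> carrier V"
  using smult_l_null[OF that] by (simp add: type_algebra_simps)

lemma smult_simps: "x \<in> carrier V \<Longrightarrow> c \<odot>\<^bsub>V\<^esub> x \<in> carrier V"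
  "x \<in> carrier V \<Longrightarrow> (c + c') \<odot>\<^bsub>V\<^esub> x = c \<odot>\<^bsub>V\<^esub> x \<oplus>\<^bsub>V\<^esub> c' \<odot>\<^bsub>V\<^esub> x"
  "x \<in> carrier V \<Longrightarrow> y \<in> carrier V \<Longrightarrow> c \<odot>\<^bsub>V\<^esub> (x \<oplus>\<^bsub>V\<^esub> y) = c \<odot>\<^bsub>V\<^esub> x \<oplus>\<^bsub>V\<^esub> c \<odot>\<^bsub>V\<^esub> y"
  "x \<in> carrier V \<Longrightarrow> (c * c') \<odot>\<^bsub>V\<^esub> x = c \<odot>\<^bsub>V\<^esub> (c' \<odot>\<^bsub>V\<^esub> x)"
  "x \<in> carrier V \<Longrightarrow> 1 \<odot>\<^bsub>V\<^esub> x = x"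
  using smult_closed[of c x] smult_l_distr[of c c' x] smult_r_distr[of c x y] smult_assoc1[of c c' x] smult_one[of x]
  by (simp_all add: type_algebra_simps)

end

lemma graded_spaceI:
  fixes V :: "('k::field, 'v, 'z) graded_scheme"
  assumes "abelian_group V"
    and closed: "\<And>c x. x \<in> carrier V \<Longrightarrow> c \<odot>\<^bsub>V\<^esub> x \<in> carrier V"
    and "\<And>c c' x. x \<in> carrier V \<Longrightarrow> (c + c') \<odot>\<^bsub>V\<^esub> x = c \<odot>\<^bsub>V\<^esub> x \<oplus>\<^bsub>V\<^esub> c' \<odot>\<^bsub>V\<^esub> x"
    and "\<And>c x y. x \<in> carrier V \<Longrightarrow> y \<in> carrier V \<Longrightarrow> c \<odot>\<^bsub>V\<^esub> (x \<oplus>\<^bsub>V\<^esub> y) = c \<odot>\<^bsub>V\<^esub> x \<oplus>\<^bsub>V\<^esub> c \<odot>\<^bsub>V\<^esub> y"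
    and "\<And>c c' x. x \<in> carrier V \<Longrightarrow> (c * c') \<odot>\<^bsub>V\<^esub> x = c \<odot>\<^bsub>V\<^esub> (c' \<odot>\<^bsub>V\<^esub> x)"
    and "\<And>x. x \<in> carrier V \<Longrightarrow> 1 \<odot>\<^bsub>V\<^esub> x = x"
    and hom: "\<And>k x. x \<in> hom_part V k \<Longrightarrow> x \<in> carrier V" "\<And>k. \<zero>\<^bsub>V\<^esub> \<in> hom_part V k"
      "\<And>k x y. x \<in> hom_part V k \<Longrightarrow> y \<in> hom_part V k \<Longrightarrow> x \<oplus>\<^bsub>V\<^esub> y \<in> hom_part V k"
      "\<And>k c x. x \<in> hom_part V k \<Longrightarrow> c \<odot>\<^bsub>V\<^esub> x \<in> hom_part V k"
    and decomp: "\<And>x. x \<in> carrier V \<Longrightarrow> \<exists>!f. is_decomp V x f"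
  shows "graded_space V"
proof -
  have m: "module (ring_of_type_algebra :: 'k ring) V"
    by (rule moduleI[OF cring_field]) (use assms in \<open>auto simp: type_algebra_simps\<close>)
  show ?thesis
  proof (rule graded_space.intro[OF m graded_space_axioms.intro])
    interpret module "ring_of_type_algebra :: 'k ring" V by (rule m)
    have inv: "\<ominus>\<^bsub>V\<^esub> x = (- 1) \<odot>\<^bsub>V\<^esub> x" if "x \<in> carrier V" for x
      using smult_l_minus[of 1 x] that assms(6) cring.cring_simprules(3)[OF cring_field]
      by (metis (no_types, lifting) M.minus_equality UNIV_I add.left_inverse assms(3) closed smult_l_null type_algebra_simps(1,5))
    show "submodule (hom_part V k) (ring_of_type_algebra :: 'k ring) V" for k
      by (rule submoduleI) (use hom inv in \<open>auto simp: type_algebra_simps\<close>)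
    show "\<exists>!f. (\<forall>k. f k \<in> hom_part V k) \<and> finite {k. f k \<noteq> \<zero>\<^bsub>V\<^esub>}
           \<and> x = (\<Oplus>\<^bsub>V\<^esub>k\<in>{k. f k \<noteq> \<zero>\<^bsub>V\<^esub>}. f k)" if "x \<in> carrier V" for x
      using decomp[OF that] by (simp only: is_decomp_def)
  qed
qed

locale graded_iso = M: graded_space M
  for r :: int and \<theta> :: "'v \<Rightarrow> 'w" and M :: "('k::field, 'v, 'y) graded_scheme"
    and T :: "('k, 'w, 'z) graded_scheme" +
  assumes inj: "inj_on \<theta> (carrier M)" and carrier_T: "carrier T = \<theta> ` carrier M"
    and \<theta>_add: "x \<in> carrier M \<Longrightarrow> y \<in> carrier M \<Longrightarrow> \<theta> x \<oplus>\<^bsub>T\<^esub> \<theta> y = \<theta> (x \<oplus>\<^bsub>M\<^esub> y)"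
    and \<theta>_zero: "\<zero>\<^bsub>T\<^esub> = \<theta> \<zero>\<^bsub>M\<^esub>"
    and \<theta>_smult: "x \<in> carrier M \<Longrightarrow> c \<odot>\<^bsub>T\<^esub> \<theta> x = \<theta> (c \<odot>\<^bsub>M\<^esub> x)"
    and \<theta>_hom: "hom_part T k = \<theta> ` hom_part M (k - r)"
begin

lemma \<theta>_eq: "x \<in> carrier M \<Longrightarrow> y \<in> carrier M \<Longrightarrow> \<theta> x = \<theta> y \<longleftrightarrow> x = y"
  using inj by (auto dest: inj_onD)

lemma abelian_group_T: "abelian_group T"
proof (rule abelian_groupI)
  fix x assume "x \<in> carrier T"
  then obtain v where v: "v \<in> carrier M" "x = \<theta> v" by (auto simp: carrier_T)
  show "\<exists>y\<in>carrier T. y \<oplus>\<^bsub>T\<^esub> x = \<zero>\<^bsub>T\<^esub>"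
    by (rule bexI[of _ "\<theta> (\<ominus>\<^bsub>M\<^esub> v)"]) (use v in \<open>auto simp: carrier_T \<theta>_add \<theta>_zero M.l_neg\<close>)
qed (auto simp: carrier_T \<theta>_add \<theta>_zero M.a_ac)

lemma decomp_iff:
  assumes f: "\<And>k. f k \<in> hom_part M k" and x: "x \<in> carrier M"
  shows "is_decomp T (\<theta> x) (\<lambda>k. \<theta> (f (k - r))) \<longleftrightarrow> is_decomp M x f"
proof -
  define K where "K = {k. f k \<noteq> \<zero>\<^bsub>M\<^esub>}"
  have fc: "f k \<in> carrier M" for k using f M.hom_part_carrier by blast
  have K: "{k. \<theta> (f (k - r)) \<noteq> \<zero>\<^bsub>T\<^esub>} = (\<lambda>k. k + r) ` K"
  proof (rule Set.set_eqI)
    fix k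
    have "k \<in> (\<lambda>k. k + r) ` K \<longleftrightarrow> k - r \<in> K"
      by (auto simp: image_iff intro!: bexI[of _ "k - r"])
    then show "k \<in> {k. \<theta> (f (k - r)) \<noteq> \<zero>\<^bsub>T\<^esub>} \<longleftrightarrow> k \<in> (\<lambda>k. k + r) ` K"
      unfolding \<theta>_zero using \<theta>_eq[OF fc M.zero_closed] by (simp add: K_def)
  qed
  have inj: "inj_on (\<lambda>k. k + r) K" by (auto simp: inj_on_def)
  have "(\<Oplus>\<^bsub>T\<^esub>k\<in>(\<lambda>k. k + r) ` K. \<theta> (f (k - r))) = \<theta> (\<Oplus>\<^bsub>M\<^esub>k\<in>K. f k)" if "finite K"
  proof -
    interpret T: abelian_group T by (rule abelian_group_T)
    have "(\<Oplus>\<^bsub>T\<^esub>k\<in>(\<lambda>k. k + r) ` K. \<theta> (f (k - r))) = (\<Oplus>\<^bsub>T\<^esub>k\<in>K. \<theta> (f (k + r - r)))"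
      by (rule T.finsum_reindex[OF _ inj]) (use fc in \<open>auto simp: carrier_T\<close>)
    also have "\<dots> = \<theta> (\<Oplus>\<^bsub>M\<^esub>k\<in>K. f k)"
      unfolding add_diff_cancel_right'
      by (rule additive_finsum[OF M.abelian_monoid_axioms T.abelian_monoid_axioms, symmetric])
        (use fc that in \<open>auto simp: carrier_T \<theta>_add \<theta>_zero\<close>)
    finally show ?thesis .
  qed
  moreover have "\<theta> x = \<theta> (\<Oplus>\<^bsub>M\<^esub>k\<in>K. f k) \<longleftrightarrow> x = (\<Oplus>\<^bsub>M\<^esub>k\<in>K. f k)"
    by (rule \<theta>_eq[OF x]) (use fc in \<open>auto intro!: M.finsum_closed\<close>)
  moreover have "finite ((\<lambda>k. k + r) ` K) \<longleftrightarrow> finite K"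
    using inj by (rule finite_image_iff)
  ultimately show ?thesis
    unfolding is_decomp_def K using f by (auto simp: K_def[symmetric] \<theta>_hom)
qed

lemma decomp_T:
  assumes "y \<in> carrier T"
  shows "\<exists>!g. is_decomp T y g"
proof -
  from assms obtain x where x: "x \<in> carrier M" "y = \<theta> x" by (auto simp: carrier_T)
  obtain f where f: "is_decomp M x f" and uniq: "\<And>g. is_decomp M x g \<Longrightarrow> g = f"
    using M.decomp[OF x(1)] by (elim ex1E) blast
  show ?thesis
  proof (rule ex1I[of _ "\<lambda>k. \<theta> (f (k - r))"])
    show "is_decomp T y (\<lambda>k. \<theta> (f (k - r)))"
      unfolding x(2) by (subst decomp_iff) (use f x in \<open>auto simp: is_decomp_def\<close>)
    fix g assume g: "is_decomp T y g"
    have "\<exists>z. z \<in> hom_part M k \<and> g (k + r) = \<theta> z" for k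
    proof -
      have "g (k + r) \<in> \<theta> ` hom_part M (k + r - r)" using g by (simp only: is_decomp_def \<theta>_hom)
      then show ?thesis by auto
    qed
    then obtain z where z: "\<And>k. z k \<in> hom_part M k" "\<And>k. g (k + r) = \<theta> (z k)" by metis
    have gz: "g = (\<lambda>k. \<theta> (z (k - r)))" using z(2)[of "_ - r"] by auto
    have "is_decomp M x z"
      using g decomp_iff[OF z(1) x(1)] unfolding gz x(2) by simp
    then show "g = (\<lambda>k. \<theta> (f (k - r)))" using uniq gz by simp
  qed
qed

lemma graded_space_T: "graded_space T"
  by (rule graded_spaceI[OF abelian_group_T])
    (auto simp: carrier_T \<theta>_add \<theta>_zero \<theta>_smult \<theta>_hom M.smult_simps M.hom_part_zero M.hom_part_add M.hom_part_smult
      decomp_T[unfolded carrier_T] M.hom_part_carrier)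

end

locale pdg_iso = graded_iso r \<theta> M T + M: pdg_space p M dM
  for p :: nat and r :: int and \<theta> :: "'v \<Rightarrow> 'w" and M :: "('k::field, 'v, 'y) graded_scheme"
    and T :: "('k, 'w, 'z) graded_scheme" and dM dT +
  assumes \<theta>_d: "x \<in> carrier M \<Longrightarrow> dT (\<theta> x) = \<theta> (dM x)"
begin

lemma dM_simps: "x \<in> carrier M \<Longrightarrow> dM x \<in> carrier M"
  "x \<in> carrier M \<Longrightarrow> y \<in> carrier M \<Longrightarrow> dM (x \<oplus>\<^bsub>M\<^esub> y) = dM x \<oplus>\<^bsub>M\<^esub> dM y"
  "x \<in> carrier M \<Longrightarrow> dM (c \<odot>\<^bsub>M\<^esub> x) = c \<odot>\<^bsub>M\<^esub> dM x"
  using M.d_linear by (auto simp: linear_maps_def)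

lemma \<theta>_d_pow: "x \<in> carrier M \<Longrightarrow> (dM ^^ k) x \<in> carrier M \<and> (dT ^^ k) (\<theta> x) = \<theta> ((dM ^^ k) x)"
  by (induction k) (auto simp: \<theta>_d dM_simps)

lemma pdg_space_T: "pdg_space p T dT"
proof (rule pdg_space.intro[OF graded_space_T], standard)
  show "dT \<in> linear_maps T T"
    by (auto simp: linear_maps_def carrier_T \<theta>_add \<theta>_smult \<theta>_d dM_simps M.smult_simps(1))
  show "dT x \<in> hom_part T (k + 2)" if "x \<in> hom_part T k" for x k
    using that M.d_degree[of _ "k - r"] by (auto simp: \<theta>_hom \<theta>_d M.hom_part_carrier algebra_simps)
  show "(dT ^^ p) x = \<zero>\<^bsub>T\<^esub>" if "x \<in> carrier T" for x
    using that by (auto simp: carrier_T \<theta>_d_pow \<theta>_zero M.d_nilpotent)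
qed

end

lemma pdg_bimodule_transport:
  fixes M :: "('k::field, 'v, 'a, 'b, 'y) gbimod_scheme" and T :: "('k, 'w, 'a, 'b, 'z) gbimod_scheme"
  assumes iso: "graded_iso r \<theta> M T" and M: "pdg_bimodule p A dA B dB M dM"
    and d: "\<And>x. x \<in> carrier M \<Longrightarrow> dT (\<theta> x) = \<theta> (dM x)"
    and l: "\<And>a x. a \<in> carrier A \<Longrightarrow> x \<in> carrier M \<Longrightarrow> lact T a (\<theta> x) = \<theta> (lact M a x)"
    and rr: "\<And>x b. x \<in> carrier M \<Longrightarrow> b \<in> carrier B \<Longrightarrow> ract T (\<theta> x) b = \<theta> (ract M x b)"
  shows "pdg_bimodule p A dA B dB T dT"
proof -
  interpret M: pdg_bimodule p A dA B dB M dM by (rule M)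
  interpret pdg_iso p r \<theta> M T dM dT
    by (rule pdg_iso.intro[OF iso M.left.mdl.pdg_space_axioms]) (standard, rule d)
  have dA: "a \<in> carrier A \<Longrightarrow> dA a \<in> carrier A" for a
    using M.left.alg.d_linear by (auto simp: linear_maps_def)
  have dB: "b \<in> carrier B \<Longrightarrow> dB b \<in> carrier B" for b
    using M.right.alg.d_linear by (auto simp: linear_maps_def)
  note ac = M.left.alg.hom_part_carrier M.right.alg.hom_part_carrier M.left.mdl.hom_part_carrier
  have L: "left_pdg_module p A dA T dT"
    by (rule left_pdg_module.intro[OF M.left.alg.pdg_algebra_axioms pdg_space_T], standard)
      (use ac in \<open>auto simp: carrier_T \<theta>_add \<theta>_smult \<theta>_d l dA dM_simps M.left.lact_closed M.left.lact_add_left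
        M.left.lact_add_right M.left.lact_smult_left M.left.lact_smult_right M.left.lact_mult M.left.lact_one
        M.left.left_leibniz M.left.mdl.smult_simps M.left.alg.smult_simps(1) \<theta>_hom M.left.lact_degree add_diff_eq[symmetric]
        intro!: image_eqI[OF refl M.left.lact_degree]\<close>)
  have R: "right_pdg_module p B dB T dT"
    by (rule right_pdg_module.intro[OF M.right.alg.pdg_algebra_axioms pdg_space_T], standard)
      (use ac in \<open>auto simp: carrier_T \<theta>_add \<theta>_smult \<theta>_d rr dB dM_simps M.right.ract_closed M.right.ract_add_left
        M.right.ract_add_right M.right.ract_smult_left M.right.ract_smult_right M.right.ract_mult M.right.ract_one
        M.right.right_leibniz M.left.mdl.smult_simps M.right.alg.smult_simps(1) \<theta>_hom
        intro!: image_eqI[OF refl M.right.ract_degree[THEN back_subst[where P = "\<lambda>k. _ \<in> hom_part M k"]]]\<close>)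
  show ?thesis
    by (rule pdg_bimodule.intro[OF L R], standard)
      (auto simp: carrier_T l rr M.left.lact_closed M.right.ract_closed M.lact_ract)
qed

lemma pdg_bimodule_shift:
  fixes M :: "('k::field, 'v, 'a, 'b, 'y) gbimod_scheme"
  assumes M: "pdg_bimodule p A dA B dB M dM"
  shows "pdg_bimodule p A dA B dB (shift r M) dM"
proof -
  interpret M: pdg_bimodule p A dA B dB M dM by (rule M)
  have "graded_iso r id M (shift r M)"
    by (rule graded_iso.intro[OF M.left.mdl.graded_space_axioms], standard) (auto simp: shift_def)
  then show ?thesis
    by (rule pdg_bimodule_transport[OF _ M]) (auto simp: shift_def)
qed

locale graded_retract = V: pdg_space p V d
  for p :: nat and \<pi> :: "'v \<Rightarrow> 'v" and V :: "('k::field, 'v, 'y) graded_scheme"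
    and T :: "('k, 'v, 'z) graded_scheme" and d +
  assumes \<pi>_linear: "\<pi> \<in> linear_maps V V" and \<pi>_idem: "x \<in> carrier V \<Longrightarrow> \<pi> (\<pi> x) = \<pi> x"
    and \<pi>_hom: "x \<in> hom_part V k \<Longrightarrow> \<pi> x \<in> hom_part V k"
    and \<pi>_d: "x \<in> carrier V \<Longrightarrow> d (\<pi> x) = \<pi> (d x)"
    and carrier_T: "carrier T = \<pi> ` carrier V" and add_T: "add T = add V"
    and zero_T: "\<zero>\<^bsub>T\<^esub> = \<zero>\<^bsub>V\<^esub>" and smult_T: "module.smult T = module.smult V"
    and hom_T: "hom_part T k = hom_part V k \<inter> carrier T"
begin

lemma \<pi>_simps: "x \<in> carrier V \<Longrightarrow> \<pi> x \<in> carrier V"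
  "x \<in> carrier V \<Longrightarrow> y \<in> carrier V \<Longrightarrow> \<pi> x \<oplus>\<^bsub>V\<^esub> \<pi> y = \<pi> (x \<oplus>\<^bsub>V\<^esub> y)"
  "x \<in> carrier V \<Longrightarrow> c \<odot>\<^bsub>V\<^esub> \<pi> x = \<pi> (c \<odot>\<^bsub>V\<^esub> x)"
  using \<pi>_linear by (auto simp: linear_maps_def)

lemma d_simps: "x \<in> carrier V \<Longrightarrow> d x \<in> carrier V"
  "x \<in> carrier V \<Longrightarrow> y \<in> carrier V \<Longrightarrow> d (x \<oplus>\<^bsub>V\<^esub> y) = d x \<oplus>\<^bsub>V\<^esub> d y"
  "x \<in> carrier V \<Longrightarrow> d (c \<odot>\<^bsub>V\<^esub> x) = c \<odot>\<^bsub>V\<^esub> d x"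
  using V.d_linear by (auto simp: linear_maps_def)

lemma \<pi>_zero: "\<pi> \<zero>\<^bsub>V\<^esub> = \<zero>\<^bsub>V\<^esub>"
  using \<pi>_simps(3)[of "\<zero>\<^bsub>V\<^esub>" 0] \<pi>_simps(1)[of "\<zero>\<^bsub>V\<^esub>"] by (simp add: V.smult_zero)

lemma in_T_iff: "x \<in> carrier T \<longleftrightarrow> x \<in> carrier V \<and> \<pi> x = x"
  by (auto simp: carrier_T \<pi>_simps \<pi>_idem) (metis image_eqI)

lemma zero_in_T: "\<zero>\<^bsub>V\<^esub> \<in> carrier T"
  by (simp add: in_T_iff \<pi>_zero)

lemma abelian_group_T: "abelian_group T"
proof (rule abelian_groupI)
  fix x assume "x \<in> carrier T"
  then obtain v where v: "v \<in> carrier V" "x = \<pi> v" by (auto simp: carrier_T)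
  show "\<exists>y\<in>carrier T. y \<oplus>\<^bsub>T\<^esub> x = \<zero>\<^bsub>T\<^esub>"
    by (rule bexI[of _ "\<pi> (\<ominus>\<^bsub>V\<^esub> v)"])
      (use v in \<open>auto simp: carrier_T add_T zero_T \<pi>_simps V.l_neg \<pi>_zero\<close>)
qed (use zero_in_T in \<open>auto simp: in_T_iff add_T zero_T V.a_ac simp flip: \<pi>_simps(2)\<close>)

lemma finsum_T: "finite K \<Longrightarrow> f \<in> K \<rightarrow> carrier T \<Longrightarrow> finsum T f K = finsum V f K"
  using additive_finsum[OF abelian_group.axioms(1)[OF abelian_group_T] V.abelian_monoid_axioms, of id K f]
  by (auto simp: zero_T add_T in_T_iff)

lemma decomp_T:
  assumes x: "x \<in> carrier T"
  shows "\<exists>!f. is_decomp T x f"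
proof -
  have xV: "x \<in> carrier V" "\<pi> x = x" using x by (auto simp: in_T_iff)
  obtain f where f: "is_decomp V x f" and uniq: "\<And>g. is_decomp V x g \<Longrightarrow> g = f"
    using V.decomp[OF xV(1)] by (elim ex1E) blast
  define K where "K = {k. f k \<noteq> \<zero>\<^bsub>V\<^esub>}"
  have fc: "f k \<in> carrier V" "finite K" for k
    using f V.hom_part_carrier by (auto simp: is_decomp_def K_def)
  have sub: "{k. \<pi> (f k) \<noteq> \<zero>\<^bsub>V\<^esub>} \<subseteq> K" by (auto simp: K_def \<pi>_zero)
  have "\<pi> x = \<pi> (\<Oplus>\<^bsub>V\<^esub>k\<in>K. f k)" using f by (simp add: is_decomp_def K_def)
  also have "\<dots> = (\<Oplus>\<^bsub>V\<^esub>k\<in>K. \<pi> (f k))"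
    by (rule additive_finsum[OF V.abelian_monoid_axioms V.abelian_monoid_axioms])
      (use fc in \<open>auto simp: \<pi>_simps \<pi>_zero\<close>)
  also have "\<dots> = (\<Oplus>\<^bsub>V\<^esub>k\<in>{k. \<pi> (f k) \<noteq> \<zero>\<^bsub>V\<^esub>}. \<pi> (f k))"
    by (rule V.add.finprod_mono_neutral_cong_right[OF fc(2) sub]) (use fc in \<open>auto simp: \<pi>_simps\<close>)
  finally have "is_decomp V x (\<lambda>k. \<pi> (f k))"
    using f sub fc(2) xV by (auto simp: is_decomp_def \<pi>_hom intro: finite_subset)
  from uniq[OF this] have \<pi>f: "\<pi> (f k) = f k" for k by metis
  have iff: "is_decomp T x g \<longleftrightarrow> is_decomp V x g \<and> (\<forall>k. g k \<in> carrier T)" for g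
    using finsum_T[of "{k. g k \<noteq> \<zero>\<^bsub>V\<^esub>}" g] by (auto simp: is_decomp_def hom_T zero_T)
  show ?thesis
  proof (rule ex1I[of _ f])
    show "is_decomp T x f" using f fc(1) \<pi>f by (simp add: iff in_T_iff)
    show "g = f" if "is_decomp T x g" for g using that uniq by (simp add: iff)
  qed
qed

lemma pdg_space_T: "pdg_space p T d"
proof (rule pdg_space.intro)
  have cl: "x \<in> carrier T \<Longrightarrow> x \<in> carrier V" "x \<in> carrier T \<Longrightarrow> c \<odot>\<^bsub>V\<^esub> x \<in> carrier T"
    "x \<in> carrier T \<Longrightarrow> y \<in> carrier T \<Longrightarrow> x \<oplus>\<^bsub>V\<^esub> y \<in> carrier T" for x y c
    using \<pi>_simps(2)[of x y] \<pi>_simps(3)[of x c] by (auto simp: in_T_iff V.smult_simps(1))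
  show "graded_space T"
    by (rule graded_spaceI[OF abelian_group_T _ _ _ _ _ _ _ _ _ decomp_T])
      (simp_all add: add_T zero_T smult_T V.smult_simps hom_T V.hom_part_zero
        V.hom_part_add V.hom_part_smult cl zero_in_T)
  show "pdg_space_axioms p T d"
    by standard (use V.d_degree in \<open>auto simp: linear_maps_def in_T_iff add_T smult_T d_simps hom_T zero_T V.d_nilpotent
        simp flip: \<pi>_d\<close>)
qed

end


lemma with_actions_simps [simp]:
  "carrier (with_actions V l r) = carrier V" "add (with_actions V l r) = add V"
  "\<zero>\<^bsub>with_actions V l r\<^esub> = \<zero>\<^bsub>V\<^esub>" "module.smult (with_actions V l r) = module.smult V"
  "hom_part (with_actions V l r) = hom_part V" "lact (with_actions V l r) = l" "ract (with_actions V l r) = r"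
  by (simp_all add: with_actions_def graded.defs gbimod.defs)

lemma graded_subspace_simps [simp]:
  "carrier (graded_subspace V C) = C" "add (graded_subspace V C) = add V"
  "\<zero>\<^bsub>graded_subspace V C\<^esub> = \<zero>\<^bsub>V\<^esub>" "module.smult (graded_subspace V C) = module.smult V"
  "hom_part (graded_subspace V C) k = hom_part V k \<inter> C"
  by (simp_all add: graded_subspace_def)

context pdg_algebra
begin

lemma dA_simps: "x \<in> carrier A \<Longrightarrow> dA x \<in> carrier A"
  "x \<in> carrier A \<Longrightarrow> y \<in> carrier A \<Longrightarrow> dA (x \<oplus>\<^bsub>A\<^esub> y) = dA x \<oplus>\<^bsub>A\<^esub> dA y"
  "x \<in> carrier A \<Longrightarrow> dA (c \<odot>\<^bsub>A\<^esub> x) = c \<odot>\<^bsub>A\<^esub> dA x"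
  using d_linear by (auto simp: linear_maps_def)

lemma dA_one: "dA \<one>\<^bsub>A\<^esub> = \<zero>\<^bsub>A\<^esub>"
proof -
  have "dA \<one>\<^bsub>A\<^esub> = dA \<one>\<^bsub>A\<^esub> \<oplus>\<^bsub>A\<^esub> dA \<one>\<^bsub>A\<^esub>"
    using leibniz[of "\<one>\<^bsub>A\<^esub>" "\<one>\<^bsub>A\<^esub>"] by (simp add: dA_simps)
  then show ?thesis by (simp add: dA_simps)
qed

end

locale corner_map = A: pdg_algebra p A dA + B: pdg_algebra p B dB
  for p :: nat and A :: "('k::field, 'a) graded" and dA and B :: "('k, 'b) graded" and dB +
  fixes \<phi> :: "'a \<Rightarrow> 'b"
  assumes \<phi>_linear: "\<phi> \<in> linear_maps A B"
    and \<phi>_mult: "a \<in> carrier A \<Longrightarrow> a' \<in> carrier A \<Longrightarrow> \<phi> (a \<otimes>\<^bsub>A\<^esub> a') = \<phi> a \<otimes>\<^bsub>B\<^esub> \<phi> a'"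
    and \<phi>_hom: "a \<in> hom_part A k \<Longrightarrow> \<phi> a \<in> hom_part B k"
    and \<phi>_d: "a \<in> carrier A \<Longrightarrow> dB (\<phi> a) = \<phi> (dA a)"
begin

lemma \<phi>_simps: "a \<in> carrier A \<Longrightarrow> \<phi> a \<in> carrier B"
  "a \<in> carrier A \<Longrightarrow> a' \<in> carrier A \<Longrightarrow> \<phi> (a \<oplus>\<^bsub>A\<^esub> a') = \<phi> a \<oplus>\<^bsub>B\<^esub> \<phi> a'"
  "a \<in> carrier A \<Longrightarrow> \<phi> (c \<odot>\<^bsub>A\<^esub> a) = c \<odot>\<^bsub>B\<^esub> \<phi> a"
  using \<phi>_linear by (auto simp: linear_maps_def)

abbreviation "ee \<equiv> \<phi> \<one>\<^bsub>A\<^esub>"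

lemma ee_simps: "ee \<in> carrier B"
  "a \<in> carrier A \<Longrightarrow> ee \<otimes>\<^bsub>B\<^esub> \<phi> a = \<phi> a" "a \<in> carrier A \<Longrightarrow> \<phi> a \<otimes>\<^bsub>B\<^esub> ee = \<phi> a"
  "ee \<in> hom_part B 0"
  using A.one_degree by (auto simp: \<phi>_simps \<phi>_hom simp flip: \<phi>_mult)

lemma ee_ee: "ee \<otimes>\<^bsub>B\<^esub> ee = ee"
  using ee_simps(2)[of "\<one>\<^bsub>A\<^esub>"] by simp

lemma ee_d: "dB ee = \<zero>\<^bsub>B\<^esub>"
proof -
  have "\<phi> \<zero>\<^bsub>A\<^esub> = \<zero>\<^bsub>B\<^esub>"
    using \<phi>_simps(3)[of "\<zero>\<^bsub>A\<^esub>" 0] \<phi>_simps(1)[of "\<zero>\<^bsub>A\<^esub>"] by (simp add: A.smult_zero B.smult_zero)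
  then show ?thesis by (simp add: \<phi>_d A.dA_one)
qed

definition "L = with_actions (graded_subspace B {ee \<otimes>\<^bsub>B\<^esub> y | y. y \<in> carrier B})
    (\<lambda>a y. \<phi> a \<otimes>\<^bsub>B\<^esub> y) (\<lambda>y b. y \<otimes>\<^bsub>B\<^esub> b)"

definition "R = with_actions (graded_subspace B {y \<otimes>\<^bsub>B\<^esub> ee | y. y \<in> carrier B})
    (\<lambda>b y. b \<otimes>\<^bsub>B\<^esub> y) (\<lambda>y a. y \<otimes>\<^bsub>B\<^esub> \<phi> a)"

lemma retract_L: "graded_retract p (\<lambda>y. ee \<otimes>\<^bsub>B\<^esub> y) B L dB"
  by (rule graded_retract.intro[OF B.pdg_space_axioms], standard)
    (use B.mult_degree[OF ee_simps(4)] in \<open>auto simp: linear_maps_def L_def ee_simps B.r_distr B.smult_mult_right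
      B.m_assoc[symmetric] ee_ee B.leibniz ee_d B.dA_simps\<close>)

lemma retract_R: "graded_retract p (\<lambda>y. y \<otimes>\<^bsub>B\<^esub> ee) B R dB"
  by (rule graded_retract.intro[OF B.pdg_space_axioms], standard)
    (use B.mult_degree[OF _ ee_simps(4)] in \<open>auto simp: linear_maps_def R_def ee_simps B.l_distr B.smult_mult_left
      B.m_assoc ee_ee B.leibniz ee_d B.dA_simps\<close>)

lemma in_L: "x \<in> carrier L \<longleftrightarrow> x \<in> carrier B \<and> ee \<otimes>\<^bsub>B\<^esub> x = x"
  and in_R: "x \<in> carrier R \<longleftrightarrow> x \<in> carrier B \<and> x \<otimes>\<^bsub>B\<^esub> ee = x"
  by (rule graded_retract.in_T_iff[OF retract_L] graded_retract.in_T_iff[OF retract_R])+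

lemma L_simps: "add L = add B" "module.smult L = module.smult B" "hom_part L k = hom_part B k \<inter> carrier L"
    "lact L = (\<lambda>a y. \<phi> a \<otimes>\<^bsub>B\<^esub> y)" "ract L = (\<lambda>y b. y \<otimes>\<^bsub>B\<^esub> b)"
  and R_simps: "add R = add B" "module.smult R = module.smult B" "hom_part R k = hom_part B k \<inter> carrier R"
    "lact R = (\<lambda>b y. b \<otimes>\<^bsub>B\<^esub> y)" "ract R = (\<lambda>y a. y \<otimes>\<^bsub>B\<^esub> \<phi> a)"
  by (simp_all add: L_def R_def)

lemma bimodule_L: "pdg_bimodule p A dA B dB L dB"
proof -
  note s = in_L L_simps \<phi>_simps A.dA_simps B.dA_simps \<phi>_mult \<phi>_d B.l_distr B.r_distr B.smult_mult_left
    B.smult_mult_right ee_simps(1-3) B.leibniz B.mult_degree \<phi>_hom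
  have as: "ee \<otimes>\<^bsub>B\<^esub> (\<phi> a \<otimes>\<^bsub>B\<^esub> x) = \<phi> a \<otimes>\<^bsub>B\<^esub> x" if "a \<in> carrier A" "x \<in> carrier B" for a x
    using that by (simp add: B.m_assoc[symmetric] \<phi>_simps ee_simps)
  have as2: "ee \<otimes>\<^bsub>B\<^esub> (x \<otimes>\<^bsub>B\<^esub> b) = x \<otimes>\<^bsub>B\<^esub> b" if "ee \<otimes>\<^bsub>B\<^esub> x = x" "x \<in> carrier B" "b \<in> carrier B" for x b
    using that by (simp add: B.m_assoc[symmetric] ee_simps)
  have "left_pdg_module p A dA L dB"
    by (rule left_pdg_module.intro[OF A.pdg_algebra_axioms graded_retract.pdg_space_T[OF retract_L]], standard)
      (auto simp: s as B.m_assoc A.hom_part_carrier)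
  moreover have "right_pdg_module p B dB L dB"
    by (rule right_pdg_module.intro[OF B.pdg_algebra_axioms graded_retract.pdg_space_T[OF retract_L]], standard)
      (auto simp: s as2 B.m_assoc B.hom_part_carrier B.a_comm)
  ultimately show ?thesis
    by (rule pdg_bimodule.intro) (standard, auto simp: s B.m_assoc)
qed

lemma bimodule_R: "pdg_bimodule p B dB A dA R dB"
proof -
  note s = in_R R_simps \<phi>_simps A.dA_simps B.dA_simps \<phi>_mult \<phi>_d B.l_distr B.r_distr B.smult_mult_left
    B.smult_mult_right ee_simps(1-3) B.leibniz B.mult_degree \<phi>_hom
  have "left_pdg_module p B dB R dB"
    by (rule left_pdg_module.intro[OF B.pdg_algebra_axioms graded_retract.pdg_space_T[OF retract_R]], standard)
      (auto simp: s B.m_assoc B.hom_part_carrier)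
  moreover have "right_pdg_module p A dA R dB"
    by (rule right_pdg_module.intro[OF A.pdg_algebra_axioms graded_retract.pdg_space_T[OF retract_R]], standard)
      (auto simp: s B.m_assoc A.hom_part_carrier B.a_comm)
  ultimately show ?thesis
    by (rule pdg_bimodule.intro) (standard, auto simp: s B.m_assoc)
qed

end

section \<open>Tensor products over the unit bimodule\<close>

lemma lookup_scal: "Poly_Mapping.lookup (scal c f) z = (c :: 'k::field) * Poly_Mapping.lookup f z"
  by (auto simp: Poly_Mapping.map.rep_eq when_def)

lemma keys_scal: "Poly_Mapping.keys (scal c f) \<subseteq> Poly_Mapping.keys (f :: 'x \<Rightarrow>\<^sub>0 'k::field)"
  by (auto simp: in_keys_iff lookup_scal)

lemma scal_single: "scal c (Poly_Mapping.single z d) = Poly_Mapping.single z (c * d :: 'k::field)"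
  by (rule poly_mapping_eqI) (simp add: lookup_scal lookup_single when_def)

lemma scal_diff: "scal c (f - g) = scal c f - scal c (g :: 'x \<Rightarrow>\<^sub>0 'k::field)"
  by (rule poly_mapping_eqI) (simp add: lookup_scal lookup_minus algebra_simps)

lemma scal_minus_one: "scal (- 1) f = - (f :: 'x \<Rightarrow>\<^sub>0 'k::field)"
  by (rule poly_mapping_eqI) (simp add: lookup_scal)

lemma lin_ext_add: "lin_ext h (f + g) = lin_ext h f + lin_ext h (g :: 'x \<Rightarrow>\<^sub>0 'k::field)"
  unfolding lin_ext_def by (rule setsum_keys_plus_distrib) (auto simp: single_add)

lemma lin_ext_single: "lin_ext h (Poly_Mapping.single z c) = Poly_Mapping.single (h z) c"
  by (cases "c = 0") (auto simp: lin_ext_def)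

lemma (in graded_space) finsum_hom_part:
  "finite K \<Longrightarrow> f \<in> K \<rightarrow> hom_part V k \<Longrightarrow> finsum V f K \<in> hom_part V k"
proof (induction K rule: finite_induct)
  case (insert x K)
  then have "finsum V f (insert x K) = f x \<oplus>\<^bsub>V\<^esub> finsum V f K"
    using hom_part_carrier by (intro finsum_insert) auto
  with insert show ?case by (auto intro: hom_part_add)
qed (simp add: hom_part_zero)

locale tensor_collapse = X: pdg_bimodule p A dA C dC Y dY
  for p :: nat and A :: "('k::field, 'a, 'z1) graded_scheme" and dA
    and C :: "('k, 'c, 'z2) graded_scheme" and dC and Y :: "('k, 'w, 'a, 'c, 'z3) gbimod_scheme" and dY +
  fixes B :: "('k, 'b, 'z4) graded_scheme"
    and M :: "('k, 'u, 'a, 'b, 'z5) gbimod_scheme" and dM :: "'u \<Rightarrow> 'u"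
    and N :: "('k, 'v, 'b, 'c, 'z6) gbimod_scheme" and dN :: "'v \<Rightarrow> 'v"
    and m :: "'u \<Rightarrow> 'v \<Rightarrow> 'w" and \<sigma> :: "'w \<Rightarrow> 'u \<times> 'v"
  assumes M_closed: "x \<in> carrier M \<Longrightarrow> x' \<in> carrier M \<Longrightarrow> x \<oplus>\<^bsub>M\<^esub> x' \<in> carrier M"
      "x \<in> carrier M \<Longrightarrow> c \<odot>\<^bsub>M\<^esub> x \<in> carrier M" "x \<in> carrier M \<Longrightarrow> dM x \<in> carrier M"
      "x \<in> carrier M \<Longrightarrow> b \<in> carrier B \<Longrightarrow> ract M x b \<in> carrier M"
      "x \<in> carrier M \<Longrightarrow> a \<in> carrier A \<Longrightarrow> lact M a x \<in> carrier M"
      "x \<in> hom_part M k \<Longrightarrow> x \<in> carrier M"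
    and N_closed: "y \<in> carrier N \<Longrightarrow> y' \<in> carrier N \<Longrightarrow> y \<oplus>\<^bsub>N\<^esub> y' \<in> carrier N"
      "y \<in> carrier N \<Longrightarrow> c \<odot>\<^bsub>N\<^esub> y \<in> carrier N" "y \<in> carrier N \<Longrightarrow> dN y \<in> carrier N"
      "y \<in> carrier N \<Longrightarrow> b \<in> carrier B \<Longrightarrow> lact N b y \<in> carrier N"
      "y \<in> carrier N \<Longrightarrow> e \<in> carrier C \<Longrightarrow> ract N y e \<in> carrier N"
      "y \<in> hom_part N k \<Longrightarrow> y \<in> carrier N"
    and m: "x \<in> carrier M \<Longrightarrow> y \<in> carrier N \<Longrightarrow> m x y \<in> carrier Y"
      "x \<in> carrier M \<Longrightarrow> x' \<in> carrier M \<Longrightarrow> y \<in> carrier N \<Longrightarrow> m (x \<oplus>\<^bsub>M\<^esub> x') y = m x y \<oplus>\<^bsub>Y\<^esub> m x' y"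
      "x \<in> carrier M \<Longrightarrow> y \<in> carrier N \<Longrightarrow> y' \<in> carrier N \<Longrightarrow> m x (y \<oplus>\<^bsub>N\<^esub> y') = m x y \<oplus>\<^bsub>Y\<^esub> m x y'"
      "x \<in> carrier M \<Longrightarrow> y \<in> carrier N \<Longrightarrow> m (c \<odot>\<^bsub>M\<^esub> x) y = c \<odot>\<^bsub>Y\<^esub> m x y"
      "x \<in> carrier M \<Longrightarrow> y \<in> carrier N \<Longrightarrow> m x (c \<odot>\<^bsub>N\<^esub> y) = c \<odot>\<^bsub>Y\<^esub> m x y"
      "x \<in> carrier M \<Longrightarrow> y \<in> carrier N \<Longrightarrow> b \<in> carrier B \<Longrightarrow> m (ract M x b) y = m x (lact N b y)"
      "x \<in> carrier M \<Longrightarrow> y \<in> carrier N \<Longrightarrow> a \<in> carrier A \<Longrightarrow> m (lact M a x) y = lact Y a (m x y)"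
      "x \<in> carrier M \<Longrightarrow> y \<in> carrier N \<Longrightarrow> e \<in> carrier C \<Longrightarrow> m x (ract N y e) = ract Y (m x y) e"
      "x \<in> carrier M \<Longrightarrow> y \<in> carrier N \<Longrightarrow> dY (m x y) = m (dM x) y \<oplus>\<^bsub>Y\<^esub> m x (dN y)"
      "x \<in> hom_part M k \<Longrightarrow> y \<in> hom_part N l \<Longrightarrow> m x y \<in> hom_part Y (k + l)"
    and \<sigma>: "z \<in> carrier Y \<Longrightarrow> \<sigma> z \<in> carrier M \<times> carrier N"
      "z \<in> carrier Y \<Longrightarrow> m (fst (\<sigma> z)) (snd (\<sigma> z)) = z"
      "z \<in> hom_part Y k \<Longrightarrow> \<exists>k' l'. k' + l' = k \<and> fst (\<sigma> z) \<in> hom_part M k' \<and> snd (\<sigma> z) \<in> hom_part N l'"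
      "x \<in> carrier M \<Longrightarrow> y \<in> carrier N \<Longrightarrow>
        Poly_Mapping.single (x, y) 1 - Poly_Mapping.single (\<sigma> (m x y)) 1 \<in> tensor_rels B M N"
      "z \<in> carrier Y \<Longrightarrow> z' \<in> carrier Y \<Longrightarrow> Poly_Mapping.single (\<sigma> (z \<oplus>\<^bsub>Y\<^esub> z')) 1
        - Poly_Mapping.single (\<sigma> z) 1 - Poly_Mapping.single (\<sigma> z') 1 \<in> tensor_rels B M N"
      "z \<in> carrier Y \<Longrightarrow> Poly_Mapping.single (\<sigma> (c \<odot>\<^bsub>Y\<^esub> z)) 1 - Poly_Mapping.single (\<sigma> z) c \<in> tensor_rels B M N"
begin

abbreviation "F \<equiv> {f :: 'u \<times> 'v \<Rightarrow>\<^sub>0 'k. Poly_Mapping.keys f \<subseteq> carrier M \<times> carrier N}"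

abbreviation "rels \<equiv> tensor_rels B M N"

definition "\<mu> f = (\<Oplus>\<^bsub>Y\<^esub>z\<in>Poly_Mapping.keys f. Poly_Mapping.lookup f z \<odot>\<^bsub>Y\<^esub> m (fst z) (snd z))"

lemma F_add: "f \<in> F \<Longrightarrow> g \<in> F \<Longrightarrow> f + g \<in> F"
  using Poly_Mapping.keys_add[of f g] by auto

lemma F_single: "x \<in> carrier M \<Longrightarrow> y \<in> carrier N \<Longrightarrow> Poly_Mapping.single (x, y) c \<in> F"
  by auto

lemma F_scal: "f \<in> F \<Longrightarrow> scal c f \<in> F"
  using keys_scal[of c f] by auto

lemma F_diff: "f \<in> F \<Longrightarrow> g \<in> F \<Longrightarrow> f - g \<in> F"
  using F_add[of f "scal (- 1) g"] F_scal[of g "- 1"] by (simp add: scal_minus_one)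

lemma F_induct [consumes 1, case_names zero add single]:
  assumes f: "f \<in> F" and "P 0" and "\<And>f g. f \<in> F \<Longrightarrow> g \<in> F \<Longrightarrow> P f \<Longrightarrow> P g \<Longrightarrow> P (f + g)"
    and "\<And>x y c. x \<in> carrier M \<Longrightarrow> y \<in> carrier N \<Longrightarrow> P (Poly_Mapping.single (x, y) c)"
  shows "P f"
proof -
  have "finite K \<Longrightarrow> K \<subseteq> carrier M \<times> carrier N \<Longrightarrow>
      (\<Sum>z\<in>K. Poly_Mapping.single z (Poly_Mapping.lookup f z)) \<in> F
      \<and> P (\<Sum>z\<in>K. Poly_Mapping.single z (Poly_Mapping.lookup f z))" for K
  proof (induction K rule: finite_induct)
    case (insert z K)
    obtain x y where z: "z = (x, y)" by (cases z)
    have *: "Poly_Mapping.single z (Poly_Mapping.lookup f z) \<in> F"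
      unfolding z using insert(4) by (intro F_single) (auto simp: z)
    have IH: "(\<Sum>z\<in>K. Poly_Mapping.single z (Poly_Mapping.lookup f z)) \<in> F"
      "P (\<Sum>z\<in>K. Poly_Mapping.single z (Poly_Mapping.lookup f z))" using insert(3,4) by simp_all
    have Pz: "P (Poly_Mapping.single z (Poly_Mapping.lookup f z))"
      unfolding z using insert(4) by (intro assms(4)) (auto simp: z)
    show ?case
      unfolding sum.insert[OF insert(1,2)]
      using F_add[OF * IH(1)] assms(3)[OF * IH(1) Pz IH(2)] by (simp only: simp_thms)
  qed (use assms(2) in auto)
  from this[of "Poly_Mapping.keys f"] show ?thesis
    using f by (subst poly_mapping_sum_singles) auto
qed

lemma \<mu>_superset:
  assumes "finite K" "Poly_Mapping.keys f \<subseteq> K" "K \<subseteq> carrier M \<times> carrier N"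
  shows "\<mu> f = (\<Oplus>\<^bsub>Y\<^esub>z\<in>K. Poly_Mapping.lookup f z \<odot>\<^bsub>Y\<^esub> m (fst z) (snd z))"
proof -
  have "m (fst z) (snd z) \<in> carrier Y" if "z \<in> K" for z using assms(3) that m(1) by auto
  then show ?thesis
    unfolding \<mu>_def
    by (intro X.left.mdl.add.finprod_mono_neutral_cong_right[OF assms(1,2), symmetric])
      (simp_all add: X.left.mdl.smult_simps(1) X.left.mdl.smult_zero in_keys_iff)
qed

lemma \<mu>_closed: "f \<in> F \<Longrightarrow> \<mu> f \<in> carrier Y"
  unfolding \<mu>_def using m(1) by (intro X.left.mdl.finsum_closed) (auto simp: X.left.mdl.smult_simps(1))

lemma \<mu>_add: "\<mu> (f + g) = \<mu> f \<oplus>\<^bsub>Y\<^esub> \<mu> g" if "f \<in> F" "g \<in> F"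
proof -
  define K where "K = Poly_Mapping.keys f \<union> Poly_Mapping.keys g"
  have K: "finite K" "K \<subseteq> carrier M \<times> carrier N" using that by (auto simp: K_def)
  have mc: "m (fst z) (snd z) \<in> carrier Y" if "z \<in> K" for z using K(2) that m(1) by auto
  have "\<mu> (f + g) = (\<Oplus>\<^bsub>Y\<^esub>z\<in>K. Poly_Mapping.lookup (f + g) z \<odot>\<^bsub>Y\<^esub> m (fst z) (snd z))"
    by (rule \<mu>_superset[OF K(1) _ K(2)]) (use Poly_Mapping.keys_add[of f g] in \<open>auto simp: K_def\<close>)
  also have "\<dots> = (\<Oplus>\<^bsub>Y\<^esub>z\<in>K. Poly_Mapping.lookup f z \<odot>\<^bsub>Y\<^esub> m (fst z) (snd z)
      \<oplus>\<^bsub>Y\<^esub> Poly_Mapping.lookup g z \<odot>\<^bsub>Y\<^esub> m (fst z) (snd z))"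
    by (rule X.left.mdl.finsum_cong') (use mc in \<open>auto simp: lookup_add X.left.mdl.smult_simps\<close>)
  also have "\<dots> = (\<Oplus>\<^bsub>Y\<^esub>z\<in>K. Poly_Mapping.lookup f z \<odot>\<^bsub>Y\<^esub> m (fst z) (snd z))
      \<oplus>\<^bsub>Y\<^esub> (\<Oplus>\<^bsub>Y\<^esub>z\<in>K. Poly_Mapping.lookup g z \<odot>\<^bsub>Y\<^esub> m (fst z) (snd z))"
    by (rule X.left.mdl.finsum_addf) (use mc in \<open>auto simp: X.left.mdl.smult_simps(1)\<close>)
  finally show ?thesis
    using \<mu>_superset[OF K(1) _ K(2), of f] \<mu>_superset[OF K(1) _ K(2), of g] by (simp add: K_def)
qed

lemma \<mu>_single: "\<mu> (Poly_Mapping.single (x, y) c) = c \<odot>\<^bsub>Y\<^esub> m x y" if "x \<in> carrier M" "y \<in> carrier N"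
  using that m(1)[OF that] by (subst \<mu>_superset[of "{(x, y)}"]) (auto simp: X.left.mdl.smult_simps(1))

lemma \<mu>_zero: "\<mu> 0 = \<zero>\<^bsub>Y\<^esub>"
  by (simp add: \<mu>_def)

lemma \<mu>_scal: "\<mu> (scal c f) = c \<odot>\<^bsub>Y\<^esub> \<mu> f" if "f \<in> F"
  using that
proof (induction f rule: F_induct)
  case zero
  have "scal c 0 = (0 :: 'u \<times> 'v \<Rightarrow>\<^sub>0 'k)" by (rule poly_mapping_eqI) (simp add: lookup_scal)
  then show ?case
    using X.left.mdl.smult_r_null[of c] by (simp add: \<mu>_zero type_algebra_simps)
next
  case (add f g)
  have "scal c (f + g) = scal c f + scal c g"
    by (rule poly_mapping_eqI) (simp add: lookup_scal lookup_add algebra_simps)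
  with add show ?case
    by (simp add: \<mu>_add[OF F_scal F_scal, simplified] \<mu>_add[simplified] X.left.mdl.smult_simps \<mu>_closed[simplified])
next
  case (single x y d)
  then show ?case by (simp add: scal_single \<mu>_single X.left.mdl.smult_simps m(1))
qed

lemma \<mu>_diff: "f \<in> F \<Longrightarrow> g \<in> F \<Longrightarrow> \<mu> (f - g) = \<mu> f \<oplus>\<^bsub>Y\<^esub> (- 1) \<odot>\<^bsub>Y\<^esub> \<mu> g"
  using \<mu>_add[OF _ F_scal, of f g "- 1"] \<mu>_scal[of g "- 1"] by (simp add: scal_minus_one)

lemma smult_minus: "z \<in> carrier Y \<Longrightarrow> z' \<in> carrier Y \<Longrightarrow> z \<oplus>\<^bsub>Y\<^esub> (- 1) \<odot>\<^bsub>Y\<^esub> z' = \<zero>\<^bsub>Y\<^esub> \<longleftrightarrow> z = z'"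
proof -
  assume z: "z \<in> carrier Y" "z' \<in> carrier Y"
  have "z' \<oplus>\<^bsub>Y\<^esub> (- 1) \<odot>\<^bsub>Y\<^esub> z' = \<zero>\<^bsub>Y\<^esub>"
    using X.left.mdl.smult_simps(2)[OF z(2), of 1 "- 1"] z by (simp add: X.left.mdl.smult_simps(5) X.left.mdl.smult_zero)
  moreover have "z = z'" if "z \<oplus>\<^bsub>Y\<^esub> (- 1) \<odot>\<^bsub>Y\<^esub> z' = \<zero>\<^bsub>Y\<^esub>"
    using X.left.mdl.a_assoc[OF z(1) X.left.mdl.smult_simps(1)[OF z(2), of "- 1"] z(2)] calculation that z
      X.left.mdl.a_comm[OF X.left.mdl.smult_simps(1)[OF z(2), of "- 1"] z(2)] by simp
  ultimately show ?thesis by blast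
qed

lemma smult_minus2:
  assumes z: "z \<in> carrier Y" "z' \<in> carrier Y"
  shows "z \<oplus>\<^bsub>Y\<^esub> z' \<oplus>\<^bsub>Y\<^esub> (- 1) \<odot>\<^bsub>Y\<^esub> z \<oplus>\<^bsub>Y\<^esub> (- 1) \<odot>\<^bsub>Y\<^esub> z' = \<zero>\<^bsub>Y\<^esub>"
proof -
  have "z \<oplus>\<^bsub>Y\<^esub> z' \<oplus>\<^bsub>Y\<^esub> (- 1) \<odot>\<^bsub>Y\<^esub> z = z' \<oplus>\<^bsub>Y\<^esub> (z \<oplus>\<^bsub>Y\<^esub> (- 1) \<odot>\<^bsub>Y\<^esub> z)"
    using z X.left.mdl.smult_simps(1)[OF z(1), of "- 1"] by (simp add: X.left.mdl.a_ac)
  also have "\<dots> = z'" using smult_minus[of z z] z by simp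
  finally show ?thesis using smult_minus[of z' z'] z by simp
qed

lemma rels_sub: "f \<in> rels \<Longrightarrow> f \<in> F \<and> \<mu> f = \<zero>\<^bsub>Y\<^esub>"
proof (induction rule: tensor_rels.induct)
  case zero
  show ?case by (simp add: \<mu>_zero)
next
  case (plus f g)
  then show ?case using F_add[of f g] \<mu>_add[of f g] by simp
next
  case (scal f c)
  then show ?case
    using F_scal[of f c] \<mu>_scal[of f c] X.left.mdl.smult_r_null[of c] by (simp add: type_algebra_simps)
next
  case (add_left x x' y)
  then show ?case
    by (intro conjI F_diff F_single M_closed(1-5))
      (simp_all only: \<mu>_diff F_diff F_single M_closed \<mu>_single m X.left.mdl.smult_simps smult_minus2)
next
  case (add_right x y y')
  then show ?case
    by (intro conjI F_diff F_single N_closed(1-5))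
      (simp_all only: \<mu>_diff F_diff F_single N_closed \<mu>_single m X.left.mdl.smult_simps smult_minus2)
next
  case (smult_left x y c)
  then show ?case
    by (intro conjI F_diff F_single M_closed(1-5))
      (simp_all only: \<mu>_diff F_single M_closed \<mu>_single m X.left.mdl.smult_simps smult_minus)
next
  case (smult_right x y c)
  then show ?case
    by (intro conjI F_diff F_single N_closed(1-5))
      (simp_all only: \<mu>_diff F_single N_closed \<mu>_single m X.left.mdl.smult_simps smult_minus)
next
  case (balanced x b y)
  then show ?case
    by (intro conjI F_diff F_single N_closed(1-5) M_closed(1-5))
      (simp_all only: \<mu>_diff F_single N_closed M_closed \<mu>_single m X.left.mdl.smult_simps smult_minus)
qed

lemma rels_diff: "f \<in> rels \<Longrightarrow> g \<in> rels \<Longrightarrow> f - g \<in> rels"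
  using tensor_rels.plus[OF _ tensor_rels.scal[of g _ _ _ "- 1"]] by (simp add: scal_minus_one)

lemma rels_single: "f \<in> F \<Longrightarrow> f - Poly_Mapping.single (\<sigma> (\<mu> f)) 1 \<in> rels"
proof (induction f rule: F_induct)
  case zero
  have "Poly_Mapping.single (\<sigma> \<zero>\<^bsub>Y\<^esub>) 1 \<in> rels"
    using \<sigma>(6)[of "\<zero>\<^bsub>Y\<^esub>" 0] by (simp add: X.left.mdl.smult_zero)
  from rels_diff[OF tensor_rels.zero this] show ?case by (simp add: \<mu>_zero)
next
  case (add f g)
  have "f + g - Poly_Mapping.single (\<sigma> (\<mu> f \<oplus>\<^bsub>Y\<^esub> \<mu> g)) 1
      = (f - Poly_Mapping.single (\<sigma> (\<mu> f)) 1) + (g - Poly_Mapping.single (\<sigma> (\<mu> g)) 1)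
        - (Poly_Mapping.single (\<sigma> (\<mu> f \<oplus>\<^bsub>Y\<^esub> \<mu> g)) 1 - Poly_Mapping.single (\<sigma> (\<mu> f)) 1
          - Poly_Mapping.single (\<sigma> (\<mu> g)) 1)" by simp
  also have "\<dots> \<in> rels"
    by (rule rels_diff[OF tensor_rels.plus[OF add(3,4)] \<sigma>(5)[OF \<mu>_closed[OF add(1)] \<mu>_closed[OF add(2)]]])
  finally show ?case using add by (simp only: \<mu>_add)
next
  case (single x y c)
  have "Poly_Mapping.single (x, y) c - Poly_Mapping.single (\<sigma> (c \<odot>\<^bsub>Y\<^esub> m x y)) 1
      = scal c (Poly_Mapping.single (x, y) 1 - Poly_Mapping.single (\<sigma> (m x y)) 1)
        - (Poly_Mapping.single (\<sigma> (c \<odot>\<^bsub>Y\<^esub> m x y)) 1 - Poly_Mapping.single (\<sigma> (m x y)) c)"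
    by (simp add: scal_diff scal_single)
  also have "\<dots> \<in> rels"
    using single by (intro rels_diff tensor_rels.scal \<sigma>(4,6) m(1))
  finally show ?case using single by (simp only: \<mu>_single)
qed

lemma rels_iff: "f \<in> F \<Longrightarrow> f \<in> rels \<longleftrightarrow> \<mu> f = \<zero>\<^bsub>Y\<^esub>"
proof
  assume f: "f \<in> F" "\<mu> f = \<zero>\<^bsub>Y\<^esub>"
  have "f - Poly_Mapping.single (\<sigma> (\<mu> f)) 1 \<in> rels" "0 - Poly_Mapping.single (\<sigma> (\<mu> 0)) 1 \<in> rels"
    using f(1) by (intro rels_single; simp)+
  from rels_diff[OF this] show "f \<in> rels" using f(2) by (simp add: \<mu>_zero)
qed (use rels_sub in blast)

definition "\<theta> z = {f \<in> F. \<mu> f = z}"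

abbreviation "T \<equiv> tensor B M N"

lemma class_eq: "f \<in> F \<Longrightarrow> tensor_class B M N f = \<theta> (\<mu> f)"
proof (rule Set.set_eqI)
  fix g assume f: "f \<in> F"
  have "g \<in> tensor_class B M N f \<longleftrightarrow> g - f \<in> rels"
    unfolding tensor_class_def by (metis (no_types, lifting) add.commute add_diff_cancel_left' diff_add_cancel image_iff)
  also have "\<dots> \<longleftrightarrow> g \<in> F \<and> \<mu> g = \<mu> f"
  proof
    assume *: "g - f \<in> rels"
    then have g: "g \<in> F" using F_add[of "g - f" f] rels_sub[OF *] f by simp
    moreover have "\<mu> g \<oplus>\<^bsub>Y\<^esub> (- 1) \<odot>\<^bsub>Y\<^esub> \<mu> f = \<zero>\<^bsub>Y\<^esub>" using rels_sub[OF *] \<mu>_diff[OF g f] by simp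
    ultimately show "g \<in> F \<and> \<mu> g = \<mu> f" using smult_minus \<mu>_closed f by blast
  next
    assume g: "g \<in> F \<and> \<mu> g = \<mu> f"
    then show "g - f \<in> rels"
      using rels_iff[OF F_diff[of g f]] \<mu>_diff[of g f] smult_minus \<mu>_closed f by auto
  qed
  finally show "g \<in> tensor_class B M N f \<longleftrightarrow> g \<in> \<theta> (\<mu> f)" by (simp add: \<theta>_def)
qed

lemma \<sigma>_in: "z \<in> carrier Y \<Longrightarrow> Poly_Mapping.single (\<sigma> z) 1 \<in> \<theta> z"
proof -
  assume z: "z \<in> carrier Y"
  obtain x y where xy: "\<sigma> z = (x, y)" "x \<in> carrier M" "y \<in> carrier N" using \<sigma>(1)[OF z] by auto
  then show ?thesis
    using \<sigma>(2)[OF z] z by (auto simp: \<theta>_def \<mu>_single X.left.mdl.smult_simps)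
qed

lemma pure: "x \<in> carrier M \<Longrightarrow> y \<in> carrier N \<Longrightarrow> pure_tensor B M N x y = \<theta> (m x y)"
  unfolding pure_tensor_def by (subst class_eq) (auto simp: \<mu>_single X.left.mdl.smult_simps m(1))

lemma \<theta>_pure: "z \<in> carrier Y \<Longrightarrow> \<theta> z = pure_tensor B M N (fst (\<sigma> z)) (snd (\<sigma> z))"
  using \<sigma>(1,2)[of z] by (subst pure) auto

lemma UN_\<theta>:
  assumes "z \<in> carrier Y" and "\<And>f. f \<in> F \<Longrightarrow> \<mu> f = z \<Longrightarrow> G f = S"
  shows "(\<Union>f\<in>\<theta> z. G f) = S"
proof (rule SUP_eq_const)
  show "\<theta> z \<noteq> {}" using \<sigma>_in[OF assms(1)] by blast
  show "G f = S" if "f \<in> \<theta> z" for f using assms(2)[of f] that by (simp add: \<theta>_def)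
qed

lemma lin_ext_lact: "f \<in> F \<Longrightarrow> a \<in> carrier A \<Longrightarrow>
    lin_ext (\<lambda>(x, y). (lact M a x, y)) f \<in> F \<and> \<mu> (lin_ext (\<lambda>(x, y). (lact M a x, y)) f) = lact Y a (\<mu> f)"
proof (induction f rule: F_induct)
  case zero
  have "lact Y a \<zero>\<^bsub>Y\<^esub> = \<zero>\<^bsub>Y\<^esub>"
    using X.left.lact_smult_right[OF zero, of "\<zero>\<^bsub>Y\<^esub>" 0] zero by (simp add: X.left.mdl.smult_zero X.left.lact_closed)
  then show ?case by (simp add: lin_ext_def \<mu>_zero)
next
  case (add f g)
  then show ?case
    using F_add[of "lin_ext (\<lambda>(x, y). (lact M a x, y)) f" "lin_ext (\<lambda>(x, y). (lact M a x, y)) g"]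
    by (simp only: lin_ext_add \<mu>_add X.left.lact_add_right \<mu>_closed simp_thms)
next
  case (single x y c)
  then show ?case
    using F_single[OF M_closed(5)] by (simp only: lin_ext_single prod.case \<mu>_single M_closed m X.left.lact_smult_right)
qed

lemma lin_ext_ract: "f \<in> F \<Longrightarrow> e \<in> carrier C \<Longrightarrow>
    lin_ext (\<lambda>(x, y). (x, ract N y e)) f \<in> F \<and> \<mu> (lin_ext (\<lambda>(x, y). (x, ract N y e)) f) = ract Y (\<mu> f) e"
proof (induction f rule: F_induct)
  case zero
  have "ract Y \<zero>\<^bsub>Y\<^esub> e = \<zero>\<^bsub>Y\<^esub>"
    using X.right.ract_smult_left[OF _ zero, of "\<zero>\<^bsub>Y\<^esub>" 0] zero by (simp add: X.left.mdl.smult_zero X.right.ract_closed)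
  then show ?case by (simp add: lin_ext_def \<mu>_zero)
next
  case (add f g)
  then show ?case
    using F_add[of "lin_ext (\<lambda>(x, y). (x, ract N y e)) f" "lin_ext (\<lambda>(x, y). (x, ract N y e)) g"]
    by (simp only: lin_ext_add \<mu>_add X.right.ract_add_left \<mu>_closed simp_thms)
next
  case (single x y c)
  then show ?case
    using F_single[OF _ N_closed(5)] by (simp only: lin_ext_single prod.case \<mu>_single N_closed m X.right.ract_smult_left)
qed

lemma \<mu>_hom_part:
  assumes "\<forall>(x, y) \<in> Poly_Mapping.keys f. \<exists>a b. a + b = k \<and> x \<in> hom_part M a \<and> y \<in> hom_part N b"
  shows "f \<in> F \<and> \<mu> f \<in> hom_part Y k"
proof
  show "f \<in> F" using assms M_closed(6) N_closed(6) by fast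
  have "m (fst z) (snd z) \<in> hom_part Y k" if "z \<in> Poly_Mapping.keys f" for z
    using bspec[OF assms that] m(10) by (auto split: prod.splits)
  then show "\<mu> f \<in> hom_part Y k"
    unfolding \<mu>_def by (intro X.left.mdl.finsum_hom_part) (auto simp: X.left.mdl.hom_part_smult)
qed

lemma iso: "graded_iso 0 \<theta> Y T"
proof (rule graded_iso.intro[OF X.left.mdl.graded_space_axioms], standard)
  show "inj_on \<theta> (carrier Y)"
  proof (rule inj_onI)
    fix z z' assume z: "z \<in> carrier Y" "z' \<in> carrier Y" "\<theta> z = \<theta> z'"
    have "Poly_Mapping.single (\<sigma> z) 1 \<in> \<theta> z" "Poly_Mapping.single (\<sigma> z) 1 \<in> \<theta> z'"
      using \<sigma>_in[OF z(1)] by (simp_all only: z(3))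
    then have "\<mu> (Poly_Mapping.single (\<sigma> z) 1) = z" "\<mu> (Poly_Mapping.single (\<sigma> z) 1) = z'"
      by (simp_all only: \<theta>_def mem_Collect_eq)
    then show "z = z'" by (rule trans[OF sym])
  qed
  have "\<theta> z \<in> tensor_class B M N ` F" if "z \<in> carrier Y" for z
    using \<sigma>_in[OF that] class_eq by (auto simp: \<theta>_def intro!: image_eqI[of _ _ "Poly_Mapping.single (\<sigma> z) 1"])
  then show "carrier T = \<theta> ` carrier Y"
    using class_eq \<mu>_closed by (auto simp: tensor_def)
  show "\<theta> x \<oplus>\<^bsub>T\<^esub> \<theta> y = \<theta> (x \<oplus>\<^bsub>Y\<^esub> y)" if "x \<in> carrier Y" "y \<in> carrier Y" for x y
  proof -
    have "(\<Union>f\<in>\<theta> x. \<Union>g\<in>\<theta> y. tensor_class B M N (f + g)) = \<theta> (x \<oplus>\<^bsub>Y\<^esub> y)"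
      by (intro UN_\<theta> that) (subst class_eq[OF F_add], auto simp: \<mu>_add)
    then show ?thesis by (simp add: tensor_def)
  qed
  show "\<zero>\<^bsub>T\<^esub> = \<theta> \<zero>\<^bsub>Y\<^esub>"
    using class_eq[of 0] by (simp add: tensor_def tensor_class_def \<mu>_zero)
  show "c \<odot>\<^bsub>T\<^esub> \<theta> x = \<theta> (c \<odot>\<^bsub>Y\<^esub> x)" if "x \<in> carrier Y" for c x
  proof -
    have "(\<Union>f\<in>\<theta> x. tensor_class B M N (scal c f)) = \<theta> (c \<odot>\<^bsub>Y\<^esub> x)"
      by (intro UN_\<theta> that) (subst class_eq[OF F_scal], auto simp: \<mu>_scal)
    then show ?thesis by (simp add: tensor_def)
  qed
  show "hom_part T k = \<theta> ` hom_part Y (k - 0)" for k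
  proof -
    define H where "H = {f :: 'u \<times> 'v \<Rightarrow>\<^sub>0 'k. \<forall>(x, y) \<in> Poly_Mapping.keys f.
        \<exists>a b. a + b = k \<and> x \<in> hom_part M a \<and> y \<in> hom_part N b}"
    have "\<theta> z \<in> tensor_class B M N ` H" if "z \<in> hom_part Y k" for z
    proof (rule image_eqI)
      have z: "z \<in> carrier Y" using that by (rule X.left.mdl.hom_part_carrier)
      show "\<theta> z = tensor_class B M N (Poly_Mapping.single (\<sigma> z) 1)"
        using \<sigma>_in[OF z] class_eq[of "Poly_Mapping.single (\<sigma> z) 1"] by (auto simp: \<theta>_def)
      show "Poly_Mapping.single (\<sigma> z) 1 \<in> H"
        using \<sigma>(3)[OF that] by (auto simp: H_def split: prod.splits) blast
    qed
    moreover have "tensor_class B M N f \<in> \<theta> ` hom_part Y k" if "f \<in> H" for f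
      using \<mu>_hom_part[of f k] class_eq[of f] that by (auto simp: H_def)
    ultimately show ?thesis
      by (auto simp: tensor_def H_def[symmetric])
  qed
qed

lemma \<theta>_eq: "x \<in> carrier Y \<Longrightarrow> y \<in> carrier Y \<Longrightarrow> \<theta> x = \<theta> y \<longleftrightarrow> x = y"
  by (rule graded_iso.\<theta>_eq[OF iso])

lemma carrier_tensor: "carrier T = \<theta> ` carrier Y"
  by (rule graded_iso.carrier_T[OF iso])

lemma dY_simps: "x \<in> carrier Y \<Longrightarrow> dY x \<in> carrier Y"
  "x \<in> carrier Y \<Longrightarrow> y \<in> carrier Y \<Longrightarrow> dY (x \<oplus>\<^bsub>Y\<^esub> y) = dY x \<oplus>\<^bsub>Y\<^esub> dY y"
  "x \<in> carrier Y \<Longrightarrow> dY (c \<odot>\<^bsub>Y\<^esub> x) = c \<odot>\<^bsub>Y\<^esub> dY x"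
  using X.left.mdl.d_linear by (auto simp: linear_maps_def)

lemma tensor_diff_\<theta>:
  assumes "is_tensor_diff B M dM N dN \<delta>" and z: "z \<in> carrier Y"
  shows "\<delta> (\<theta> z) = \<theta> (dY z)"
proof -
  have s: "fst (\<sigma> z) \<in> carrier M" "snd (\<sigma> z) \<in> carrier N" using \<sigma>(1)[OF z] by auto
  have "\<delta> (\<theta> z) = pure_tensor B M N (dM (fst (\<sigma> z))) (snd (\<sigma> z))
      \<oplus>\<^bsub>T\<^esub> pure_tensor B M N (fst (\<sigma> z)) (dN (snd (\<sigma> z)))"
    using assms(1) s unfolding \<theta>_pure[OF z] is_tensor_diff_def by blast
  also have "\<dots> = \<theta> (m (dM (fst (\<sigma> z))) (snd (\<sigma> z)) \<oplus>\<^bsub>Y\<^esub> m (fst (\<sigma> z)) (dN (snd (\<sigma> z))))"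
    using s by (simp only: pure M_closed N_closed graded_iso.\<theta>_add[OF iso] m(1))
  also have "\<dots> = \<theta> (dY z)" using s \<sigma>(2)[OF z] by (simp only: m(9)[symmetric])
  finally show ?thesis .
qed

lemma tensor_diff_ex1: "\<exists>!\<delta>. is_tensor_diff B M dM N dN \<delta>"
proof (rule ex_ex1I)
  define \<delta> where "\<delta> = restrict (\<lambda>S. \<theta> (dY (inv_into (carrier Y) \<theta> S))) (carrier T)"
  have \<delta>: "\<delta> (\<theta> z) = \<theta> (dY z)" if "z \<in> carrier Y" for z
    using that graded_iso.inj[OF iso] by (simp add: \<delta>_def carrier_tensor inv_into_f_f)
  have "is_tensor_diff B M dM N dN \<delta>"
    unfolding is_tensor_diff_def
  proof (intro conjI ballI)
    show "\<delta> \<in> extensional (carrier T)" by (simp add: \<delta>_def)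
    show "\<delta> \<in> linear_maps T T"
      by (auto simp: linear_maps_def carrier_tensor \<delta> dY_simps graded_iso.\<theta>_add[OF iso]
          graded_iso.\<theta>_smult[OF iso] X.left.mdl.smult_simps(1))
    fix x y assume xy: "x \<in> carrier M" "y \<in> carrier N"
    then show "\<delta> (pure_tensor B M N x y) = pure_tensor B M N (dM x) y \<oplus>\<^bsub>T\<^esub> pure_tensor B M N x (dN y)"
      by (simp only: pure M_closed N_closed graded_iso.\<theta>_add[OF iso] m(1,9) \<delta>)
  qed
  then show "\<exists>\<delta>. is_tensor_diff B M dM N dN \<delta>" by blast
  fix \<delta> \<delta>' assume d: "is_tensor_diff B M dM N dN \<delta>" "is_tensor_diff B M dM N dN \<delta>'"
  show "\<delta> = \<delta>'"
    by (rule extensionalityI[of _ "carrier T"])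
      (use d in \<open>auto simp: is_tensor_diff_def carrier_tensor tensor_diff_\<theta>[OF d(1)] tensor_diff_\<theta>[OF d(2)]\<close>)
qed

lemma tensor_bimodule:
  assumes "is_tensor_diff B M dM N dN \<delta>"
  shows "pdg_bimodule p A dA C dC T \<delta>"
proof (rule pdg_bimodule_transport[OF iso X.pdg_bimodule_axioms])
  show "lact T a (\<theta> x) = \<theta> (lact Y a x)" if "a \<in> carrier A" "x \<in> carrier Y" for a x
  proof -
    have "(\<Union>f\<in>\<theta> x. tensor_class B M N (lin_ext (\<lambda>(x, y). (lact M a x, y)) f)) = \<theta> (lact Y a x)"
      by (rule UN_\<theta>[OF that(2)]) (use lin_ext_lact[OF _ that(1)] class_eq in auto)
    then show ?thesis by (simp add: tensor_def)
  qed
  show "ract T (\<theta> x) e = \<theta> (ract Y x e)" if "x \<in> carrier Y" "e \<in> carrier C" for x e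
  proof -
    have "(\<Union>f\<in>\<theta> x. tensor_class B M N (lin_ext (\<lambda>(x, y). (x, ract N y e)) f)) = \<theta> (ract Y x e)"
      by (rule UN_\<theta>[OF that(1)]) (use lin_ext_ract[OF _ that(2)] class_eq in auto)
    then show ?thesis by (simp add: tensor_def)
  qed
qed (rule tensor_diff_\<theta>[OF assms])

end

lemma tensor_collapse_left:
  fixes A :: "('k::field, 'a) graded" and M :: "('k, 'v, 'a, 'b, 'z) gbimod_scheme"
  assumes "pdg_bimodule p A dA B dB M dM"
  shows "tensor_collapse p A dA B dB M dM A (regular_bimodule A) dA M dM (lact M) (\<lambda>z. (\<one>\<^bsub>A\<^esub>, z))"
proof -
  interpret M: pdg_bimodule p A dA B dB M dM by (rule assms)
  have d: "dM x \<in> carrier M" if "x \<in> carrier M" for x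
    using that M.left.mdl.d_linear by (auto simp: linear_maps_def)
  show ?thesis
  proof (rule tensor_collapse.intro[OF assms], standard, goal_cases)
    case (25 z k)
    then show ?case
      using M.left.alg.one_degree by (intro exI[of _ 0] exI[of _ k]) (simp add: regular_bimodule_def)
  next
    case (26 x y)
    then show ?case
      using tensor_rels.balanced[of "\<one>\<^bsub>A\<^esub>" "regular_bimodule A" x A y M] by (simp add: regular_bimodule_def)
  next
    case (27 z z')
    then show ?case by (intro tensor_rels.add_right) (simp_all add: regular_bimodule_def)
  next
    case (28 z c)
    then show ?case by (intro tensor_rels.smult_right) (simp_all add: regular_bimodule_def)
  qed (simp_all add: regular_bimodule_def M.left.alg.smult_simps(1) M.left.mdl.smult_simps(1) M.left.lact_closed
      M.right.ract_closed d M.left.alg.dA_simps M.left.lact_add_left M.left.lact_add_right M.left.lact_smult_left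
      M.left.lact_smult_right M.left.lact_mult M.lact_ract M.left.left_leibniz M.left.lact_degree M.left.lact_one
      M.left.alg.hom_part_carrier M.left.mdl.hom_part_carrier)
qed

lemma tensor_collapse_right:
  fixes A :: "('k::field, 'a) graded" and M :: "('k, 'v, 'b, 'a, 'z) gbimod_scheme"
  assumes "pdg_bimodule p B dB A dA M dM"
  shows "tensor_collapse p B dB A dA M dM A M dM (regular_bimodule A) dA (ract M) (\<lambda>z. (z, \<one>\<^bsub>A\<^esub>))"
proof -
  interpret M: pdg_bimodule p B dB A dA M dM by (rule assms)
  have d: "dM x \<in> carrier M" if "x \<in> carrier M" for x
    using that M.left.mdl.d_linear by (auto simp: linear_maps_def)
  show ?thesis
  proof (rule tensor_collapse.intro[OF assms], standard, goal_cases)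
    case (25 z k)
    then show ?case
      using M.right.alg.one_degree by (intro exI[of _ k] exI[of _ 0]) (simp add: regular_bimodule_def)
  next
    case (26 x y)
    then show ?case
      using tensor_rels.scal[OF tensor_rels.balanced[of x M y A "\<one>\<^bsub>A\<^esub>" "regular_bimodule A"], of "- 1"]
      by (simp add: regular_bimodule_def scal_minus_one)
  next
    case (27 z z')
    then show ?case by (intro tensor_rels.add_left) (simp_all add: regular_bimodule_def)
  next
    case (28 z c)
    then show ?case by (intro tensor_rels.smult_left) (simp_all add: regular_bimodule_def)
  qed (simp_all add: regular_bimodule_def M.right.alg.smult_simps(1) M.left.mdl.smult_simps(1) M.left.lact_closed
      M.right.ract_closed d M.right.alg.dA_simps M.right.ract_add_left M.right.ract_add_right M.right.ract_smult_left
      M.right.ract_smult_right M.right.ract_mult M.lact_ract M.right.right_leibniz M.right.ract_degree M.right.ract_one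
      M.right.alg.hom_part_carrier M.left.mdl.hom_part_carrier M.left.mdl.a_comm)
qed

section \<open>The algebra and its derivation\<close>

lemma cls_eq: "cls s n a = {b. proj s n b = proj s n a}"
proof -
  have "cls s n a = (\<lambda>h. h + a) ` D_ideal s n"
    by (auto simp: cls_def a_r_coset_def' ring_of_type_algebra_def)
  also have "\<dots> = {b. b - a \<in> D_ideal s n}"
    by (auto intro!: image_eqI[where x = "_ - a"])
  finally show ?thesis by (simp add: proj_eq_iff)
qed

lemma cls_eq_iff: "cls s n a = cls s n b \<longleftrightarrow> proj s n a = proj s n b"
  by (auto simp: cls_eq)

lemma D_simps:
  "carrier (D s n) = range (cls s n)"
  "cls s n a \<oplus>\<^bsub>D s n\<^esub> cls s n b = cls s n (a + b)" "cls s n a \<otimes>\<^bsub>D s n\<^esub> cls s n b = cls s n (a * b)"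
  "\<zero>\<^bsub>D s n\<^esub> = cls s n 0" "\<one>\<^bsub>D s n\<^esub> = cls s n 1" "c \<odot>\<^bsub>D s n\<^esub> cls s n a = cls s n (scal c a)"
  "hom_part (D s n) k = cls s n ` {a. homog s n k a}"
proof -
  note hom = ideal.rcos_ring_hom[OF D_ideal_ideal[of s n]]
  have m: "cls s n a \<otimes>\<^bsub>ring_of_type_algebra Quot D_ideal s n\<^esub> cls s n b = cls s n (a * b)" for a b
    using ring_hom_mult[OF hom, of a b] by (simp add: cls_def ring_of_type_algebra_def)
  then show "cls s n a \<otimes>\<^bsub>D s n\<^esub> cls s n b = cls s n (a * b)"
    by (simp add: D_def Let_def)
  show "cls s n a \<oplus>\<^bsub>D s n\<^esub> cls s n b = cls s n (a + b)"
    using ring_hom_add[OF hom, of a b] by (simp add: D_def Let_def cls_def ring_of_type_algebra_def)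
  show "c \<odot>\<^bsub>D s n\<^esub> cls s n a = cls s n (scal c a)"
    by (simp add: D_def Let_def m scal_conv)
  have "D_ideal s n = cls s n 0"
    by (auto simp: cls_eq proj_zero proj_eq_0_iff)
  then show "\<zero>\<^bsub>D s n\<^esub> = cls s n 0" by (simp add: D_def Let_def FactRing_def)
  show "\<one>\<^bsub>D s n\<^esub> = cls s n 1"
    by (simp add: D_def Let_def FactRing_def cls_def ring_of_type_algebra_def)
  show "carrier (D s n) = range (cls s n)"
    by (auto simp: D_def Let_def FactRing_def cls_def A_RCOSETS_def' ring_of_type_algebra_def)
  show "hom_part (D s n) k = cls s n ` {a. homog s n k a}"
    by (simp add: D_def Let_def)
qed

lemma falg_gen_induct [case_names cong zero add scal mult idem x E psi]:
  fixes P :: "'k::field falg \<Rightarrow> bool"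
  assumes cong: "\<And>a b. proj s n a = proj s n b \<Longrightarrow> P a \<Longrightarrow> P b" and zero: "P 0"
    and add: "\<And>a b. P a \<Longrightarrow> P b \<Longrightarrow> P (a + b)" and scal: "\<And>c a. P a \<Longrightarrow> P (scal c a)"
    and mult: "\<And>a b. P a \<Longrightarrow> P b \<Longrightarrow> P (a * b)" and idem: "\<And>i. i \<in> Seq s n \<Longrightarrow> P (idem i)"
    and x: "\<And>i l. i \<in> Seq s n \<Longrightarrow> is_gen s n (GX l) \<Longrightarrow> ent i l = Black \<Longrightarrow> P (vx l * idem i)"
    and E: "\<And>i d l c. i \<in> Seq s n \<Longrightarrow> is_gen s n (GE d l) \<Longrightarrow> ent i l = Red c \<Longrightarrow> d \<le> c \<Longrightarrow> P (vE d l * idem i)"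
    and psi: "\<And>i l. i \<in> Seq s n \<Longrightarrow> is_gen s n (GPsi l) \<Longrightarrow> ent i l = Black \<or> ent i (l + 1) = Black \<Longrightarrow>
      P (psi l * idem i)"
  shows "P a"
proof -
  interpret webster_rep s n "proj s n :: 'k falg \<Rightarrow> 'k dw" by (rule webster_rep_proj)
  have sum: "(\<And>x. x \<in> A \<Longrightarrow> P (f x)) \<Longrightarrow> P (sum f A)" for f :: "entry list \<Rightarrow> 'k falg" and A
    by (induction A rule: infinite_finite_induct) (auto intro: zero add)
  have zero': "proj s n b = 0 \<Longrightarrow> P b" for b
    using cong[OF _ zero, of b] by (simp add: proj_zero)
  have one: "P 1"
    by (rule cong[OF _ sum[of "Seq s n" idem]]) (auto simp: unit h_sum intro: idem)
  have idems: "P b" if "\<And>i. i \<in> Seq s n \<Longrightarrow> P (b * idem i)" for b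
  proof (rule cong[OF _ sum[of "Seq s n" "\<lambda>i. b * idem i"]])
    show "proj s n (\<Sum>i\<in>Seq s n. b * idem i) = proj s n b"
      using one_mult(2)[of b] by (simp add: unit h_simps flip: sum_distrib_left)
  qed (rule that)
  have letter: "P (letter g)" for g
  proof (cases "is_gen s n g")
    case True
    show ?thesis
    proof (cases g)
      case (GI i)
      with True show ?thesis using idem[of i] by (simp add: is_gen_def idem_def)
    next
      case (GX l)
      show ?thesis
      proof (rule idems)
        fix i assume i: "i \<in> Seq s n"
        have "P (vx l * idem i)"
        proof (cases "ent i l")
          case Black
          with i True GX show ?thesis by (intro x) auto
        next
          case (Red c)
          then show ?thesis by (intro zero') (simp add: h_mult x_red[OF e_V])
        qed
        then show "P (letter g * idem i)" by (simp add: GX vx_def)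
      qed
    next
      case (GE d l)
      then have d: "1 \<le> d" using True by (simp add: is_gen_def)
      show ?thesis
      proof (rule idems)
        fix i assume i: "i \<in> Seq s n"
        have "P (vE d l * idem i)"
        proof (cases "ent i l")
          case Black
          then show ?thesis using d by (intro zero') (simp add: h_mult E_black[OF e_V])
        next
          case (Red c)
          show ?thesis
          proof (cases "d \<le> c")
            case True
            with i \<open>is_gen s n g\<close> GE Red show ?thesis by (intro E) auto
          next
            case False
            then show ?thesis using Red by (intro zero') (simp add: h_mult E_large[OF e_V])
          qed
        qed
        then show "P (letter g * idem i)" using d by (simp add: GE vE_def)
      qed
    next
      case (GPsi l)
      show ?thesis
      proof (rule idems)
        fix i assume i: "i \<in> Seq s n"
        have "P (psi l * idem i)"
        proof (cases "ent i l = Black \<or> ent i (l + 1) = Black")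
          case True
          with i \<open>is_gen s n g\<close> GPsi show ?thesis by (intro psi) auto
        next
          case False
          then obtain c d where cd: "ent i l = Red c" "ent i (l + 1) = Red d"
            by (metis entry.exhaust)
          show ?thesis by (rule zero') (simp only: h_mult P_red_red[OF e_V cd])
        qed
        then show "P (letter g * idem i)" by (simp add: GPsi psi_def)
      qed
    qed
  next
    case False
    then show ?thesis by (intro zero' no_gen)
  qed
  show ?thesis
    by (induction a rule: falg_induct) (auto intro: add scal one mult letter)
qed

definition HM :: "nat list \<Rightarrow> nat \<Rightarrow> int \<Rightarrow> 'k::field dw set" where
  "HM s n k = proj s n ` {a. homog s n k a}"

lemma cls_hom_part: "cls s n a \<in> hom_part (D s n) k \<longleftrightarrow> proj s n a \<in> HM s n k"
  by (auto simp: D_simps HM_def cls_eq_iff)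

lemma HM_homog: "homog s n k a \<Longrightarrow> proj s n a \<in> HM s n k"
  by (simp add: HM_def)

lemma HM_zero: "0 \<in> HM s n k"
  using HM_homog[OF homog.zero] by (simp add: proj_zero)

lemma HM_add: "x \<in> HM s n k \<Longrightarrow> y \<in> HM s n k \<Longrightarrow> x + y \<in> HM s n k"
  unfolding HM_def by (auto intro!: imageI homog.plus simp flip: proj_add)

lemma HM_scal: "x \<in> HM s n k \<Longrightarrow> dw_scal c * x \<in> HM s n k"
  unfolding HM_def by (auto intro!: imageI homog.scal simp flip: proj_scal)

lemma HM_mult: "x \<in> HM s n k \<Longrightarrow> y \<in> HM s n l \<Longrightarrow> m = k + l \<Longrightarrow> x * y \<in> HM s n m"
  unfolding HM_def by (auto intro!: imageI homog.times simp flip: proj_mult)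

lemma HM_uminus: "x \<in> HM s n k \<Longrightarrow> - x \<in> HM s n k"
proof -
  interpret scalar_hom dw_scal by (rule scalar_hom_dw_scal)
  have "dw_scal (- 1) = (- 1 :: 'a dw)"
    using add[of 1 "- 1"] by (simp add: zero one eq_neg_iff_add_eq_0 add.commute)
  then show "x \<in> HM s n k \<Longrightarrow> - x \<in> HM s n k" for x :: "'a dw"
    using HM_scal[of x s n k "- 1"] by simp
qed

lemma HM_diff: "x \<in> HM s n k \<Longrightarrow> y \<in> HM s n k \<Longrightarrow> x - y \<in> HM s n k"
  using HM_add[OF _ HM_uminus] by (metis add_uminus_conv_diff)

lemma HM_sum: "(\<And>x. x \<in> A \<Longrightarrow> f x \<in> HM s n k) \<Longrightarrow> sum f A \<in> HM s n k"
  by (induction A rule: infinite_finite_induct) (auto intro: HM_zero HM_add)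

lemma HM_of_nat: "x \<in> HM s n k \<Longrightarrow> of_nat c * x \<in> HM s n k"
  by (induction c) (auto simp: distrib_right intro: HM_zero HM_add)

context
  fixes s :: "nat list" and n :: nat and K :: "'k::field"
begin

interpretation webster_rep s n "proj s n :: 'k falg \<Rightarrow> 'k dw" by (rule webster_rep_proj)

lemma HM_e: "e i \<in> HM s n 0"
  by (cases "i \<in> Seq s n") (auto simp: e_notin HM_zero intro: HM_homog homog.idem)

lemma HM_one: "proj s n 1 \<in> (HM s n 0 :: 'k dw set)"
  by (rule HM_homog) (rule homog.one)

lemma HM_Y: "Y j \<in> HM s n 2"
proof (cases "is_gen s n (GX j)")
  case True
  then show ?thesis by (intro HM_homog homog.x)
next
  case False
  then have "Y j = 0" by (intro X_notin) (simp add: is_gen_def)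
  then show ?thesis by (simp add: HM_zero)
qed

lemma HM_E: "E d j \<in> HM s n (2 * int d)"
proof -
  consider "d = 0" | "is_gen s n (GE d j)" | "1 \<le> d" "\<not> is_gen s n (GE d j)" by linarith
  then show ?thesis
  proof cases
    case 2
    then show ?thesis by (intro HM_homog homog.E)
  next
    case 3
    then have "E d j = 0" by (intro E_notin) (auto simp: is_gen_def)
    then show ?thesis by (simp add: HM_zero)
  qed (simp add: E_zero HM_one)
qed

lemma HM_psi: "P j * e i \<in> HM s n (psi_deg j i)"
proof -
  have "homog s n (psi_deg j i) (psi j * idem i :: 'k falg) \<or> P j * e i = 0"
    using e_notin[of i] P_notin[of j] P_red_red[OF e_V, of i j]
    by (cases "i \<in> Seq s n"; cases "is_gen s n (GPsi j)"; cases "ent i j"; cases "ent i (j + 1)")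
      (auto simp: psi_deg_def is_gen_def intro: homog.psi_black_black homog.psi_red_black homog.psi_black_red)
  then show ?thesis using HM_zero HM_homog by (fastforce simp: h_mult)
qed

lemma HM_psi_V: "v \<in> V i \<Longrightarrow> v \<in> HM s n k \<Longrightarrow> m = psi_deg j i + k \<Longrightarrow> P j * v \<in> HM s n m"
  using HM_mult[OF HM_psi, of v k m j i] by (simp add: mult.assoc VD)

lemma dD_homog: "homog s n k a \<Longrightarrow> \<delta> a \<in> (HM s n (k + 2) :: 'k dw set)"
proof (induction rule: homog.induct)
  case (scal k a c)
  then show ?case using HM_scal by (simp add: \<delta>_def dD_scal proj_scal)
next
  case (times k a l b)
  then have "\<delta> a * proj s n b \<in> HM s n (k + l + 2)" "proj s n a * \<delta> b \<in> HM s n (k + l + 2)"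
    by (auto intro: HM_mult[OF _ HM_homog] HM_mult[OF HM_homog])
  then show ?case by (simp add: \<delta>_mult HM_add)
next
  case (x j)
  show ?case unfolding \<delta>_vx by (rule HM_mult[OF HM_Y HM_Y]) simp
next
  case (E d j)
  have "E d j * E 1 j \<in> HM s n (2 * int d + 2)" by (rule HM_mult[OF HM_E HM_E]) simp
  moreover have "E (d + 1) j \<in> HM s n (2 * int d + 2)" using HM_E[of "d + 1" j] by (simp add: algebra_simps)
  ultimately show ?case unfolding \<delta>_vE by (intro HM_diff HM_of_nat)
next
  case (psi_black_black i j)
  then have deg: "psi_deg j i = - 2" by (simp add: psi_deg_def)
  have "Y j * (P j * e i) \<in> HM s n (- 2 + 2)" by (rule HM_mult[OF HM_Y HM_psi]) (simp add: deg)
  moreover have "P j * (Y (j + 1) * e i) \<in> HM s n (- 2 + 2)"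
    by (rule HM_psi_V[OF X_V[OF e_V] HM_mult[OF HM_Y HM_e refl]]) (simp add: deg)
  ultimately show ?case
    by (simp only: \<delta>_idem_right \<delta>_psi_bb[OF e_V psi_black_black(3,4)]) (intro HM_diff HM_uminus)
next
  case (psi_red_black i j a)
  then have deg: "psi_deg j i = int a" by (simp add: psi_deg_def)
  have "P j * (Y (j + 1) * e i) \<in> HM s n (int a + 2)"
    by (rule HM_psi_V[OF X_V[OF e_V] HM_mult[OF HM_Y HM_e refl]]) (simp add: deg)
  then show ?case
    by (simp only: \<delta>_idem_right \<delta>_psi_rb[OF e_V psi_red_black(3,4)]) (intro HM_of_nat)
next
  case (psi_black_red i j a)
  then have deg: "psi_deg j i = int a" by (simp add: psi_deg_def)
  have "P j * (E 1 (j + 1) * e i) \<in> HM s n (int a + 2)"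
    by (rule HM_psi_V[OF E_V[OF e_V] HM_mult[OF HM_E HM_e refl]]) (simp add: deg)
  then show ?case by (simp only: \<delta>_idem_right \<delta>_psi_br[OF e_V psi_black_red(3,4)])
qed (auto simp: \<delta>_zero \<delta>_add \<delta>_one \<delta>_idem intro: HM_zero HM_add)

end

definition dec :: "nat list \<Rightarrow> nat \<Rightarrow> 'k::field falg \<Rightarrow> bool" where
  "dec s n a \<longleftrightarrow> (\<exists>K F. finite K \<and> (\<forall>k. homog s n k (F k)) \<and> (\<forall>k. k \<notin> K \<longrightarrow> F k = 0)
     \<and> proj s n a = proj s n (sum F K))"

lemma dec_add: "dec s n a \<Longrightarrow> dec s n b \<Longrightarrow> dec s n (a + b)"
proof -
  assume "dec s n a" "dec s n b"
  then obtain K F L G where K: "finite K" "\<And>k. homog s n k (F k)" "\<And>k. k \<notin> K \<Longrightarrow> F k = 0" "proj s n a = proj s n (sum F K)"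
    and L: "finite L" "\<And>k. homog s n k (G k)" "\<And>k. k \<notin> L \<Longrightarrow> G k = 0" "proj s n b = proj s n (sum G L)"
    unfolding dec_def by metis
  have "sum F K = sum F (K \<union> L)" "sum G L = sum G (K \<union> L)"
    using K L by (auto intro!: sum.mono_neutral_left)
  then have "proj s n (a + b) = proj s n (\<Sum>k\<in>K \<union> L. F k + G k)"
    using K L by (simp add: proj_add sum.distrib)
  then show ?thesis
    unfolding dec_def using K L by (intro exI[of _ "K \<union> L"] exI[of _ "\<lambda>k. F k + G k"]) (auto intro: homog.plus)
qed

lemma dec_homog: "homog s n k a \<Longrightarrow> dec s n a"
  unfolding dec_def by (intro exI[of _ "{k}"] exI[of _ "\<lambda>l. if l = k then a else 0"]) (auto intro: homog.zero)

lemma dec_cong: "proj s n a = proj s n b \<Longrightarrow> dec s n a \<Longrightarrow> dec s n b"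
  by (simp add: dec_def)

lemma dec_sum: "(\<And>x. x \<in> A \<Longrightarrow> dec s n (f x)) \<Longrightarrow> dec s n (sum f A)"
  by (induction A rule: infinite_finite_induct) (auto intro: dec_add dec_homog homog.zero)

lemma dec_mult:
  assumes "dec s n a" "dec s n b" shows "dec s n (a * b)"
proof -
  obtain K F L G where K: "finite K" "\<And>k. homog s n k (F k)" "proj s n a = proj s n (sum F K)"
    and L: "finite L" "\<And>k. homog s n k (G k)" "proj s n b = proj s n (sum G L)"
    using assms unfolding dec_def by metis
  have "dec s n (\<Sum>k\<in>K. \<Sum>l\<in>L. F k * G l)"
    using K L by (intro dec_sum dec_homog[OF homog.times])
  then show ?thesis
    by (rule dec_cong[rotated]) (simp add: proj_mult K(3) L(3) flip: sum_product)
qed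

lemma dec_all: "dec s n (a :: 'k::field falg)"
proof (induction a rule: falg_gen_induct[where s = s and n = n])
  case (scal c a)
  have "dec s n (scal c 1 * a)" by (intro dec_mult scal dec_homog[OF homog.scal[OF homog.one]])
  then show ?case by simp
next
  case (psi i l)
  obtain b :: "'k falg" where "homog s n (psi_deg l i) b" "proj s n b = proj s n (psi l * idem i)"
    using HM_psi[of s n l i, where 'k = 'k] by (auto simp: HM_def proj_mult)
  then show ?case by (blast intro: dec_cong dec_homog)
qed (auto intro: dec_cong dec_add dec_mult dec_homog homog.zero homog.idem homog.x homog.E homog.times)

lemma abelian_group_D: "abelian_group (D s n :: ('k::field, 'k falg set) graded)"
proof (rule abelian_groupI)
  fix x :: "'k falg set" assume "x \<in> carrier (D s n)"
  then obtain a :: "'k falg" where a: "x = cls s n a" by (auto simp: D_simps)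
  show "\<exists>y\<in>carrier (D s n). y \<oplus>\<^bsub>D s n\<^esub> x = \<zero>\<^bsub>D s n\<^esub>"
    by (rule bexI[of _ "cls s n (- a)"]) (auto simp: D_simps a)
qed (auto simp: D_simps algebra_simps)

lemma finsum_D:
  "finite K \<Longrightarrow> finsum (D s n) (\<lambda>k. cls s n (F k)) K = cls s n (sum F K :: 'k::field falg)"
proof (induction K rule: finite_induct)
  case empty
  then show ?case by (simp add: abelian_monoid.finsum_empty[OF abelian_group.axioms(1)[OF abelian_group_D]] D_simps)
next
  case (insert k K)
  then show ?case
    by (subst abelian_monoid.finsum_insert[OF abelian_group.axioms(1)[OF abelian_group_D]]) (auto simp: D_simps)
qed

lemma D_decomp:
  fixes a :: "'k::field falg"
  shows "\<exists>!f. is_decomp (D s n) (cls s n a) f"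
proof (rule ex_ex1I)
  interpret D: abelian_group "D s n :: ('k, 'k falg set) graded" by (rule abelian_group_D)
  obtain K and F :: "int \<Rightarrow> 'k falg" where K: "finite K" "\<And>k. homog s n k (F k)" "\<And>k. k \<notin> K \<Longrightarrow> F k = 0"
    "proj s n a = proj s n (sum F K)"
    using dec_all[of s n a] unfolding dec_def by metis
  have sub: "{k. cls s n (F k) \<noteq> cls s n 0} \<subseteq> K" using K(3) by auto
  have "cls s n a = finsum (D s n) (\<lambda>k. cls s n (F k)) K"
    using K(4) by (simp add: finsum_D[OF K(1)] cls_eq_iff)
  also have "\<dots> = finsum (D s n) (\<lambda>k. cls s n (F k)) {k. cls s n (F k) \<noteq> cls s n 0}"
    by (rule D.add.finprod_mono_neutral_cong_right[OF K(1) sub]) (auto simp: D_simps)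
  finally have "is_decomp (D s n) (cls s n a) (\<lambda>k. cls s n (F k))"
    using K(2) finite_subset[OF sub K(1)] by (simp add: is_decomp_def D_simps)
  then show "\<exists>f. is_decomp (D s n) (cls s n a) f" by blast
  have uniq: "f k = {b. proj s n b = Poly_Mapping.lookup (grading s n a) k}"
    if f: "is_decomp (D s n) (cls s n a) f" for f k
  proof -
    have "\<forall>k. \<exists>b. homog s n k b \<and> f k = cls s n b" using f by (auto simp: is_decomp_def D_simps)
    then obtain F where F: "\<And>k. homog s n k (F k)" "\<And>k. f k = cls s n (F k)" by metis
    define K where "K = {k. f k \<noteq> cls s n 0}"
    have fF: "f = (\<lambda>k. cls s n (F k))" by (rule ext) (rule F(2))
    have "finite K" "cls s n a = finsum (D s n) f K"
      using f unfolding is_decomp_def D_simps K_def[symmetric] by blast+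
    then have K: "finite K" "cls s n a = finsum (D s n) (\<lambda>k. cls s n (F k)) K"
      by (simp_all only: fF)
    have "proj s n a = proj s n (sum F K)" using K by (simp add: finsum_D cls_eq_iff)
    then have "grading s n a = grading s n (sum F K)" by (rule grading_cong)
    also have "\<dots> = (\<Sum>k\<in>K. Poly_Mapping.single k (proj s n (F k)))"
      by (simp add: grading_sum grading_homog[OF F(1)])
    finally have "Poly_Mapping.lookup (grading s n a) k = (if k \<in> K then proj s n (F k) else 0)"
      using K(1) by (simp add: lookup_sum lookup_single when_def)
    also have "\<dots> = proj s n (F k)"
      by (auto simp: K_def F(2) cls_eq_iff proj_zero)
    finally show ?thesis by (simp add: F(2) cls_eq)
  qed
  show "f = g" if "is_decomp (D s n) (cls s n a) f" "is_decomp (D s n) (cls s n a) g" for f g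
    by (rule ext) (simp add: uniq[OF that(1)] uniq[OF that(2)])
qed

lemma graded_space_D: "graded_space (D s n :: ('k::field, 'k falg set) graded)"
proof -
  have dec: "\<exists>!f. is_decomp (D s n) x f" if "x \<in> carrier (D s n)" for x :: "'k falg set"
  proof -
    obtain a where "x = cls s n a" using \<open>x \<in> carrier (D s n)\<close> by (auto simp: D_simps(1))
    then show ?thesis using D_decomp[of s n a] by (simp only:)
  qed
  show ?thesis
    by (rule graded_spaceI[OF abelian_group_D _ _ _ _ _ _ _ _ _ dec])
      (auto simp: D_simps scal_add scal_add_left intro: homog.zero homog.plus homog.scal)
qed

lemma ring_D: "ring (D s n :: ('k::field, 'k falg set) graded)"
  by (rule ringI[OF abelian_group_D monoidI]) (auto simp: D_simps algebra_simps)

lemma cls_restrict: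
  assumes "\<And>a b. proj s n a = proj s n b \<Longrightarrow> G a = G b"
  shows "restrict (\<lambda>S. G (SOME a. a \<in> S)) (carrier (D s n)) (cls s n a) = G a"
proof -
  have "(SOME b. b \<in> cls s n a) \<in> cls s n a" by (rule someI[of _ a]) (simp add: cls_eq)
  then have "G (SOME b. b \<in> cls s n a) = G a" by (intro assms) (simp add: cls_eq)
  then show ?thesis by (simp add: D_simps)
qed


context
  fixes s :: "nat list" and n :: nat and K :: "'k::field"
begin

interpretation webster_rep s n "proj s n :: 'k falg \<Rightarrow> 'k dw" by (rule webster_rep_proj)

lemma dD_vx: "proj s n (dD s n (vx j) :: 'k falg) = proj s n (vx j ^ 2)"
  using \<delta>_vx[of j] by (simp add: \<delta>_def h_mult power2_eq_square)

lemma dD_vE: "proj s n (dD s n (vE d j * idem i) :: 'k falg)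
    = proj s n ((vE d j * vE 1 j - of_nat (d + 1) * vE (d + 1) j) * idem i)"
proof -
  have "\<delta> (vE d j * idem i) = (E d j * E 1 j - of_nat (d + 1) * E (d + 1) j) * e i"
    by (simp only: \<delta>_idem_right \<delta>_vE)
  then show ?thesis
    by (simp only: \<delta>_def h_mult[of _ "idem i"] h_diff h_of_nat h_mult[of "vE d j"])
qed

lemma dD_vE_top: "ent i j = Red d \<Longrightarrow>
    proj s n (dD s n (vE d j * idem i) :: 'k falg) = proj s n (vE d j * vE 1 j * idem i)"
  using E_large[OF e_V, of i j d "d + 1"]
  by (simp only: dD_vE h_mult h_diff h_of_nat left_diff_distrib mult.assoc) simp

lemma dD_psi: "proj s n (dD s n (psi j * idem i) :: 'k falg) = proj s n (psi_val j i)"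
proof -
  have "\<delta> (psi j * idem i) = proj s n (psi_val j i) * e i"
    by (simp only: \<delta>_idem_right \<delta>_psi[OF e_V])
  also have "\<dots> = proj s n (psi_val j i)"
    by (simp add: psi_val_def h_simps left_diff_distrib mult.assoc e_e split: entry.splits)
  finally show ?thesis by (simp only: \<delta>_def)
qed

end

lemma is_partial_D_unique:
  assumes \<delta>: "is_partial_D s n \<delta>"
  shows "\<delta> (cls s n a) = cls s n (dD s n (a :: 'k::field falg))"
proof -
  have add': "\<delta> (cls s n (a + b)) = \<delta> (cls s n a) \<oplus>\<^bsub>D s n\<^esub> \<delta> (cls s n b)"
    and scal': "\<delta> (cls s n (scal c a)) = c \<odot>\<^bsub>D s n\<^esub> \<delta> (cls s n a)"
    and range': "\<delta> (cls s n a) \<in> range (cls s n)" for a b :: "'k falg" and c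
    using \<delta> unfolding is_partial_D_def linear_maps_def D_simps(1) by (auto simp flip: D_simps(2,6))
  have mult': "\<delta> (cls s n (a * b)) = \<delta> (cls s n a) \<otimes>\<^bsub>D s n\<^esub> cls s n b \<oplus>\<^bsub>D s n\<^esub> cls s n a \<otimes>\<^bsub>D s n\<^esub> \<delta> (cls s n b)"
    for a b :: "'k falg"
    using \<delta> unfolding is_partial_D_def D_simps(1) by (auto simp flip: D_simps(3))
  have zero': "scal 0 b = (0 :: 'k falg)" for b by (simp add: scal_conv)
  show ?thesis
  proof (induction a rule: falg_gen_induct[where s = s and n = n])
    case (cong a b)
    from cong(1) have "cls s n a = cls s n b" "cls s n (dD s n a) = cls s n (dD s n b)"
      using dD_cong[OF cong(1)] by (simp_all only: cls_eq_iff)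
    with cong(2) show ?case by simp
  next
    case zero
    obtain b where "\<delta> (cls s n 0) = cls s n b" using range'[of 0] by auto
    then show ?case using scal'[of 0 0] by (simp add: zero' D_simps dD_zero)
  next
    case (add a b)
    then show ?case by (simp add: add' D_simps dD_add)
  next
    case (scal c a)
    then show ?case by (simp add: scal' D_simps dD_scal)
  next
    case (mult a b)
    then show ?case by (simp add: mult' D_simps dD_mult)
  next
    case (idem i)
    then show ?case using \<delta> by (simp add: is_partial_D_def dD_idem)
  next
    case (x i l)
    have "\<delta> (cls s n (vx l)) = cls s n (dD s n (vx l))" "\<delta> (cls s n (idem i)) = cls s n 0"
      using \<delta> x by (simp_all add: is_partial_D_def cls_eq_iff dD_vx)
    then show ?case by (simp add: mult' D_simps dD_mult dD_idem)
  next
    case (E i d l c)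
    have "(d < c \<longrightarrow> \<delta> (cls s n (vE d l * idem i)) =
           cls s n ((vE d l * vE 1 l - of_nat (d + 1) * vE (d + 1) l) * idem i)) \<and>
        (d = c \<longrightarrow> \<delta> (cls s n (vE d l * idem i)) = cls s n (vE d l * vE 1 l * idem i))"
      using \<delta> E(1,2,3) unfolding is_partial_D_def by blast
    with E dD_vE_top[of i l d s n, where 'k = 'k] show ?case
      by (cases "d = c") (simp_all only: cls_eq_iff dD_vE simp_thms le_neq_implies_less)
  next
    case (psi i l)
    have "(ent i l = Black \<and> ent i (l + 1) = Black \<longrightarrow>
           \<delta> (cls s n (psi l * idem i)) =
             cls s n (- (vx l * psi l * idem i) - psi l * vx (l + 1) * idem i)) \<and>
        (\<forall>a. ent i l = Red a \<and> ent i (l + 1) = Black \<longrightarrow>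
           \<delta> (cls s n (psi l * idem i)) =
             cls s n (of_nat a * psi l * vx (l + 1) * idem i)) \<and>
        (\<forall>a. ent i l = Black \<and> ent i (l + 1) = Red a \<longrightarrow>
           \<delta> (cls s n (psi l * idem i)) = cls s n (psi l * vE 1 (l + 1) * idem i))"
      by (rule \<delta>[unfolded is_partial_D_def, THEN conjunct2, THEN conjunct2, THEN conjunct2, THEN conjunct2,
            THEN conjunct2, THEN conjunct2, THEN bspec, OF psi(1), THEN spec, THEN mp, OF psi(2)])
    then have "\<delta> (cls s n (psi l * idem i)) = cls s n (psi_val l i)"
      using psi(3) by (cases "ent i l"; cases "ent i (l + 1)") (simp_all add: psi_val_def)
    then show ?case by (simp only: cls_eq_iff dD_psi)
  qed
qed

lemma partial_D:
  "is_partial_D s n (partial_D s n :: 'k::field falg set \<Rightarrow> 'k falg set)"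
  "partial_D s n (cls s n a) = cls s n (dD s n (a :: 'k falg))"
proof -
  define \<delta> :: "'k falg set \<Rightarrow> 'k falg set"
    where "\<delta> = restrict (\<lambda>S. cls s n (dD s n (SOME a. a \<in> S))) (carrier (D s n))"
  have \<delta>: "\<delta> (cls s n a) = cls s n (dD s n a)" for a
    unfolding \<delta>_def
    by (rule cls_restrict[where G = "\<lambda>a. cls s n (dD s n a)"]) (simp only: cls_eq_iff, rule dD_cong)
  have "is_partial_D s n \<delta>"
    unfolding is_partial_D_def
  proof (intro conjI ballI allI impI)
    show "\<delta> \<in> extensional (carrier (D s n))" by (simp add: \<delta>_def)
    show "\<delta> \<in> linear_maps (D s n) (D s n)"
      by (auto simp: linear_maps_def D_simps \<delta> dD_add dD_scal)
    show "\<delta> (x \<otimes>\<^bsub>D s n\<^esub> y) = \<delta> x \<otimes>\<^bsub>D s n\<^esub> y \<oplus>\<^bsub>D s n\<^esub> x \<otimes>\<^bsub>D s n\<^esub> \<delta> y"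
      if "x \<in> carrier (D s n)" "y \<in> carrier (D s n)" for x y
      using that by (auto simp: D_simps \<delta> dD_mult)
    show "\<delta> (cls s n (idem i)) = cls s n 0" for i by (simp add: \<delta> dD_idem)
    show "\<delta> (cls s n (vx j)) = cls s n (vx j ^ 2)" for j by (simp only: \<delta> cls_eq_iff dD_vx)
    show "\<delta> (cls s n (vE d j * idem i)) =
        cls s n ((vE d j * vE 1 j - of_nat (d + 1) * vE (d + 1) j) * idem i)" for i j d
      by (simp only: \<delta> cls_eq_iff dD_vE)
    show "\<delta> (cls s n (vE d j * idem i)) = cls s n (vE d j * vE 1 j * idem i)"
      if "is_gen s n (GE d j) \<and> ent i j = Red a" "d = a" for i j d a
    proof -
      have "ent i j = Red d" using that by simp
      then show ?thesis by (simp only: \<delta> cls_eq_iff dD_vE_top)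
    qed
    show "\<delta> (cls s n (psi j * idem i)) = cls s n (- (vx j * psi j * idem i) - psi j * vx (j + 1) * idem i)"
      if "ent i j = Black \<and> ent i (j + 1) = Black" for i j
      using that by (simp only: \<delta> cls_eq_iff dD_psi psi_val_def prod.case entry.case)
    show "\<delta> (cls s n (psi j * idem i)) = cls s n (of_nat a * psi j * vx (j + 1) * idem i)"
      if "ent i j = Red a \<and> ent i (j + 1) = Black" for i j a
      using that by (simp only: \<delta> cls_eq_iff dD_psi psi_val_def prod.case entry.case)
    show "\<delta> (cls s n (psi j * idem i)) = cls s n (psi j * vE 1 (j + 1) * idem i)"
      if "ent i j = Black \<and> ent i (j + 1) = Red a" for i j a
      using that by (simp only: \<delta> cls_eq_iff dD_psi psi_val_def prod.case entry.case)
  qed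
  moreover have "\<delta>' = \<delta>" if "is_partial_D s n \<delta>'" for \<delta>'
  proof (rule extensionalityI[of _ "carrier (D s n)"])
    show "\<delta>' \<in> extensional (carrier (D s n))" using that by (simp add: is_partial_D_def)
    show "\<delta> \<in> extensional (carrier (D s n))" by (simp add: \<delta>_def)
    show "\<delta>' x = \<delta> x" if "x \<in> carrier (D s n)" for x
      using that is_partial_D_unique[OF \<open>is_partial_D s n \<delta>'\<close>] by (auto simp: D_simps \<delta>)
  qed
  ultimately have eq: "partial_D s n = \<delta>" and *: "is_partial_D s n \<delta>"
    unfolding partial_D_def by (blast intro: the_equality)+
  from * show "is_partial_D s n (partial_D s n :: 'k falg set \<Rightarrow> 'k falg set)" by (simp only: eq)
  show "partial_D s n (cls s n a) = cls s n (dD s n a)" by (simp only: eq \<delta>)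
qed

lemma pdg_algebra_D:
  assumes "CHAR('k::field) = p" "p > 0"
  shows "pdg_algebra p (D s n :: ('k, 'k falg set) graded) (partial_D s n)"
proof -
  have pow: "(partial_D s n ^^ k) (cls s n a) = cls s n ((dD s n ^^ k) (a :: 'k falg))" for k a
    by (induction k) (auto simp: partial_D)
  have "pdg_space p (D s n :: ('k, 'k falg set) graded) (partial_D s n)"
  proof (rule pdg_space.intro[OF graded_space_D], standard)
    show "partial_D s n \<in> linear_maps (D s n) (D s n :: ('k, 'k falg set) graded)"
      by (rule partial_D(1)[unfolded is_partial_D_def, THEN conjunct2, THEN conjunct1])
    show "partial_D s n x \<in> hom_part (D s n) (k + 2)" if x: "x \<in> hom_part (D s n) k" for x :: "'k falg set" and k
    proof -
      obtain a :: "'k falg" where "x = cls s n a" "homog s n k a" using x by (auto simp: D_simps)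
      then show ?thesis
        using dD_homog[of s n k a] by (simp add: partial_D cls_hom_part webster_rep.\<delta>_def[OF webster_rep_proj])
    qed
    show "(partial_D s n ^^ p) x = \<zero>\<^bsub>D s n\<^esub>" if "x \<in> carrier (D s n)" for x :: "'k falg set"
    proof -
      obtain a where "x = cls s n a" using \<open>x \<in> carrier (D s n)\<close> by (auto simp: D_simps(1))
      then show ?thesis
        by (simp only: pow D_simps(4) cls_eq_iff proj_zero proj_eq_0_iff dD_pow_p_ideal[OF assms])
    qed
  qed
  then show ?thesis
    by (rule pdg_algebra.intro[OF _ ring_D], unfold_locales)
      (auto simp: D_simps partial_D dD_mult intro: homog.one homog.times)
qed

section \<open>The inclusion maps\<close>

context splitting
begin

definition phi :: "'k::field falg \<Rightarrow> 'k dw" where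
  "phi = hom_ext dw_scal (\<Sum>i\<in>Seq s n. proj t n (idem (sp i))) (\<lambda>g. proj t n (phi_gen g))"

lemma phi_hom:
  shows phi_rep_phi: "phi_rep s n j a (proj t n) (phi :: 'k::field falg \<Rightarrow> 'k dw)"
    and phi_scal: "phi (scal c x) = dw_scal c * (phi x :: 'k dw)"
proof -
  interpret phi_base s n j a "proj t n :: 'k falg \<Rightarrow> 'k dw"
    by (rule phi_base.intro[OF splitting_axioms webster_rep_proj])
  let ?u = "\<Sum>i\<in>Seq s n. proj t n (idem (sp i)) :: 'k dw"
  have uv: "?u * v = v" if "i \<in> Seq s n" "v \<in> W i" for i v
    using act_sum[OF that, of "\<lambda>_. 1"] that by (simp add: h_sum)
  have eu: "e (sp i) * ?u = e (sp i)" if "i \<in> Seq s n" for i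
  proof -
    have "e (sp i) * ?u = (\<Sum>k\<in>Seq s n. if k = i then e (sp i) else 0)"
      unfolding sum_distrib_left using inj_onD[OF sp_inj _ that]
      by (intro sum.cong) (auto simp: e_e)
    then show ?thesis using that by (simp add: finite_Seq)
  qed
  have g_left: "?u * proj t n (phi_gen x) = proj t n (phi_gen x)" for x
  proof -
    have u_op: "?u * proj t n (\<Sum>i\<in>Seq s n. f i * idem (sp i)) = proj t n (\<Sum>i\<in>Seq s n. f i * idem (sp i))"
      if "\<And>i. i \<in> Seq s n \<Longrightarrow> ?u * (proj t n (f i) * e (sp i)) = proj t n (f i) * e (sp i)" for f
      unfolding h_sum h_mult sum_distrib_left[of ?u] by (rule sum.cong[OF refl that])
    show ?thesis
    proof (cases "is_gen s n x")
      case True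
      show ?thesis
      proof (cases x)
        case (GI i)
        with True show ?thesis using uv[OF _ e_V] by (simp add: phi_gen_def is_gen_def)
      next
        case (GX l)
        have "?u * proj t n (\<Sum>i\<in>Seq s n. op_x l i * idem (sp i)) = proj t n (\<Sum>i\<in>Seq s n. op_x l i * idem (sp i))"
          by (rule u_op, rule uv, assumption, rule op_x_V, rule e_V)
        with True GX show ?thesis by (simp only: phi_gen_def if_True gen.case)
      next
        case (GE d l)
        have "?u * proj t n (\<Sum>i\<in>Seq s n. op_E d l i * idem (sp i)) = proj t n (\<Sum>i\<in>Seq s n. op_E d l i * idem (sp i))"
          by (rule u_op, rule uv, assumption, rule op_E_V, rule e_V)
        with True GE show ?thesis by (simp only: phi_gen_def if_True gen.case)
      next
        case (GPsi l)
        then have l: "1 \<le> l" "l + 1 \<le> length s + n" using True by (auto simp: is_gen_def)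
        have "?u * proj t n (\<Sum>i\<in>Seq s n. op_psi l i * idem (sp i)) = proj t n (\<Sum>i\<in>Seq s n. op_psi l i * idem (sp i))"
        proof (rule u_op)
          fix i assume i: "i \<in> Seq s n"
          show "?u * (proj t n (op_psi l i) * e (sp i)) = proj t n (op_psi l i) * e (sp i)"
          proof (cases "ent i l = Black \<or> ent i (l + 1) = Black")
            case True
            have "length i = length s + n" by (rule length_Seq[OF i])
            then show ?thesis
              using swap_Seq[OF i l(1) _ True] l by (intro uv[OF _ op_psi_W[OF i e_V l True]]) auto
          next
            case False
            then have "proj t n (op_psi l i) * e (sp i) = 0"
              by (intro op_psi_rr[OF i e_V l(1)]) auto
            then show ?thesis by simp
          qed
        qed
        with True GPsi show ?thesis by (simp only: phi_gen_def if_True gen.case)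
      qed
    qed (simp add: phi_gen_def h_zero)
  qed
  have g_right: "proj t n (phi_gen x) * ?u = proj t n (phi_gen x)" for x
    by (cases x) (auto simp: phi_gen_def is_gen_def h_zero eu h_sum h_mult sum_distrib_right[of _ _ ?u] mult.assoc)
  have uu: "?u * ?u = ?u"
    unfolding sum_distrib_right[of _ _ ?u] by (rule sum.cong[OF refl eu])
  interpret C: corner_hom "dw_scal :: 'k \<Rightarrow> 'k dw" ?u "\<lambda>g. proj t n (phi_gen g)"
    by (rule corner_hom.intro[OF scalar_hom_dw_scal], standard) (rule uu g_left g_right)+
  show "phi_rep s n j a (proj t n) (phi :: 'k falg \<Rightarrow> 'k dw)"
    by (rule phi_rep.intro[OF phi_base_axioms], standard)
      (simp_all add: phi_def C.hom_ext_add C.hom_ext_mult C.hom_ext_letter C.hom_ext_one)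
  show "phi (scal c x) = dw_scal c * (phi x :: 'k dw)"
    unfolding phi_def by (rule C.hom_ext_scal)
qed

context
  fixes K :: "'k::field"
begin

interpretation phi_rep s n j a "proj t n :: 'k falg \<Rightarrow> 'k dw" phi
  by (rule phi_rep_phi)

lemma phi_cong: "proj s n x = proj s n y \<Longrightarrow> phi x = (phi y :: 'k dw)"
proof -
  have "D_ideal s n \<subseteq> {x :: 'k falg. phi x = 0}"
    by (rule D_ideal_minimal) (auto simp: phi_rel \<phi>_zero \<phi>_add \<phi>_mult)
  then show "proj s n x = proj s n y \<Longrightarrow> phi x = (phi y :: 'k dw)"
    using \<phi>_diff[of x y] by (auto simp: proj_eq_iff)
qed

lemma phi_lift: "\<exists>y. proj t n y = (phi x :: 'k dw)"
proof (induction x rule: falg_induct)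
  case (add x y)
  then show ?case by (metis \<phi>_add h_add)
next
  case (scal c x)
  then show ?case by (metis phi_scal proj_scal)
next
  case one
  show ?case unfolding \<phi>_one by (metis h_sum)
next
  case (letter g x)
  then show ?case by (metis \<phi>_mult \<phi>_letter h_mult)
qed

definition lft :: "'k falg \<Rightarrow> 'k falg" where "lft x = (SOME y. proj t n y = phi x)"

lemma proj_lft: "proj t n (lft x) = phi x"
  unfolding lft_def using phi_lift by (rule someI_ex)

lemma cls_lft: "cls t n (lft x) = cls t n y \<longleftrightarrow> phi x = proj t n y"
  by (simp add: cls_eq_iff proj_lft)

lemma phi_gens:
  assumes i: "i \<in> Seq s n"
  shows "is_gen s n (GX l) \<Longrightarrow> phi (vx l * idem i) = (proj t n (op_x l i * idem (sp i)) :: 'k dw)"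
    and "is_gen s n (GE d l) \<Longrightarrow> phi (vE d l * idem i) = (proj t n (op_E d l i * idem (sp i)) :: 'k dw)"
    and "is_gen s n (GPsi l) \<Longrightarrow> phi (psi l * idem i) = (proj t n (op_psi l i * idem (sp i)) :: 'k dw)"
  using act_x[OF i e_V, of l] act_E[OF i e_V, of l d] act_psi[OF i e_V, of l]
  by (auto simp: is_gen_def \<phi>_mult \<phi>_idem[OF i] h_mult)

lemma is_Phi_unique:
  assumes f: "is_Phi s n j a f"
  shows "f (cls s n x) = cls t n (lft x)"
proof -
  have add': "f (cls s n (x + y)) = f (cls s n x) \<oplus>\<^bsub>D t n\<^esub> f (cls s n y)"
    and scal': "f (cls s n (scal c x)) = c \<odot>\<^bsub>D t n\<^esub> f (cls s n x)"
    and range': "f (cls s n x) \<in> range (cls t n)" for x y :: "'k falg" and c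
    using f unfolding is_Phi_def Let_def linear_maps_def D_simps(1) by (auto simp flip: D_simps(2,6))
  have mult': "f (cls s n (x * y)) = f (cls s n x) \<otimes>\<^bsub>D t n\<^esub> f (cls s n y)" for x y :: "'k falg"
    using f unfolding is_Phi_def Let_def D_simps(1) by (auto simp flip: D_simps(3))
  have zero': "scal 0 b = (0 :: 'k falg)" for b by (simp add: scal_conv)
  note gens = f[unfolded is_Phi_def Let_def, THEN conjunct2, THEN conjunct2, THEN conjunct2, THEN bspec]
  show ?thesis
  proof (induction x rule: falg_gen_induct[where s = s and n = n])
    case (cong x y)
    have "cls s n x = cls s n y" "cls t n (lft x) = cls t n (lft y)"
      using cong(1) phi_cong[OF cong(1)] by (simp_all add: cls_eq_iff proj_lft)
    with cong(2) show ?case by simp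
  next
    case zero
    obtain b where "f (cls s n 0) = cls t n b" using range'[of 0] by auto
    then have "f (cls s n 0) = cls t n 0" using scal'[of 0 0] by (simp add: zero' D_simps)
    also have "\<dots> = cls t n (lft 0)" by (simp add: cls_eq_iff proj_lft \<phi>_zero h_zero)
    finally show ?case .
  next
    case (add x y)
    then show ?case by (simp add: add' D_simps cls_eq_iff proj_lft h_add \<phi>_add)
  next
    case (scal c x)
    then show ?case by (simp add: scal' D_simps cls_eq_iff proj_lft proj_scal phi_scal)
  next
    case (mult x y)
    then show ?case by (simp add: mult' D_simps cls_eq_iff proj_lft h_mult \<phi>_mult)
  next
    case (idem i)
    then show ?case using gens[of i] by (simp add: cls_eq_iff proj_lft \<phi>_idem)
  next
    case (x i l)
    then have "l \<noteq> L i" using L_bounds(4)[of i] by auto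
    then consider "l < L i" | "L i < l" by linarith
    then show ?case
      using gens[OF x(1), THEN conjunct2, THEN conjunct2, THEN conjunct1] x(2)
      by cases (simp_all add: cls_eq_iff proj_lft phi_gens[OF x(1)] op_x_def)
  next
    case (E i d l c)
    have le: "l = L i \<Longrightarrow> d \<le> s ! (j - 1)" using L_bounds(4)[OF E(1)] E(3,4) by auto
    consider "l < L i" | "l = L i" | "L i < l" by linarith
    then show ?case
      using gens[OF E(1), THEN conjunct2, THEN conjunct1] E(2) le
      by cases (simp_all add: cls_eq_iff proj_lft phi_gens[OF E(1)] op_E_def sum_distrib_right split_def)
  next
    case (psi i l)
    then have l: "1 \<le> l" "l + 1 \<le> length s + n" by (auto simp: is_gen_def)
    show ?case
      using gens[OF psi(1), THEN conjunct2, THEN conjunct2, THEN conjunct2] psi(2)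
      by (cases rule: L_cases[OF psi(1) l psi(3)])
        (simp_all add: cls_eq_iff proj_lft phi_gens[OF psi(1)] op_psi_def)
  qed
qed

lemma Phi:
  "is_Phi s n j a (Phi s n j a :: 'k falg set \<Rightarrow> 'k falg set)"
  "Phi s n j a (cls s n x) = cls t n (lft x)"
proof -
  define f :: "'k falg set \<Rightarrow> 'k falg set"
    where "f = restrict (\<lambda>S. cls t n (lft (SOME a. a \<in> S))) (carrier (D s n))"
  have f: "f (cls s n x) = cls t n (lft x)" for x
    unfolding f_def
    by (rule cls_restrict[where G = "\<lambda>a. cls t n (lft a)"]) (simp only: cls_eq_iff proj_lft, rule phi_cong)
  have "is_Phi s n j a f"
    unfolding is_Phi_def Let_def
  proof (intro conjI ballI allI)
    show "f \<in> extensional (carrier (D s n))" by (simp add: f_def)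
    show "f \<in> linear_maps (D s n) (D t n)"
      by (auto simp: linear_maps_def D_simps f cls_eq_iff proj_lft h_add \<phi>_add proj_scal phi_scal)
    show "f (u \<otimes>\<^bsub>D s n\<^esub> v) = f u \<otimes>\<^bsub>D t n\<^esub> f v" if "u \<in> carrier (D s n)" "v \<in> carrier (D s n)" for u v
      using that unfolding D_simps(1)
      by (elim rangeE) (simp only: D_simps(3) f cls_eq_iff proj_lft h_mult \<phi>_mult)
  qed (auto simp: f cls_lft \<phi>_idem phi_gens op_x_def op_E_def op_psi_def sum_distrib_right split_def)
  moreover have "g = f" if "is_Phi s n j a g" for g
  proof (rule extensionalityI[of _ "carrier (D s n)"])
    show "g \<in> extensional (carrier (D s n))" using that by (simp add: is_Phi_def Let_def)
    show "f \<in> extensional (carrier (D s n))" by (simp add: f_def)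
    show "g x = f x" if "x \<in> carrier (D s n)" for x
      using that is_Phi_unique[OF \<open>is_Phi s n j a g\<close>] by (auto simp: D_simps f)
  qed
  ultimately have eq: "Phi s n j a = f" and *: "is_Phi s n j a f"
    unfolding Phi_def by (blast intro: the_equality)+
  from * show "is_Phi s n j a (Phi s n j a :: 'k falg set \<Rightarrow> 'k falg set)" by (simp only: eq)
  show "Phi s n j a (cls s n x) = cls t n (lft x)" by (simp only: eq f)
qed

end

end

section \<open>The inclusion maps are compatible with degree and derivation\<close>

lemma conv_derivative:
  fixes F G :: "nat \<Rightarrow> 'q::ring_1"
  shows "(\<Sum>k\<le>d. of_nat (k + 1) * (F (k + 1) * G (d - k))) + (\<Sum>k\<le>d. of_nat (d - k + 1) * (F k * G (d - k + 1)))
    = of_nat (d + 1) * conv F G (d + 1)"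
proof -
  have 1: "(\<Sum>k\<le>Suc d. of_nat k * (F k * G (Suc d - k))) = (\<Sum>k\<le>d. of_nat (k + 1) * (F (k + 1) * G (d - k)))"
    by (subst sum.atMost_Suc_shift) simp
  have 2: "(\<Sum>k\<le>Suc d. of_nat (Suc d - k) * (F k * G (Suc d - k))) = (\<Sum>k\<le>d. of_nat (d - k + 1) * (F k * G (d - k + 1)))"
  proof -
    have "(\<Sum>k\<le>Suc d. of_nat (Suc d - k) * (F k * G (Suc d - k))) = (\<Sum>k\<le>d. of_nat (Suc d - k) * (F k * G (Suc d - k)))"
      by (simp only: sum.atMost_Suc diff_self_eq_0 of_nat_0 mult_zero_left add_0_right)
    also have "\<dots> = (\<Sum>k\<le>d. of_nat (d - k + 1) * (F k * G (d - k + 1)))"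
    proof (rule sum.cong[OF refl])
      fix k assume "k \<in> {..d}"
      then have "Suc d - k = d - k + 1" by auto
      then show "of_nat (Suc d - k) * (F k * G (Suc d - k)) = of_nat (d - k + 1) * (F k * G (d - k + 1))"
        by (simp only:)
    qed
    finally show ?thesis .
  qed
  have "of_nat k * x + of_nat (Suc d - k) * x = of_nat (Suc d) * x" if "k \<le> Suc d" for k and x :: 'q
    using that by (simp only: of_nat_add[symmetric] distrib_right[symmetric] le_add_diff_inverse)
  then have "(\<Sum>k\<le>Suc d. of_nat k * (F k * G (Suc d - k))) + (\<Sum>k\<le>Suc d. of_nat (Suc d - k) * (F k * G (Suc d - k)))
      = (\<Sum>k\<le>Suc d. of_nat (Suc d) * (F k * G (Suc d - k)))"
    unfolding sum.distrib[symmetric] by (intro sum.cong) (simp_all only: atMost_iff)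
  then show ?thesis
    unfolding 1 2 by (simp only: conv_def sum_distrib_left Suc_eq_plus1)
qed

context splitting
begin

context
  fixes K :: "'k::field"
begin

interpretation phi_rep s n j a "proj t n :: 'k falg \<Rightarrow> 'k dw" phi
  by (rule phi_rep_phi)

lemma length_sp': "i \<in> Seq s n \<Longrightarrow> length (sp i) = length s + 1 + n"
  using length_Seq[OF sp_Seq, of i] by (simp add: length_t)

lemma ent_sp_shift: "i \<in> Seq s n \<Longrightarrow> L i < l \<Longrightarrow> ent (sp i) (l + 1) = ent i l"
  and ent_sp_L: "i \<in> Seq s n \<Longrightarrow> ent (sp i) (L i) = Red (s ! (j - 1) - a)" "i \<in> Seq s n \<Longrightarrow> ent (sp i) (L i + 1) = Red a"
  using ent_sp[of i "l + 1"] ent_sp[of i "L i"] ent_sp[of i "L i + 1"] L_bounds(1)[of i] by auto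

lemma phi_psi_homog:
  assumes i: "i \<in> Seq s n" and g: "is_gen s n (GPsi l)" and b: "ent i l = Black \<or> ent i (l + 1) = Black"
  shows "phi (psi l * idem i) \<in> (HM t n (psi_deg l i) :: 'k dw set)"
proof -
  have l: "1 \<le> l" "l + 1 \<le> length s + n" using g by (auto simp: is_gen_def)
  have sl: "l < length (sp i)" "l + 1 < length (sp i)" using l length_sp'[OF i] by auto
  have red: "ent i (L i) = Red (s ! (j - 1))" by (rule L_bounds(4)[OF i])
  show ?thesis
    unfolding phi_gens(3)[OF i g] h_mult
  proof (cases rule: L_cases[OF i l b])
    case 1
    have "psi_deg l (sp i) = psi_deg l i"
      using 1 ent_sp_lt[OF i l(1)] ent_sp_lt[OF i, of "l + 1"] by (simp add: psi_deg_def)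
    then show "proj t n (op_psi l i) * e (sp i) \<in> HM t n (psi_deg l i)"
      using HM_psi[of t n l "sp i", where 'k = 'k] 1 by (simp add: op_psi_simps)
  next
    case 2
    have ents: "ent (sp i) l = Black" "ent (sp i) (l + 1) = Red (s ! (j - 1) - a)" "ent (sp i) (l + 1 + 1) = Red a"
      using ent_sp_lt[OF i l(1)] ent_sp_L[OF i] 2 by auto
    have "psi_deg l i = psi_deg (l + 1) (swap_entries l (sp i)) + psi_deg l (sp i)"
      using ents sl l 2 red a by (simp add: psi_deg_def ent_swap)
    from HM_psi_V[OF P_V[OF e_V] HM_psi this] show "proj t n (op_psi l i) * e (sp i) \<in> HM t n (psi_deg l i)"
      using 2 by (simp add: op_psi_simps mult.assoc)
  next
    case 3
    have ents: "ent (sp i) l = Red (s ! (j - 1) - a)" "ent (sp i) (l + 1) = Red a" "ent (sp i) (l + 1 + 1) = Black"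
      using ent_sp_shift[OF i, of "l + 1"] ent_sp_L[OF i] 3 by auto
    have "psi_deg l i = psi_deg l (swap_entries (l + 1) (sp i)) + psi_deg (l + 1) (sp i)"
      using ents sl l 3 red a by (simp add: psi_deg_def ent_swap)
    from HM_psi_V[OF P_V[OF e_V] HM_psi this] show "proj t n (op_psi l i) * e (sp i) \<in> HM t n (psi_deg l i)"
      using 3 by (simp add: op_psi_simps mult.assoc)
  next
    case 4
    have "psi_deg (l + 1) (sp i) = psi_deg l i"
      using 4 ent_sp_shift[OF i, of l] ent_sp_shift[OF i, of "l + 1"] by (simp add: psi_deg_def)
    then show "proj t n (op_psi l i) * e (sp i) \<in> HM t n (psi_deg l i)"
      using HM_psi[of t n "l + 1" "sp i", where 'k = 'k] 4 by (simp add: op_psi_simps)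
  qed
qed

lemma phi_homog: "homog s n k x \<Longrightarrow> phi x \<in> (HM t n k :: 'k dw set)"
proof (induction rule: homog.induct)
  case (times k x l y)
  show ?case using HM_mult[OF times.IH refl] by (simp only: \<phi>_mult)
next
  case one
  show ?case unfolding \<phi>_one by (intro HM_sum HM_e)
next
  case (x l)
  have "phi (vx l) = (\<Sum>i\<in>Seq s n. proj t n (op_x l i) * e (sp i))"
    using x by (simp add: vx_def \<phi>_letter phi_gen_def h_sum h_mult)
  moreover have "proj t n (op_x l i) \<in> (HM t n 2 :: 'k dw set)" for i
    by (simp add: op_x_def HM_Y h_zero HM_zero)
  ultimately show ?case by (auto intro!: HM_sum HM_mult[OF _ HM_e])
next
  case (E d l)
  have "phi (vE d l) = (\<Sum>i\<in>Seq s n. proj t n (op_E d l i) * e (sp i))"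
    using E by (simp add: vE_def \<phi>_letter phi_gen_def h_sum h_mult is_gen_def)
  moreover have "proj t n (op_E d l i) \<in> (HM t n (2 * int d) :: 'k dw set)" for i
  proof (cases "l = L i")
    case True
    show ?thesis
      unfolding h_op_E_eq[OF True] conv_def by (intro HM_sum HM_mult[OF HM_E HM_E]) auto
  qed (simp add: op_E_def HM_E)
  ultimately show ?case by (auto intro!: HM_sum HM_mult[OF _ HM_e])
next
  case (psi_black_black i l)
  with phi_psi_homog[of i l] show ?case by (simp add: psi_deg_def)
next
  case (psi_red_black i l c)
  with phi_psi_homog[of i l] show ?case by (simp add: psi_deg_def)
next
  case (psi_black_red i l c)
  with phi_psi_homog[of i l] show ?case by (simp add: psi_deg_def)
qed (auto simp: \<phi>_zero \<phi>_add phi_scal \<phi>_idem intro: HM_zero HM_add HM_scal HM_e)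

lemma \<phi>_of_nat: "phi (of_nat c * x) = of_nat c * (phi x :: 'k dw)"
  by (induction c) (simp_all add: \<phi>_zero \<phi>_add distrib_right)

lemma \<delta>_lft: "phi x = proj t n y \<Longrightarrow> \<delta> (lft x) = \<delta> (y :: 'k falg)"
  unfolding \<delta>_def by (rule dD_cong) (simp add: proj_lft)

lemma \<delta>_op_x: "l \<noteq> L i \<Longrightarrow> \<delta> (op_x l i) = (proj t n (op_x l i) * proj t n (op_x l i) :: 'k dw)"
  by (auto simp: op_x_def \<delta>_vx)

lemma \<delta>_op_E: "\<delta> (op_E d l i) = (proj t n (op_E d l i) * proj t n (op_E 1 l i)
    - of_nat (d + 1) * proj t n (op_E (d + 1) l i) :: 'k dw)"
proof (cases "l = L i")
  case True
  let ?F = "\<lambda>d. E d l" and ?G = "\<lambda>d. E d (l + 1)"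
  have one: "conv ?F ?G 1 = ?G 1 + ?F 1"
    by (simp add: conv_def E_zero)
  have "\<delta> (op_E d l i) = (\<Sum>k\<le>d. \<delta> (vE k l * vE (d - k) (l + 1)))"
    using True by (simp add: op_E_def sum_pairs \<delta>_sum)
  also have "\<dots> = (\<Sum>k\<le>d. ?F k * ?G (d - k) * (?G 1 + ?F 1)
      - (of_nat (k + 1) * (?F (k + 1) * ?G (d - k)) + of_nat (d - k + 1) * (?F k * ?G (d - k + 1))))"
  proof (rule sum.cong[OF refl])
    fix k
    have "?F k * ?F 1 * ?G (d - k) = ?F k * ?G (d - k) * ?F 1"
      using E_E[of 1 l "d - k" "l + 1"] by (simp add: mult.assoc)
    moreover have "?F k * (of_nat (d - k + 1) * ?G (d - k + 1)) = of_nat (d - k + 1) * (?F k * ?G (d - k + 1))"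
      by (metis mult.assoc mult_of_nat_commute)
    ultimately show "\<delta> (vE k l * vE (d - k) (l + 1)) = ?F k * ?G (d - k) * (?G 1 + ?F 1)
        - (of_nat (k + 1) * (?F (k + 1) * ?G (d - k)) + of_nat (d - k + 1) * (?F k * ?G (d - k + 1)))"
      unfolding \<delta>_mult \<delta>_vE left_diff_distrib right_diff_distrib distrib_left
      by (simp only: mult.assoc) simp
  qed
  also have "\<dots> = conv ?F ?G d * conv ?F ?G 1 - of_nat (d + 1) * conv ?F ?G (d + 1)"
    unfolding sum_subtractf sum.distrib conv_derivative[where F = ?F and G = ?G] one by (simp only: conv_def sum_distrib_right)
  finally show ?thesis
    by (simp only: h_op_E_eq[OF True])
next
  case False
  then show ?thesis by (simp add: op_E_def \<delta>_vE)
qed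

lemma \<delta>_op_psi:
  assumes i: "i \<in> Seq s n" and g: "is_gen s n (GPsi l)" and b: "ent i l = Black \<or> ent i (l + 1) = Black"
  shows "\<delta> (op_psi l i) * e (sp i) = (phi (psi_val l i) :: 'k dw)"
proof -
  have l: "1 \<le> l" "l + 1 \<le> length s + n" "1 \<le> l + 1" "l \<le> length s + n" using g by (auto simp: is_gen_def)
  have sl: "l < length (sp i)" "l + 1 < length (sp i)" using l length_sp'[OF i] by auto
  have red: "ent i (L i) = Red (s ! (j - 1))" by (rule L_bounds(4)[OF i])
  have ab: "of_nat (s ! (j - 1) - a) * w + of_nat a * w = of_nat (s ! (j - 1)) * w" for w :: "'k dw"
    by (simp only: distrib_right[symmetric] of_nat_add[symmetric] le_add_diff_inverse2 a)
  note sw = swapped[OF i l(1,2) b]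
  have P: "phi (psi l) * v = proj t n (op_psi l i) * v" if "v \<in> W i" for v
    by (rule act_psi[OF i that l(1,2)])
  have X: "phi (vx (l + 1)) * e (sp i) = proj t n (op_x (l + 1) i) * e (sp i)"
    by (rule act_x[OF i e_V l(3,2)])
  have X': "phi (vx l) * (proj t n (op_psi l i) * e (sp i))
      = proj t n (op_x l (swap_entries l i)) * (proj t n (op_psi l i) * e (sp i))"
    by (rule act_x[OF sw(1) op_psi_W[OF i e_V l(1,2) b] l(1,4)])
  have E1: "phi (vE 1 (l + 1)) * e (sp i) = proj t n (op_E 1 (l + 1) i) * e (sp i)"
    by (rule act_E[OF i e_V l(3,2)])
  note Pe = P[OF e_V] P[OF op_x_V[OF e_V]] P[OF op_E_V[OF e_V]]
  show ?thesis
  proof (cases "ent i l"; cases "ent i (l + 1)")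
    assume bb: "ent i l = Black" "ent i (l + 1) = Black"
    have rhs: "phi (psi_val l i) = - (proj t n (op_x l (swap_entries l i)) * (proj t n (op_psi l i) * e (sp i)))
        - proj t n (op_psi l i) * (proj t n (op_x (l + 1) i) * e (sp i))"
      using bb by (simp only: psi_val_def prod.case entry.case \<phi>_diff \<phi>_uminus \<phi>_mult \<phi>_idem[OF i] mult.assoc Pe X X')
    show ?thesis
      unfolding rhs
    proof (cases rule: L_cases[OF i l(1,2) b])
      case 1
      have "ent (sp i) l = Black" "ent (sp i) (l + 1) = Black"
        using 1 bb ent_sp_lt[OF i l(1)] ent_sp_lt[OF i l(3)] by simp_all
      then show "\<delta> (op_psi l i) * e (sp i) = - (proj t n (op_x l (swap_entries l i)) * (proj t n (op_psi l i) * e (sp i)))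
        - proj t n (op_psi l i) * (proj t n (op_x (l + 1) i) * e (sp i))"
        using 1 sw(2) \<delta>_psi_bb[OF e_V] by (simp add: op_psi_def op_x_def)
    next
      case 4
      have "ent (sp i) (l + 1) = Black" "ent (sp i) (l + 1 + 1) = Black"
        using 4 bb ent_sp_shift[OF i, of l] ent_sp_shift[OF i, of "l + 1"] by simp_all
      then show "\<delta> (op_psi l i) * e (sp i) = - (proj t n (op_x l (swap_entries l i)) * (proj t n (op_psi l i) * e (sp i)))
        - proj t n (op_psi l i) * (proj t n (op_x (l + 1) i) * e (sp i))"
        using 4 sw(5) \<delta>_psi_bb[OF e_V] by (simp add: op_psi_def op_x_def)
    qed (use bb red in auto)
  next
    fix c assume rb: "ent i l = Red c" "ent i (l + 1) = Black"
    have rhs: "phi (psi_val l i) = of_nat c * (proj t n (op_psi l i) * (proj t n (op_x (l + 1) i) * e (sp i)))"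
    proof -
      have "psi_val l i = of_nat c * (psi l * (vx (l + 1) * idem i) :: 'k falg)"
        using rb by (simp only: psi_val_def prod.case entry.case mult.assoc)
      then show ?thesis
        by (simp only: \<phi>_of_nat \<phi>_mult[of "psi l"] \<phi>_mult[of "vx (l + 1)"] \<phi>_idem[OF i] X Pe)
    qed
    show ?thesis
      unfolding rhs
    proof (cases rule: L_cases[OF i l(1,2) b])
      case 1
      have "ent (sp i) l = Red c" "ent (sp i) (l + 1) = Black"
        using 1 rb ent_sp_lt[OF i l(1)] ent_sp_lt[OF i l(3)] by simp_all
      then show "\<delta> (op_psi l i) * e (sp i) = of_nat c * (proj t n (op_psi l i) * (proj t n (op_x (l + 1) i) * e (sp i)))"
        using 1 \<delta>_psi_rb[OF e_V] by (simp add: op_psi_def op_x_def)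
    next
      case 3
      have ents: "ent (sp i) l = Red (s ! (j - 1) - a)" "ent (sp i) (l + 1) = Red a" "ent (sp i) (l + 1 + 1) = Black"
        using ent_sp_shift[OF i, of "l + 1"] ent_sp_L[OF i] 3 by auto
      have ents': "ent (swap_entries (l + 1) (sp i)) l = Red (s ! (j - 1) - a)"
          "ent (swap_entries (l + 1) (sp i)) (l + 1) = Black"
        using ents sl l by (simp_all add: ent_swap)
      have c: "c = s ! (j - 1)" using 3 rb red by simp
      have "\<delta> (op_psi l i) * e (sp i) = \<delta> (psi l) * (P (l + 1) * e (sp i)) + P l * (\<delta> (psi (l + 1)) * e (sp i))"
        using 3 by (simp add: op_psi_def \<delta>_mult distrib_right mult.assoc)
      also have "\<delta> (psi l) * (P (l + 1) * e (sp i)) = of_nat (s ! (j - 1) - a) * (P l * (P (l + 1) * (Y (l + 1 + 1) * e (sp i))))"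
        by (simp only: \<delta>_psi_rb[OF P_V[OF e_V] ents'] X_P_rb[OF e_V ents(2,3)])
      also have "P l * (\<delta> (psi (l + 1)) * e (sp i)) = of_nat a * (P l * (P (l + 1) * (Y (l + 1 + 1) * e (sp i))))"
      proof -
        have "x * (of_nat a * w) = of_nat a * (x * w)" for x w :: "'k dw"
          by (metis mult.assoc mult_of_nat_commute)
        then show ?thesis unfolding \<delta>_psi_rb[OF e_V ents(2,3)] .
      qed
      also have "of_nat (s ! (j - 1) - a) * (P l * (P (l + 1) * (Y (l + 1 + 1) * e (sp i))))
          + of_nat a * (P l * (P (l + 1) * (Y (l + 1 + 1) * e (sp i))))
          = of_nat c * (P l * (P (l + 1) * (Y (l + 1 + 1) * e (sp i))))"
        by (simp only: c ab)
      finally show "\<delta> (op_psi l i) * e (sp i) = of_nat c * (proj t n (op_psi l i) * (proj t n (op_x (l + 1) i) * e (sp i)))"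
        using 3 op_psi_simps(3)[OF 3] op_x_simps(3)[of i "l + 1"] by (simp add: mult.assoc)
    next
      case 4
      have "ent (sp i) (l + 1) = Red c" "ent (sp i) (l + 1 + 1) = Black"
        using 4 rb ent_sp_shift[OF i, of l] ent_sp_shift[OF i, of "l + 1"] by simp_all
      then show "\<delta> (op_psi l i) * e (sp i) = of_nat c * (proj t n (op_psi l i) * (proj t n (op_x (l + 1) i) * e (sp i)))"
        using 4 \<delta>_psi_rb[OF e_V] by (simp add: op_psi_def op_x_def)
    qed (use rb red in auto)
  next
    fix c assume br: "ent i l = Black" "ent i (l + 1) = Red c"
    have rhs: "phi (psi_val l i) = proj t n (op_psi l i) * (proj t n (op_E 1 (l + 1) i) * e (sp i))"
      using br by (simp only: psi_val_def prod.case entry.case \<phi>_mult \<phi>_idem[OF i] mult.assoc Pe E1)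
    show ?thesis
      unfolding rhs
    proof (cases rule: L_cases[OF i l(1,2) b])
      case 1
      have "ent (sp i) l = Black" "ent (sp i) (l + 1) = Red c"
        using 1 br ent_sp_lt[OF i l(1)] ent_sp_lt[OF i l(3)] by simp_all
      then show "\<delta> (op_psi l i) * e (sp i) = proj t n (op_psi l i) * (proj t n (op_E 1 (l + 1) i) * e (sp i))"
        using 1 \<delta>_psi_br[OF e_V] by (simp add: op_psi_def op_E_def)
    next
      case 2
      have ents: "ent (sp i) l = Black" "ent (sp i) (l + 1) = Red (s ! (j - 1) - a)" "ent (sp i) (l + 1 + 1) = Red a"
        using ent_sp_lt[OF i l(1)] ent_sp_L[OF i] 2 by auto
      have ents': "ent (swap_entries l (sp i)) (l + 1) = Black" "ent (swap_entries l (sp i)) (l + 1 + 1) = Red a"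
        using ents sl l by (simp_all add: ent_swap)
      have far: "E 1 (l + 1 + 1) * (P l * e (sp i)) = P l * (E 1 (l + 1 + 1) * e (sp i))"
        using P_E_far[of "l + 1 + 1" l 1] by (simp flip: mult.assoc)
      have "\<delta> (op_psi l i) * e (sp i) = \<delta> (psi (l + 1)) * (P l * e (sp i)) + P (l + 1) * (\<delta> (psi l) * e (sp i))"
        using 2 by (simp add: op_psi_def \<delta>_mult distrib_right mult.assoc)
      also have "\<dots> = P (l + 1) * (P l * (E 1 (l + 1 + 1) * e (sp i))) + P (l + 1) * (P l * (E 1 (l + 1) * e (sp i)))"
        by (simp only: \<delta>_psi_br[OF P_V[OF e_V] ents'] \<delta>_psi_br[OF e_V ents(1,2)] far)
      moreover have "proj t n (op_E 1 (l + 1) i) = E 1 (l + 1 + 1) + E 1 (l + 1)"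
        using h_op_E_eq[OF 2(1), of 1] by (simp add: conv_def E_zero)
      ultimately show "\<delta> (op_psi l i) * e (sp i) = proj t n (op_psi l i) * (proj t n (op_E 1 (l + 1) i) * e (sp i))"
        using 2 by (simp only: op_psi_simps(2) distrib_left distrib_right mult.assoc)
    next
      case 4
      have "ent (sp i) (l + 1) = Black" "ent (sp i) (l + 1 + 1) = Red c"
        using 4 br ent_sp_shift[OF i, of l] ent_sp_shift[OF i, of "l + 1"] by simp_all
      then show "\<delta> (op_psi l i) * e (sp i) = proj t n (op_psi l i) * (proj t n (op_E 1 (l + 1) i) * e (sp i))"
        using 4 \<delta>_psi_br[OF e_V] by (simp add: op_psi_def op_E_def)
    qed (use br red in auto)
  qed (use b in auto)
qed

lemma phi_dD: "\<delta> (lft x) = (phi (dD s n x) :: 'k dw)"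
proof (induction x rule: falg_gen_induct[where s = s and n = n])
  case (cong x y)
  have "phi x = (phi y :: 'k dw)" "phi (dD s n x) = (phi (dD s n y) :: 'k dw)"
    using phi_cong[OF cong(1)] phi_cong[OF dD_cong[OF cong(1)]] by simp_all
  with cong(2) \<delta>_lft[of y "lft x"] show ?case by (simp add: proj_lft)
next
  case zero
  show ?case using \<delta>_lft[of 0 0] by (simp add: \<phi>_zero h_zero \<delta>_zero dD_zero)
next
  case (add x y)
  then show ?case using \<delta>_lft[of "x + y" "lft x + lft y"] by (simp add: \<phi>_add h_add proj_lft \<delta>_add dD_add)
next
  case (scal c x)
  have "\<delta> (lft (scal c x)) = \<delta> (scal c (lft x))" by (rule \<delta>_lft) (simp add: phi_scal proj_scal proj_lft)
  also have "\<dots> = dw_scal c * \<delta> (lft x)" by (simp only: \<delta>_def dD_scal proj_scal)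
  finally show ?case using scal by (simp add: dD_scal phi_scal)
next
  case (mult x y)
  then show ?case
    using \<delta>_lft[of "x * y" "lft x * lft y"] by (simp add: \<phi>_mult \<phi>_add h_mult proj_lft \<delta>_mult dD_mult)
next
  case (idem i)
  then show ?case using \<delta>_lft[of "idem i" "idem (sp i)"] by (simp add: \<phi>_idem \<delta>_idem dD_idem \<phi>_zero)
next
  case (x i l)
  have l: "1 \<le> l" "l \<le> length s + n" using x(2) by (auto simp: is_gen_def)
  have nL: "l \<noteq> L i" using L_bounds(4)[OF x(1)] x(3) by auto
  have "\<delta> (lft (vx l * idem i)) = proj t n (op_x l i) * (proj t n (op_x l i) * e (sp i))"
    by (simp only: \<delta>_lft[OF phi_gens(1)[OF x(1,2)]] \<delta>_idem_right \<delta>_op_x[OF nL] mult.assoc)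
  moreover have "phi (dD s n (vx l * idem i)) = (phi (vx l * (vx l * idem i)) :: 'k dw)"
    by (rule phi_cong) (simp only: dD_mult dD_idem mult_zero_right add_0_right proj_mult dD_vx power2_eq_square mult.assoc)
  moreover have "phi (vx l * (vx l * idem i)) = proj t n (op_x l i) * (proj t n (op_x l i) * e (sp i))"
    by (simp only: \<phi>_mult \<phi>_idem[OF x(1)] act_x[OF x(1) e_V l] act_x[OF x(1) op_x_V[OF e_V] l])
  ultimately show ?case by simp
next
  case (E i d l c)
  have l: "1 \<le> l" "l \<le> length s + n" using E(2) by (auto simp: is_gen_def)
  have "\<delta> (lft (vE d l * idem i)) = (proj t n (op_E d l i) * proj t n (op_E 1 l i)
      - of_nat (d + 1) * proj t n (op_E (d + 1) l i)) * e (sp i)"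
    by (simp only: \<delta>_lft[OF phi_gens(2)[OF E(1,2)]] \<delta>_idem_right \<delta>_op_E)
  moreover have "phi (dD s n (vE d l * idem i))
      = (phi ((vE d l * vE 1 l - of_nat (d + 1) * vE (d + 1) l) * idem i) :: 'k dw)"
    by (rule phi_cong) (rule dD_vE)
  moreover have "phi ((vE d l * vE 1 l - of_nat (d + 1) * vE (d + 1) l) * idem i)
      = (proj t n (op_E d l i) * proj t n (op_E 1 l i) - of_nat (d + 1) * proj t n (op_E (d + 1) l i)) * e (sp i)"
    by (simp only: \<phi>_mult[of _ "idem i"] \<phi>_diff \<phi>_of_nat \<phi>_mult[of "vE d l"] \<phi>_idem[OF E(1)] left_diff_distrib mult.assoc
        act_E[OF E(1) e_V l] act_E[OF E(1) op_E_V[OF e_V] l])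
  ultimately show ?case by simp
next
  case (psi i l)
  have "\<delta> (lft (psi l * idem i)) = phi (psi_val l i)"
    by (simp only: \<delta>_lft[OF phi_gens(3)[OF psi(1,2)]] \<delta>_idem_right \<delta>_op_psi[OF psi])
  moreover have "phi (dD s n (psi l * idem i)) = (phi (psi_val l i) :: 'k dw)"
    by (rule phi_cong) (rule dD_psi)
  ultimately show ?case by simp
qed

lemma Phi_one: "Phi s n j a \<one>\<^bsub>D s n\<^esub> = (e_hat t n j :: 'k falg set)"
proof -
  have "phi 1 = (proj t n (\<Sum>i\<in>adjacent_Seq t n j. idem i) :: 'k dw)"
    by (simp add: \<phi>_one adjacent_Seq_eq sum.reindex[OF sp_inj] h_sum)
  then show ?thesis by (simp only: D_simps(5) Phi e_hat_def cls_lft)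
qed

lemma corner_map_Phi:
  assumes "CHAR('k) = p" "p > 0"
  shows "corner_map p (D s n :: ('k, 'k falg set) graded) (partial_D s n) (D t n) (partial_D t n) (Phi s n j a)"
proof (rule corner_map.intro[OF pdg_algebra_D[OF assms] pdg_algebra_D[OF assms]], standard)
  note is_Phi = Phi(1)[unfolded is_Phi_def Let_def, THEN conjunct2]
  show "Phi s n j a \<in> linear_maps (D s n :: ('k, 'k falg set) graded) (D t n)"
    by (rule is_Phi[THEN conjunct1])
  fix x y :: "'k falg set" and k
  show "Phi s n j a (x \<otimes>\<^bsub>D s n\<^esub> y) = Phi s n j a x \<otimes>\<^bsub>D t n\<^esub> Phi s n j a y"
    if "x \<in> carrier (D s n)" "y \<in> carrier (D s n)"
    using is_Phi[THEN conjunct2, THEN conjunct1] that by blast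
  show "Phi s n j a x \<in> hom_part (D t n) k" if "x \<in> hom_part (D s n) k"
  proof -
    obtain b where "x = cls s n b" "homog s n k b"
      using \<open>x \<in> hom_part (D s n) k\<close> by (auto simp: D_simps(7))
    then show ?thesis by (simp add: Phi(2) cls_hom_part proj_lft phi_homog)
  qed
  show "partial_D t n (Phi s n j a x) = Phi s n j a (partial_D s n x)" if "x \<in> carrier (D s n)"
  proof -
    obtain b where "x = cls s n b" using \<open>x \<in> carrier (D s n)\<close> by (auto simp: D_simps(1))
    then show ?thesis
      using phi_dD[of b] by (simp only: Phi(2) partial_D(2) cls_eq_iff proj_lft \<delta>_def)
  qed
qed

end

end

section \<open>The splitter bimodules\<close>

lemma split_list_merge:
  assumes "1 \<le> j" "j < length s"
  shows "split_list j (s ! j) (merge j s) = s" "length (merge j s) = length s - 1"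
    "merge j s ! (j - 1) = s ! (j - 1) + s ! j"
proof -
  have "take (j - 1) s @ s ! (j - 1) # s ! j # drop (j + 1) s = s"
    using assms id_take_nth_drop[of "j - 1" s] Cons_nth_drop_Suc[of j s] by simp
  then show "split_list j (s ! j) (merge j s) = s"
    using assms by (simp add: split_list_def merge_def nth_append)
  show "length (merge j s) = length s - 1" "merge j s ! (j - 1) = s ! (j - 1) + s ! j"
    using assms by (auto simp: merge_def nth_append)
qed

theorem theorem4p2:
  fixes p m n j :: nat and s :: "nat list"
  assumes "CHAR('k::field) = p" and "p > 0"
    and "length s = m" and "1 \<le> j" and "j \<le> m - 1"
  shows
    "(\<exists>!\<delta> :: 'k splitter_elt \<Rightarrow> 'k splitter_elt. is_partial_up s n j \<delta>) \<and>
     (\<exists>!\<delta> :: 'k splitter_elt \<Rightarrow> 'k splitter_elt. is_partial_down s n j \<delta>) \<and>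
     pdg_bimodule p
       (D (merge j s) n :: ('k, 'k falg set) graded) (partial_D (merge j s) n)
       (D s n) (partial_D s n)
       (tri_up s n j) (partial_up s n j) \<and>
     pdg_bimodule p
       (D s n :: ('k, 'k falg set) graded) (partial_D s n)
       (D (merge j s) n) (partial_D (merge j s) n)
       (tri_down s n j) (partial_down s n j)"
proof -
  have j: "1 \<le> j" "j < length s" using assms by auto
  interpret S: splitting "merge j s" n j "s ! j"
    by standard (use j split_list_merge[OF j] in auto)
  interpret C: corner_map p "D (merge j s) n :: ('k, 'k falg set) graded" "partial_D (merge j s) n"
    "D s n" "partial_D s n" "incl s n j"
    using S.corner_map_Phi[OF assms(1,2)] by (simp only: split_list_merge(1)[OF j] incl_def)
  have ee: "C.ee = e_hat s n j"
    using S.Phi_one[where 'k = 'k] by (simp only: split_list_merge(1)[OF j] incl_def)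
  have "C.L = e_hat_D s n j" "C.R = D_e_hat s n j"
    by (simp_all only: C.L_def C.R_def e_hat_D_def D_e_hat_def ee)
  with C.bimodule_L C.bimodule_R have bim:
    "pdg_bimodule p (D (merge j s) n) (partial_D (merge j s) n) (D s n) (partial_D s n)
      (e_hat_D s n j :: ('k, _, _, _) gbimod) (partial_D s n)"
    "pdg_bimodule p (D s n) (partial_D s n) (D (merge j s) n) (partial_D (merge j s) n)
      (D_e_hat s n j :: ('k, _, _, _) gbimod) (partial_D s n)"
    by simp_all
  note up = tensor_collapse_left[OF bim(1)] and down = tensor_collapse_right[OF bim(2)]
  have ex: "\<exists>!\<delta> :: 'k splitter_elt \<Rightarrow> 'k splitter_elt. is_partial_up s n j \<delta>"
    "\<exists>!\<delta> :: 'k splitter_elt \<Rightarrow> 'k splitter_elt. is_partial_down s n j \<delta>"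
    unfolding is_partial_up_def is_partial_down_def
    by (rule tensor_collapse.tensor_diff_ex1[OF up] tensor_collapse.tensor_diff_ex1[OF down])+
  have the: "is_partial_up s n j (partial_up s n j :: 'k splitter_elt \<Rightarrow> 'k splitter_elt)"
    "is_partial_down s n j (partial_down s n j :: 'k splitter_elt \<Rightarrow> 'k splitter_elt)"
    unfolding partial_up_def partial_down_def by (rule theI'[OF ex(1)] theI'[OF ex(2)])+
  show ?thesis
    unfolding tri_up_def tri_down_def
    by (intro conjI ex pdg_bimodule_shift)
      (rule tensor_collapse.tensor_bimodule[OF up the(1)[unfolded is_partial_up_def]]
        tensor_collapse.tensor_bimodule[OF down the(2)[unfolded is_partial_down_def]])+
qed

end
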